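(* Let $0<\gamma<\infty$ and $T>0$. Let $(u_1,\omega_1,\psi_1)$ be a classical solution of the system $$\partial_t u_1 + u^r\partial_r u_1 + u^z\partial_z u_1 = 2u_1\partial_z\psi_1,\qquad \partial_t \omega_1 + u^r\partial_r \omega_1 + u^z\partial_z \omega_1 = \partial_z(u_1^2),$$ $$-\Big(\partial_r^2+\frac{3}{r}\partial_r+\partial_z^2\Big)\psi_1=\omega_1,\qquad u^r=-r\partial_z\psi_1,\quad u^z=2\psi_1+r\partial_r\psi_1,$$ in a space-time region $\mathcal{W}$, where $\mathcal{W}$ is either (i) $\mathcal{C}_{\delta,T}=\{(r,z,t): 1-\delta<r<1,\ -\delta<z<\delta,\ T-\delta<t<T\}$ for some $0<\delta\ll 1$, or (ii) $\mathcal{W}_{\delta(t)}=\{(r,z,t): 1-\delta(t)<r<1,\ -\delta(t)<z<\delta(t),\ T_0<t<T\}$ for some $T_0<T$ and some decreasing function $\delta:(T_0,T)\to(0,\infty)$ with $\lim_{t\to T^-}\delta(t)=0$ and $\limsup_{t\to T^-}(T-t)^{-\gamma}\delta(t)=\infty$. Suppose that on $\mathcal{W}$ the solution has the generalized self-similar form $$u_1=(T-t)^{-1+\frac{\gamma}{2}}\sum_{k=0}^\infty (T-t)^{k\gamma}U_k(R,Z),\quad \omega_1=(T-t)^{-1}\sum_{k=0}^\infty (T-t)^{k\gamma}\Omega_k(R,Z),\quad \psi_1=(T-t)^{-1+2\gamma}\sum_{k=0}^\infty (T-t)^{k\gamma}\Psi_k(R,Z),$$ with $R=(r-1)(T-t)^{-\gamma}$,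 $Z=z(T-t)^{-\gamma}$, where the profiles $U_k,\Omega_k,\Psi_k$ are independent of $t$ and defined on $\mathcal{D}=\{Y=(R,Z)\in\mathbb{R}^2: R\le 0\}$. Assume: (a) $U_k,\Omega_k,\Psi_k\in C^1_{loc}(\overline{\mathcal{D}})$ for all $k\ge 0$; (b) for all $k\ge0$, $|U_k(Y)|+|\Omega_k(Y)|=o(1)$ and $|\nabla\Psi_k(Y)|=o(|Y|)$ as $|Y|\to\infty$; (c) $\partial_Z\Psi_k(0,Z)=0$ for all $Z\in\mathbb{R}$ and all $k\ge0$; (d) for some even integer $p$, $\displaystyle\lim_{\rho\to\infty}\int_{\{Y\in\mathcal{D}:\rho<|Y|<2\rho\}}\big(U_k^p+\Omega_k^p\big)\,dY=0$ for all integers $0\le k\le 1/\gamma$. Then $u_1\equiv0$, $\omega_1\equiv 0$ and $\nabla\psi_1\equiv0$ on $\mathcal{W}$.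
   Context: This concerns axisymmetric solutions of the 3D incompressible Euler equations in the cylinder $\{0<r<1\}$ in cylindrical coordinates $(r,\theta,z)$, with velocity $u=u^re_r+u^\theta e_\theta+u^ze_z$ independent of $\theta$. Here $u_1=u^\theta/r$, $\omega_1=\omega^\theta/r$, $\psi_1=\psi^\theta/r$, where $\omega^\theta$ is the angular component of the vorticity $\mathrm{curl}\,u$ and $\psi^\theta$ is the angular component of the vector stream function $\psi$ (with $\mathrm{curl}\,\psi=u$, $\mathrm{div}\,\psi=0$). $T$ is a (possible) blow-up time. $\nabla=(\partial_R,\partial_Z)$ in the profile variables and $\nabla\psi_1$ denotes the spatial gradient in $(r,z)$. Condition (c) corresponds to the vanishing of the normal velocity $u^r=-r\partial_z\psi_1$ at the boundary $r=1$. *)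

theory Defs
  imports "HOL-Analysis.Analysis" "HOL-Library.Landau_Symbols" "HOL-Library.Liminf_Limsup"
begin

definition pr :: "(real \<Rightarrow> real \<Rightarrow> real \<Rightarrow> real) \<Rightarrow> real \<Rightarrow> real \<Rightarrow> real \<Rightarrow> real" where
  "pr f r z t = deriv (\<lambda>s. f s z t) r"
definition pz :: "(real \<Rightarrow> real \<Rightarrow> real \<Rightarrow> real) \<Rightarrow> real \<Rightarrow> real \<Rightarrow> real \<Rightarrow> real" where
  "pz f r z t = deriv (\<lambda>s. f r s t) z"
definition pt :: "(real \<Rightarrow> real \<Rightarrow> real \<Rightarrow> real) \<Rightarrow> real \<Rightarrow> real \<Rightarrow> real \<Rightarrow> real" where
  "pt f r z t = deriv (\<lambda>s. f r z s) t"

definition cont3 :: "(real \<times> real \<times> real) set \<Rightarrow> (real \<Rightarrow> real \<Rightarrow> real \<Rightarrow> real) \<Rightarrow> bool" where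
  "cont3 W f \<longleftrightarrow> continuous_on W (\<lambda>(r,z,t). f r z t)"

definition C1_space :: "(real \<times> real \<times> real) set \<Rightarrow> (real \<Rightarrow> real \<Rightarrow> real \<Rightarrow> real) \<Rightarrow> bool" where
  "C1_space W f \<longleftrightarrow> cont3 W f \<and>
     (\<forall>(r,z,t)\<in>W. (\<lambda>s. f s z t) differentiable (at r) \<and> (\<lambda>s. f r s t) differentiable (at z)) \<and>
     cont3 W (pr f) \<and> cont3 W (pz f)"

definition C1_spacetime :: "(real \<times> real \<times> real) set \<Rightarrow> (real \<Rightarrow> real \<Rightarrow> real \<Rightarrow> real) \<Rightarrow> bool" where
  "C1_spacetime W f \<longleftrightarrow> C1_space W f \<and>
     (\<forall>(r,z,t)\<in>W. (\<lambda>s. f r z s) differentiable (at t)) \<and> cont3 W (pt f)"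

definition classical_solution ::
  "(real \<times> real \<times> real) set \<Rightarrow> (real \<Rightarrow> real \<Rightarrow> real \<Rightarrow> real) \<Rightarrow> (real \<Rightarrow> real \<Rightarrow> real \<Rightarrow> real)
    \<Rightarrow> (real \<Rightarrow> real \<Rightarrow> real \<Rightarrow> real) \<Rightarrow> bool" where
  "classical_solution W u1 om1 psi1 \<longleftrightarrow>
     C1_spacetime W u1 \<and> C1_spacetime W om1 \<and>
     C1_space W psi1 \<and> C1_space W (pr psi1) \<and> C1_space W (pz psi1) \<and>
     (\<forall>(r,z,t)\<in>W.
        (let ur = - r * pz psi1 r z t;
             uz = 2 * psi1 r z t + r * pr psi1 r z t in
         pt u1 r z t + ur * pr u1 r z t + uz * pz u1 r z t = 2 * u1 r z t * pz psi1 r z t \<and>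
         pt om1 r z t + ur * pr om1 r z t + uz * pz om1 r z t
            = pz (\<lambda>r z t. (u1 r z t)\<^sup>2) r z t \<and>
         - (pr (pr psi1) r z t + 3 / r * pr psi1 r z t + pz (pz psi1) r z t) = om1 r z t))"

definition region_C :: "real \<Rightarrow> real \<Rightarrow> (real \<times> real \<times> real) set" where
  "region_C \<delta> T = {(r,z,t). 1 - \<delta> < r \<and> r < 1 \<and> - \<delta> < z \<and> z < \<delta> \<and> T - \<delta> < t \<and> t < T}"

definition region_W :: "(real \<Rightarrow> real) \<Rightarrow> real \<Rightarrow> real \<Rightarrow> (real \<times> real \<times> real) set" where
  "region_W \<delta> T0 T = {(r,z,t). 0 < r \<and> 1 - \<delta> t < r \<and> r < 1 \<and> - \<delta> t < z \<and> z < \<delta> t \<and> T0 < t \<and> t < T}"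

definition Dom :: "(real \<times> real) set" where
  "Dom = {Y. fst Y \<le> 0}"

definition C1_Dom :: "(real \<times> real \<Rightarrow> real) \<Rightarrow> (real \<times> real \<Rightarrow> real) \<Rightarrow> (real \<times> real \<Rightarrow> real) \<Rightarrow> bool" where
  "C1_Dom f fR fZ \<longleftrightarrow>
     (\<forall>y\<in>Dom. (f has_derivative (\<lambda>h. fR y * fst h + fZ y * snd h)) (at y within Dom)) \<and>
     continuous_on Dom fR \<and> continuous_on Dom fZ"

end

theory Submission
  imports Defs "HOL-Complex_Analysis.Complex_Analysis"
begin

text \<open>In the variables \<open>(R, Z)\<close> and with \<open>s = (T - t)\<^sup>\<gamma>\<close> the Euler system becomes a system whose coefficients are power
  series in \<open>s\<close>. A Baire argument bounds the coefficients locally on a dense open set, and interior gradient estimates for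
  the rescaled elliptic equation then identify the limit \<open>s \<rightarrow> 0\<close>: the first non-vanishing \<open>U\<^sub>k\<close> solves a linear
  transport equation \<open>\<alpha> f + \<gamma> Y \<bullet> \<nabla>f + \<nabla>\<^sup>\<bottom>\<Psi>\<^sub>0 \<bullet> \<nabla>f = 0\<close>, which has no decaying solution. Hence \<open>u\<^sub>1 = 0\<close>, and
  then \<open>\<omega>\<^sub>1 = 0\<close> by the same argument. The coefficients \<open>\<Psi>\<^sub>k\<close> of the remaining solution of a homogeneous elliptic
  equation are locally uniformly bounded near every interior point, because separately analytic functions are jointly
  analytic. Inductively \<open>\<Psi>\<^sub>k\<close> is harmonic on the half plane with sublinear gradient and vanishing tangential derivative,
  so \<open>\<Psi>\<^sub>k = c + a R\<close> by Liouville; the term \<open>(3/r) \<partial>\<^sub>r\<close> makes \<open>-3 a\<close> the Laplacian of \<open>\<Psi>\<^sub>k\<^sub>+\<^sub>1\<close>, which forces \<open>a = 0\<close>.\<close>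

section \<open>Gradient estimate for the Laplacian\<close>

text \<open>Everything is shaped by how little the expansion provides: the series converge
  pointwise, without local uniformity and without termwise derivatives, and the profiles have only
  one derivative. Gradients of \<open>psi1\<close> can still be compared with those of
  \<open>Psi 0\<close> because the Poisson equation controls gradients by sup norms; gradients of
  the transported quantity have no such control, so its limit equation is obtained by testing at
  maxima. In that limit the stretching term and the s-derivative of the series carry a factor s,
  which is why a linear equation driven by \<open>Psi 0\<close> alone remains at every order. Bounds
  on a dense open set are enough there, since a first-order identity between continuous functions
  extends to the closure. For harmonicity they are not: a Laplacian could concentrate on the closed
  exceptional set. Hence bounds near every interior point are required for the coefficients of
  \<open>psi1\<close>, and the homogeneous equation, available once the vorticity is gone, supplies
  the analyticity on lines that yields them.\<close>

lemma second_deriv_local_max: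
  fixes f f' :: "real \<Rightarrow> real"
  assumes d: "0 < d"
    and f: "\<And>y. \<bar>y\<bar> < d \<Longrightarrow> (f has_real_derivative f' y) (at y)"
    and f': "(f' has_real_derivative l) (at 0)"
    and max: "\<And>y. \<bar>y\<bar> < d \<Longrightarrow> f y \<le> f 0"
  shows "f' 0 = 0" and "l \<le> 0"
proof -
  show f0: "f' 0 = 0"
    using DERIV_local_max[OF f[of 0] d] max d by (auto simp: abs_minus_commute)
  show "l \<le> 0"
  proof (rule ccontr)
    assume "\<not> l \<le> 0"
    \<comment> \<open>\<open>f'\<close> is differentiable at 0 only, so there is no Taylor formula;
      but a positive slope of \<open>f'\<close> makes it positive just right of 0, and the mean
      value theorem pushes \<open>f\<close> above its maximum.\<close>
    then obtain e where e: "e > 0" "\<And>h. 0 < h \<Longrightarrow> h < e \<Longrightarrow> f' 0 < f' (0 + h)"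
      using DERIV_pos_inc_right[OF f'] by force
    define h where "h = min d e / 2"
    have h: "0 < h" "h < d" "h < e" using d e(1) by (auto simp: h_def)
    have "\<exists>z. 0 < z \<and> z < h \<and> f h - f 0 = (h - 0) * f' z"
      using h by (intro MVT2) (auto intro!: f)
    then obtain z where z: "0 < z" "z < h" "f h - f 0 = h * f' z" by auto
    have "f' z > 0" using e(2)[of z] z h f0 by auto
    with z h have "f h > f 0" by (smt (verit) mult_pos_pos)
    with max[of h] h show False by auto
  qed
qed

text \<open>Only pure second derivatives along coordinate lines are recorded, as existential
  witnesses without continuity. This is what a maximum principle consumes, and it passes directly to
  differences and to difference quotients.\<close>

definition lap_on :: "'a::euclidean_space set \<Rightarrow> ('a \<Rightarrow> real) \<Rightarrow> ('a \<Rightarrow> real) \<Rightarrow> bool" where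
  "lap_on S u f \<longleftrightarrow> open S \<and> continuous_on S u \<and>
     (\<exists>u1 u2. \<forall>x\<in>S. (\<forall>b\<in>Basis. ((\<lambda>t. u (x + t *\<^sub>R b)) has_real_derivative u1 b x) (at 0) \<and>
        ((\<lambda>t. u1 b (x + t *\<^sub>R b)) has_real_derivative u2 b x) (at 0)) \<and>
        (\<Sum>b\<in>Basis. u2 b x) = f x)"

lemma line_deriv_shift:
  fixes u :: "'a::real_normed_vector \<Rightarrow> real"
  assumes "((\<lambda>t. u (x + c *\<^sub>R b + t *\<^sub>R b)) has_real_derivative D) (at 0)"
  shows "((\<lambda>t. u (x + t *\<^sub>R b)) has_real_derivative D) (at c)"
proof -
  have "x + (t + c) *\<^sub>R b = x + c *\<^sub>R b + t *\<^sub>R b" for t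
    by (simp add: scaleR_left_distrib algebra_simps)
  then have "((\<lambda>t. u (x + (t + c) *\<^sub>R b)) has_real_derivative D) (at 0)"
    using assms by presburger
  then show ?thesis
    using DERIV_shift[of "\<lambda>t. u (x + t *\<^sub>R b)" D 0 c] by simp
qed

text \<open>Brandt's trick: the doubled function \<open>w x \<mu> = (u (x + \<mu> e) - u (x - \<mu> e)) / 2\<close> satisfies an elliptic
  equation in \<open>(x, \<mu>)\<close> and vanishes at \<open>\<mu> = 0\<close>, so a barrier linear in \<open>\<mu>\<close> bounds the derivative of \<open>u\<close>.\<close>

lemma gradient_estimate_aux:
  fixes u f :: "'a::euclidean_space \<Rightarrow> real"
  assumes lap: "lap_on S u f" and sub: "cball x0 (2 * d) \<subseteq> S" and d: "0 < d" and e: "e \<in> Basis"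
    and K: "\<And>x. x \<in> cball x0 (2 * d) \<Longrightarrow> \<bar>u x\<bar> \<le> K"
    and N: "\<And>x. x \<in> cball x0 (2 * d) \<Longrightarrow> \<bar>f x\<bar> \<le> N"
    and K': "K \<le> K'" "N * d\<^sup>2 < K'"
    and mu: "0 \<le> \<mu>" "\<mu> \<le> d"
  shows "u (x0 + \<mu> *\<^sub>R e) - u (x0 - \<mu> *\<^sub>R e) \<le> 2 * (2 * real DIM('a) + 1) * K' * \<mu> / d"
proof -
  define B :: real where "B = 2 * real DIM('a)"
  have Bpos: "0 \<le> B" by (simp add: B_def)
  have N0: "0 \<le> N" using N[of x0] d by (smt (verit) centre_in_cball)
  have K'pos: "0 < K'" using K'(2) N0 by (smt (verit) zero_le_mult_iff zero_le_power2)
  obtain u1 u2 where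
    D1: "\<And>x b. x \<in> S \<Longrightarrow> b \<in> Basis \<Longrightarrow> ((\<lambda>t. u (x + t *\<^sub>R b)) has_real_derivative u1 b x) (at 0)" and
    D2: "\<And>x b. x \<in> S \<Longrightarrow> b \<in> Basis \<Longrightarrow> ((\<lambda>t. u1 b (x + t *\<^sub>R b)) has_real_derivative u2 b x) (at 0)" and
    D3: "\<And>x. x \<in> S \<Longrightarrow> (\<Sum>b\<in>Basis. u2 b x) = f x"
    and opS: "open S" and cont: "continuous_on S u"
    using lap unfolding lap_on_def by metis
  have ne: "norm e = 1" using e by simp
  define w where "w = (\<lambda>x m. (u (x + m *\<^sub>R e) - u (x - m *\<^sub>R e)) / 2)"
  \<comment> \<open>The barrier is nonnegative at \<open>m = 0\<close>, where \<open>w\<close>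
    vanishes, and at least \<open>K'\<close> where \<open>norm (x - x0) = d\<close> or
    \<open>m = d\<close> (there the two \<open>m\<close>-terms add up to 1). Its concavity in
    \<open>m\<close> of size \<open>2 * B\<close>, with \<open>B\<close> twice the dimension,
    outweighs its convexity in \<open>x\<close>.\<close>
  define P where "P = (\<lambda>x m. K' * ((norm (x - x0))\<^sup>2 / d\<^sup>2 + (B + 1) * m / d - B * m\<^sup>2 / d\<^sup>2))"
  define H where "H = (\<lambda>(x, m). w x m - P x m)"
  define Q where "Q = cball x0 d \<times> {0..d}"
  have inQ: "x + m *\<^sub>R e \<in> cball x0 (2 * d)" "x - m *\<^sub>R e \<in> cball x0 (2 * d)"
    if "x \<in> cball x0 d" "\<bar>m\<bar> \<le> d" for x m
  proof -
    have "norm (x - x0) \<le> d" using that by (simp add: dist_norm norm_minus_commute)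
    moreover have "norm (m *\<^sub>R e) \<le> d" using that ne by simp
    ultimately have "norm (x - x0 + m *\<^sub>R e) \<le> 2 * d" "norm (x - x0 - m *\<^sub>R e) \<le> 2 * d"
      using norm_triangle_ineq[of "x - x0" "m *\<^sub>R e"] norm_triangle_ineq4[of "x - x0" "m *\<^sub>R e"] by linarith+
    moreover have "x - x0 + m *\<^sub>R e = x + m *\<^sub>R e - x0" "x - x0 - m *\<^sub>R e = x - m *\<^sub>R e - x0" by auto
    ultimately show "x + m *\<^sub>R e \<in> cball x0 (2 * d)" "x - m *\<^sub>R e \<in> cball x0 (2 * d)"
      by (simp_all add: dist_norm norm_minus_commute[of x0])
  qed
  have inQS: "x + m *\<^sub>R e \<in> S" "x - m *\<^sub>R e \<in> S" if "x \<in> cball x0 d" "\<bar>m\<bar> \<le> d" for x m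
    using inQ[OF that] sub by auto
  have contH: "continuous_on Q H"
  proof -
    have "continuous_on Q (\<lambda>z. u (fst z + snd z *\<^sub>R e))" "continuous_on Q (\<lambda>z. u (fst z - snd z *\<^sub>R e))"
      by (rule continuous_on_compose2[OF cont], force intro!: continuous_intros,
          use inQS in \<open>force simp: Q_def\<close>)+
    then show ?thesis unfolding H_def w_def P_def case_prod_unfold
      by (intro continuous_intros) (use d in auto)
  qed
  have "compact Q" unfolding Q_def by (intro compact_Times) auto
  moreover have "Q \<noteq> {}" using d by (auto simp: Q_def)
  ultimately obtain z where z: "z \<in> Q" "\<And>y. y \<in> Q \<Longrightarrow> H y \<le> H z"
    using continuous_attains_sup[OF _ _ contH] by metis
  obtain y m where zy: "z = (y, m)" by force
  have ym: "y \<in> cball x0 d" "0 \<le> m" "m \<le> d" using z(1) by (auto simp: Q_def zy)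
  have "H z \<le> 0"
  proof (rule ccontr)
    assume pos: "\<not> H z \<le> 0"
    then have pos': "P y m < w y m" by (simp add: H_def zy)
    have wK: "w y m \<le> K'"
    proof -
      have "\<bar>u (y + m *\<^sub>R e)\<bar> \<le> K" "\<bar>u (y - m *\<^sub>R e)\<bar> \<le> K"
        using inQ[of y m] ym by (auto intro!: K)
      then show ?thesis using K'(1) unfolding w_def by (auto simp: field_simps)
    qed
    have mterm: "0 \<le> (B + 1) * m / d - B * m\<^sup>2 / d\<^sup>2"
    proof -
      have "B * m\<^sup>2 / d\<^sup>2 = B * (m / d) * (m / d)" by (simp add: power2_eq_square)
      also have "\<dots> \<le> B * (m / d) * 1"
        using ym d Bpos by (intro mult_left_mono) auto
      also have "\<dots> \<le> (B + 1) * m / d" using ym d by (simp add: field_simps)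
      finally show ?thesis by simp
    qed
    have m0: "0 < m"
    proof (rule ccontr)
      assume "\<not> 0 < m"
      then have "m = 0" using ym by auto
      then have "w y m = 0" "0 \<le> P y m" using K'pos by (auto simp: w_def P_def)
      then show False using pos' by auto
    qed
    have md: "m < d"
    proof (rule ccontr)
      assume "\<not> m < d"
      then have "m = d" using ym by auto
      then have "P y m = K' * ((norm (y - x0))\<^sup>2 / d\<^sup>2 + 1)" using d by (simp add: P_def field_simps power2_eq_square)
      then have "K' \<le> P y m" using K'pos by simp
      then show False using pos' wK by auto
    qed
    have yd: "norm (y - x0) < d"
    proof (rule ccontr)
      assume "\<not> norm (y - x0) < d"
      then have "norm (y - x0) = d" using ym by (auto simp: dist_norm norm_minus_commute)
      then have "P y m = K' * (1 + ((B + 1) * m / d - B * m\<^sup>2 / d\<^sup>2))" using d by (simp add: P_def)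
      then have "K' \<le> P y m" using K'pos mterm by simp
      then show False using pos' wK by auto
    qed
    define r where "r = min (d - norm (y - x0)) (min m (d - m))"
    have r0: "r > 0" using m0 md yd by (auto simp: r_def)
    have yt: "y + t *\<^sub>R b \<in> cball x0 d" if "\<bar>t\<bar> < r" "b \<in> Basis" for t b
    proof -
      have "norm (y + t *\<^sub>R b - x0) \<le> norm (y - x0) + norm (t *\<^sub>R b)"
        by (metis add_diff_eq add.commute norm_triangle_ineq diff_add_eq)
      also have "\<dots> \<le> d" using that by (auto simp: r_def)
      finally show ?thesis by (simp add: dist_norm norm_minus_commute)
    qed
    define Sb where "Sb = (\<lambda>b. (u2 b (y + m *\<^sub>R e) - u2 b (y - m *\<^sub>R e)) / 2)"
    have space: "Sb b - 2 * K' / d\<^sup>2 \<le> 0" if b: "b \<in> Basis" for b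
    proof -
      define q where "q = 1 / d\<^sup>2"
      define g where "g = (\<lambda>t. H (y + t *\<^sub>R b, m))"
      define g' where "g' = (\<lambda>t. (u1 b (y + m *\<^sub>R e + t *\<^sub>R b) - u1 b (y - m *\<^sub>R e + t *\<^sub>R b)) / 2
          - K' * ((2 * ((y - x0) \<bullet> b) + 2 * t) * q))"
      have nrm: "(norm (y + t *\<^sub>R b - x0))\<^sup>2 = (norm (y - x0))\<^sup>2 + 2 * t * ((y - x0) \<bullet> b) + t\<^sup>2" for t
        unfolding power2_norm_eq_inner using b
        by (simp add: inner_add_left inner_add_right inner_diff_left inner_diff_right inner_commute
            inner_same_Basis power2_eq_square algebra_simps)
      have g_eq: "g = (\<lambda>t. (u (y + m *\<^sub>R e + t *\<^sub>R b) - u (y - m *\<^sub>R e + t *\<^sub>R b)) / 2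
          - K' * (((norm (y - x0))\<^sup>2 + 2 * t * ((y - x0) \<bullet> b) + t\<^sup>2) * q + ((B + 1) * m / d - B * m\<^sup>2 / d\<^sup>2)))"
        unfolding g_def H_def w_def P_def by (simp add: nrm algebra_simps q_def add_divide_distrib diff_divide_distrib)
      have st: "y + m *\<^sub>R e + t *\<^sub>R b \<in> S" "y - m *\<^sub>R e + t *\<^sub>R b \<in> S" if "\<bar>t\<bar> < r" for t
        using inQS[OF yt[OF that b], of m] ym by (auto simp: algebra_simps)
      have dg: "(g has_real_derivative g' t) (at t)" if t: "\<bar>t\<bar> < r" for t
      proof -
        have "((\<lambda>t. u (y + m *\<^sub>R e + t *\<^sub>R b)) has_real_derivative u1 b (y + m *\<^sub>R e + t *\<^sub>R b)) (at t)"
          "((\<lambda>t. u (y - m *\<^sub>R e + t *\<^sub>R b)) has_real_derivative u1 b (y - m *\<^sub>R e + t *\<^sub>R b)) (at t)"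
          by (rule line_deriv_shift, rule D1[OF st(1)[OF t] b], rule line_deriv_shift, rule D1[OF st(2)[OF t] b])
        then show ?thesis unfolding g_eq g'_def
          by (auto intro!: derivative_eq_intros)
      qed
      have dg': "(g' has_real_derivative (Sb b - 2 * K' / d\<^sup>2)) (at 0)"
      proof -
        have "((\<lambda>t. u1 b (y + m *\<^sub>R e + t *\<^sub>R b)) has_real_derivative u2 b (y + m *\<^sub>R e)) (at 0)"
          "((\<lambda>t. u1 b (y - m *\<^sub>R e + t *\<^sub>R b)) has_real_derivative u2 b (y - m *\<^sub>R e)) (at 0)"
          using st[of 0] r0 D2 b by auto
        then show ?thesis unfolding g'_def Sb_def
          by (auto intro!: derivative_eq_intros) (auto simp: q_def)
      qed
      have "g t \<le> g 0" if "\<bar>t\<bar> < r" for t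
        unfolding g_def using z(2)[of "(y + t *\<^sub>R b, m)"] yt[OF that b] ym by (auto simp: Q_def zy)
      from second_deriv_local_max(2)[OF r0 dg dg' this] show ?thesis .
    qed
    \<comment> \<open>\<open>w\<close> sees \<open>x\<close> only through \<open>x + m e\<close> and
      \<open>x - m e\<close>, so its second \<open>m\<close>-derivative is its second derivative
      along \<open>e\<close>. Testing in \<open>m\<close> thus bounds \<open>Sb e\<close> through
      the concave part of the barrier.\<close>
    have mudir: "Sb e + 2 * K' * B / d\<^sup>2 \<le> 0"
    proof -
      define g where "g = (\<lambda>t. H (y, m + t))"
      define g' where "g' = (\<lambda>t. (u1 e (y + m *\<^sub>R e + t *\<^sub>R e) + u1 e (y - m *\<^sub>R e + (-t) *\<^sub>R e)) / 2
          - K' * ((B + 1) / d - 2 * B * (m + t) / d\<^sup>2))"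
      have g_eq: "g = (\<lambda>t. (u (y + m *\<^sub>R e + t *\<^sub>R e) - u (y - m *\<^sub>R e + (-t) *\<^sub>R e)) / 2
          - K' * ((norm (y - x0))\<^sup>2 / d\<^sup>2 + (B + 1) * (m + t) / d - B * (m + t)\<^sup>2 / d\<^sup>2))"
        unfolding g_def H_def w_def P_def by (simp add: algebra_simps)
      have st: "y + m *\<^sub>R e + t *\<^sub>R e \<in> S" "y - m *\<^sub>R e + (-t) *\<^sub>R e \<in> S" if "\<bar>t\<bar> < r" for t
        using inQS[OF ym(1), of "m + t"] that by (auto simp: algebra_simps r_def)
      have dg: "(g has_real_derivative g' t) (at t)" if t: "\<bar>t\<bar> < r" for t
      proof -
        have 1: "((\<lambda>t. u (y + m *\<^sub>R e + t *\<^sub>R e)) has_real_derivative u1 e (y + m *\<^sub>R e + t *\<^sub>R e)) (at t)"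
          by (rule line_deriv_shift, rule D1[OF st(1)[OF t] e])
        have "((\<lambda>t. u (y - m *\<^sub>R e + t *\<^sub>R e)) has_real_derivative u1 e (y - m *\<^sub>R e + (-t) *\<^sub>R e)) (at (-t))"
          by (rule line_deriv_shift, rule D1[OF st(2)[OF t] e])
        then have 2: "((\<lambda>t. u (y - m *\<^sub>R e + (-t) *\<^sub>R e)) has_real_derivative - u1 e (y - m *\<^sub>R e + (-t) *\<^sub>R e)) (at t)"
          by (simp only: DERIV_mirror)
        show ?thesis unfolding g_eq g'_def
          using 1 2 by (auto intro!: derivative_eq_intros) (use d in \<open>auto simp: field_simps power4_eq_xxxx power2_eq_square\<close>)
      qed
      have dg': "(g' has_real_derivative (Sb e + 2 * K' * B / d\<^sup>2)) (at 0)"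
      proof -
        have 1: "((\<lambda>t. u1 e (y + m *\<^sub>R e + t *\<^sub>R e)) has_real_derivative u2 e (y + m *\<^sub>R e)) (at 0)"
          using st(1)[of 0] r0 D2 e by auto
        have "((\<lambda>t. u1 e (y - m *\<^sub>R e + t *\<^sub>R e)) has_real_derivative u2 e (y - m *\<^sub>R e)) (at (- 0))"
          using st(2)[of 0] r0 D2 e by auto
        then have 2: "((\<lambda>t. u1 e (y - m *\<^sub>R e + (-t) *\<^sub>R e)) has_real_derivative - u2 e (y - m *\<^sub>R e)) (at 0)"
          by (simp only: DERIV_mirror)
        show ?thesis unfolding g'_def Sb_def
          using 1 2 by (auto intro!: derivative_eq_intros) (use d in \<open>auto simp: field_simps power4_eq_xxxx power2_eq_square\<close>)
      qed
      have "g t \<le> g 0" if "\<bar>t\<bar> < r" for t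
        unfolding g_def using z(2)[of "(y, m + t)"] that ym by (simp add: Q_def zy r_def abs_less_iff)
      from second_deriv_local_max(2)[OF r0 dg dg' this] show ?thesis .
    qed
    \<comment> \<open>With n the dimension and k = \<open>K' / d\<^sup>2\<close>, the other
      directions contribute at most 2 (n - 1) k and \<open>e\<close> at most -4 n k. The total is
      below -k < -N, yet it is half a difference of two values of \<open>f\<close>, hence at least
      -N.\<close>
    have "(\<Sum>b\<in>Basis - {e}. Sb b - 2 * K' / d\<^sup>2) \<le> 0"
      by (intro sum_nonpos) (use space in auto)
    then have "(\<Sum>b\<in>Basis - {e}. Sb b) - real (DIM('a) - 1) * (2 * K' / d\<^sup>2) \<le> 0"
      by (simp add: sum_subtractf card_Diff_singleton e)
    then have "(\<Sum>b\<in>Basis. Sb b) - Sb e - (real DIM('a) - 1) * (2 * K' / d\<^sup>2) \<le> 0"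
      using e DIM_positive[where 'a='a] by (simp add: sum_diff1 of_nat_diff)
    moreover have "Sb e - 2 * K' / d\<^sup>2 \<le> 0" using space e by auto
    moreover have "(\<Sum>b\<in>Basis. Sb b) = (f (y + m *\<^sub>R e) - f (y - m *\<^sub>R e)) / 2"
      using D3[OF inQS(1)[of y m]] D3[OF inQS(2)[of y m]] ym
      by (simp add: Sb_def sum_subtractf flip: sum_divide_distrib)
    moreover have "\<bar>f (y + m *\<^sub>R e)\<bar> \<le> N" "\<bar>f (y - m *\<^sub>R e)\<bar> \<le> N"
      using inQ[of y m] ym by (auto intro!: N)
    moreover have "N < K' / d\<^sup>2" using K'(2) d by (simp add: field_simps)
    moreover have "2 * K' * B / d\<^sup>2 = 4 * real DIM('a) * (K' / d\<^sup>2)" by (simp add: B_def)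
    moreover have "(real DIM('a) - 1) * (2 * K' / d\<^sup>2) = 2 * real DIM('a) * (K'/d\<^sup>2) - 2 * (K'/d\<^sup>2)"
      by (simp add: algebra_simps diff_divide_distrib)
    ultimately show False using mudir by argo
  qed
  then have "H (x0, \<mu>) \<le> 0" using z(2)[of "(x0, \<mu>)"] mu d by (force simp: Q_def)
  then have "w x0 \<mu> \<le> K' * ((B + 1) * \<mu> / d - B * \<mu>\<^sup>2 / d\<^sup>2)" by (simp add: H_def P_def)
  also have "\<dots> \<le> K' * ((B + 1) * \<mu> / d)"
    using K'pos Bpos by (intro mult_left_mono) auto
  finally show ?thesis by (simp add: w_def B_def field_simps)
qed

lemma lap_on_uminus: "lap_on S u f \<Longrightarrow> lap_on S (\<lambda>x. - u x) (\<lambda>x. - f x)"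
  unfolding lap_on_def
proof (elim conjE exE, intro conjI)
  fix u1 u2
  assume *: "\<forall>x\<in>S. (\<forall>b\<in>Basis. ((\<lambda>t. u (x + t *\<^sub>R b)) has_real_derivative u1 b x) (at 0) \<and>
             ((\<lambda>t. u1 b (x + t *\<^sub>R b)) has_real_derivative u2 b x) (at 0)) \<and> sum (\<lambda>b. u2 b x) Basis = f x"
  show "\<exists>u1 u2. \<forall>x\<in>S. (\<forall>b\<in>Basis. ((\<lambda>t. - u (x + t *\<^sub>R b)) has_real_derivative u1 b x) (at 0) \<and>
             ((\<lambda>t. u1 b (x + t *\<^sub>R b)) has_real_derivative u2 b x) (at 0)) \<and> (\<Sum>b\<in>Basis. u2 b x) = - f x"
    by (rule exI[of _ "\<lambda>b x. - u1 b x"], rule exI[of _ "\<lambda>b x. - u2 b x"])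
       (use * in \<open>auto intro!: derivative_intros simp: sum_negf\<close>)
qed (auto intro!: continuous_intros)

text \<open>The strict inequality needed by the barrier leaves a slack in \<open>K'\<close>, which
  is sent to 0; applying the one-sided bound to \<open>-u\<close> as well gives the absolute value.
  The result is stated for symmetric differences, so it bounds difference quotients with a constant
  independent of the step.\<close>

lemma gradient_estimate:
  fixes u f :: "'a::euclidean_space \<Rightarrow> real"
  assumes lap: "lap_on S u f" and sub: "cball x0 (2 * d) \<subseteq> S" and d: "0 < d" and e: "e \<in> Basis"
    and K: "\<And>x. x \<in> cball x0 (2 * d) \<Longrightarrow> \<bar>u x\<bar> \<le> K"
    and N: "\<And>x. x \<in> cball x0 (2 * d) \<Longrightarrow> \<bar>f x\<bar> \<le> N"
    and mu: "0 \<le> \<mu>" "\<mu> \<le> d"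
  shows "\<bar>u (x0 + \<mu> *\<^sub>R e) - u (x0 - \<mu> *\<^sub>R e)\<bar> \<le> 2 * (2 * real DIM('a) + 1) * (K + N * d\<^sup>2) * \<mu> / d"
proof -
  have K0: "0 \<le> K" using K[of x0] d by (smt (verit) centre_in_cball)
  have N0: "0 \<le> N" using N[of x0] d by (smt (verit) centre_in_cball)
  define A where "A = 2 * (2 * real DIM('a) + 1) * \<mu> / d"
  have A0: "0 \<le> A" using mu d by (simp add: A_def)
  have "\<bar>u (x0 + \<mu> *\<^sub>R e) - u (x0 - \<mu> *\<^sub>R e)\<bar> \<le> A * (K + N * d\<^sup>2)"
  proof (rule field_le_epsilon)
    fix \<epsilon> :: real assume "\<epsilon> > 0"
    define \<eta> where "\<eta> = \<epsilon> / (A + 1)"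
    have eta: "\<eta> > 0" "A * \<eta> \<le> \<epsilon>" using \<open>\<epsilon> > 0\<close> A0 by (auto simp: \<eta>_def field_simps)
    have 1: "K \<le> K + N * d\<^sup>2 + \<eta>" "N * d\<^sup>2 < K + N * d\<^sup>2 + \<eta>" using K0 N0 eta by auto
    have "u (x0 + \<mu> *\<^sub>R e) - u (x0 - \<mu> *\<^sub>R e) \<le> A * (K + N * d\<^sup>2 + \<eta>)"
      using gradient_estimate_aux[OF lap sub d e K N 1 mu] by (simp add: A_def mult_ac)
    moreover have "- u (x0 + \<mu> *\<^sub>R e) - - u (x0 - \<mu> *\<^sub>R e) \<le> A * (K + N * d\<^sup>2 + \<eta>)"
      using gradient_estimate_aux[OF lap_on_uminus[OF lap] sub d e _ _ 1 mu] K N by (simp add: A_def mult_ac)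
    ultimately show "\<bar>u (x0 + \<mu> *\<^sub>R e) - u (x0 - \<mu> *\<^sub>R e)\<bar> \<le> A * (K + N * d\<^sup>2) + \<epsilon>"
      using eta by (auto simp: algebra_simps)
  qed
  then show ?thesis by (simp add: A_def mult_ac)
qed

section \<open>Difference quotients of solutions and polynomial approximation on lines\<close>

definition diffq :: "real \<Rightarrow> 'a::real_vector \<Rightarrow> ('a \<Rightarrow> real) \<Rightarrow> 'a \<Rightarrow> real" where
  "diffq h e u = (\<lambda>x. (u (x + h *\<^sub>R e) - u x) / h)"

lemma lap_on_diffq:
  assumes lap: "lap_on S u (\<lambda>_. 0)" and S': "open S'" "S' \<subseteq> S" "\<And>x. x \<in> S' \<Longrightarrow> x + h *\<^sub>R e \<in> S"
  shows "lap_on S' (diffq h e u) (\<lambda>_. 0)"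
proof -
  obtain u1 u2 where
    D1: "\<And>x b. x \<in> S \<Longrightarrow> b \<in> Basis \<Longrightarrow> ((\<lambda>t. u (x + t *\<^sub>R b)) has_real_derivative u1 b x) (at 0)" and
    D2: "\<And>x b. x \<in> S \<Longrightarrow> b \<in> Basis \<Longrightarrow> ((\<lambda>t. u1 b (x + t *\<^sub>R b)) has_real_derivative u2 b x) (at 0)" and
    D3: "\<And>x. x \<in> S \<Longrightarrow> (\<Sum>b\<in>Basis. u2 b x) = 0"
    and opS: "open S" and cont: "continuous_on S u"
    using lap unfolding lap_on_def by metis
  have sw: "x + t *\<^sub>R b + h *\<^sub>R e = x + h *\<^sub>R e + t *\<^sub>R b" for x b and t :: real by (simp add: algebra_simps)
  have "continuous_on S' (diffq h e u)" unfolding diffq_def divide_inverse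
    by (intro continuous_intros continuous_on_compose2[OF cont]) (use S' in auto)
  moreover have "\<exists>v1 v2. \<forall>x\<in>S'. (\<forall>b\<in>Basis. ((\<lambda>t. diffq h e u (x + t *\<^sub>R b)) has_real_derivative v1 b x) (at 0) \<and>
        ((\<lambda>t. v1 b (x + t *\<^sub>R b)) has_real_derivative v2 b x) (at 0)) \<and> (\<Sum>b\<in>Basis. v2 b x) = 0"
  proof (intro exI ballI conjI)
    fix x assume x: "x \<in> S'"
    then have x': "x \<in> S" "x + h *\<^sub>R e \<in> S" using S' by auto
    show "((\<lambda>t. diffq h e u (x + t *\<^sub>R b)) has_real_derivative diffq h e (u1 b) x) (at 0)"
      "((\<lambda>t. diffq h e (u1 b) (x + t *\<^sub>R b)) has_real_derivative diffq h e (u2 b) x) (at 0)" if b: "b \<in> Basis" for b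
      unfolding diffq_def sw using D1[OF _ b] D2[OF _ b] x' by (auto intro!: DERIV_cdivide DERIV_diff)
    show "(\<Sum>b\<in>Basis. diffq h e (u2 b) x) = 0"
      using D3[OF x'(1)] D3[OF x'(2)] by (simp add: diffq_def sum_subtractf flip: sum_divide_distrib)
  qed
  ultimately show ?thesis using S'(1) unfolding lap_on_def by blast
qed

text \<open>A difference quotient of a solution of the homogeneous equation is again one, so the
  gradient estimate with \<open>N = 0\<close> can be iterated; derivatives above the second never
  have to exist. Each round costs \<open>3 * d\<close> of radius: \<open>2 * d\<close> for the ball
  in the estimate and at most \<open>d\<close> for the shift. The bound does not depend on the step
  \<open>h\<close>.\<close>

lemma iterated_difference_bound:
  fixes u :: "'a::euclidean_space \<Rightarrow> real"
  assumes lap: "lap_on (ball x0 \<rho>) u (\<lambda>_. 0)" and e: "e \<in> Basis"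
    and K: "\<And>x. x \<in> ball x0 \<rho> \<Longrightarrow> \<bar>u x\<bar> \<le> K"
    and h: "0 < h" "h \<le> d"
  shows "lap_on (ball x0 (\<rho> - 3 * real n * d)) ((diffq h e ^^ n) u) (\<lambda>_. 0) \<and>
     (\<forall>x \<in> ball x0 (\<rho> - 3 * real n * d). \<bar>(diffq h e ^^ n) u x\<bar> \<le> K * ((2 * real DIM('a) + 1) / d) ^ n)"
proof (induction n)
  case 0
  then show ?case using lap K by simp
next
  case (Suc n)
  define v where "v = (diffq h e ^^ n) u"
  define r where "r = \<rho> - 3 * real n * d"
  define L where "L = K * ((2 * real DIM('a) + 1) / d) ^ n"
  have r': "\<rho> - 3 * real (Suc n) * d = r - 3 * d" by (simp add: r_def algebra_simps)
  have d: "0 < d" using h by auto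
  have ne: "norm e = 1" using e by simp
  have lv: "lap_on (ball x0 r) v (\<lambda>_. 0)" and bv: "\<And>x. x \<in> ball x0 r \<Longrightarrow> \<bar>v x\<bar> \<le> L"
    using Suc by (auto simp: v_def r_def L_def)
  have shift: "x + s *\<^sub>R e \<in> ball x0 (r - 3 * d + \<bar>s\<bar>)" if "x \<in> ball x0 (r - 3 * d)" for x s
  proof -
    have "norm (x - x0 + s *\<^sub>R e) \<le> norm (x - x0) + \<bar>s\<bar>" using norm_triangle_ineq[of "x - x0" "s *\<^sub>R e"] ne by simp
    moreover have "x - x0 + s *\<^sub>R e = x + s *\<^sub>R e - x0" by simp
    ultimately show ?thesis using that by (simp add: dist_norm norm_minus_commute[of x0])
  qed
  have "lap_on (ball x0 (r - 3 * d)) (diffq h e v) (\<lambda>_. 0)"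
  proof (rule lap_on_diffq[OF lv])
    show "ball x0 (r - 3 * d) \<subseteq> ball x0 r" using d by (intro subset_ball) auto
    show "x + h *\<^sub>R e \<in> ball x0 r" if "x \<in> ball x0 (r - 3 * d)" for x
      using shift[OF that, of h] h d by (auto intro: less_le_trans)
  qed auto
  moreover have "\<bar>diffq h e v x\<bar> \<le> L * ((2 * real DIM('a) + 1) / d)" if x: "x \<in> ball x0 (r - 3 * d)" for x
  proof -
    \<comment> \<open>Centring at the midpoint turns the forward difference into the symmetric
      difference of the gradient estimate.\<close>
    define y where "y = x + (h / 2) *\<^sub>R e"
    have y: "y \<in> ball x0 (r - 3 * d + h / 2)" using shift[OF x, of "h / 2"] h by (simp add: y_def)
    have cb: "cball y (2 * d) \<subseteq> ball x0 r"
    proof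
      fix z assume "z \<in> cball y (2 * d)"
      then show "z \<in> ball x0 r" using y h d dist_triangle[of x0 z y] by simp
    qed
    have "\<bar>v (y + (h / 2) *\<^sub>R e) - v (y - (h / 2) *\<^sub>R e)\<bar> \<le> 2 * (2 * real DIM('a) + 1) * (L + 0 * d\<^sup>2) * (h / 2) / d"
      using h d cb by (intro gradient_estimate[OF lv cb d e]) (auto intro!: bv)
    moreover have "y + (h / 2) *\<^sub>R e = x + h *\<^sub>R e" "y - (h / 2) *\<^sub>R e = x"
      by (simp_all add: y_def add.assoc flip: scaleR_left_distrib)
    moreover have "2 * (2 * real DIM('a) + 1) * (L + 0 * d\<^sup>2) * (h / 2) / d = L * ((2 * real DIM('a) + 1) / d) * h"
      using d by (simp add: field_simps)
    ultimately have "\<bar>v (x + h *\<^sub>R e) - v x\<bar> \<le> L * ((2 * real DIM('a) + 1) / d) * h" by metis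
    then show ?thesis using h by (simp add: diffq_def abs_divide pos_divide_le_eq)
  qed
  ultimately show ?case unfolding r' by (simp add: v_def L_def mult_ac)
qed

text \<open>The Steklov average. This mollifier is matched to \<open>diffq\<close>: the derivative
  of \<open>avg h g\<close> is exactly \<open>diffq h 1 g\<close>, so the n-fold average of a merely
  continuous function has the n-fold difference quotient as its n-th derivative.\<close>

definition avg :: "real \<Rightarrow> (real \<Rightarrow> real) \<Rightarrow> real \<Rightarrow> real" where
  "avg h g = (\<lambda>x. integral {x..x + h} g / h)"

lemma avg_has_derivative:
  assumes g: "continuous_on UNIV g" and h: "0 < h"
  shows "(avg h g has_real_derivative diffq h 1 g x) (at x)"
proof -
  define a b where "a = x - 1" and "b = x + h + 1"
  have cg: "continuous_on S g" for S using g continuous_on_subset by blast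
  have int: "g integrable_on {p..q}" for p q using cg integrable_continuous_real by blast
  have D: "((\<lambda>y. integral {a..y} g) has_real_derivative g t) (at t)" if "a < t" "t < b" for t
    using integral_has_real_derivative[OF cg, of t a b] that at_within_interior[of t "{a..b}"] by auto
  have D2: "((\<lambda>y. integral {a..y + h} g) has_real_derivative g (x + h)) (at x)"
    using DERIV_shift[of "\<lambda>y. integral {a..y} g" "g (x + h)" x h] D[of "x + h"] h by (simp add: a_def b_def)
  have "((\<lambda>y. (integral {a..y + h} g - integral {a..y} g) / h) has_real_derivative (g (x + h) - g x) / h) (at x)"
    using D[of x] D2 h by (auto intro!: DERIV_cdivide DERIV_diff simp: a_def b_def)
  moreover have "\<forall>\<^sub>F y in nhds x. (integral {a..y + h} g - integral {a..y} g) / h = avg h g y"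
  proof -
    have "\<forall>\<^sub>F y in nhds x. y \<in> {a<..}" by (intro eventually_nhds_in_open) (auto simp: a_def)
    then show ?thesis
    proof eventually_elim
      case (elim y)
      then show ?case using Henstock_Kurzweil_Integration.integral_combine[of a y "y + h" g] int h by (auto simp: avg_def)
    qed
  qed
  ultimately show ?thesis by (simp add: diffq_def DERIV_cong_ev)
qed

lemma continuous_avg:
  assumes "continuous_on UNIV g" "0 < h"
  shows "continuous_on UNIV (avg h g)"
  using avg_has_derivative[OF assms] by (intro DERIV_continuous_on) auto

lemma continuous_diffq:
  assumes "continuous_on UNIV g"
  shows "continuous_on UNIV (diffq h (1::real) g)"
  unfolding diffq_def divide_inverse by (intro continuous_intros continuous_on_compose2[OF assms]) auto

lemma continuous_avg_funpow:
  assumes "continuous_on UNIV g" "0 < h"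
  shows "continuous_on UNIV ((avg h ^^ n) g)"
  by (induction n) (use assms continuous_avg in auto)

lemma avg_diffq_commute:
  assumes g: "continuous_on UNIV g" and h: "0 < h"
  shows "avg h (diffq h 1 g) = diffq h 1 (avg h g)"
proof
  fix x
  have cg: "continuous_on S g" for S using g continuous_on_subset by blast
  have int: "g integrable_on {p..q}" for p q using cg integrable_continuous_real by blast
  have i2: "integral {x..x + h} (\<lambda>w. g (w + h)) = integral {x + h..x + h + h} g"
    using integral_shift_real_ivl[of "x + h" h "x + h + h" g] by (simp add: algebra_simps)
  have i3: "(\<lambda>w. g (w + h)) integrable_on {x..x + h}"
    by (intro integrable_continuous_real continuous_on_compose2[OF g]) (auto intro!: continuous_intros)
  show "avg h (diffq h 1 g) x = diffq h 1 (avg h g) x"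
    using integral_diff[OF i3 int[of x "x + h"]] unfolding i2
    by (simp add: avg_def diffq_def) (simp add: diff_divide_distrib)
qed

lemma avg_funpow_diffq_commute:
  assumes g: "continuous_on UNIV g" and h: "0 < h"
  shows "(avg h ^^ n) (diffq h 1 g) = diffq h 1 ((avg h ^^ n) g)"
  by (induction n) (use avg_diffq_commute[OF continuous_avg_funpow[OF g h] h] in auto)

text \<open>The n-fold average at \<open>x\<close> samples \<open>g\<close> only on the interval
  from \<open>x\<close> to \<open>x + n h\<close>.\<close>

lemma avg_funpow_close:
  assumes g: "continuous_on UNIV g" and h: "0 < h"
    and "\<And>y. x \<le> y \<Longrightarrow> y \<le> x + real n * h \<Longrightarrow> \<bar>g y - v\<bar> \<le> \<epsilon>"
  shows "\<bar>(avg h ^^ n) g x - v\<bar> \<le> \<epsilon>"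
  using assms(3)
proof (induction n arbitrary: x)
  case 0
  then show ?case by simp
next
  case (Suc n)
  define f where "f = (avg h ^^ n) g"
  have cf: "continuous_on UNIV f" using continuous_avg_funpow[OF g h] by (simp add: f_def)
  have int: "f integrable_on {x..x + h}"
    using cf continuous_on_subset integrable_continuous_real by blast
  have f: "\<bar>f w - v\<bar> \<le> \<epsilon>" if "w \<in> {x..x + h}" for w
    unfolding f_def using that h by (intro Suc.IH Suc.prems) (auto simp: algebra_simps)
  have "norm (integral {x..x + h} (\<lambda>w. f w - v)) \<le> \<epsilon> * (x + h - x)"
    using f h continuous_on_subset[OF cf] by (intro integral_bound) (auto intro!: continuous_intros)
  moreover have "integral {x..x + h} (\<lambda>w. f w - v) = integral {x..x + h} f - v * h"
    using integral_diff[OF int, of "\<lambda>_. v"] h by (simp add: integrable_const_ivl)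
  ultimately have "\<bar>integral {x..x + h} f - v * h\<bar> \<le> \<epsilon> * h" by simp
  moreover have "integral {x..x + h} f - v * h = h * (avg h f x - v)"
    using h by (simp add: avg_def field_simps)
  ultimately have "h * \<bar>avg h f x - v\<bar> \<le> h * \<epsilon>" using h by (simp add: abs_mult mult_ac)
  then show ?case using h by (simp add: f_def)
qed

lemma pderiv_sum': "pderiv (\<Sum>i\<in>A. f i) = (\<Sum>i\<in>A. pderiv (f i))"
  by (induction A rule: infinite_finite_induct) (auto simp: pderiv_add)

lemma poly_antiderivative: "\<exists>Q. pderiv Q = P \<and> degree Q \<le> Suc (degree P)"
  for P :: "real poly"
proof (intro exI conjI)
  define Q where "Q = (\<Sum>i\<le>degree P. monom (coeff P i / real (Suc i)) (Suc i))"
  have "pderiv Q = (\<Sum>i\<le>degree P. monom (coeff P i) i)"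
    unfolding Q_def pderiv_sum' by (intro sum.cong) (auto simp: pderiv_monom simp del: of_nat_Suc)
  then show "pderiv Q = P" by (simp add: poly_as_sum_of_monoms)
  show "degree Q \<le> Suc (degree P)"
    unfolding Q_def by (intro degree_sum_le) (auto intro!: order.trans[OF degree_monom_le])
qed

text \<open>Taylor's theorem with the remainder obtained by repeated integration: differentiating
  one average trades it for one difference quotient, and the antiderivative of the inductive
  polynomial, normalised to agree at \<open>a\<close>, is compared by monotonicity.\<close>

lemma avg_poly_approx:
  assumes h: "0 < h"
  shows "continuous_on UNIV g \<Longrightarrow> (\<And>x. x \<in> {a..c} \<Longrightarrow> \<bar>(diffq h 1 ^^ n) g x\<bar> \<le> K) \<Longrightarrow>
    \<exists>P. degree P \<le> n \<and> (\<forall>x\<in>{a..c}. \<bar>(avg h ^^ n) g x - poly P x\<bar> \<le> K * (x - a) ^ n / fact n)"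
proof (induction n arbitrary: g)
  case 0
  show ?case by (rule exI[of _ 0]) (use 0 in auto)
next
  case (Suc n)
  have "\<exists>P. degree P \<le> n \<and> (\<forall>x\<in>{a..c}. \<bar>(avg h ^^ n) (diffq h 1 g) x - poly P x\<bar> \<le> K * (x - a) ^ n / fact n)"
    by (rule Suc.IH[OF continuous_diffq[OF Suc.prems(1)]]) (use Suc.prems(2) in \<open>auto simp: funpow_swap1\<close>)
  then obtain P where P: "degree P \<le> n"
    "\<And>x. x \<in> {a..c} \<Longrightarrow> \<bar>(avg h ^^ n) (diffq h 1 g) x - poly P x\<bar> \<le> K * (x - a) ^ n / fact n"
    by blast
  obtain Q where Q: "pderiv Q = P" "degree Q \<le> Suc n" using poly_antiderivative[of P] P(1) by force
  define f where "f = (avg h ^^ Suc n) g"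
  define Q' where "Q' = Q + [:f a - poly Q a:]"
  have Q': "degree Q' \<le> Suc n" unfolding Q'_def using Q(2) by (intro degree_add_le) auto
  define \<phi> where "\<phi> = (\<lambda>x. f x - poly Q' x)"
  define \<phi>' where "\<phi>' = (\<lambda>x. (avg h ^^ n) (diffq h 1 g) x - poly P x)"
  have D: "(\<phi> has_real_derivative \<phi>' x) (at x)" for x
  proof -
    have "(f has_real_derivative (avg h ^^ n) (diffq h 1 g) x) (at x)"
      using avg_has_derivative[OF continuous_avg_funpow[OF Suc.prems(1) h] h, of n x]
      by (simp add: f_def avg_funpow_diffq_commute[OF Suc.prems(1) h])
    moreover have "((\<lambda>x. poly Q' x) has_real_derivative poly P x) (at x)"
      unfolding Q'_def using Q(1) by (auto intro!: derivative_eq_intros)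
    ultimately show ?thesis unfolding \<phi>_def \<phi>'_def by (rule DERIV_diff)
  qed
  define \<psi> where "\<psi> = (\<lambda>x. K * (x - a) ^ Suc n / fact (Suc n))"
  have D2: "(\<psi> has_real_derivative K * (x - a) ^ n / fact n) (at x)" for x
  proof -
    have "(\<psi> has_real_derivative K * (real (Suc n) * (x - a) ^ n) / fact (Suc n)) (at x)"
      unfolding \<psi>_def by (auto intro!: derivative_eq_intros simp del: of_nat_Suc fact_Suc power_Suc)
    also have "K * (real (Suc n) * (x - a) ^ n) / fact (Suc n) = K * (x - a) ^ n / fact n"
      unfolding fact_Suc by (simp add: divide_simps del: of_nat_Suc)
    finally show ?thesis .
  qed
  have "\<bar>\<phi> x\<bar> \<le> \<psi> x" if x: "x \<in> {a..c}" for x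
  proof -
    have "\<psi> a - \<phi> a \<le> \<psi> x - \<phi> x"
      by (rule DERIV_nonneg_imp_nondecreasing[of a x "\<lambda>x. \<psi> x - \<phi> x"])
         (use x P(2) in \<open>auto intro!: exI DERIV_diff D D2 simp: \<phi>'_def abs_le_iff\<close>)
    moreover have "\<psi> a + \<phi> a \<le> \<psi> x + \<phi> x"
      by (rule DERIV_nonneg_imp_nondecreasing[of a x "\<lambda>x. \<psi> x + \<phi> x"])
         (use x P(2) in \<open>fastforce intro!: exI DERIV_add D D2 simp: \<phi>'_def abs_le_iff\<close>)+
    moreover have "\<psi> a = 0" "\<phi> a = 0" by (auto simp: \<psi>_def \<phi>_def Q'_def)
    ultimately show ?thesis by auto
  qed
  then show ?case using Q' unfolding \<phi>_def \<psi>_def f_def by blast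
qed

lemma diffq_funpow_cong:
  assumes "0 < h" "\<And>y. x \<le> y \<Longrightarrow> y \<le> x + real n * h \<Longrightarrow> f y = g y"
  shows "(diffq h 1 ^^ n) f x = (diffq h (1::real) ^^ n) g x"
  using assms(2)
proof (induction n arbitrary: x)
  case (Suc n)
  have "(diffq h 1 ^^ n) f x = (diffq h 1 ^^ n) g x" "(diffq h 1 ^^ n) f (x + h) = (diffq h 1 ^^ n) g (x + h)"
    by (rule Suc.IH, rule Suc.prems; use assms(1) in \<open>simp add: algebra_simps\<close>)+
  then show ?case by (simp add: diffq_def[of h 1 "(diffq h 1 ^^ n) f"] diffq_def[of h 1 "(diffq h 1 ^^ n) g"])
qed auto

text \<open>A bound on n-th difference quotients that is uniform in the step acts as a bound on the
  n-th derivative: the averages have Taylor polynomials with the right remainder and are arbitrarily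
  close to \<open>g\<close>, which itself may be merely continuous.\<close>

lemma poly_approx_of_differences:
  assumes ac: "a < c" "c < c'" and g: "continuous_on {a..c'} g" and h0: "0 < h0"
    and K: "\<And>h x. 0 < h \<Longrightarrow> h < h0 \<Longrightarrow> x \<in> {a..c} \<Longrightarrow> \<bar>(diffq h 1 ^^ n) g x\<bar> \<le> K"
    and E: "0 < E"
  shows "\<exists>P. degree P \<le> n \<and> (\<forall>x\<in>{a..c}. \<bar>g x - poly P x\<bar> \<le> K * (c - a) ^ n / fact n + E)"
proof -
  \<comment> \<open>Clamping the argument extends \<open>g\<close> continuously to the whole line,
    where the averages are defined.\<close>
  define G where "G = (\<lambda>x. g (max a (min c' x)))"
  have G: "continuous_on UNIV G" unfolding G_def
    by (rule continuous_on_compose2[OF g]) (use ac in \<open>auto intro!: continuous_intros\<close>)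
  have "uniformly_continuous_on {a..c'} g" using g by (intro compact_uniformly_continuous) auto
  then obtain \<delta> where \<delta>: "0 < \<delta>" "\<And>x y. x \<in> {a..c'} \<Longrightarrow> y \<in> {a..c'} \<Longrightarrow> \<bar>y - x\<bar> < \<delta> \<Longrightarrow> \<bar>g y - g x\<bar> < E"
    using E unfolding uniformly_continuous_on_def dist_real_def by metis
  \<comment> \<open>\<open>n * h\<close> stays below both the modulus of continuity and the margin
    \<open>c' - c\<close>, so averaging changes little and every sampled point lies in
    \<open>{a..c'}\<close>.\<close>
  define h where "h = min (h0 / 2) (min \<delta> (c' - c) / (real n + 2))"
  have h: "0 < h" "h < h0" using h0 \<delta> ac by (auto simp: h_def)
  have nh: "real n * h < min \<delta> (c' - c)"
  proof -
    have "real n * h \<le> real n * (min \<delta> (c' - c) / (real n + 2))"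
      by (intro mult_left_mono) (auto simp: h_def)
    also have "\<dots> < min \<delta> (c' - c)" using \<delta>(1) ac by (simp add: field_simps del: min_less_iff_conj)
    finally show ?thesis .
  qed
  have Gg: "G y = g y" if "y \<in> {a..c'}" for y using that by (simp add: G_def)
  have "\<bar>(diffq h 1 ^^ n) G x\<bar> \<le> K" if x: "x \<in> {a..c}" for x
  proof -
    have "(diffq h 1 ^^ n) G x = (diffq h 1 ^^ n) g x"
      by (rule diffq_funpow_cong[OF h(1)]) (use x nh in \<open>auto intro!: Gg\<close>)
    then show ?thesis using K[OF h x] by simp
  qed
  from avg_poly_approx[OF h(1) G this] obtain P where P: "degree P \<le> n"
    "\<And>x. x \<in> {a..c} \<Longrightarrow> \<bar>(avg h ^^ n) G x - poly P x\<bar> \<le> K * (x - a) ^ n / fact n" by blast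
  have "\<bar>g x - poly P x\<bar> \<le> K * (c - a) ^ n / fact n + E" if x: "x \<in> {a..c}" for x
  proof -
    have "\<bar>(avg h ^^ n) G x - g x\<bar> \<le> E"
    proof (rule avg_funpow_close[OF G h(1)])
      fix y assume y: "x \<le> y" "y \<le> x + real n * h"
      then have "y \<in> {a..c'}" using x nh by auto
      then show "\<bar>G y - g x\<bar> \<le> E" using \<delta>(2)[of x y] y x nh ac by (simp add: Gg)
    qed
    moreover have "K * (x - a) ^ n / fact n \<le> K * (c - a) ^ n / fact n"
    proof -
      have "0 \<le> K" using K[OF h x] by linarith
      then show ?thesis using x by (intro divide_right_mono mult_left_mono power_mono) auto
    qed
    ultimately show ?thesis using P(2)[OF x] by linarith
  qed
  then show ?thesis using P(1) by blast
qed

section \<open>Lagrange interpolation at separated nodes and separate analyticity\<close>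

definition lag :: "(nat \<Rightarrow> 'a::field) \<Rightarrow> nat \<Rightarrow> nat \<Rightarrow> 'a \<Rightarrow> 'a" where
  "lag x n i z = (\<Prod>j\<in>{..n} - {i}. (z - x j) / (x i - x j))"

definition lag_poly :: "(nat \<Rightarrow> 'a::field) \<Rightarrow> nat \<Rightarrow> nat \<Rightarrow> 'a poly" where
  "lag_poly x n i = (\<Prod>j\<in>{..n} - {i}. smult (1 / (x i - x j)) [:- x j, 1:])"

lemma poly_lag_poly: "poly (lag_poly x n i) z = lag x n i z"
  unfolding lag_poly_def lag_def poly_prod by (intro prod.cong) (auto simp: divide_simps)

lemma degree_lag_poly:
  assumes "i \<le> n" shows "degree (lag_poly x n i) \<le> n"
proof -
  have "degree (lag_poly x n i) \<le> (\<Sum>j\<in>{..n} - {i}. degree (smult (1 / (x i - x j)) [:- x j, 1:]))"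
    unfolding lag_poly_def using degree_prod_sum_le[of "{..n} - {i}" "\<lambda>j. smult (1 / (x i - x j)) [:- x j, 1:]"]
    by (simp add: o_def)
  also have "\<dots> \<le> (\<Sum>j\<in>{..n} - {i}. 1)" by (intro sum_mono) simp
  also have "\<dots> = n" using assms by simp
  finally show ?thesis .
qed

lemma lag_node:
  assumes "inj_on x {..n}" "i \<le> n" "k \<le> n"
  shows "lag x n i (x k) = (if k = i then 1 else 0)"
proof (cases "k = i")
  case True
  have "x i - x j \<noteq> 0" if "j \<in> {..n} - {i}" for j using that assms by (auto simp: inj_on_def)
  then show ?thesis using True by (simp add: lag_def)
next
  case False
  then show ?thesis using assms unfolding lag_def by (auto intro!: prod_zero bexI[of _ k])
qed

lemma lagrange_identity:
  fixes P :: "'a::field poly"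
  assumes inj: "inj_on x {..n}" and deg: "degree P \<le> n"
  shows "poly P z = (\<Sum>i\<le>n. poly P (x i) * lag x n i z)"
proof -
  define Q where "Q = (\<Sum>i\<le>n. smult (poly P (x i)) (lag_poly x n i))"
  have "degree Q \<le> n"
    unfolding Q_def by (intro degree_sum_le) (use degree_lag_poly in \<open>auto intro: order.trans[OF degree_smult_le]\<close>)
  moreover have "poly Q (x k) = poly P (x k)" if "k \<le> n" for k
    using that by (simp add: Q_def poly_sum poly_lag_poly lag_node[OF inj _ that] if_distrib cong: if_cong)
  moreover have "card (x ` {..n}) = Suc n" using inj by (simp add: card_image)
  ultimately have "Q = P"
    using deg by (intro poly_eqI_degree[of "x ` {..n}"]) auto
  then have "poly P z = poly Q z" by simp
  then show ?thesis by (simp add: Q_def poly_sum poly_lag_poly)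
qed

lemma power_div_fact_le_exp:
  assumes "0 \<le> x" shows "x ^ n / fact n \<le> exp (x::real)"
proof -
  have "(\<Sum>k\<in>{n}. x ^ k /\<^sub>R fact k) \<le> (\<Sum>k. x ^ k /\<^sub>R fact k)"
    by (rule sum_le_suminf[OF summable_exp_generic]) (use assms in auto)
  then show ?thesis by (simp add: exp_def divide_inverse mult.commute)
qed

text \<open>A Lebesgue constant for separated nodes. With spacing \<sigma> = \<kappa> / (n + 1) the
  denominators are at least \<sigma>^n i! (n - i)!, so the sum is at most (2 L / \<sigma>)^n / n!.
  The factor (n + 1)^n / n! is at most e^(n + 1), which produces the powers of 3.\<close>

lemma lag_sum_bound:
  fixes x :: "nat \<Rightarrow> 'a::real_normed_field"
  assumes lam: "0 < \<kappa>"
    and sep: "\<And>i j. i \<le> n \<Longrightarrow> j \<le> n \<Longrightarrow> \<kappa> / real (Suc n) * \<bar>real i - real j\<bar> \<le> norm (x i - x j)"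
    and L: "\<And>j. j \<le> n \<Longrightarrow> norm (z - x j) \<le> L"
  shows "(\<Sum>i\<le>n. norm (lag x n i z)) \<le> 3 * (6 * L / \<kappa>) ^ n"
proof -
  define \<sigma> where "\<sigma> = \<kappa> / real (Suc n)"
  have \<sigma>: "0 < \<sigma>" using lam by (simp add: \<sigma>_def)
  have L0: "0 \<le> L" using L[of 0] norm_ge_zero[of "z - x 0"] by linarith
  have tm: "norm (lag x n i z) \<le> (L / \<sigma>) ^ n / (fact i * fact (n - i))" if i: "i \<le> n" for i
  proof -
    have "norm (lag x n i z) = (\<Prod>j\<in>{..n} - {i}. norm (z - x j) / norm (x i - x j))"
      by (simp add: lag_def prod_norm norm_divide flip: prod_norm)
    also have "\<dots> \<le> (\<Prod>j\<in>{..n} - {i}. L / \<sigma> * (1 / \<bar>real i - real j\<bar>))"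
    proof (intro prod_mono conjI)
      fix j assume j: "j \<in> {..n} - {i}"
      then have "0 < \<sigma> * \<bar>real i - real j\<bar>" using \<sigma> by auto
      moreover have "\<sigma> * \<bar>real i - real j\<bar> \<le> norm (x i - x j)" using sep i j by (auto simp: \<sigma>_def)
      ultimately have "norm (z - x j) / norm (x i - x j) \<le> L / (\<sigma> * \<bar>real i - real j\<bar>)"
        using L[of j] j L0 by (intro frac_le) auto
      then show "norm (z - x j) / norm (x i - x j) \<le> L / \<sigma> * (1 / \<bar>real i - real j\<bar>)" by simp
    qed auto
    also have "\<dots> = (L / \<sigma>) ^ n / (\<Prod>j\<in>{..n} - {i}. \<bar>real i - real j\<bar>)"
      using i by (simp add: prod.distrib prod_dividef power_divide)
    also have "(\<Prod>j\<in>{..n} - {i}. \<bar>real i - real j\<bar>) = fact i * fact (n - i)"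
    proof -
      have eq: "{..n} - {i} = {..<i} \<union> {i<..n}" using i by auto
      have "(\<Prod>j\<in>{..n} - {i}. \<bar>real i - real j\<bar>) = (\<Prod>j<i. \<bar>real i - real j\<bar>) * (\<Prod>j\<in>{i<..n}. \<bar>real i - real j\<bar>)"
        unfolding eq by (rule prod.union_disjoint) auto
      also have "(\<Prod>j<i. \<bar>real i - real j\<bar>) = (\<Prod>j\<in>{1..i}. real j)"
        by (rule prod.reindex_bij_witness[of _ "\<lambda>j. i - j" "\<lambda>j. i - j"]) auto
      also have "(\<Prod>j\<in>{i<..n}. \<bar>real i - real j\<bar>) = (\<Prod>j\<in>{1..n - i}. real j)"
        by (rule prod.reindex_bij_witness[of _ "\<lambda>j. i + j" "\<lambda>j. j - i"]) auto
      finally show ?thesis by (simp add: fact_prod)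
    qed
    finally show ?thesis .
  qed
  have "(\<Sum>i\<le>n. norm (lag x n i z)) \<le> (\<Sum>i\<le>n. (L / \<sigma>) ^ n / fact n * real (n choose i))"
    using tm by (intro sum_mono) (fastforce simp: binomial_fact)
  also have "\<dots> = (L / \<sigma>) ^ n / fact n * 2 ^ n"
    unfolding sum_distrib_left[symmetric] of_nat_sum[symmetric] choose_row_sum by simp
  also have "\<dots> = (2 * L / \<kappa>) ^ n * (real (Suc n) ^ n / fact n)"
    by (simp add: \<sigma>_def power_mult_distrib power_divide)
  also have "\<dots> \<le> (2 * L / \<kappa>) ^ n * (3 * 3 ^ n)"
  proof (intro mult_left_mono)
    have "real (Suc n) ^ n / fact n \<le> exp (real (Suc n))" by (intro power_div_fact_le_exp) simp
    also have "\<dots> = exp 1 ^ Suc n" by (simp add: exp_of_nat_mult[symmetric] flip: power_Suc del: of_nat_Suc power_Suc)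
    also have "\<dots> \<le> 3 ^ Suc n" by (intro power_mono exp_le) auto
    finally show "real (Suc n) ^ n / fact n \<le> 3 * 3 ^ n" by simp
  qed (use L0 lam in auto)
  also have "\<dots> = 3 * (6 * L / \<kappa>) ^ n"
  proof -
    have "(6 * L / \<kappa>) ^ n = (3 * (2 * L / \<kappa>)) ^ n" by simp
    then show ?thesis unfolding power_mult_distrib[of 3] by simp
  qed
  finally show ?thesis .
qed

text \<open>Greedy choice: take the least point of the set, discard the interval of length \<sigma>
  starting there, and continue. Each choice costs at most \<sigma> of measure.\<close>

lemma spaced_points:
  fixes F :: "real set"
  assumes "compact F" "0 \<le> \<sigma>" "real n * \<sigma> < measure lborel F"
  shows "\<exists>x. (\<forall>i\<le>n. x i \<in> F) \<and> (\<forall>j\<le>n. \<forall>i<j. \<sigma> * (real j - real i) \<le> x j - x i)"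
  using assms(1,3)
proof (induction n arbitrary: F)
  case 0
  then have "F \<noteq> {}" by auto
  then obtain y where "y \<in> F" by auto
  then show ?case by (intro exI[of _ "\<lambda>_. y"]) auto
next
  case (Suc n)
  have "0 \<le> real (Suc n) * \<sigma>" using \<open>0 \<le> \<sigma>\<close> by simp
  then have "F \<noteq> {}" using Suc.prems(2) by (intro notI) (simp del: of_nat_Suc)
  then obtain x0 where x0: "x0 \<in> F" "\<And>y. y \<in> F \<Longrightarrow> x0 \<le> y"
    using compact_attains_inf[OF Suc.prems(1)] by auto
  define F' where "F' = F \<inter> {x0 + \<sigma>..}"
  have cF': "compact F'" unfolding F'_def using Suc.prems(1) by (intro compact_Int_closed) auto
  have fm: "A \<in> fmeasurable lborel" if "compact A" for A :: "real set"
    using that by (intro fmeasurable_compact)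
  have "measure lborel F \<le> measure lborel ({x0..x0 + \<sigma>} \<union> F')"
    using x0 Suc.prems(1) cF' by (intro measure_mono_fmeasurable)
      (auto simp: F'_def intro!: fmeasurable.Un fm compact_Int_closed sets.Un borel_closed compact_imp_closed)
  also have "\<dots> \<le> measure lborel {x0..x0 + \<sigma>} + measure lborel F'"
    using cF' by (intro measure_Un_le) (auto intro: borel_compact)
  also have "\<dots> = \<sigma> + measure lborel F'" using \<open>0 \<le> \<sigma>\<close> by simp
  finally have "real n * \<sigma> < measure lborel F'" using Suc.prems(2) by (simp add: algebra_simps)
  from Suc.IH[OF cF' this] obtain x where x: "\<And>i. i \<le> n \<Longrightarrow> x i \<in> F'"
    "\<And>i j. j \<le> n \<Longrightarrow> i < j \<Longrightarrow> \<sigma> * (real j - real i) \<le> x j - x i" by blast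
  define y where "y = (\<lambda>i. case i of 0 \<Rightarrow> x0 | Suc i \<Rightarrow> x i)"
  show ?case
  proof (intro exI conjI allI impI)
    show "y i \<in> F" if "i \<le> Suc n" for i
      using that x(1) x0(1) by (cases i) (auto simp: y_def F'_def)
    fix j i assume ji: "j \<le> Suc n" "i < j"
    then obtain j' where j': "j = Suc j'" by (cases j) auto
    show "\<sigma> * (real j - real i) \<le> y j - y i"
    proof (cases i)
      case 0
      have "\<sigma> * real j' \<le> x j' - x 0"
        using x(2)[of j' 0] ji by (cases "j' = 0") (auto simp: j')
      moreover have "x0 + \<sigma> \<le> x 0" using x(1)[of 0] by (auto simp: F'_def)
      ultimately show ?thesis by (simp add: 0 j' y_def algebra_simps)
    next
      case (Suc i')
      then show ?thesis using x(2)[of j' i'] ji by (simp add: j' y_def)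
    qed
  qed
qed

text \<open>A quantitative two-constants theorem: a power series that is tiny on a real interval and of moderate size on a
  disc is small near the origin. Its Taylor polynomial at \<open>s1\<close> is interpolated at nodes in the interval.\<close>

lemma two_constants:
  fixes s1 s2 b A \<nu> :: real
  assumes s: "0 < s1" "s1 < s2" "100 * s2 \<le> b" and A: "1 \<le> A" and \<nu>: "0 < \<nu>"
  shows "\<exists>q>0. \<forall>n (e :: nat \<Rightarrow> real). (\<forall>k. \<bar>e k\<bar> * b ^ k \<le> A ^ n) \<longrightarrow>
     (\<forall>s\<in>{s1..s2}. \<bar>\<Sum>k. e k * s ^ k\<bar> \<le> q ^ n) \<longrightarrow> (\<forall>k. \<bar>e k\<bar> * s1 ^ k \<le> 19 * \<nu> ^ n)"
proof -
  define \<iota> where "\<iota> = s2 - s1"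
  have \<iota>: "0 < \<iota>" "\<iota> \<le> s2" using s by (auto simp: \<iota>_def)
  have b: "0 < b" using s by auto
  \<comment> \<open>\<open>B\<close> is the base \<open>6 * L / \<kappa>\<close> of the Lebesgue
    constant for equally spaced nodes on a segment of length \<iota>, with evaluation points within
    \<open>2 * s2\<close> of the nodes. The degree will be \<open>l * n\<close>, with
    \<open>l\<close> chosen so that a Taylor remainder \<open>A ^ n / 2 ^ (l * n)\<close> is at most
    \<open>\<nu> ^ n\<close>; then \<open>q\<close> is \<open>\<nu>\<close> divided by the
    amplification \<open>B ^ l\<close>.\<close>
  define B where "B = 12 * s2 / \<iota>"
  have B: "0 < B" using s \<iota> by (simp add: B_def)
  obtain l :: nat where "(1 / 2) ^ l < \<nu> / A"
    using real_arch_pow_inv[of "\<nu> / A" "1 / 2"] \<nu> A by auto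
  then have l: "(1 / 2) ^ l * A \<le> \<nu>" using A by (simp add: pos_less_divide_eq)
  define q where "q = \<nu> / B ^ l"
  have q: "0 < q" using \<nu> B by (simp add: q_def)
  show ?thesis
  proof (intro exI[of _ q] conjI allI impI q)
    fix n :: nat and e :: "nat \<Rightarrow> real" and k0 :: nat
    assume eb: "\<forall>k. \<bar>e k\<bar> * b ^ k \<le> A ^ n"
      and small: "\<forall>s\<in>{s1..s2}. \<bar>\<Sum>k. e k * s ^ k\<bar> \<le> q ^ n"
    have e: "\<bar>e k\<bar> \<le> A ^ n / b ^ k" for k
      using eb b by (simp add: pos_le_divide_eq)
    define F :: "complex fps" where "F = Abs_fps (\<lambda>k. of_real (e k))"
    define f where "f = eval_fps F"
    have nb: "norm (of_real (e k) * z ^ k) \<le> A ^ n * (norm z / b) ^ k" for k and z :: complex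
    proof -
      have "norm (of_real (e k) * z ^ k) = \<bar>e k\<bar> * norm z ^ k" by (simp add: norm_mult norm_power)
      also have "\<dots> \<le> A ^ n / b ^ k * norm z ^ k" by (intro mult_right_mono e) auto
      finally show ?thesis by (simp add: power_divide)
    qed
    have sg: "summable (\<lambda>k. A ^ n * (norm z / b) ^ k)" if "norm z < b" for z :: complex
      using that b by (intro summable_mult summable_geometric) auto
    have sm: "summable (\<lambda>k. of_real (e k) * z ^ k)" if "norm z < b" for z :: complex
      by (rule summable_comparison_test'[OF sg[OF that], of 0]) (use nb in auto)
    have feq: "f z = (\<Sum>k. of_real (e k) * z ^ k)" for z by (simp add: f_def F_def eval_fps_def)
    have "ereal (3 * b / 4) \<le> fps_conv_radius F"
      using conv_radius_geI[OF sm[of "of_real (3 * b / 4)"]] b by (simp add: fps_conv_radius_def F_def)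
    then have lt: "ereal r < fps_conv_radius F" if "r < 3 * b / 4" for r
      using that by (rule_tac less_le_trans[of "ereal r" "ereal (3 * b / 4)"]) auto
    have rad: "ball 0 (3 * b / 4) \<subseteq> eball 0 (fps_conv_radius F)" and rad0: "0 < fps_conv_radius F"
      using lt[of 0] b by (auto simp: in_eball_iff zero_ereal_def intro!: lt)
    have hol: "f holomorphic_on S" if "S \<subseteq> ball 0 (3 * b / 4)" for S
      unfolding f_def using rad that by (intro holomorphic_on_eval_fps) auto
    have fb: "norm (f z) \<le> 2 * A ^ n" if z: "norm z \<le> b / 2" for z
    proof -
      have "norm (f z) \<le> (\<Sum>k. A ^ n * (norm z / b) ^ k)"
        unfolding feq using z b by (intro norm_suminf_le nb sg) auto
      also have "\<dots> = A ^ n * (1 / (1 - norm z / b))"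
        using z b by (subst suminf_mult) (auto simp: suminf_geometric)
      also have "\<dots> \<le> A ^ n * 2"
        using z b A by (intro mult_left_mono) (auto simp: field_simps)
      finally show ?thesis by simp
    qed
    define g where "g = (\<lambda>j. (deriv ^^ j) f (of_real s1) / fact j)"
    have cb: "norm z \<le> b / 2" if "z \<in> cball (of_real s1) (b / 4)" for z :: complex
      using that norm_triangle_ineq2[of z "of_real s1"] s b by (auto simp: dist_norm norm_minus_commute)
    have cb': "cball (of_real s1) (b / 4) \<subseteq> (ball 0 (3 * b / 4) :: complex set)"
      using cb b by force
    have gj: "norm (g j) \<le> 2 * A ^ n / (b / 4) ^ j" for j
    proof -
      have "norm ((deriv ^^ j) f (of_real s1)) \<le> fact j * (2 * A ^ n) / (b / 4) ^ j"
      proof (rule Cauchy_inequality)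
        show "f holomorphic_on ball (of_real s1) (b / 4)" using cb' by (intro hol) auto
        show "continuous_on (cball (of_real s1) (b / 4)) f" using hol[OF cb'] by (rule holomorphic_on_imp_continuous_on)
        show "norm (f x) \<le> 2 * A ^ n" if "norm (of_real s1 - x) = b / 4" for x
          using that by (intro fb cb) (simp add: dist_norm)
      qed (use b in auto)
      then show ?thesis by (simp add: g_def norm_divide field_simps)
    qed
    have gs: "(\<lambda>j. g j * w ^ j) sums f (of_real s1 + w)" if "norm w < b / 4" for w
    proof -
      have "f holomorphic_on ball (of_real s1) (b / 4)" using cb' by (intro hol) auto
      from holomorphic_power_series[OF this, of "of_real s1 + w"] that show ?thesis
        by (simp add: g_def dist_norm)
    qed
    define N where "N = l * n"
    define P where "P = (\<Sum>j\<le>N. monom (g j) j)"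
    have degP: "degree P \<le> N" unfolding P_def by (intro degree_sum_le) (auto intro: order.trans[OF degree_monom_le])
    have polyP: "poly P w = (\<Sum>j\<le>N. g j * w ^ j)" for w by (simp add: P_def poly_sum poly_monom)
    have tail: "norm (f (of_real s1 + w) - poly P w) \<le> 4 * A ^ n * (4 * norm w / b) ^ Suc N" if w: "norm w \<le> b / 8" for w
    proof -
      define \<theta> where "\<theta> = 4 * norm w / b"
      have \<theta>: "0 \<le> \<theta>" "\<theta> \<le> 1 / 2" using w b by (auto simp: \<theta>_def field_simps)
      have sums: "(\<lambda>j. g j * w ^ j) sums f (of_real s1 + w)" using w b by (intro gs) auto
      have "(\<lambda>j. g (j + Suc N) * w ^ (j + Suc N)) sums (f (of_real s1 + w) - (\<Sum>j<Suc N. g j * w ^ j))"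
        using sums_split_initial_segment[OF sums] .
      then have eq: "f (of_real s1 + w) - poly P w = (\<Sum>j. g (j + Suc N) * w ^ (j + Suc N))"
        by (simp add: sums_iff polyP lessThan_Suc_atMost)
      have t: "norm (g j * w ^ j) \<le> 2 * A ^ n * \<theta> ^ j" for j
      proof -
        have "norm (g j * w ^ j) = norm (g j) * norm w ^ j" by (simp add: norm_mult norm_power)
        also have "\<dots> \<le> 2 * A ^ n / (b / 4) ^ j * norm w ^ j" by (intro mult_right_mono gj) auto
        also have "\<dots> = 2 * A ^ n * (norm w / (b / 4)) ^ j" by (simp add: power_divide)
        also have "norm w / (b / 4) = \<theta>" by (simp add: \<theta>_def)
        finally show ?thesis .
      qed
      have "norm (f (of_real s1 + w) - poly P w) \<le> (\<Sum>j. 2 * A ^ n * \<theta> ^ Suc N * \<theta> ^ j)"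
        unfolding eq
      proof (rule norm_suminf_le)
        show "norm (g (j + Suc N) * w ^ (j + Suc N)) \<le> 2 * A ^ n * \<theta> ^ Suc N * \<theta> ^ j" for j
          using t[of "j + Suc N"] by (simp add: power_add mult_ac)
        show "summable (\<lambda>j. 2 * A ^ n * \<theta> ^ Suc N * \<theta> ^ j)"
          using \<theta> by (intro summable_mult summable_geometric) auto
      qed
      also have "\<dots> = 2 * A ^ n * \<theta> ^ Suc N * (1 / (1 - \<theta>))"
        using \<theta> by (subst suminf_mult) (auto simp: suminf_geometric)
      also have "\<dots> \<le> 2 * A ^ n * \<theta> ^ Suc N * 2"
        using \<theta> A by (intro mult_left_mono) (auto simp: field_simps)
      finally show ?thesis by (simp add: \<theta>_def mult_ac)
    qed
    define x :: "nat \<Rightarrow> complex" where "x = (\<lambda>i. of_real (\<iota> * real i / real (Suc N)))"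
    have xn: "norm (x i) = \<iota> * real i / real (Suc N)" for i
      using \<iota> unfolding x_def norm_of_real by simp
    have xi: "norm (x i) \<le> \<iota>" if "i \<le> N" for i
    proof -
      have "real i / real (Suc N) \<le> 1" using that by simp
      then have "\<iota> * (real i / real (Suc N)) \<le> \<iota> * 1" using \<iota> by (intro mult_left_mono) auto
      then show ?thesis by (simp add: xn)
    qed
    have sep: "\<iota> / real (Suc N) * \<bar>real i - real j\<bar> \<le> norm (x i - x j)" for i j
    proof -
      have "x i - x j = of_real (\<iota> / real (Suc N) * (real i - real j))"
        by (simp add: x_def diff_divide_distrib algebra_simps)
      then have "norm (x i - x j) = \<bar>\<iota> / real (Suc N) * (real i - real j)\<bar>" by (simp only: norm_of_real)
      then show ?thesis using \<iota> by (simp add: abs_mult)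
    qed
    have inj: "inj_on x {..N}"
    proof (rule inj_onI)
      fix i j assume "x i = x j"
      then have "\<iota> * real i / real (Suc N) = \<iota> * real j / real (Suc N)" unfolding x_def by (simp only: of_real_eq_iff)
      then show "i = j" using \<iota> by (simp del: of_nat_Suc)
    qed
    have ib: "4 * \<iota> / b \<le> 1" "\<iota> \<le> b / 8" using \<iota> s b by (auto simp: field_simps)
    have node: "norm (poly P (x i)) \<le> q ^ n + 4 * A ^ n * (4 * \<iota> / b) ^ N" if i: "i \<le> N" for i
    proof -
      define s where "s = s1 + \<iota> * real i / real (Suc N)"
      have s12: "s \<in> {s1..s2}" using xi[OF i] \<iota> unfolding xn s_def by (auto simp: \<iota>_def)
      have sb: "s < b" using s12 assms(1-3) by auto
      have "summable (\<lambda>k. e k * s ^ k)"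
      proof -
        have "summable (\<lambda>k. of_real (e k) * (of_real s) ^ k :: complex)" using sb s12 s by (intro sm) auto
        then have "summable (\<lambda>k. of_real (e k * s ^ k) :: complex)" by simp
        then show ?thesis unfolding summable_of_real_iff .
      qed
      then have "f (of_real s) = of_real (\<Sum>k. e k * s ^ k)"
        unfolding feq by (subst suminf_of_real) auto
      then have 1: "norm (f (of_real s)) \<le> q ^ n" using small s12 by (simp only: norm_of_real) 
      have 2: "of_real s = of_real s1 + x i" by (simp add: s_def x_def)
      have "norm (f (of_real s1 + x i) - poly P (x i)) \<le> 4 * A ^ n * (4 * norm (x i) / b) ^ Suc N"
        using xi[OF i] ib by (intro tail) auto
      also have "\<dots> \<le> 4 * A ^ n * (4 * \<iota> / b) ^ Suc N"
        using xi[OF i] b A by (intro mult_left_mono power_mono divide_right_mono) auto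
      also have "\<dots> \<le> 4 * A ^ n * (4 * \<iota> / b) ^ N"
        using ib b \<iota> A by (intro mult_left_mono power_decreasing) auto
      finally show ?thesis using 1 norm_triangle_ineq2[of "poly P (x i)" "f (of_real s)"] unfolding 2
        by (simp add: norm_minus_commute)
    qed
    \<comment> \<open>Extrapolation from the nodes to the disc of radius \<open>s1\<close> about 0.
      It passes through the Taylor polynomial at \<open>s1\<close>, to which interpolation applies
      exactly; Cauchy's inequality on this disc then yields the coefficients.\<close>
    have fsmall: "norm (f z) \<le> 19 * \<nu> ^ n" if z: "norm z \<le> s1" for z
    proof -
      define w where "w = z - of_real s1"
      have w: "norm w \<le> 2 * s1" using norm_triangle_ineq4[of z "of_real s1"] z s by (simp add: w_def)
      have "norm (poly P w) = norm (\<Sum>i\<le>N. poly P (x i) * lag x N i w)"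
        using lagrange_identity[OF inj degP, of w] by simp
      also have "\<dots> \<le> (\<Sum>i\<le>N. (q ^ n + 4 * A ^ n * (4 * \<iota> / b) ^ N) * norm (lag x N i w))"
        by (rule sum_norm_le) (use node in \<open>auto simp: norm_mult intro!: mult_right_mono\<close>)
      also have "\<dots> = (q ^ n + 4 * A ^ n * (4 * \<iota> / b) ^ N) * (\<Sum>i\<le>N. norm (lag x N i w))"
        by (simp add: sum_distrib_left)
      also have "\<dots> \<le> (q ^ n + 4 * A ^ n * (4 * \<iota> / b) ^ N) * (3 * (6 * (2 * s2) / \<iota>) ^ N)"
      proof (intro mult_left_mono lag_sum_bound)
        show "norm (w - x j) \<le> 2 * s2" if "j \<le> N" for j
          using norm_triangle_ineq4[of w "x j"] w xi[OF that] s by (auto simp: \<iota>_def)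
      qed (use sep \<iota> q A b in auto)
      also have "6 * (2 * s2) / \<iota> = B" by (simp add: B_def)
      also have "(q ^ n + 4 * A ^ n * (4 * \<iota> / b) ^ N) * (3 * B ^ N) = 3 * (q ^ n * B ^ N) + 12 * A ^ n * (4 * \<iota> / b * B) ^ N"
        by (simp add: power_mult_distrib power_divide algebra_simps)
      \<comment> \<open>The Taylor error at the nodes decays like
        \<open>(4 * \<iota> / b) ^ N\<close> and is amplified by \<open>B ^ N\<close>. The product
        has base \<open>48 * s2 / b\<close>, at most 1/2 because
        \<open>100 * s2 \<le> b\<close>.\<close>
      also have "\<dots> \<le> 3 * (q ^ n * B ^ N) + 12 * A ^ n * (1 / 2) ^ N"
      proof -
        have "4 * \<iota> / b * B = 48 * s2 / b" using \<iota> by (simp add: B_def)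
        also have "\<dots> \<le> 1 / 2" using s b by (simp add: field_simps)
        finally have "4 * \<iota> / b * B \<le> 1 / 2" .
        then show ?thesis using A b B \<iota> by (intro add_left_mono mult_left_mono power_mono) auto
      qed
      finally have p: "norm (poly P w) \<le> 3 * (q ^ n * B ^ N) + 12 * A ^ n * (1 / 2) ^ N" .
      have "norm (f (of_real s1 + w) - poly P w) \<le> 4 * A ^ n * (4 * norm w / b) ^ Suc N"
        using w s by (intro tail) auto
      also have "\<dots> \<le> 4 * A ^ n * (1 / 2) ^ Suc N"
        using w s b A by (intro mult_left_mono power_mono) (auto simp: field_simps)
      also have "\<dots> \<le> 4 * A ^ n * (1 / 2) ^ N" using A by simp
      finally have t: "norm (f z - poly P w) \<le> 4 * A ^ n * (1 / 2) ^ N" by (simp add: w_def)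
      have "norm (f z) \<le> 3 * (q ^ n * B ^ N) + 16 * (A ^ n * (1 / 2) ^ N)"
        using p t norm_triangle_ineq2[of "f z" "poly P w"] by linarith
      also have "q ^ n * B ^ N = \<nu> ^ n"
        using B by (simp add: q_def N_def power_divide power_mult mult.commute)
      also have "A ^ n * (1 / 2) ^ N = ((1 / 2) ^ l * A) ^ n"
        unfolding N_def power_mult power_mult_distrib by (simp add: mult.commute)
      also have "3 * \<nu> ^ n + 16 * ((1 / 2) ^ l * A) ^ n \<le> 3 * \<nu> ^ n + 16 * \<nu> ^ n"
        using l A by (intro add_left_mono mult_left_mono power_mono) auto
      finally show ?thesis by simp
    qed
    have sub: "cball 0 s1 \<subseteq> (ball 0 (3 * b / 4) :: complex set)" using s by auto
    have "norm ((deriv ^^ k0) f 0) \<le> fact k0 * (19 * \<nu> ^ n) / s1 ^ k0"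
    proof (rule Cauchy_inequality)
      show "f holomorphic_on ball 0 s1" using sub by (intro hol) auto
      show "continuous_on (cball 0 s1) f" using hol[OF sub] by (rule holomorphic_on_imp_continuous_on)
    qed (use s fsmall in auto)
    then have D: "norm ((deriv ^^ k0) f 0) / fact k0 \<le> 19 * \<nu> ^ n / s1 ^ k0"
      by (simp add: pos_divide_le_eq mult.commute)
    have "of_real (e k0) = (deriv ^^ k0) f 0 / fact k0"
      using fps_nth_conv_deriv[OF rad0, of k0] by (simp add: F_def f_def)
    then have "\<bar>e k0\<bar> = norm ((deriv ^^ k0) f 0) / fact k0"
      by (metis norm_of_real norm_divide norm_fact)
    then show "\<bar>e k0\<bar> * s1 ^ k0 \<le> 19 * \<nu> ^ n"
      using D s by (simp add: pos_le_divide_eq)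
  qed
qed


text \<open>Half of the measure guarantees spacing \<open>(c - a) / (2 * (n + 1))\<close> at
  distances of at most \<open>c - a\<close>, whence the base 6 * 2 = 12. This number does not depend
  on the set, so the approximation rate \<open>q\<close> below can be fixed before the functions are
  known.\<close>

lemma lag_nodes_in_closed_set:
  fixes F :: "real set"
  assumes ac: "a < c" and F: "compact F" "F \<subseteq> {a..c}" "(c - a) / 2 < measure lborel F"
  obtains x where "inj_on x {..n}" "\<And>i. i \<le> n \<Longrightarrow> x i \<in> F"
    "\<And>z. z \<in> {a..c} \<Longrightarrow> (\<Sum>i\<le>n. \<bar>lag x n i z\<bar>) \<le> 3 * 12 ^ n"
proof -
  define \<kappa> where "\<kappa> = (c - a) / 2"
  have \<kappa>: "0 < \<kappa>" using ac by (simp add: \<kappa>_def)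
  have "real n * (\<kappa> / real (Suc n)) \<le> \<kappa> * 1"
    using \<kappa> by (simp add: field_simps)
  then have "real n * (\<kappa> / real (Suc n)) < measure lborel F"
    using F(3) unfolding \<kappa>_def[symmetric] by linarith
  with spaced_points[OF F(1), of "\<kappa> / real (Suc n)" n] \<kappa> obtain x where x: "\<And>i. i \<le> n \<Longrightarrow> x i \<in> F"
    "\<And>i j. j \<le> n \<Longrightarrow> i < j \<Longrightarrow> \<kappa> / real (Suc n) * (real j - real i) \<le> x j - x i" by fastforce
  have sep: "\<kappa> / real (Suc n) * \<bar>real i - real j\<bar> \<le> norm (x i - x j)" if ij: "i \<le> n" "j \<le> n" for i j
  proof (cases i j rule: linorder_cases)
    case less
    have "\<bar>real i - real j\<bar> = real j - real i" using less by simp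
    then show ?thesis using x(2)[OF ij(2) less] by auto
  next
    case greater
    have "\<bar>real i - real j\<bar> = real i - real j" using greater by simp
    then show ?thesis using x(2)[OF ij(1) greater] by auto
  qed auto
  have inj: "inj_on x {..n}"
  proof (rule inj_onI)
    fix i j assume ij: "i \<in> {..n}" "j \<in> {..n}" "x i = x j"
    then have "\<kappa> / real (Suc n) * \<bar>real i - real j\<bar> \<le> 0" using sep[of i j] by simp
    moreover have "0 < \<kappa> / real (Suc n)" using \<kappa> by simp
    ultimately show "i = j" by (smt (verit) mult_pos_pos of_nat_eq_iff)
  qed
  have "(\<Sum>i\<le>n. \<bar>lag x n i z\<bar>) \<le> 3 * 12 ^ n" if z: "z \<in> {a..c}" for z
  proof -
    have "(\<Sum>i\<le>n. norm (lag x n i z)) \<le> 3 * (6 * (c - a) / \<kappa>) ^ n"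
    proof (rule lag_sum_bound[OF \<kappa> sep])
      show "norm (z - x j) \<le> c - a" if "j \<le> n" for j
      proof -
        have "x j \<in> {a..c}" using x(1)[OF that] F(2) by auto
        then show ?thesis using z by auto
      qed
    qed
    also have "6 * (c - a) / \<kappa> = 12" using ac by (simp add: \<kappa>_def field_simps)
    finally show ?thesis by simp
  qed
  with inj x(1) that show thesis by blast
qed

text \<open>The closed level sets increase to the whole interval, so by continuity of measure one of
  them has more than half its length. A category argument would give a subinterval of unknown size,
  from which the whole interval could not be reached with a fixed constant.\<close>

lemma powser_pointwise_bound_imp_closed_level_set:
  fixes \<Psi> :: "nat \<Rightarrow> 'p \<Rightarrow> real \<Rightarrow> real"
  assumes ac: "a < c"
    and cont: "\<And>k \<pi>. \<pi> \<in> P \<Longrightarrow> continuous_on {a..c} (\<Psi> k \<pi>)"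
    and fin: "\<And>x. x \<in> {a..c} \<Longrightarrow> \<exists>m. \<forall>k. \<forall>\<pi>\<in>P. \<bar>\<Psi> k \<pi> x\<bar> * b ^ k \<le> m"
  obtains F C where "compact F" "F \<subseteq> {a..c}" "(c - a) / 2 < measure lborel F" "0 \<le> C"
    "\<And>x k \<pi>. x \<in> F \<Longrightarrow> \<pi> \<in> P \<Longrightarrow> \<bar>\<Psi> k \<pi> x\<bar> * b ^ k \<le> C"
proof -
  define F where "F = (\<lambda>N::nat. {x \<in> {a..c}. \<forall>k. \<forall>\<pi>\<in>P. \<bar>\<Psi> k \<pi> x\<bar> * b ^ k \<le> real N})"
  have cl: "closed (F N)" for N
  proof -
    have "F N = {a..c} \<inter> (\<Inter>k. \<Inter>\<pi>\<in>P. {x \<in> {a..c}. \<bar>\<Psi> k \<pi> x\<bar> * b ^ k \<le> real N})"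
      unfolding F_def by auto
    moreover have "closed {x \<in> {a..c}. \<bar>\<Psi> k \<pi> x\<bar> * b ^ k \<le> real N}" if "\<pi> \<in> P" for k \<pi>
      using cont[OF that] by (intro continuous_closed_preimage_constant continuous_on_closed_Collect_le continuous_intros) auto
    ultimately show ?thesis by (auto intro!: closed_Int closed_INT)
  qed
  have comp: "compact (F N)" for N
    using compact_Int_closed[OF compact_Icc[of a c] cl[of N]] by (simp add: F_def Int_def conj_ac)
  have un: "(\<Union>N. F N) = {a..c}"
  proof (intro equalityI subsetI)
    fix x assume x: "x \<in> {a..c}"
    then obtain m where m: "\<forall>k. \<forall>\<pi>\<in>P. \<bar>\<Psi> k \<pi> x\<bar> * b ^ k \<le> m" using fin by blast
    obtain N :: nat where "m \<le> real N" using real_arch_simple by blast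
    then have "x \<in> F N" using m x unfolding F_def by (blast intro: order.trans)
    then show "x \<in> (\<Union>N. F N)" by blast
  qed (auto simp: F_def)
  have "(\<lambda>N. measure lborel (F N)) \<longlonglongrightarrow> measure lborel (\<Union>N. F N)"
  proof (rule Lim_measure_incseq)
    show "range F \<subseteq> sets lborel" using cl by (auto intro: borel_closed)
    show "incseq F"
    proof (rule incseq_SucI, rule subsetI)
      fix n x assume x: "x \<in> F n"
      then have "\<bar>\<Psi> k \<pi> x\<bar> * b ^ k \<le> real (Suc n)" if "\<pi> \<in> P" for k \<pi>
        using that order.trans[of "\<bar>\<Psi> k \<pi> x\<bar> * b ^ k" "real n" "real (Suc n)"] by (simp add: F_def)
      then show "x \<in> F (Suc n)" using x by (simp add: F_def)
    qed
    show "emeasure lborel (\<Union>N. F N) \<noteq> \<infinity>" using ac by (simp add: un)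
  qed
  then have lim: "(\<lambda>N. measure lborel (F N)) \<longlonglongrightarrow> c - a" using ac by (simp add: un)
  have "\<forall>\<^sub>F N in sequentially. (c - a) / 2 < measure lborel (F N)"
    by (rule order_tendstoD(1)[OF lim]) (use ac in auto)
  then obtain N where N: "(c - a) / 2 < measure lborel (F N)" by (auto simp: eventually_sequentially)
  show thesis
    by (rule that[OF comp[of N] _ N, of "real N"]) (auto simp: F_def)
qed

text \<open>A substitute for the cross theorem on separately analytic functions: the interpolation nodes are taken in a set
  of half measure on which the coefficients are bounded, so the interpolation error of the sum is tiny on a real
  interval of \<open>s\<close> and of controlled size on a complex disc.\<close>

lemma separate_analyticity_uniform_bound:
  assumes s: "0 < s1" "s1 < s2" "100 * s2 \<le> b"
  shows "\<exists>q>0. \<forall>(\<Psi> :: nat \<Rightarrow> 'p \<Rightarrow> real \<Rightarrow> real) P a c K. a < c \<longrightarrow>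
     (\<forall>k. \<forall>\<pi>\<in>P. continuous_on {a..c} (\<Psi> k \<pi>)) \<longrightarrow>
     (\<forall>x\<in>{a..c}. \<exists>m. \<forall>k. \<forall>\<pi>\<in>P. \<bar>\<Psi> k \<pi> x\<bar> * b ^ k \<le> m) \<longrightarrow>
     (\<forall>n. \<forall>\<pi>\<in>P. \<forall>s\<in>{s1..s2}. \<exists>p. degree p \<le> n \<and> (\<forall>x\<in>{a..c}. \<bar>(\<Sum>k. \<Psi> k \<pi> x * s ^ k) - poly p x\<bar> \<le> K * q ^ n)) \<longrightarrow>
     (\<exists>C. \<forall>k. \<forall>\<pi>\<in>P. \<forall>x\<in>{a..c}. \<bar>\<Psi> k \<pi> x\<bar> * s1 ^ k \<le> C)"
proof -
  \<comment> \<open>\<open>A = 12\<close> matches the growth of the interpolants. The gain 1/24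
    beats this growth with a factor 1/2 to spare, so that successive interpolants differ by a
    summable amount.\<close>
  obtain q0 where q0: "0 < q0" and tc': "\<forall>n (e :: nat \<Rightarrow> real). (\<forall>k. \<bar>e k\<bar> * b ^ k \<le> 12 ^ n) \<longrightarrow>
     (\<forall>s\<in>{s1..s2}. \<bar>\<Sum>k. e k * s ^ k\<bar> \<le> q0 ^ n) \<longrightarrow> (\<forall>k. \<bar>e k\<bar> * s1 ^ k \<le> 19 * (1 / 24) ^ n)"
    using two_constants[OF s, of 12 "1 / 24"] by auto
  have tc: "\<bar>e k\<bar> * s1 ^ k \<le> 19 * (1 / 24) ^ n"
    if "\<And>k. \<bar>e k\<bar> * b ^ k \<le> 12 ^ n" "\<And>s. s \<in> {s1..s2} \<Longrightarrow> \<bar>\<Sum>k. e k * s ^ k\<bar> \<le> q0 ^ n" for n k and e :: "nat \<Rightarrow> real"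
    using tc'[rule_format, of e n k] that by simp
  have b: "0 < b" using s by auto
  \<comment> \<open>Interpolation amplifies the approximation error by \<open>12 ^ n\<close>; the
    division compensates.\<close>
  define q where "q = q0 / 12"
  have q: "0 < q" using q0 by (simp add: q_def)
  have "\<exists>C. \<forall>k. \<forall>\<pi>\<in>P. \<forall>x\<in>{a..c}. \<bar>\<Psi> k \<pi> x\<bar> * s1 ^ k \<le> C"
    if ac: "a < c" and cont: "\<forall>k. \<forall>\<pi>\<in>P. continuous_on {a..c} (\<Psi> k \<pi>)"
      and fin: "\<forall>x\<in>{a..c}. \<exists>m. \<forall>k. \<forall>\<pi>\<in>P. \<bar>\<Psi> k \<pi> x\<bar> * b ^ k \<le> m"
      and approx: "\<forall>n. \<forall>\<pi>\<in>P. \<forall>s\<in>{s1..s2}. \<exists>p. degree p \<le> n \<and> (\<forall>x\<in>{a..c}. \<bar>(\<Sum>k. \<Psi> k \<pi> x * s ^ k) - poly p x\<bar> \<le> K * q ^ n)"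
    for \<Psi> :: "nat \<Rightarrow> 'p \<Rightarrow> real \<Rightarrow> real" and P a c K
  proof -
    obtain F C0 where F: "compact F" "F \<subseteq> {a..c}" "(c - a) / 2 < measure lborel F" and C0: "0 \<le> C0"
      and FC: "\<And>x k \<pi>. x \<in> F \<Longrightarrow> \<pi> \<in> P \<Longrightarrow> \<bar>\<Psi> k \<pi> x\<bar> * b ^ k \<le> C0"
      using powser_pointwise_bound_imp_closed_level_set[OF ac, of P \<Psi> b] cont fin by metis
    have "\<exists>x. inj_on x {..n} \<and> (\<forall>i\<le>n. x i \<in> F) \<and> (\<forall>z\<in>{a..c}. (\<Sum>i\<le>n. \<bar>lag x n i z\<bar>) \<le> 3 * 12 ^ n)" for n
      using lag_nodes_in_closed_set[OF ac F] by metis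
    then obtain X where X: "\<And>n. inj_on (X n) {..n}" "\<And>n i. i \<le> n \<Longrightarrow> X n i \<in> F"
      "\<And>n z. z \<in> {a..c} \<Longrightarrow> (\<Sum>i\<le>n. \<bar>lag (X n) n i z\<bar>) \<le> 3 * 12 ^ n" by metis
    have interp: "\<bar>\<Sum>i\<le>n. y i * lag (X n) n i x\<bar> \<le> B * (3 * 12 ^ n)"
      if "x \<in> {a..c}" "\<And>i. i \<le> n \<Longrightarrow> \<bar>y i\<bar> \<le> B" for n x y B
    proof -
      have "0 \<le> B" using that(2)[of 0] by auto
      have "\<bar>\<Sum>i\<le>n. y i * lag (X n) n i x\<bar> \<le> (\<Sum>i\<le>n. B * \<bar>lag (X n) n i x\<bar>)"
        by (rule order.trans[OF sum_abs]) (use that(2) in \<open>auto simp: abs_mult intro!: sum_mono mult_right_mono\<close>)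
      also have "\<dots> = B * (\<Sum>i\<le>n. \<bar>lag (X n) n i x\<bar>)" by (simp add: sum_distrib_left)
      also have "\<dots> \<le> B * (3 * 12 ^ n)" using X(3)[OF that(1)] \<open>0 \<le> B\<close> by (rule mult_left_mono)
      finally show ?thesis .
    qed
    define K' where "K' = \<bar>K\<bar>"
    define p where "p = (\<lambda>k \<pi> n x. \<Sum>i\<le>n. \<Psi> k \<pi> (X n i) * lag (X n) n i x)"
    have sm: "summable (\<lambda>k. \<Psi> k \<pi> x * s ^ k)" if "x \<in> {a..c}" "\<pi> \<in> P" "s \<in> {s1..s2}" for x \<pi> s
    proof -
      obtain m where m: "\<And>k. \<bar>\<Psi> k \<pi> x\<bar> * b ^ k \<le> m" using fin \<open>x \<in> {a..c}\<close> \<open>\<pi> \<in> P\<close> by blast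
      have "norm (\<Psi> k \<pi> x * s ^ k) \<le> m * (s / b) ^ k" for k
      proof -
        have "\<bar>\<Psi> k \<pi> x\<bar> \<le> m / b ^ k" using m[of k] b by (simp add: pos_le_divide_eq)
        then have "\<bar>\<Psi> k \<pi> x\<bar> * \<bar>s\<bar> ^ k \<le> m / b ^ k * \<bar>s\<bar> ^ k" by (rule mult_right_mono) auto
        then show ?thesis using that(3) s by (simp add: abs_mult power_abs power_divide)
      qed
      moreover have "summable (\<lambda>k. m * (s / b) ^ k)"
        using that(3) s b by (intro summable_mult summable_geometric) auto
      ultimately show ?thesis
        using summable_comparison_test'[of "\<lambda>k. m * (s / b) ^ k" 0 "\<lambda>k. \<Psi> k \<pi> x * s ^ k"] by blast
    qed
    \<comment> \<open>The two-constants bound is applied to the interpolation error of the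
      coefficients at fixed \<open>x\<close>: its power series has size \<open>12 ^ n\<close> on the
      large disc and \<open>q0 ^ n\<close> on the real interval, after division by \<open>B\<close>.
      The constant involves the pointwise bound \<open>m\<close> at this \<open>x\<close>.\<close>
    have err: "\<bar>\<Psi> k \<pi> x - p k \<pi> n x\<bar> * s1 ^ k \<le> (m + 3 * C0 + 4 * K' + 1) * (19 * (1 / 24) ^ n)"
      if x: "x \<in> {a..c}" and \<pi>: "\<pi> \<in> P" and m: "\<And>k. \<bar>\<Psi> k \<pi> x\<bar> * b ^ k \<le> m" for k \<pi> n x m
    proof -
      define B where "B = m + 3 * C0 + 4 * K' + 1"
      have m0: "0 \<le> m" using m[of 0] by auto
      have B: "0 < B" using m0 C0 by (simp add: B_def K'_def)
      define e where "e = (\<lambda>k. (\<Psi> k \<pi> x - p k \<pi> n x) / B)"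
      have "\<bar>e k\<bar> * b ^ k \<le> 12 ^ n" for k
      proof -
        have "\<bar>p k \<pi> n x\<bar> \<le> C0 / b ^ k * (3 * 12 ^ n)"
          unfolding p_def using FC[OF X(2) \<pi>] b by (intro interp x) (auto simp: pos_le_divide_eq)
        then have "\<bar>p k \<pi> n x\<bar> * b ^ k \<le> 3 * C0 * 12 ^ n" using b by (simp add: field_simps)
        moreover have "\<bar>\<Psi> k \<pi> x - p k \<pi> n x\<bar> * b ^ k \<le> \<bar>\<Psi> k \<pi> x\<bar> * b ^ k + \<bar>p k \<pi> n x\<bar> * b ^ k"
          unfolding distrib_right[symmetric] using b by (intro mult_right_mono) auto
        ultimately have "\<bar>\<Psi> k \<pi> x - p k \<pi> n x\<bar> * b ^ k \<le> m * 1 + 3 * C0 * 12 ^ n" using m[of k] by linarith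
        also have "\<dots> \<le> m * 12 ^ n + 3 * C0 * 12 ^ n" using m0 by (intro add_right_mono mult_left_mono) auto
        also have "\<dots> \<le> B * 12 ^ n" unfolding distrib_right[symmetric]
          by (intro mult_right_mono) (auto simp: B_def K'_def)
        finally show ?thesis using B by (simp add: e_def abs_divide pos_divide_le_eq mult.commute)
      qed
      moreover have "\<bar>\<Sum>k. e k * s ^ k\<bar> \<le> q0 ^ n" if s': "s \<in> {s1..s2}" for s
      proof -
        define f where "f = (\<lambda>x. \<Sum>k. \<Psi> k \<pi> x * s ^ k)"
        obtain r where r: "degree r \<le> n" "\<And>x. x \<in> {a..c} \<Longrightarrow> \<bar>f x - poly r x\<bar> \<le> K * q ^ n"
          using approx \<pi> s' unfolding f_def by meson
        have Kq: "K * q ^ n \<le> K' * q ^ n" using q by (intro mult_right_mono) (auto simp: K'_def)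
        have fs: "(\<lambda>k. \<Psi> k \<pi> z * s ^ k) sums f z" if "z \<in> {a..c}" for z
          unfolding f_def using sm[OF that \<pi> s'] by (rule summable_sums)
        have XF: "X n i \<in> {a..c}" if "i \<le> n" for i using X(2)[OF that] F(2) by auto
        have "(\<lambda>k. (\<Psi> k \<pi> x * s ^ k - (\<Sum>i\<le>n. \<Psi> k \<pi> (X n i) * s ^ k * lag (X n) n i x)) / B) sums
            ((f x - (\<Sum>i\<le>n. f (X n i) * lag (X n) n i x)) / B)"
          by (intro sums_divide sums_diff sums_sum sums_mult2 fs x XF) auto
        moreover have "(\<Psi> k \<pi> x * s ^ k - (\<Sum>i\<le>n. \<Psi> k \<pi> (X n i) * s ^ k * lag (X n) n i x)) / B = e k * s ^ k" for k
        proof -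
          have "(\<Sum>i\<le>n. \<Psi> k \<pi> (X n i) * s ^ k * lag (X n) n i x) = p k \<pi> n x * s ^ k"
            unfolding p_def sum_distrib_right by (rule sum.cong) (simp_all only: mult_ac)
          then show ?thesis unfolding e_def by (simp only: left_diff_distrib times_divide_eq_left)
        qed
        ultimately have "(\<Sum>k. e k * s ^ k) = (f x - (\<Sum>i\<le>n. f (X n i) * lag (X n) n i x)) / B"
          by (simp add: sums_iff)
        \<comment> \<open>Interpolation at n + 1 nodes reproduces polynomials of degree n, so
          \<open>r\<close> can be subtracted from the sum everywhere.\<close>
        also have "f x - (\<Sum>i\<le>n. f (X n i) * lag (X n) n i x)
            = (f x - poly r x) - (\<Sum>i\<le>n. (f (X n i) - poly r (X n i)) * lag (X n) n i x)"
          using lagrange_identity[OF X(1) r(1), of x] by (simp add: left_diff_distrib sum_subtractf)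
        finally have eq: "(\<Sum>k. e k * s ^ k)
            = ((f x - poly r x) - (\<Sum>i\<le>n. (f (X n i) - poly r (X n i)) * lag (X n) n i x)) / B" .
        have "\<bar>\<Sum>i\<le>n. (f (X n i) - poly r (X n i)) * lag (X n) n i x\<bar> \<le> K' * q ^ n * (3 * 12 ^ n)"
          by (intro interp x) (use r(2)[OF XF] Kq in force)
        moreover have "\<bar>f x - poly r x\<bar> \<le> K' * q ^ n * 12 ^ n"
        proof -
          have "\<bar>f x - poly r x\<bar> \<le> K' * q ^ n * 1" using r(2)[OF x] Kq by linarith
          also have "\<dots> \<le> K' * q ^ n * 12 ^ n" using q by (intro mult_left_mono) (auto simp: K'_def)
          finally show ?thesis .
        qed
        ultimately have "\<bar>(f x - poly r x) - (\<Sum>i\<le>n. (f (X n i) - poly r (X n i)) * lag (X n) n i x)\<bar> \<le> 4 * K' * (q ^ n * 12 ^ n)"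
          by linarith
        also have "q ^ n * 12 ^ n = q0 ^ n" by (simp add: q_def flip: power_mult_distrib)
        also have "4 * K' * q0 ^ n \<le> B * q0 ^ n" using m0 C0 q0 by (intro mult_right_mono) (auto simp: B_def)
        finally show ?thesis unfolding eq using B by (simp add: abs_divide pos_divide_le_eq mult.commute)
      qed
      ultimately have "\<bar>e k\<bar> * s1 ^ k \<le> 19 * (1 / 24) ^ n" by (rule tc)
      then have "\<bar>\<Psi> k \<pi> x - p k \<pi> n x\<bar> * s1 ^ k \<le> B * (19 * (1 / 24) ^ n)"
        using B by (simp add: e_def abs_divide pos_divide_le_eq mult.commute)
      then show ?thesis unfolding B_def .
    qed
    \<comment> \<open>The constant of \<open>err\<close> with \<open>m\<close> replaced by
      \<open>C0\<close>, valid at points of \<open>F\<close> and hence uniformly at all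
      nodes.\<close>
    define C1 where "C1 = C0 + 3 * C0 + 4 * K' + 1"
    have C1: "0 \<le> C1" using C0 by (simp add: C1_def K'_def)
    \<comment> \<open>The difference of successive interpolants is the interpolant, at the new
      nodes, of the error of the old one. Those nodes lie in \<open>F\<close>, so the bound is
      uniform over the whole interval although \<open>err\<close> is not.\<close>
    have step: "\<bar>p k \<pi> (Suc n) x - p k \<pi> n x\<bar> * s1 ^ k \<le> 38 * 36 * C1 * (1 / 2) ^ n"
      if x: "x \<in> {a..c}" and \<pi>: "\<pi> \<in> P" for k \<pi> n x
    proof -
      define r where "r = (\<Sum>i\<le>n. smult (\<Psi> k \<pi> (X n i)) (lag_poly (X n) n i))"
      have pr: "poly r x = p k \<pi> n x" for x by (simp add: r_def p_def poly_sum poly_lag_poly)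
      have "degree r \<le> n" unfolding r_def
        by (intro degree_sum_le) (use degree_lag_poly in \<open>auto intro: order.trans[OF degree_smult_le]\<close>)
      then have r: "degree r \<le> Suc n" by simp
      have "\<bar>\<Psi> k \<pi> (X (Suc n) i) - poly r (X (Suc n) i)\<bar> \<le> C1 * (19 * (1 / 24) ^ n) / s1 ^ k" if "i \<le> Suc n" for i
      proof -
        have XF: "X (Suc n) i \<in> F" using X(2)[OF that] .
        then have "X (Suc n) i \<in> {a..c}" using F(2) by blast
        from err[OF this \<pi> FC[OF XF \<pi>], of k n]
        have "\<bar>\<Psi> k \<pi> (X (Suc n) i) - poly r (X (Suc n) i)\<bar> * s1 ^ k \<le> C1 * (19 * (1 / 24) ^ n)"
          unfolding pr C1_def .
        moreover have "0 < s1 ^ k" using s(1) by simp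
        ultimately show ?thesis by (simp only: pos_le_divide_eq)
      qed
      then have "\<bar>\<Sum>i\<le>Suc n. (\<Psi> k \<pi> (X (Suc n) i) - poly r (X (Suc n) i)) * lag (X (Suc n)) (Suc n) i x\<bar>
          \<le> C1 * (19 * (1 / 24) ^ n) / s1 ^ k * (3 * 12 ^ Suc n)"
        by (intro interp x)
      moreover have "(\<Sum>i\<le>Suc n. (\<Psi> k \<pi> (X (Suc n) i) - poly r (X (Suc n) i)) * lag (X (Suc n)) (Suc n) i x)
          = p k \<pi> (Suc n) x - poly r x"
        unfolding left_diff_distrib sum_subtractf lagrange_identity[OF X(1) r, of x] p_def ..
      ultimately have "\<bar>p k \<pi> (Suc n) x - p k \<pi> n x\<bar> \<le> C1 * (19 * (1 / 24) ^ n) * (3 * 12 ^ Suc n) / s1 ^ k"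
        unfolding pr by simp
      moreover have "0 < s1 ^ k" using s(1) by simp
      ultimately have "\<bar>p k \<pi> (Suc n) x - p k \<pi> n x\<bar> * s1 ^ k \<le> C1 * (19 * (1 / 24) ^ n) * (3 * 12 ^ Suc n)"
        by (simp only: pos_le_divide_eq)
      also have "\<dots> = 19 * 36 * C1 * ((1 / 24) ^ n * 12 ^ n)" by simp
      also have "(1 / 24) ^ n * 12 ^ n = (1 / 2 :: real) ^ n" by (simp flip: power_mult_distrib)
      also have "19 * 36 * C1 * (1 / 2) ^ n \<le> 38 * 36 * C1 * (1 / 2) ^ n" using C1 by (intro mult_right_mono) auto
      finally show ?thesis .
    qed
    define D where "D = 38 * 36 * C1"
    have bound: "\<bar>p k \<pi> n x\<bar> * s1 ^ k \<le> \<bar>p k \<pi> 0 x\<bar> * s1 ^ k + D * (2 - 2 * (1 / 2) ^ n)"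
      if x: "x \<in> {a..c}" and \<pi>: "\<pi> \<in> P" for k \<pi> n x
    proof (induction n)
      case (Suc n)
      have "\<bar>p k \<pi> (Suc n) x\<bar> * s1 ^ k \<le> \<bar>p k \<pi> n x\<bar> * s1 ^ k + \<bar>p k \<pi> (Suc n) x - p k \<pi> n x\<bar> * s1 ^ k"
        unfolding distrib_right[symmetric] using s(1) by (intro mult_right_mono) auto
      moreover have "\<bar>p k \<pi> (Suc n) x - p k \<pi> n x\<bar> * s1 ^ k \<le> D * (1 / 2) ^ n"
        using step[OF x \<pi>] unfolding D_def .
      moreover have "D * (2 - 2 * (1 / 2) ^ n) + D * (1 / 2) ^ n = D * (2 - 2 * (1 / 2) ^ Suc n)"
        by (simp add: field_simps)
      ultimately show ?case using Suc.IH by linarith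
    qed auto
    have p0: "\<bar>p k \<pi> 0 x\<bar> * s1 ^ k \<le> 3 * C0" if x: "x \<in> {a..c}" and \<pi>: "\<pi> \<in> P" for k \<pi> x
    proof -
      have "\<bar>p k \<pi> 0 x\<bar> \<le> C0 / b ^ k * (3 * 12 ^ 0)"
        unfolding p_def using FC[OF X(2) \<pi>] b by (intro interp x) (auto simp: pos_le_divide_eq)
      then have "\<bar>p k \<pi> 0 x\<bar> * b ^ k \<le> 3 * C0" using b by (simp add: field_simps)
      moreover have "\<bar>p k \<pi> 0 x\<bar> * s1 ^ k \<le> \<bar>p k \<pi> 0 x\<bar> * b ^ k"
        using s by (intro mult_left_mono power_mono) auto
      ultimately show ?thesis by linarith
    qed
    have "\<bar>\<Psi> k \<pi> x\<bar> * s1 ^ k \<le> 3 * C0 + 2 * D" if x: "x \<in> {a..c}" and \<pi>: "\<pi> \<in> P" for k \<pi> x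
    proof -
      obtain m where m': "\<forall>k. \<forall>\<pi>\<in>P. \<bar>\<Psi> k \<pi> x\<bar> * b ^ k \<le> m" using bspec[OF fin x] ..
      have m: "\<bar>\<Psi> k \<pi> x\<bar> * b ^ k \<le> m" for k by (rule m'[rule_format, OF \<pi>])
      define E where "E = (m + 3 * C0 + 4 * K' + 1) * 19"
      have D0: "0 \<le> D" using C1 by (simp add: D_def)
      \<comment> \<open>The bound \<open>m\<close> at this \<open>x\<close> enters only through
        \<open>E\<close>, which is multiplied by a decaying factor; letting n tend to infinity
        leaves a constant independent of \<open>x\<close>.\<close>
      have *: "\<bar>\<Psi> k \<pi> x\<bar> * s1 ^ k \<le> 3 * C0 + 2 * D + E * (1 / 24) ^ n" for n
      proof -
        have "\<bar>\<Psi> k \<pi> x\<bar> * s1 ^ k \<le> \<bar>p k \<pi> n x\<bar> * s1 ^ k + \<bar>\<Psi> k \<pi> x - p k \<pi> n x\<bar> * s1 ^ k"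
          unfolding distrib_right[symmetric] using s(1) by (intro mult_right_mono) auto
        moreover have "D * (2 - 2 * (1 / 2) ^ n) \<le> D * 2" by (rule mult_left_mono[OF _ D0]) simp
        moreover have "\<bar>\<Psi> k \<pi> x - p k \<pi> n x\<bar> * s1 ^ k \<le> E * (1 / 24) ^ n"
          using err[OF x \<pi> m, of k n] by (simp only: E_def mult.assoc)
        ultimately show ?thesis using p0[OF x \<pi>, of k] bound[OF x \<pi>, of k n] by linarith
      qed
      have "(\<lambda>n. 3 * C0 + 2 * D + E * (1 / 24) ^ n) \<longlonglongrightarrow> 3 * C0 + 2 * D + E * 0"
        by (intro tendsto_intros LIMSEQ_realpow_zero) auto
      then show ?thesis using * by (intro LIMSEQ_le_const[of _ "3 * C0 + 2 * D"]) auto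
    qed
    then show ?thesis by blast
  qed
  note main = this
  show ?thesis
  proof (rule exI[of _ q], intro conjI allI impI q)
    fix \<Psi> :: "nat \<Rightarrow> 'p \<Rightarrow> real \<Rightarrow> real" and P a c K
    assume *: "a < c" "\<forall>k. \<forall>\<pi>\<in>P. continuous_on {a..c} (\<Psi> k \<pi>)"
      "\<forall>x\<in>{a..c}. \<exists>m. \<forall>k. \<forall>\<pi>\<in>P. \<bar>\<Psi> k \<pi> x\<bar> * b ^ k \<le> m"
      "\<forall>n. \<forall>\<pi>\<in>P. \<forall>s\<in>{s1..s2}. \<exists>p. degree p \<le> n \<and> (\<forall>x\<in>{a..c}. \<bar>(\<Sum>k. \<Psi> k \<pi> x * s ^ k) - poly p x\<bar> \<le> K * q ^ n)"
    show "\<exists>C. \<forall>k. \<forall>\<pi>\<in>P. \<forall>x\<in>{a..c}. \<bar>\<Psi> k \<pi> x\<bar> * s1 ^ k \<le> C"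
      by (rule main[OF *])
  qed
qed

section \<open>The axisymmetric elliptic operator\<close>

definition ell :: "real \<Rightarrow> (real \<times> real) set \<Rightarrow> (real \<times> real \<Rightarrow> real) \<Rightarrow> (real \<times> real \<Rightarrow> real) \<Rightarrow> bool" where
  "ell s S g f \<longleftrightarrow> open S \<and> continuous_on S g \<and> (\<forall>R Z. (R, Z) \<in> S \<longrightarrow> 0 < 1 + s * R) \<and>
     (\<exists>g1 g11 g2 g22. \<forall>R Z. (R, Z) \<in> S \<longrightarrow>
        ((\<lambda>x. g (x, Z)) has_real_derivative g1 (R, Z)) (at R) \<and> ((\<lambda>x. g1 (x, Z)) has_real_derivative g11 (R, Z)) (at R) \<and>
        ((\<lambda>z. g (R, z)) has_real_derivative g2 (R, Z)) (at Z) \<and> ((\<lambda>z. g2 (R, z)) has_real_derivative g22 (R, Z)) (at Z) \<and>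
        g11 (R, Z) + 3 * s / (1 + s * R) * g1 (R, Z) + g22 (R, Z) = f (R, Z))"

text \<open>The operator in \<open>ell\<close> is the Laplacian of \<open>\<real>\<^sup>4 \<times> \<real>\<close> acting on functions of \<open>(\<bar>x\<bar>, z)\<close>, written in the
  scaled variables \<open>r = 1 + s R\<close>; \<open>complex \<times> complex\<close> serves as \<open>\<real>\<^sup>4\<close>.\<close>

type_synonym R5 = "(complex \<times> complex) \<times> real"

definition lift :: "real \<Rightarrow> R5 \<Rightarrow> real \<times> real" where
  "lift s x = ((norm ((1, 0) + s *\<^sub>R fst x) - 1) / s, snd x)"

lemma norm_add_scaled_basis:
  fixes w b :: "'a::euclidean_space"
  assumes "b \<in> Basis"
  shows "norm (w + c *\<^sub>R b) = sqrt ((norm w)\<^sup>2 + 2 * c * (w \<bullet> b) + c\<^sup>2)"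
proof -
  have "(norm (w + c *\<^sub>R b))\<^sup>2 = (norm w)\<^sup>2 + 2 * c * (w \<bullet> b) + c\<^sup>2"
    unfolding power2_norm_eq_inner using assms
    by (simp add: inner_add_left inner_add_right inner_commute inner_same_Basis power2_eq_square algebra_simps)
  then show ?thesis by (metis norm_ge_zero real_sqrt_unique)
qed

text \<open>The lift absorbs the first-order term, whose coefficient depends on \<open>s\<close>,
  into a Laplacian on one fixed space. Solutions belonging to different values of \<open>s\<close>
  thereby become subtractable.\<close>

lemma lap_on_lift:
  assumes ell: "ell s S g f" and s: "0 < s"
  shows "lap_on {x. lift s x \<in> S} (\<lambda>x. g (lift s x)) (\<lambda>x. f (lift s x))"
proof -
  obtain g1 g11 g2 g22 where opS: "open S" and cont: "continuous_on S g" and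
    G: "\<And>R Z. (R, Z) \<in> S \<Longrightarrow> ((\<lambda>x. g (x, Z)) has_real_derivative g1 (R, Z)) (at R)"
       "\<And>R Z. (R, Z) \<in> S \<Longrightarrow> ((\<lambda>x. g1 (x, Z)) has_real_derivative g11 (R, Z)) (at R)"
       "\<And>R Z. (R, Z) \<in> S \<Longrightarrow> ((\<lambda>z. g (R, z)) has_real_derivative g2 (R, Z)) (at Z)"
       "\<And>R Z. (R, Z) \<in> S \<Longrightarrow> ((\<lambda>z. g2 (R, z)) has_real_derivative g22 (R, Z)) (at Z)"
    and eq: "\<And>R Z. (R, Z) \<in> S \<Longrightarrow> g11 (R, Z) + 3 * s / (1 + s * R) * g1 (R, Z) + g22 (R, Z) = f (R, Z)"
    and pos: "\<And>R Z. (R, Z) \<in> S \<Longrightarrow> 0 < 1 + s * R"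
    using ell unfolding ell_def by blast
  define w where "w = (\<lambda>x :: R5. ((1, 0) :: complex \<times> complex) + s *\<^sub>R fst x)"
  define \<rho> where "\<rho> = (\<lambda>x. (norm (w x) - 1) / s)"
  have lift: "lift s x = (\<rho> x, snd x)" for x by (simp add: lift_def \<rho>_def w_def)
  have cl: "continuous_on A (lift s)" for A unfolding lift_def by (intro continuous_intros) (use s in auto)
  have 1: "open {x. lift s x \<in> S}" using open_vimage[OF opS cl] by (simp add: vimage_def)
  have 2: "continuous_on {x. lift s x \<in> S} (\<lambda>x. g (lift s x))"
    by (rule continuous_on_compose2[OF cont cl]) auto
  define u1 where "u1 = (\<lambda>(b :: R5) x. if fst b = 0 then g2 (lift s x) else g1 (lift s x) * ((w x \<bullet> fst b) / norm (w x)))"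
  define u2 where "u2 = (\<lambda>(b :: R5) x. if fst b = 0 then g22 (lift s x)
     else g11 (lift s x) * ((w x \<bullet> fst b) / norm (w x))\<^sup>2
       + g1 (lift s x) * (s / norm (w x) - s * (w x \<bullet> fst b)\<^sup>2 / norm (w x) ^ 3))"
  have "(\<forall>b\<in>Basis. ((\<lambda>t. g (lift s (x + t *\<^sub>R b))) has_real_derivative u1 b x) (at 0) \<and>
        ((\<lambda>t. u1 b (x + t *\<^sub>R b)) has_real_derivative u2 b x) (at 0)) \<and> (\<Sum>b\<in>Basis. u2 b x) = f (lift s x)"
    if x: "lift s x \<in> S" for x
  proof -
    have xS: "(\<rho> x, snd x) \<in> S" using x by (simp add: lift)
    have wpos: "0 < norm (w x)" using pos[OF xS] s by (simp add: \<rho>_def)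
    have norm_eq: "1 + s * \<rho> x = norm (w x)" using s by (simp add: \<rho>_def)
    have sp: "((\<lambda>t. g (lift s (x + t *\<^sub>R b))) has_real_derivative u1 b x) (at 0) \<and>
        ((\<lambda>t. u1 b (x + t *\<^sub>R b)) has_real_derivative u2 b x) (at 0)" if b: "b = (c, 0)" "c \<in> Basis" for b c
    proof -
      define m where "m = w x \<bullet> c"
      have c0: "c \<noteq> 0" "c \<bullet> c = 1" using b(2) by (auto simp: inner_same_Basis)
      have fb: "fst b = c" by (simp add: b(1))
      have wt: "w (x + t *\<^sub>R b) = w x + (s * t) *\<^sub>R c" for t by (simp add: w_def b(1) scaleR_add_right)
      define r where "r = (\<lambda>t. sqrt ((norm (w x))\<^sup>2 + 2 * (s * t) * m + (s * t)\<^sup>2))"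
      have nw: "norm (w (x + t *\<^sub>R b)) = r t" for t
        unfolding wt m_def r_def by (rule norm_add_scaled_basis[OF b(2)])
      have \<rho>t: "\<rho> (x + t *\<^sub>R b) = (r t - 1) / s" for t by (simp add: \<rho>_def nw)
      have st: "snd (x + t *\<^sub>R b) = snd x" for t by (simp add: b(1))
      have r0: "r 0 = norm (w x)" by (simp add: r_def)
      have dr: "(r has_real_derivative s * m / norm (w x)) (at 0)"
        unfolding r_def using wpos by (auto intro!: derivative_eq_intros simp: field_simps)
      then have d\<rho>: "((\<lambda>t. (r t - 1) / s) has_real_derivative m / norm (w x)) (at 0)"
        using s by (auto intro!: derivative_eq_intros simp: field_simps)
      have g1': "((\<lambda>x'. g (x', snd x)) has_real_derivative g1 (\<rho> x, snd x)) (at ((r 0 - 1) / s))"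
        "((\<lambda>x'. g1 (x', snd x)) has_real_derivative g11 (\<rho> x, snd x)) (at ((r 0 - 1) / s))"
        using G(1,2)[OF xS] by (simp_all add: r0 \<rho>_def)
      have D1: "((\<lambda>t. g ((r t - 1) / s, snd x)) has_real_derivative g1 (\<rho> x, snd x) * (m / norm (w x))) (at 0)"
        by (rule DERIV_chain2[where f = "\<lambda>x'. g (x', snd x)", OF g1'(1) d\<rho>])
      have D2: "((\<lambda>t. g1 ((r t - 1) / s, snd x)) has_real_derivative g11 (\<rho> x, snd x) * (m / norm (w x))) (at 0)"
        by (rule DERIV_chain2[where f = "\<lambda>x'. g1 (x', snd x)", OF g1'(2) d\<rho>])
      have wm: "w (x + t *\<^sub>R b) \<bullet> c = m + s * t" for t by (simp add: wt m_def inner_add_left c0)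
      have D3: "((\<lambda>t. (m + s * t) / r t) has_real_derivative (s / norm (w x) - s * m\<^sup>2 / norm (w x) ^ 3)) (at 0)"
        by (rule derivative_eq_intros dr refl | use wpos in \<open>simp add: r0 field_simps power2_eq_square power3_eq_cube\<close>)+
      have D4: "((\<lambda>t. g1 ((r t - 1) / s, snd x) * ((m + s * t) / r t)) has_real_derivative
          g11 (\<rho> x, snd x) * (m / norm (w x)) * (m / norm (w x)) +
          (s / norm (w x) - s * m\<^sup>2 / norm (w x) ^ 3) * g1 (\<rho> x, snd x)) (at 0)"
        using DERIV_mult[OF D2 D3] by (simp add: r0 \<rho>_def)
      show ?thesis
        using D1 D4 unfolding u1_def u2_def lift \<rho>t st fb wm nw m_def[symmetric]
        by (simp add: c0 power2_eq_square mult_ac)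
    qed
    have zd: "((\<lambda>t. g (lift s (x + t *\<^sub>R b))) has_real_derivative u1 b x) (at 0) \<and>
        ((\<lambda>t. u1 b (x + t *\<^sub>R b)) has_real_derivative u2 b x) (at 0)" if b: "b = (0, 1)" for b
    proof -
      have "\<rho> (x + t *\<^sub>R b) = \<rho> x" for t by (simp add: \<rho>_def w_def b)
      moreover have "((\<lambda>t. g (\<rho> x, snd x + t)) has_real_derivative g2 (\<rho> x, snd x)) (at 0)"
        using G(3)[OF xS] DERIV_shift[of "\<lambda>z. g (\<rho> x, z)" _ 0 "snd x"] by (simp add: add.commute)
      moreover have "((\<lambda>t. g2 (\<rho> x, snd x + t)) has_real_derivative g22 (\<rho> x, snd x)) (at 0)"
        using G(4)[OF xS] DERIV_shift[of "\<lambda>z. g2 (\<rho> x, z)" _ 0 "snd x"] by (simp add: add.commute)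
      ultimately show ?thesis by (simp add: u1_def u2_def lift b)
    qed
    have "(\<Sum>b\<in>Basis. u2 b x) = (\<Sum>c\<in>Basis. u2 (c, 0) x) + u2 (0, 1) x"
      unfolding Basis_prod_def by (subst sum.union_disjoint) (auto simp: sum.reindex inj_on_def nonzero_Basis)
    also have "(\<Sum>c\<in>Basis. u2 (c, 0) x) = (\<Sum>c\<in>Basis. (w x \<bullet> c)\<^sup>2 * (g11 (lift s x) / (norm (w x))\<^sup>2 - g1 (lift s x) * s / norm (w x) ^ 3)
        + g1 (lift s x) * s / norm (w x))"
      by (intro sum.cong) (auto simp: u2_def power_divide algebra_simps nonzero_Basis)
    \<comment> \<open>The squares of the four direction cosines add up to 1, while
      \<open>g1 * s / norm (w x)\<close> is counted once per direction; 4 - 1 = 3 is the coefficient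
      in \<open>ell\<close>.\<close>
    also have "\<dots> = (norm (w x))\<^sup>2 * (g11 (lift s x) / (norm (w x))\<^sup>2 - g1 (lift s x) * s / norm (w x) ^ 3)
        + 4 * (g1 (lift s x) * s / norm (w x))"
      unfolding sum.distrib sum_distrib_right[symmetric]
      by (simp add: norm_eq_sqrt_inner euclidean_inner[of "w x" "w x"] power2_eq_square sum_nonneg)
    also have "\<dots> = g11 (lift s x) + 3 * s / norm (w x) * g1 (lift s x)"
      using wpos by (simp add: field_simps power2_eq_square power3_eq_cube)
    also have "u2 (0, 1) x = g22 (lift s x)" by (simp add: u2_def)
    finally have "(\<Sum>b\<in>Basis. u2 b x) = f (lift s x)"
      using eq[OF xS] by (simp add: lift norm_eq)
    moreover have "b \<in> Basis \<Longrightarrow> (\<exists>c. b = (c, 0) \<and> c \<in> Basis) \<or> b = (0, 1)" for b :: R5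
      by (auto simp: Basis_prod_def)
    ultimately show ?thesis using sp zd by blast
  qed
  then show ?thesis unfolding lap_on_def using 1 2 by blast
qed

lemma lap_on_diff:
  assumes "lap_on S u f" "lap_on S v h"
  shows "lap_on S (\<lambda>x. u x - v x) (\<lambda>x. f x - h x)"
proof -
  obtain u1 u2 where u: "\<And>x. x \<in> S \<Longrightarrow> (\<forall>b\<in>Basis. ((\<lambda>t. u (x + t *\<^sub>R b)) has_real_derivative u1 b x) (at 0) \<and>
        ((\<lambda>t. u1 b (x + t *\<^sub>R b)) has_real_derivative u2 b x) (at 0)) \<and> (\<Sum>b\<in>Basis. u2 b x) = f x"
    and S: "open S" "continuous_on S u" using assms(1) unfolding lap_on_def by metis
  obtain v1 v2 where v: "\<And>x. x \<in> S \<Longrightarrow> (\<forall>b\<in>Basis. ((\<lambda>t. v (x + t *\<^sub>R b)) has_real_derivative v1 b x) (at 0) \<and>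
        ((\<lambda>t. v1 b (x + t *\<^sub>R b)) has_real_derivative v2 b x) (at 0)) \<and> (\<Sum>b\<in>Basis. v2 b x) = h x"
    and S': "continuous_on S v" using assms(2) unfolding lap_on_def by metis
  have "\<exists>u1 u2. \<forall>x\<in>S. (\<forall>b\<in>Basis. ((\<lambda>t. u (x + t *\<^sub>R b) - v (x + t *\<^sub>R b)) has_real_derivative u1 b x) (at 0) \<and>
        ((\<lambda>t. u1 b (x + t *\<^sub>R b)) has_real_derivative u2 b x) (at 0)) \<and> (\<Sum>b\<in>Basis. u2 b x) = f x - h x"
    by (rule exI[of _ "\<lambda>b x. u1 b x - v1 b x"], rule exI[of _ "\<lambda>b x. u2 b x - v2 b x"])
       (use u v in \<open>auto intro!: DERIV_diff simp: sum_subtractf\<close>)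
  then show ?thesis unfolding lap_on_def using S S' by (auto intro!: continuous_intros)
qed

lemma lap_on_subset:
  assumes "lap_on S u f" "open S'" "S' \<subseteq> S"
  shows "lap_on S' u f"
proof -
  obtain u1 u2 where u: "\<forall>x\<in>S. (\<forall>b\<in>Basis. ((\<lambda>t. u (x + t *\<^sub>R b)) has_real_derivative u1 b x) (at 0) \<and>
        ((\<lambda>t. u1 b (x + t *\<^sub>R b)) has_real_derivative u2 b x) (at 0)) \<and> (\<Sum>b\<in>Basis. u2 b x) = f x"
    and c: "continuous_on S u" using assms(1) unfolding lap_on_def by metis
  have "\<forall>x\<in>S'. (\<forall>b\<in>Basis. ((\<lambda>t. u (x + t *\<^sub>R b)) has_real_derivative u1 b x) (at 0) \<and>
        ((\<lambda>t. u1 b (x + t *\<^sub>R b)) has_real_derivative u2 b x) (at 0)) \<and> (\<Sum>b\<in>Basis. u2 b x) = f x"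
    using u assms(3) by (simp add: subset_iff)
  then show ?thesis
    unfolding lap_on_def using continuous_on_subset[OF c assms(3)] assms(2) by blast
qed

text \<open>A right inverse of \<open>lift s\<close> on points with positive radius, independent of
  \<open>s\<close>. It maps coordinate lines to lines along basis vectors of the lifted space, so
  derivatives can be read off there.\<close>

definition lift_pt :: "real \<times> real \<Rightarrow> R5" where
  "lift_pt y = ((fst y *\<^sub>R (1, 0), snd y))"

definition lift_dir :: "real \<times> real \<Rightarrow> R5" where
  "lift_dir e = (fst e *\<^sub>R (1, 0), snd e)"

lemma lift_pt_line: "lift_pt y + t *\<^sub>R lift_dir e = lift_pt (y + t *\<^sub>R e)"
  by (simp add: lift_pt_def lift_dir_def scaleR_left_distrib)

lemma lift_dir_Basis: "e = (1, 0) \<or> e = (0, 1) \<Longrightarrow> lift_dir e \<in> Basis"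
  by (auto simp: lift_dir_def Basis_prod_def zero_prod_def)

lemma lift_lift_pt:
  assumes "0 < s" "0 < 1 + s * fst y"
  shows "lift s (lift_pt y) = y"
proof -
  have "((1, 0) :: complex \<times> complex) + s *\<^sub>R fst y *\<^sub>R (1, 0) = (1 + s * fst y) *\<^sub>R (1, 0)"
    by (simp add: scaleR_left_distrib)
  then show ?thesis using assms by (simp add: lift_def lift_pt_def norm_Pair)
qed

lemma dist_lift:
  assumes "0 < s"
  shows "dist (lift s x) (lift s y) \<le> dist x y"
proof -
  have "\<bar>norm ((1, 0) + s *\<^sub>R fst x) - norm ((1, 0) + s *\<^sub>R fst y)\<bar> \<le> norm (s *\<^sub>R (fst x - fst y))"
    using norm_triangle_ineq3[of "(1, 0) + s *\<^sub>R fst x" "(1, 0) + s *\<^sub>R fst y"]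
    by (simp add: scaleR_diff_right)
  also have "\<dots> = s * norm (fst x - fst y)" using assms by simp
  finally have "dist (fst (lift s x)) (fst (lift s y)) \<le> dist (fst x) (fst y)"
    using assms by (simp add: lift_def dist_norm pos_divide_le_eq mult.commute flip: diff_divide_distrib)
  then show ?thesis
    unfolding dist_prod_def[of "lift s x"] dist_prod_def[of x]
    by (intro real_sqrt_le_mono add_mono power_mono) (auto simp: lift_def)
qed

text \<open>Expanding the norm at the unit vector: \<open>(norm (e + s X) - 1) / s\<close> tends to
  the component of X along e, with error of order \<open>s\<close> on bounded sets. Lifts for
  different small \<open>s\<close> are therefore uniformly close.\<close>

lemma lift_approx:
  assumes s: "0 < s" and M: "norm (fst x) \<le> M" "s * M \<le> 1 / 2"
  shows "\<bar>fst (lift s x) - fst x \<bullet> (1, 0)\<bar> \<le> s * M\<^sup>2"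
proof -
  define X where "X = fst x"
  define a where "a = X \<bullet> (1, 0)"
  define N where "N = norm ((1, 0) + s *\<^sub>R X)"
  have nb: "norm ((1, 0) :: complex \<times> complex) = 1" by (simp add: norm_Pair)
  have M0: "0 \<le> M" using M(1) norm_ge_zero order.trans by blast
  have a: "\<bar>a\<bar> \<le> M" using Cauchy_Schwarz_ineq2[of X "(1, 0)"] M(1) nb by (simp add: a_def X_def)
  have "s * \<bar>a\<bar> \<le> s * M" using a s by (intro mult_left_mono) auto
  then have sa: "1 / 2 \<le> 1 + s * a" using M(2) s abs_ge_minus_self[of "s * a"]
    by (simp only: abs_mult abs_of_pos)
  have N2: "N\<^sup>2 = 1 + 2 * s * a + s\<^sup>2 * (norm X)\<^sup>2"
    unfolding N_def a_def power2_norm_eq_inner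
    by (simp add: inner_add_left inner_add_right inner_commute power2_eq_square algebra_simps)
  have "N\<^sup>2 - (1 + s * a)\<^sup>2 = s\<^sup>2 * ((norm X)\<^sup>2 - a\<^sup>2)" unfolding N2 by (simp add: power2_eq_square algebra_simps)
  then have eq: "(N - (1 + s * a)) * (N + (1 + s * a)) = s\<^sup>2 * ((norm X)\<^sup>2 - a\<^sup>2)"
    by (simp add: power2_eq_square algebra_simps)
  have a2: "a\<^sup>2 \<le> (norm X)\<^sup>2" using Cauchy_Schwarz_ineq2[of X "(1, 0)"] nb by (simp add: a_def abs_le_square_iff[symmetric])
  have Nge: "1 + s * a \<le> N"
  proof (rule ccontr)
    assume "\<not> 1 + s * a \<le> N"
    then have "(N - (1 + s * a)) * (N + (1 + s * a)) < 0"
      using sa by (intro mult_neg_pos) (auto simp: N_def intro: add_nonneg_pos)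
    moreover have "0 \<le> s\<^sup>2 * ((norm X)\<^sup>2 - a\<^sup>2)" using a2 by simp
    ultimately show False using eq by linarith
  qed
  have "(N - (1 + s * a)) * 1 \<le> (N - (1 + s * a)) * (N + (1 + s * a))"
    using Nge sa by (intro mult_left_mono) auto
  also have "\<dots> \<le> s\<^sup>2 * M\<^sup>2" unfolding eq using M(1) by (intro mult_left_mono) (auto simp: X_def intro!: diff_le_eq[THEN iffD2] add_increasing2 power_mono)
  finally have "N - (1 + s * a) \<le> s\<^sup>2 * M\<^sup>2" by simp
  then have "(N - (1 + s * a)) / s \<le> s\<^sup>2 * M\<^sup>2 / s" using s by (intro divide_right_mono) auto
  moreover have "(N - (1 + s * a)) / s = fst (lift s x) - a" using s by (simp add: lift_def N_def X_def field_simps)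
  moreover have "0 \<le> (N - (1 + s * a)) / s" using Nge s by simp
  ultimately show ?thesis using s by (simp add: a_def X_def power2_eq_square)
qed

section \<open>Gradient convergence and analyticity for the rescaled operator\<close>

lemma symmetric_difference_bound_deriv:
  fixes h :: "real \<Rightarrow> real"
  assumes D: "(h has_real_derivative D) (at 0)" and d: "0 < d"
    and b: "\<And>\<mu>. 0 < \<mu> \<Longrightarrow> \<mu> < d \<Longrightarrow> \<bar>h \<mu> - h (- \<mu>)\<bar> \<le> 2 * c * \<mu>"
  shows "\<bar>D\<bar> \<le> c"
proof -
  have "((\<lambda>t. h (- t)) has_real_derivative - D) (at 0)"
    by (rule DERIV_mirror[THEN iffD1]) (use D in simp)
  from DERIV_diff[OF D this] have "((\<lambda>t. h t - h (- t)) has_real_derivative 2 * D) (at 0)" by simp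
  then have "((\<lambda>\<mu>. (h \<mu> - h (- \<mu>)) / \<mu>) \<longlongrightarrow> 2 * D) (at 0)"
    by (simp add: has_field_derivative_iff)
  then have "((\<lambda>\<mu>. \<bar>(h \<mu> - h (- \<mu>)) / \<mu>\<bar>) \<longlongrightarrow> \<bar>2 * D\<bar>) (at_right 0)"
    by (intro tendsto_rabs) (rule filterlim_mono[OF _ order_refl at_le], auto)
  moreover have "\<forall>\<^sub>F \<mu> in at_right 0. \<bar>(h \<mu> - h (- \<mu>)) / \<mu>\<bar> \<le> 2 * c"
    using eventually_at_right_less[of 0] eventually_at_rightI[of 0 d "\<lambda>\<mu>. \<mu> < d", OF _ d]
    by (auto elim!: eventually_elim2 simp: abs_divide pos_divide_le_eq b)
  ultimately have "\<bar>2 * D\<bar> \<le> 2 * c" by (rule tendsto_upperbound) simp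
  then show ?thesis by (simp add: abs_mult)
qed

lemma ell_pos: "ell s S g f \<Longrightarrow> y \<in> S \<Longrightarrow> 0 < 1 + s * fst y"
  by (cases y) (auto simp: ell_def)

lemma lift_in_ball:
  assumes s: "0 < s" and y: "0 < 1 + s * fst y" and x: "x \<in> cball (lift_pt y) r"
  shows "lift s x \<in> cball y r"
  using dist_lift[OF s, of "lift_pt y" x] x by (simp add: lift_lift_pt[OF s y])

text \<open>Lifted through their own \<open>s n\<close> and \<open>s m\<close>, two members of the
  sequence differ by a solution of a Poisson equation with uniformly small size and source, because
  the lifts are close and the limits uniformly continuous. The gradient estimate turns this into
  closeness of symmetric differences, uniformly in the step.\<close>

lemma C1_convergence:
  fixes g f :: "nat \<Rightarrow> real \<times> real \<Rightarrow> real"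
  assumes ell: "\<forall>\<^sub>F n in sequentially. ell (s n) (ball y0 \<rho>) (g n) (f n)"
    and s: "\<And>n. 0 < s n" "s \<longlonglongrightarrow> 0" and \<rho>: "0 < \<rho>"
    and gu: "uniform_limit (ball y0 \<rho>) g gl sequentially" and fu: "uniform_limit (ball y0 \<rho>) f fl sequentially"
    and gc: "continuous_on (ball y0 \<rho>) gl" and fc: "continuous_on (ball y0 \<rho>) fl"
    and e: "e = (1, 0) \<or> e = (0, 1)" and \<epsilon>: "0 < \<epsilon>"
  shows "\<forall>\<^sub>F n in sequentially. \<forall>y\<in>ball y0 (\<rho> / 4). \<forall>D D'. ((\<lambda>t. g n (y + t *\<^sub>R e)) has_real_derivative D) (at 0) \<longrightarrow>
      ((\<lambda>t. gl (y + t *\<^sub>R e)) has_real_derivative D') (at 0) \<longrightarrow> \<bar>D - D'\<bar> \<le> \<epsilon>"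
proof -
  define d where "d = \<rho> / 8"
  have d: "0 < d" using \<rho> by (simp add: d_def)
  define M where "M = norm y0 + \<rho>"
  have M: "0 < M" using \<rho> by (simp add: M_def add_nonneg_pos)
  \<comment> \<open>11 is \<open>2 * 5 + 1\<close> from the gradient estimate in dimension 5;
    \<open>\<eta>\<close> is chosen so that the resulting derivative bound is exactly
    \<open>\<epsilon>\<close>.\<close>
  define q where "q = 11 * (1 + d\<^sup>2)"
  define \<eta> where "\<eta> = \<epsilon> * d / q"
  have q: "0 < q" by (simp add: q_def add_pos_nonneg)
  have \<eta>: "0 < \<eta>" using \<epsilon> d q by (simp add: \<eta>_def)
  have \<eta>3: "0 < \<eta> / 3" using \<eta> by simp
  have \<eta>eq: "11 * (\<eta> + \<eta> * d\<^sup>2) / d = \<epsilon>"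
  proof -
    have "11 * (\<eta> + \<eta> * d\<^sup>2) = \<eta> * q" by (simp add: algebra_simps q_def)
    also have "\<dots> = \<epsilon> * d" using q by (simp add: \<eta>_def)
    finally show ?thesis using d by simp
  qed
  have ne: "norm e = 1" using e by (auto simp: norm_Pair)
  define E where "E = lift_dir e"
  have E: "E \<in> Basis" unfolding E_def by (rule lift_dir_Basis[OF e])
  have sub: "cball y0 (\<rho> / 2) \<subseteq> ball y0 \<rho>" using \<rho> by auto
  have uc: "\<exists>\<delta>>0. \<forall>x\<in>cball y0 (\<rho> / 2). \<forall>y\<in>cball y0 (\<rho> / 2). dist x y < \<delta> \<longrightarrow> \<bar>k x - k y\<bar> < \<eta> / 3"
    if "continuous_on (ball y0 \<rho>) k" for k :: "real \<times> real \<Rightarrow> real"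
  proof -
    have "uniformly_continuous_on (cball y0 (\<rho> / 2)) k"
      using continuous_on_subset[OF that sub] by (intro compact_uniformly_continuous) auto
    from this[unfolded uniformly_continuous_on_def, THEN spec[of _ "\<eta> / 3"], THEN mp, OF \<eta>3]
    obtain \<delta> where "0 < \<delta>" "\<forall>x\<in>cball y0 (\<rho> / 2). \<forall>x'\<in>cball y0 (\<rho> / 2). dist x' x < \<delta> \<longrightarrow> dist (k x') (k x) < \<eta> / 3"
      by (elim exE conjE)
    then show ?thesis unfolding dist_real_def by (intro exI[of _ \<delta>] conjI ballI impI) (blast, metis)
  qed
  obtain \<delta>1 where \<delta>1: "0 < \<delta>1" "\<And>x y. x \<in> cball y0 (\<rho> / 2) \<Longrightarrow> y \<in> cball y0 (\<rho> / 2) \<Longrightarrow> dist x y < \<delta>1 \<Longrightarrow> \<bar>gl x - gl y\<bar> < \<eta> / 3"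
    using uc[OF gc] by blast
  obtain \<delta>2 where \<delta>2: "0 < \<delta>2" "\<And>x y. x \<in> cball y0 (\<rho> / 2) \<Longrightarrow> y \<in> cball y0 (\<rho> / 2) \<Longrightarrow> dist x y < \<delta>2 \<Longrightarrow> \<bar>fl x - fl y\<bar> < \<eta> / 3"
    using uc[OF fc] by blast
  define \<delta> where "\<delta> = min \<delta>1 \<delta>2"
  have \<delta>: "0 < \<delta>" using \<delta>1 \<delta>2 by (simp add: \<delta>_def)
  have "\<forall>\<^sub>F n in sequentially. s n < min (1 / (2 * M)) (\<delta> / (2 * M\<^sup>2))"
    by (rule order_tendstoD(2)[OF s(2)]) (use M \<delta> in auto)
  moreover have "\<forall>\<^sub>F n in sequentially. \<forall>x\<in>ball y0 \<rho>. dist (g n x) (gl x) < \<eta> / 3"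
    by (rule uniform_limitD[OF gu \<eta>3])
  moreover have "\<forall>\<^sub>F n in sequentially. \<forall>x\<in>ball y0 \<rho>. dist (f n x) (fl x) < \<eta> / 3"
    by (rule uniform_limitD[OF fu \<eta>3])
  ultimately have "\<forall>\<^sub>F n in sequentially. ell (s n) (ball y0 \<rho>) (g n) (f n) \<and> s n < min (1 / (2 * M)) (\<delta> / (2 * M\<^sup>2)) \<and>
      (\<forall>x\<in>ball y0 \<rho>. dist (g n x) (gl x) < \<eta> / 3) \<and> (\<forall>x\<in>ball y0 \<rho>. dist (f n x) (fl x) < \<eta> / 3)"
    using ell by eventually_elim auto
  then obtain N where N': "\<forall>n\<ge>N. ell (s n) (ball y0 \<rho>) (g n) (f n) \<and> s n < min (1 / (2 * M)) (\<delta> / (2 * M\<^sup>2)) \<and>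
      (\<forall>x\<in>ball y0 \<rho>. dist (g n x) (gl x) < \<eta> / 3) \<and> (\<forall>x\<in>ball y0 \<rho>. dist (f n x) (fl x) < \<eta> / 3)"
    unfolding eventually_sequentially ..
  have N: "\<And>n. n \<ge> N \<Longrightarrow> ell (s n) (ball y0 \<rho>) (g n) (f n)"
    "\<And>n. n \<ge> N \<Longrightarrow> s n < 1 / (2 * M)" "\<And>n. n \<ge> N \<Longrightarrow> s n < \<delta> / (2 * M\<^sup>2)"
    "\<And>n x. n \<ge> N \<Longrightarrow> x \<in> ball y0 \<rho> \<Longrightarrow> \<bar>g n x - gl x\<bar> < \<eta> / 3"
    "\<And>n x. n \<ge> N \<Longrightarrow> x \<in> ball y0 \<rho> \<Longrightarrow> \<bar>f n x - fl x\<bar> < \<eta> / 3"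
    using N' unfolding dist_real_def by (simp_all del: mem_ball)
  have main: "\<bar>(g n (y + \<mu> *\<^sub>R e) - g m (y + \<mu> *\<^sub>R e)) - (g n (y - \<mu> *\<^sub>R e) - g m (y - \<mu> *\<^sub>R e))\<bar> \<le> 2 * \<epsilon> * \<mu>"
    if nm: "n \<ge> N" "m \<ge> N" and y: "y \<in> ball y0 (\<rho> / 4)" and \<mu>: "0 \<le> \<mu>" "\<mu> \<le> d" for n m y \<mu>
  proof -
    define x where "x = lift_pt y"
    have y\<rho>: "y \<in> ball y0 \<rho>" using y \<rho> by auto
    have lin: "lift (s n) z \<in> cball y r" if "n \<ge> N" "z \<in> cball x r" for n z r
      using lift_in_ball[OF s(1) ell_pos[OF N(1)[OF that(1)] y\<rho>]] that by (simp add: x_def)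
    have lin2: "lift (s n) z \<in> cball y0 (\<rho> / 2)" if "n \<ge> N" "z \<in> cball x (2 * d)" for n z
      using lin[OF that] y dist_triangle[of y0 "lift (s n) z" y] by (simp add: d_def)
    define u where "u = (\<lambda>z. g n (lift (s n) z) - g m (lift (s m) z))"
    define v where "v = (\<lambda>z. f n (lift (s n) z) - f m (lift (s m) z))"
    have lp: "lap_on (ball x (3 * d)) (\<lambda>z. g n (lift (s n) z)) (\<lambda>z. f n (lift (s n) z))" if "n \<ge> N" for n
    proof (rule lap_on_subset[OF lap_on_lift[OF N(1)[OF that] s(1)]])
      show "ball x (3 * d) \<subseteq> {z. lift (s n) z \<in> ball y0 \<rho>}"
      proof
        fix z assume "z \<in> ball x (3 * d)"
        then have "lift (s n) z \<in> cball y (3 * d)" using that by (intro lin) auto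
        then show "z \<in> {z. lift (s n) z \<in> ball y0 \<rho>}" using y \<rho> dist_triangle[of y0 "lift (s n) z" y] by (simp add: d_def)
      qed
    qed auto
    have lap: "lap_on (ball x (3 * d)) u v" unfolding u_def v_def by (intro lap_on_diff lp nm)
    have close: "dist (lift (s n) z) (lift (s m) z) < \<delta>" if z: "z \<in> cball x (2 * d)" for z
    proof -
      have "norm (fst z) \<le> M"
      proof -
        have "norm (fst z - fst x) \<le> 2 * d" using z dist_fst_le[of x z] by (simp add: dist_norm norm_minus_commute)
        moreover have "norm (fst x) \<le> norm y" using norm_fst_le[of "fst y" "snd y"] by (simp add: x_def lift_pt_def norm_Pair)
        moreover have "norm y \<le> norm y0 + \<rho> / 4" using y norm_triangle_ineq2[of y y0] by (simp add: dist_norm norm_minus_commute)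
        ultimately show ?thesis using norm_triangle_ineq2[of "fst z" "fst x"] \<rho> by (simp add: M_def d_def)
      qed
      then have a: "\<bar>fst (lift (s n) z) - fst z \<bullet> (1, 0)\<bar> \<le> s n * M\<^sup>2" if "n \<ge> N" for n
        using N(2)[OF that] M by (intro lift_approx s) (auto simp: field_simps)
      have b: "s n * M\<^sup>2 < \<delta> / 2" if "n \<ge> N" for n
        using N(3)[OF that] M by (simp add: field_simps)
      have "dist (lift (s n) z) (lift (s m) z) = \<bar>fst (lift (s n) z) - fst (lift (s m) z)\<bar>"
        by (simp add: dist_prod_def lift_def dist_real_def)
      then show ?thesis using a[OF nm(1)] a[OF nm(2)] b[OF nm(1)] b[OF nm(2)] by linarith
    qed
    have ub: "\<bar>u z\<bar> \<le> \<eta>" and vb: "\<bar>v z\<bar> \<le> \<eta>" if z: "z \<in> cball x (2 * d)" for z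
    proof -
      note in2 = lin2[OF nm(1) z] lin2[OF nm(2) z]
      have in3: "lift (s n) z \<in> ball y0 \<rho>" "lift (s m) z \<in> ball y0 \<rho>" using in2 sub by auto
      have "\<bar>gl (lift (s n) z) - gl (lift (s m) z)\<bar> < \<eta> / 3" "\<bar>fl (lift (s n) z) - fl (lift (s m) z)\<bar> < \<eta> / 3"
        using close[OF z] by (intro \<delta>1(2) \<delta>2(2) in2; simp add: \<delta>_def)+
      then show "\<bar>u z\<bar> \<le> \<eta>" "\<bar>v z\<bar> \<le> \<eta>"
        using N(4)[OF nm(1) in3(1)] N(4)[OF nm(2) in3(2)] N(5)[OF nm(1) in3(1)] N(5)[OF nm(2) in3(2)]
        unfolding u_def v_def by linarith+
    qed
    have "cball x (2 * d) \<subseteq> ball x (3 * d)" using d by auto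
    from gradient_estimate[OF lap this d E ub vb \<mu>]
    have est: "\<bar>u (x + \<mu> *\<^sub>R E) - u (x - \<mu> *\<^sub>R E)\<bar> \<le> 2 * (11 * (\<eta> + \<eta> * d\<^sup>2) / d) * \<mu>" by (simp add: mult_ac)
    have ug: "u (x + t *\<^sub>R E) = g n (y + t *\<^sub>R e) - g m (y + t *\<^sub>R e)" if "\<bar>t\<bar> \<le> d" for t
    proof -
      have "y + t *\<^sub>R e \<in> ball y0 \<rho>"
        using y that ne \<rho> dist_triangle[of y0 "y + t *\<^sub>R e" y] by (simp add: d_def dist_norm)
      then have "lift (s n) (lift_pt (y + t *\<^sub>R e)) = y + t *\<^sub>R e" if "n \<ge> N" for n
        using ell_pos[OF N(1)[OF that]] by (intro lift_lift_pt s)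
      then show ?thesis using nm by (simp add: u_def x_def E_def lift_pt_line)
    qed
    show ?thesis using est ug[of \<mu>] ug[of "- \<mu>"] \<mu> unfolding \<eta>eq by simp
  qed
  \<comment> \<open>The second index tends to infinity in the symmetric differences, where pointwise
    convergence suffices; derivatives are taken only afterwards, with the first index fixed.\<close>
  have "\<bar>D - D'\<bar> \<le> \<epsilon>"
    if n: "n \<ge> N" and y: "y \<in> ball y0 (\<rho> / 4)" and D: "((\<lambda>t. g n (y + t *\<^sub>R e)) has_real_derivative D) (at 0)"
      "((\<lambda>t. gl (y + t *\<^sub>R e)) has_real_derivative D') (at 0)" for n y D D'
  proof (rule symmetric_difference_bound_deriv[OF DERIV_diff[OF D] d])
    fix \<mu> assume \<mu>: "0 < \<mu>" "\<mu> < d"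
    have inb: "y + t *\<^sub>R e \<in> ball y0 \<rho>" if "\<bar>t\<bar> \<le> d" for t
      using y that ne \<rho> dist_triangle[of y0 "y + t *\<^sub>R e" y] by (simp add: d_def dist_norm)
    have lim: "(\<lambda>m. g m (y + t *\<^sub>R e)) \<longlonglongrightarrow> gl (y + t *\<^sub>R e)" if "\<bar>t\<bar> \<le> d" for t
      using gu inb[OF that] by (rule tendsto_uniform_limitI)
    have "(\<lambda>m. \<bar>(g n (y + \<mu> *\<^sub>R e) - g m (y + \<mu> *\<^sub>R e)) - (g n (y - \<mu> *\<^sub>R e) - g m (y - \<mu> *\<^sub>R e))\<bar>)
        \<longlonglongrightarrow> \<bar>(g n (y + \<mu> *\<^sub>R e) - gl (y + \<mu> *\<^sub>R e)) - (g n (y - \<mu> *\<^sub>R e) - gl (y - \<mu> *\<^sub>R e))\<bar>"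
      using lim[of \<mu>] lim[of "- \<mu>"] \<mu> by (intro tendsto_intros) auto
    then have "\<bar>(g n (y + \<mu> *\<^sub>R e) - gl (y + \<mu> *\<^sub>R e)) - (g n (y - \<mu> *\<^sub>R e) - gl (y - \<mu> *\<^sub>R e))\<bar> \<le> 2 * \<epsilon> * \<mu>"
      by (rule LIMSEQ_le_const2) (use main[OF n _ y, of _ \<mu>] \<mu> in auto)
    then show "\<bar>g n (y + \<mu> *\<^sub>R e) - gl (y + \<mu> *\<^sub>R e) - (g n (y + (- \<mu>) *\<^sub>R e) - gl (y + (- \<mu>) *\<^sub>R e))\<bar> \<le> 2 * \<epsilon> * \<mu>"
      by simp
  qed
  then show ?thesis unfolding eventually_sequentially by blast
qed

lemma diffq_funpow_line:
  "(diffq h 1 ^^ n) (\<lambda>t. u (x + t *\<^sub>R e)) t = (diffq h e ^^ n) u (x + (t::real) *\<^sub>R e)"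
proof (induction n arbitrary: t)
  case (Suc n)
  have "x + (t + h) *\<^sub>R e = x + t *\<^sub>R e + h *\<^sub>R e" by (simp add: scaleR_left_distrib)
  then have "(diffq h e ^^ n) u (x + (t + h) *\<^sub>R e) = (diffq h e ^^ n) u (x + t *\<^sub>R e + h *\<^sub>R e)" by (rule arg_cong)
  then show ?case
    by (simp only: funpow.simps o_apply diffq_def[of h 1 "(diffq h 1 ^^ n) (\<lambda>t. u (x + t *\<^sub>R e))"]
        diffq_def[of h e "(diffq h e ^^ n) u"] Suc real_scaleR_def mult_1_right)
qed simp

text \<open>Quantitative analyticity along coordinate lines. The differences of order n are at most
  \<open>K * (11 / d) ^ n\<close>, and the factorial in the remainder compensates the factor n + 1
  in \<open>1 / d\<close>. The rate \<open>400 * l / \<rho>\<close> can be made as small as desired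
  by shortening the segment, which is what the separate analyticity bound demands.\<close>

lemma ell_poly_approx:
  assumes ell: "ell s (ball y \<rho>) g (\<lambda>_. 0)" and s: "0 < s"
    and K: "\<And>z. z \<in> ball y \<rho> \<Longrightarrow> \<bar>g z\<bar> \<le> K"
    and e: "e = (1, 0) \<or> e = (0, 1)" and l: "0 < l" "l \<le> \<rho> / 8"
  shows "\<exists>P. degree P \<le> n \<and> (\<forall>t\<in>{-l..l}. \<bar>g (y + t *\<^sub>R e) - poly P t\<bar> \<le> 4 * (K + 1) * (400 * l / \<rho>) ^ n)"
proof -
  have \<rho>: "0 < \<rho>" using l by auto
  have yb: "y \<in> ball y \<rho>" using \<rho> by simp
  have K0: "0 \<le> K" using K[OF yb] by linarith
  have ne: "norm e = 1" using e by (auto simp: norm_Pair)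
  define E where "E = lift_dir e"
  have E: "E \<in> Basis" unfolding E_def by (rule lift_dir_Basis[OF e])
  then have nE: "norm E = 1" by simp
  define x where "x = lift_pt y"
  define u where "u = (\<lambda>z. g (lift s z))"
  have lin: "lift s z \<in> ball y \<rho>" if z: "z \<in> ball x \<rho>" for z
    using dist_lift[OF s, of x z] that lift_lift_pt[OF s ell_pos[OF ell yb]] by (simp add: x_def)
  have lap: "lap_on (ball x \<rho>) u (\<lambda>_. 0)"
    unfolding u_def by (rule lap_on_subset[OF lap_on_lift[OF ell s]]) (use lin in auto)
  \<comment> \<open>n differences cost \<open>3 * n * d\<close> of radius, so this choice keeps half
    of the ball.\<close>
  define d where "d = \<rho> / (6 * real (Suc n))"
  have d: "0 < d" using \<rho> by (simp add: d_def)
  have nd: "3 * real n * d \<le> \<rho> / 2"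
  proof -
    have "3 * real n * d = (\<rho> / 2) * (real n / real (Suc n))" by (simp add: d_def field_simps)
    also have "\<dots> \<le> (\<rho> / 2) * 1" using \<rho> by (intro mult_left_mono) auto
    finally show ?thesis by simp
  qed
  have xin: "x + t *\<^sub>R E \<in> ball x r" if "\<bar>t\<bar> < r" for t r using that nE by (simp add: dist_norm)
  define L where "L = K * (11 / d) ^ n"
  have "\<exists>P. degree P \<le> n \<and> (\<forall>t\<in>{-l..l}. \<bar>u (x + t *\<^sub>R E) - poly P t\<bar> \<le> L * (l - - l) ^ n / fact n + (400 * l / \<rho>) ^ n)"
  proof (rule poly_approx_of_differences[of "-l" l "2 * l"])
    have "continuous_on (ball x \<rho>) u" using lap by (simp add: lap_on_def)
    then show "continuous_on {-l..2 * l} (\<lambda>t. u (x + t *\<^sub>R E))"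
      by (rule continuous_on_compose2) (use l \<rho> in \<open>auto intro!: continuous_intros xin simp: abs_less_iff simp del: mem_ball\<close>)
    show "0 < d" by (rule d)
    fix h t assume h: "0 < h" "h < d" and t: "t \<in> {-l..l}"
    have "x + t *\<^sub>R E \<in> ball x (\<rho> - 3 * real n * d)" using nd l t \<rho> by (intro xin) auto
    then show "\<bar>(diffq h 1 ^^ n) (\<lambda>t. u (x + t *\<^sub>R E)) t\<bar> \<le> L"
      unfolding diffq_funpow_line
      using iterated_difference_bound[OF lap E _ h(1), of K d n] h K lin by (simp add: L_def u_def)
  qed (use l \<rho> in auto)
  then obtain P where P: "degree P \<le> n"
    "\<And>t. t \<in> {-l..l} \<Longrightarrow> \<bar>u (x + t *\<^sub>R E) - poly P t\<bar> \<le> L * (2 * l) ^ n / fact n + (400 * l / \<rho>) ^ n" by auto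
  have "L * (2 * l) ^ n / fact n = K * (132 * l / \<rho>) ^ n * (real (Suc n) ^ n / fact n)"
  proof -
    have "11 / d * (2 * l) = 132 * l / \<rho> * real (Suc n)" using \<rho> by (simp add: d_def field_simps)
    then have "(11 / d) ^ n * (2 * l) ^ n = (132 * l / \<rho>) ^ n * real (Suc n) ^ n"
      by (simp only: power_mult_distrib[symmetric])
    then show ?thesis by (simp add: L_def)
  qed
  also have "\<dots> \<le> K * (132 * l / \<rho>) ^ n * (3 * 3 ^ n)"
  proof (intro mult_left_mono)
    have "real (Suc n) ^ n / fact n \<le> exp (real (Suc n))" by (intro power_div_fact_le_exp) simp
    also have "\<dots> = exp 1 ^ Suc n" by (simp add: exp_of_nat_mult[symmetric] flip: power_Suc del: of_nat_Suc power_Suc)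
    also have "\<dots> \<le> 3 ^ Suc n" by (intro power_mono exp_le) auto
    finally show "real (Suc n) ^ n / fact n \<le> 3 * 3 ^ n" by simp
  qed (use K0 l \<rho> in auto)
  also have "\<dots> = 3 * K * (396 * l / \<rho>) ^ n"
  proof -
    have "(396 * l / \<rho>) ^ n = (3 * (132 * l / \<rho>)) ^ n" by simp
    then show ?thesis unfolding power_mult_distrib[of 3] by simp
  qed
  also have "\<dots> \<le> 3 * K * (400 * l / \<rho>) ^ n"
    using K0 l \<rho> by (intro mult_left_mono power_mono divide_right_mono) auto
  finally have b: "L * (2 * l) ^ n / fact n + (400 * l / \<rho>) ^ n \<le> (3 * K + 1) * (400 * l / \<rho>) ^ n"
    by (simp add: distrib_right)
  also have "\<dots> \<le> 4 * (K + 1) * (400 * l / \<rho>) ^ n"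
    using K0 l \<rho> by (intro mult_right_mono) auto
  finally have b: "L * (2 * l) ^ n / fact n + (400 * l / \<rho>) ^ n \<le> 4 * (K + 1) * (400 * l / \<rho>) ^ n" .
  have "\<bar>g (y + t *\<^sub>R e) - poly P t\<bar> \<le> 4 * (K + 1) * (400 * l / \<rho>) ^ n" if t: "t \<in> {-l..l}" for t
  proof -
    have "y + t *\<^sub>R e \<in> ball y \<rho>" using t l \<rho> ne by (auto simp: dist_norm abs_less_iff)
    then have "lift s (lift_pt (y + t *\<^sub>R e)) = y + t *\<^sub>R e" using ell_pos[OF ell] by (intro lift_lift_pt s)
    then have "u (x + t *\<^sub>R E) = g (y + t *\<^sub>R e)" by (simp add: u_def x_def E_def lift_pt_line)
    then show ?thesis using P(2)[OF t] b by simp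
  qed
  then show ?thesis using P(1) by blast
qed

lemma ell_subset:
  assumes "ell s S g f" "open S'" "S' \<subseteq> S"
  shows "ell s S' g f"
proof -
  obtain g1 g11 g2 g22 where g: "\<forall>R Z. (R, Z) \<in> S \<longrightarrow>
        ((\<lambda>x. g (x, Z)) has_real_derivative g1 (R, Z)) (at R) \<and> ((\<lambda>x. g1 (x, Z)) has_real_derivative g11 (R, Z)) (at R) \<and>
        ((\<lambda>z. g (R, z)) has_real_derivative g2 (R, Z)) (at Z) \<and> ((\<lambda>z. g2 (R, z)) has_real_derivative g22 (R, Z)) (at Z) \<and>
        g11 (R, Z) + 3 * s / (1 + s * R) * g1 (R, Z) + g22 (R, Z) = f (R, Z)"
    and c: "continuous_on S g" and p: "\<forall>R Z. (R, Z) \<in> S \<longrightarrow> 0 < 1 + s * R"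
    using assms(1) unfolding ell_def by (elim conjE exE) blast
  show ?thesis unfolding ell_def
  proof (intro conjI exI allI impI)
    show "continuous_on S' g" using continuous_on_subset[OF c assms(3)] .
    fix R Z assume "(R, Z) \<in> S'"
    then have in_S: "(R, Z) \<in> S" using assms(3) by blast
    show "0 < 1 + s * R" using p in_S by blast
    note g[rule_format, OF in_S]
    then show "((\<lambda>x. g (x, Z)) has_real_derivative g1 (R, Z)) (at R)" "((\<lambda>x. g1 (x, Z)) has_real_derivative g11 (R, Z)) (at R)"
        "((\<lambda>z. g (R, z)) has_real_derivative g2 (R, Z)) (at Z)" "((\<lambda>z. g2 (R, z)) has_real_derivative g22 (R, Z)) (at Z)"
        "g11 (R, Z) + 3 * s / (1 + s * R) * g1 (R, Z) + g22 (R, Z) = f (R, Z)" by blast+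
  qed (rule assms)
qed

lemma powser_term_bound:
  fixes a :: "nat \<Rightarrow> real"
  assumes "summable (\<lambda>k. a k * b ^ k)" "0 \<le> b"
  shows "\<exists>m. \<forall>k. \<bar>a k\<bar> * b ^ k \<le> m"
proof -
  have "Bseq (\<lambda>k. a k * b ^ k)" using summable_LIMSEQ_zero[OF assms(1)] by (intro convergent_imp_Bseq) (auto simp: convergent_def)
  then obtain m where "\<forall>k. norm (a k * b ^ k) \<le> m" unfolding Bseq_def by blast
  then show ?thesis using assms(2) by (intro exI[of _ m]) (simp add: abs_mult)
qed

text \<open>The one-variable bound is used twice. In the Z direction with R fixed it yields, for
  each R, a bound uniform in Z; this is the pointwise hypothesis for the R direction with Z as
  parameter. Each use shrinks the weight, hence the requirement of solutions at arbitrarily small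
  s.\<close>

lemma coeff_uniform_bound:
  fixes \<Psi> :: "nat \<Rightarrow> real \<times> real \<Rightarrow> real"
  assumes \<rho>: "0 < \<rho>"
    and cont: "\<And>k. continuous_on (ball y0 \<rho>) (\<Psi> k)"
    and good: "\<And>\<epsilon>. 0 < \<epsilon> \<Longrightarrow> \<exists>s1 s2 K. 0 < s1 \<and> s1 < s2 \<and> s2 < \<epsilon> \<and> (\<forall>s\<in>{s1..s2}.
        ell s (ball y0 \<rho>) (\<lambda>y. \<Sum>k. \<Psi> k y * s ^ k) (\<lambda>_. 0) \<and>
        (\<forall>y\<in>ball y0 \<rho>. summable (\<lambda>k. \<Psi> k y * s ^ k) \<and> \<bar>\<Sum>k. \<Psi> k y * s ^ k\<bar> \<le> K))"
  shows "\<exists>\<eta> b C. 0 < \<eta> \<and> 0 < b \<and> (\<forall>y\<in>ball y0 \<eta>. \<forall>k. \<bar>\<Psi> k y\<bar> * b ^ k \<le> C)"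
proof -
  obtain R0 Z0 where y0: "y0 = (R0, Z0)" by force
  define r where "r = \<rho> / 2"
  have r: "0 < r" using \<rho> by (simp add: r_def)
  have inb: "(R0 + x, Z0 + z) \<in> ball y0 (\<bar>x\<bar> + \<bar>z\<bar> + e)" if "0 < e" for x z e :: real
  proof -
    have "norm (- x, - z) \<le> \<bar>x\<bar> + \<bar>z\<bar>" using norm_Pair_le[of "- x" "- z"] by simp
    then show ?thesis using that by (simp add: y0 dist_norm)
  qed
  have sub: "ball (R0 + x, Z0 + z) r \<subseteq> ball y0 \<rho>" if "\<bar>x\<bar> + \<bar>z\<bar> < r" for x z
  proof
    fix v assume "v \<in> ball (R0 + x, Z0 + z) r"
    moreover have "(R0 + x, Z0 + z) \<in> ball y0 (\<bar>x\<bar> + \<bar>z\<bar> + (r - \<bar>x\<bar> - \<bar>z\<bar>))" using that by (intro inb) simp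
    ultimately show "v \<in> ball y0 \<rho>" using dist_triangle[of y0 v "(R0 + x, Z0 + z)"] by (simp add: r_def)
  qed
  define G where "G = (\<lambda>s y. \<Sum>k. \<Psi> k y * s ^ k)"
  have approx: "\<exists>P. degree P \<le> n \<and> (\<forall>t\<in>{-l..l}. \<bar>G s ((R0 + x, Z0 + z) + t *\<^sub>R e) - poly P t\<bar> \<le> 4 * (K + 1) * q ^ n)"
    if xz: "\<bar>x\<bar> + \<bar>z\<bar> < r" and "0 < s" and l: "ell s (ball y0 \<rho>) (G s) (\<lambda>_. 0)"
      and K: "\<And>y. y \<in> ball y0 \<rho> \<Longrightarrow> \<bar>G s y\<bar> \<le> K" and e: "e = (1, 0) \<or> e = (0, 1)"
      and lq: "0 < l" "l \<le> r / 8" "400 * l / r \<le> q" for x z s K n e l q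
  proof -
    have 1: "ell s (ball (R0 + x, Z0 + z) r) (G s) (\<lambda>_. 0)" using ell_subset[OF l _ sub[OF xz]] by simp
    have "0 \<le> K" using K[of y0] \<rho> by (smt (verit) centre_in_ball)
    then have "4 * (K + 1) * (400 * l / r) ^ n \<le> 4 * (K + 1) * q ^ n"
      using lq r by (intro mult_left_mono power_mono) auto
    moreover obtain P where "degree P \<le> n" "\<forall>t\<in>{-l..l}. \<bar>G s ((R0 + x, Z0 + z) + t *\<^sub>R e) - poly P t\<bar> \<le> 4 * (K + 1) * (400 * l / r) ^ n"
      using ell_poly_approx[OF 1 \<open>0 < s\<close> K[OF subsetD[OF sub[OF xz]]] e lq(1,2), of n] by blast
    ultimately show ?thesis by (intro exI[of _ P]) (auto intro: order.trans)
  qed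
  have memb: "(R0 + x, Z0 + z) \<in> ball y0 \<rho>" if "\<bar>x\<bar> + \<bar>z\<bar> < r" for x z 
    using sub[OF that] r centre_in_ball[of "(R0 + x, Z0 + z)" r] by blast
  obtain a1 a2 where a: "0 < a1" "a1 < a2" "\<And>y. y \<in> ball y0 \<rho> \<Longrightarrow> summable (\<lambda>k. \<Psi> k y * a2 ^ k)"
    using good[of 1] by force
  have a2: "0 < a2" using a by simp
  have fin0: "\<exists>m. \<forall>k. \<bar>\<Psi> k y\<bar> * a2 ^ k \<le> m" if "y \<in> ball y0 \<rho>" for y
    using powser_term_bound[OF a(3)[OF that]] a2 by simp
  obtain s1 s2 K where s12: "0 < s1" "s1 < s2" "s2 < a2 / 100" and
    sG: "\<And>s. s \<in> {s1..s2} \<Longrightarrow> ell s (ball y0 \<rho>) (G s) (\<lambda>_. 0)" "\<And>s y. s \<in> {s1..s2} \<Longrightarrow> y \<in> ball y0 \<rho> \<Longrightarrow> \<bar>G s y\<bar> \<le> K"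
    using good[of "a2 / 100"] a2 unfolding G_def by force
  have "100 * s2 \<le> a2" using s12 by simp
  from separate_analyticity_uniform_bound[OF s12(1,2) this, where 'p = real] obtain q where q: "0 < q"
    and qb: "\<forall>(\<Psi> :: nat \<Rightarrow> real \<Rightarrow> real \<Rightarrow> real) P a c K. a < c \<longrightarrow>
     (\<forall>k. \<forall>\<pi>\<in>P. continuous_on {a..c} (\<Psi> k \<pi>)) \<longrightarrow>
     (\<forall>x\<in>{a..c}. \<exists>m. \<forall>k. \<forall>\<pi>\<in>P. \<bar>\<Psi> k \<pi> x\<bar> * a2 ^ k \<le> m) \<longrightarrow>
     (\<forall>n. \<forall>\<pi>\<in>P. \<forall>s\<in>{s1..s2}. \<exists>p. degree p \<le> n \<and> (\<forall>x\<in>{a..c}. \<bar>(\<Sum>k. \<Psi> k \<pi> x * s ^ k) - poly p x\<bar> \<le> K * q ^ n)) \<longrightarrow>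
     (\<exists>C. \<forall>k. \<forall>\<pi>\<in>P. \<forall>x\<in>{a..c}. \<bar>\<Psi> k \<pi> x\<bar> * s1 ^ k \<le> C)" by (elim exE conjE)
  \<comment> \<open>The rate \<open>q\<close> depends only on the interval of \<open>s\<close> and
    the weight, so the segment can be shortened afterwards to reach it.\<close>
  define l where "l = min (r / 8) (q * r / 400)"
  have l: "0 < l" "l \<le> r / 8" "400 * l / r \<le> q" using r q by (auto simp: l_def min_def field_simps)
  \<comment> \<open>The parameter set is the single point \<open>x\<close>: at this stage the
    constant may depend on \<open>x\<close>.\<close>
  have fin1: "\<exists>C. \<forall>k. \<forall>\<pi>\<in>{x}. \<forall>z\<in>{-l..l}. \<bar>\<Psi> k (R0 + \<pi>, Z0 + z)\<bar> * s1 ^ k \<le> C" if x: "\<bar>x\<bar> \<le> r / 8" for x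
  proof (rule qb[rule_format, of "-l" l "{x}" "\<lambda>k \<pi> z. \<Psi> k (R0 + \<pi>, Z0 + z)" "4 * (K + 1)"])
    show "- l < l" using l by simp
    have mem: "(R0 + x, Z0 + z) \<in> ball y0 \<rho>" if "z \<in> {-l..l}" for z
      using that x l r by (intro memb) auto
    show "continuous_on {- l..l} (\<lambda>z. \<Psi> k (R0 + \<pi>, Z0 + z))" if "\<pi> \<in> {x}" for k \<pi>
      by (rule continuous_on_compose2[OF cont[of k]]) (use mem that in \<open>auto intro!: continuous_intros simp del: mem_ball\<close>)
    show "\<exists>m. \<forall>k. \<forall>\<pi>\<in>{x}. \<bar>\<Psi> k (R0 + \<pi>, Z0 + z)\<bar> * a2 ^ k \<le> m" if "z \<in> {-l..l}" for z
      using fin0[OF mem[OF that]] by simp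
    fix n \<pi> s assume \<pi>: "\<pi> \<in> {x}" and s: "s \<in> {s1..s2}"
    have "\<exists>P. degree P \<le> n \<and> (\<forall>t\<in>{-l..l}. \<bar>G s ((R0 + x, Z0 + 0) + t *\<^sub>R (0, 1)) - poly P t\<bar> \<le> 4 * (K + 1) * q ^ n)"
      using x r s s12 by (intro approx sG l) auto
    then show "\<exists>p. degree p \<le> n \<and> (\<forall>z\<in>{-l..l}. \<bar>(\<Sum>k. \<Psi> k (R0 + \<pi>, Z0 + z) * s ^ k) - poly p z\<bar> \<le> 4 * (K + 1) * q ^ n)"
      using \<pi> by (simp add: G_def)
  qed
  \<comment> \<open>The previous weight \<open>s1\<close> plays the role of \<open>b\<close> in the
    second use, so the new interval must lie below \<open>s1 / 100\<close>.\<close>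
  obtain t1 t2 K' where t12: "0 < t1" "t1 < t2" "t2 < s1 / 100" and
    tG: "\<And>s. s \<in> {t1..t2} \<Longrightarrow> ell s (ball y0 \<rho>) (G s) (\<lambda>_. 0)" "\<And>s y. s \<in> {t1..t2} \<Longrightarrow> y \<in> ball y0 \<rho> \<Longrightarrow> \<bar>G s y\<bar> \<le> K'"
    using good[of "s1 / 100"] s12 unfolding G_def by force
  have "100 * t2 \<le> s1" using t12 by simp
  from separate_analyticity_uniform_bound[OF t12(1,2) this, where 'p = real] obtain q' where q': "0 < q'"
    and qb': "\<forall>(\<Psi> :: nat \<Rightarrow> real \<Rightarrow> real \<Rightarrow> real) P a c K. a < c \<longrightarrow>
     (\<forall>k. \<forall>\<pi>\<in>P. continuous_on {a..c} (\<Psi> k \<pi>)) \<longrightarrow>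
     (\<forall>x\<in>{a..c}. \<exists>m. \<forall>k. \<forall>\<pi>\<in>P. \<bar>\<Psi> k \<pi> x\<bar> * s1 ^ k \<le> m) \<longrightarrow>
     (\<forall>n. \<forall>\<pi>\<in>P. \<forall>s\<in>{t1..t2}. \<exists>p. degree p \<le> n \<and> (\<forall>x\<in>{a..c}. \<bar>(\<Sum>k. \<Psi> k \<pi> x * s ^ k) - poly p x\<bar> \<le> K * q' ^ n)) \<longrightarrow>
     (\<exists>C. \<forall>k. \<forall>\<pi>\<in>P. \<forall>x\<in>{a..c}. \<bar>\<Psi> k \<pi> x\<bar> * t1 ^ k \<le> C)" by (elim exE conjE)
  define l' where "l' = min (r / 8) (q' * r / 400)"
  have l': "0 < l'" "l' \<le> r / 8" "400 * l' / r \<le> q'" using r q' by (auto simp: l'_def min_def field_simps)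
  \<comment> \<open>Now the whole segment in Z is the parameter set, and the constant becomes
    uniform in both variables.\<close>
  have "\<exists>C. \<forall>k. \<forall>\<pi>\<in>{-l..l}. \<forall>x\<in>{-l'..l'}. \<bar>\<Psi> k (R0 + x, Z0 + \<pi>)\<bar> * t1 ^ k \<le> C"
  proof (rule qb'[rule_format, of "-l'" l' "{-l..l}" "\<lambda>k \<pi> x. \<Psi> k (R0 + x, Z0 + \<pi>)" "4 * (K' + 1)"])
    show "- l' < l'" using l' by simp
    have mem: "(R0 + x, Z0 + z) \<in> ball y0 \<rho>" if "z \<in> {-l..l}" "x \<in> {-l'..l'}" for x z
      using that l l' r by (intro memb) auto
    show "continuous_on {- l'..l'} (\<lambda>x. \<Psi> k (R0 + x, Z0 + \<pi>))" if "\<pi> \<in> {-l..l}" for k \<pi>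
      by (rule continuous_on_compose2[OF cont[of k]]) (use mem that in \<open>auto intro!: continuous_intros simp del: mem_ball\<close>)
    show "\<exists>m. \<forall>k. \<forall>\<pi>\<in>{-l..l}. \<bar>\<Psi> k (R0 + x, Z0 + \<pi>)\<bar> * s1 ^ k \<le> m" if "x \<in> {-l'..l'}" for x
      using fin1[of x] that l' by auto
    fix n \<pi> s assume \<pi>: "\<pi> \<in> {-l..l}" and s: "s \<in> {t1..t2}"
    have "\<exists>P. degree P \<le> n \<and> (\<forall>t\<in>{-l'..l'}. \<bar>G s ((R0 + 0, Z0 + \<pi>) + t *\<^sub>R (1, 0)) - poly P t\<bar> \<le> 4 * (K' + 1) * q' ^ n)"
      using \<pi> l r s t12 by (intro approx tG l') auto
    then show "\<exists>p. degree p \<le> n \<and> (\<forall>x\<in>{-l'..l'}. \<bar>(\<Sum>k. \<Psi> k (R0 + x, Z0 + \<pi>) * s ^ k) - poly p x\<bar> \<le> 4 * (K' + 1) * q' ^ n)"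
      by (simp add: G_def)
  qed
  then obtain C where C: "\<And>k z x. z \<in> {-l..l} \<Longrightarrow> x \<in> {-l'..l'} \<Longrightarrow> \<bar>\<Psi> k (R0 + x, Z0 + z)\<bar> * t1 ^ k \<le> C" by blast
  have "\<bar>\<Psi> k y\<bar> * t1 ^ k \<le> C" if y: "y \<in> ball y0 (min l l')" for y k
  proof -
    obtain R Z where RZ: "y = (R, Z)" by force
    have "norm (R0 - R, Z0 - Z) < min l l'" using y by (simp add: RZ y0 dist_norm)
    then have "\<bar>R - R0\<bar> < min l l'" "\<bar>Z - Z0\<bar> < min l l'"
      using norm_fst_le[of "R0 - R" "Z0 - Z"] norm_snd_le[of "Z0 - Z" "R0 - R"] by auto
    then have "\<bar>\<Psi> k (R0 + (R - R0), Z0 + (Z - Z0))\<bar> * t1 ^ k \<le> C" by (intro C) auto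
    then show ?thesis by (simp add: RZ)
  qed
  then show ?thesis using l l' t12 by (intro exI[of _ "min l l'"] exI[of _ t1] exI[of _ C]) auto
qed

section \<open>Transport equations for the profiles\<close>

lemma C1_Dom_R:
  assumes "C1_Dom a aR aZ" "R \<le> 0"
  shows "((\<lambda>r. a (r, Z)) has_real_derivative aR (R, Z)) (at R within {..0})"
proof -
  have "(a has_derivative (\<lambda>h. aR (R, Z) * fst h + aZ (R, Z) * snd h)) (at (R, Z) within Dom)"
    using assms unfolding C1_Dom_def Dom_def by simp
  then have "(a has_derivative (\<lambda>h. aR (R, Z) * fst h + aZ (R, Z) * snd h)) (at (R, Z) within (\<lambda>r. (r, Z)) ` {..0})"
    by (rule has_derivative_subset) (auto simp: Dom_def)
  moreover have "((\<lambda>r. (r, Z)) has_derivative (\<lambda>r. (r, 0))) (at R within {..0})"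
    by (auto intro!: derivative_eq_intros)
  ultimately show ?thesis
    using has_derivative_in_compose[of "\<lambda>r. (r, Z)" "\<lambda>r. (r, 0)" R "{..0}"]
    by (force simp: has_field_derivative_def mult_commute_abs)
qed

lemma C1_Dom_Z:
  assumes "C1_Dom a aR aZ" "R \<le> 0"
  shows "((\<lambda>z. a (R, z)) has_real_derivative aZ (R, Z)) (at Z)"
proof -
  have "(a has_derivative (\<lambda>h. aR (R, Z) * fst h + aZ (R, Z) * snd h)) (at (R, Z) within Dom)"
    using assms unfolding C1_Dom_def Dom_def by simp
  then have "(a has_derivative (\<lambda>h. aR (R, Z) * fst h + aZ (R, Z) * snd h)) (at (R, Z) within (\<lambda>z. (R, z)) ` UNIV)"
    by (rule has_derivative_subset) (use assms in \<open>auto simp: Dom_def\<close>)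
  moreover have "((\<lambda>z. (R, z)) has_derivative (\<lambda>z. (0, z))) (at Z)"
    by (auto intro!: derivative_eq_intros)
  ultimately show ?thesis
    using has_derivative_in_compose[of "\<lambda>z. (R, z)" "\<lambda>z. (0, z)" Z UNIV]
    by (force simp: has_field_derivative_def mult_commute_abs)
qed

lemma C1_Dom_continuous: "C1_Dom a aR aZ \<Longrightarrow> continuous_on Dom a"
  unfolding C1_Dom_def by (auto intro!: has_derivative_continuous_on)

lemma closed_Dom: "closed Dom"
  unfolding Dom_def by (intro closed_Collect_le continuous_intros)

lemma integral_shift_compact_support:
  fixes p q :: "real \<Rightarrow> real"
  assumes h: "0 \<le> h" and p: "\<And>x. L \<le> \<bar>x\<bar> \<Longrightarrow> p x = 0" and K: "L + h \<le> K" "0 \<le> L"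
    and c: "continuous_on UNIV p" "continuous_on UNIV q"
  shows "integral {-K..K} (\<lambda>x. p x * q (x + h)) = integral {-K..K} (\<lambda>x. p (x - h) * q x)"
proof -
  define f where "f = (\<lambda>x. p (x - h) * q x)"
  have int: "f integrable_on {u..v}" for u v
    unfolding f_def by (intro integrable_continuous_real continuous_intros continuous_on_compose2[OF c(1)] continuous_on_subset[OF c(2)]) auto
  have "integral {-K..K} (\<lambda>x. p x * q (x + h)) = integral {-K + h..K + h} f"
    using integral_shift_real_ivl[of "-K + h" h "K + h" f] by (simp add: f_def)
  moreover have "integral {-K..-K + h} f + integral {-K + h..K + h} f = integral {-K..K + h} f"
    using h K int by (intro Henstock_Kurzweil_Integration.integral_combine) auto
  moreover have "integral {-K..K} f + integral {K..K + h} f = integral {-K..K + h} f"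
    using h K int by (intro Henstock_Kurzweil_Integration.integral_combine) auto
  moreover have "integral {-K..-K + h} f = integral {-K..-K + h} (\<lambda>_. 0)"
    by (rule integral_cong) (use h K in \<open>auto simp: f_def intro!: p\<close>)
  moreover have "integral {K..K + h} f = integral {K..K + h} (\<lambda>_. 0)"
    by (rule integral_cong) (use h K in \<open>auto simp: f_def intro!: p\<close>)
  ultimately show ?thesis by (simp add: f_def)
qed

text \<open>Integration by parts in \<open>R\<close> shows that \<open>h \<mapsto> \<integral> a\<^sub>R b(\<cdot> + h e\<^sub>Z) + a(\<cdot> - h e\<^sub>Z) b\<^sub>R\<close> is constant; its derivative at
  \<open>h = 0\<close> is the claim. Neither function needs second derivatives.\<close>

lemma jacobian_integral_zero:
  assumes a: "C1_Dom a aR aZ" and b: "C1_Dom b bR bZ"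
    and supp: "\<And>y. y \<in> Dom \<Longrightarrow> L \<le> norm y \<Longrightarrow> a y = 0" and L: "0 < L"
    and bdry: "\<And>Z. bZ (0, Z) = 0"
  shows "integral (cbox (-L, -(L + 1)) (0, L + 1)) (\<lambda>y. aR y * bZ y - aZ y * bR y) = 0"
proof -
  \<comment> \<open>The margin 1 keeps the support of \<open>a\<close> inside the box under the
    shifts by at most 1/2 used below.\<close>
  define K where "K = L + 1"
  define Q where "Q = cbox (-L, -K) (0::real, K)"
  have QD: "Q \<subseteq> Dom" by (auto simp: Q_def Dom_def cbox_Pair_eq)
  note ca = C1_Dom_continuous[OF a] and cb = C1_Dom_continuous[OF b]
  have cc: "continuous_on Dom aR" "continuous_on Dom aZ" "continuous_on Dom bR" "continuous_on Dom bZ"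
    using a b by (auto simp: C1_Dom_def)
  define U where "U = {0..1/2::real}"
  have cF: "continuous_on (U \<times> Q) (\<lambda>(h, y). k1 y * k2 (y + (0, c * h)))"
    if "continuous_on Dom k1" "continuous_on Dom k2" for k1 k2 :: "real \<times> real \<Rightarrow> real" and c :: real
  proof -
    have "continuous_on (U \<times> Q) (\<lambda>z. k1 (snd z))" "continuous_on (U \<times> Q) (\<lambda>z. k2 (snd z + (0, c * fst z)))"
      by (rule continuous_on_compose2[OF that(1)] continuous_on_compose2[OF that(2)];
          use QD in \<open>force intro!: continuous_intros simp: Dom_def\<close>)+
    then show ?thesis unfolding case_prod_unfold by (intro continuous_intros)
  qed
  have cF1: "continuous_on Q (\<lambda>y. k1 y * k2 (y + (0, h)))"
    if "continuous_on Dom k1" "continuous_on Dom k2" for k1 k2 :: "real \<times> real \<Rightarrow> real" and h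
  proof -
    have "continuous_on Q k1" "continuous_on Q (\<lambda>z. k2 (z + (0, h)))"
      by (rule continuous_on_subset[OF that(1) QD]) (rule continuous_on_compose2[OF that(2)],
          use QD in \<open>force intro!: continuous_intros simp: Dom_def\<close>, use QD in \<open>force simp: Dom_def\<close>)
    then show ?thesis by (intro continuous_intros)
  qed
  have lin: "((\<lambda>h. k (y + (0, c * h))) has_real_derivative c * kZ (y + (0, c * h))) (at h within U)"
    if "C1_Dom k kR kZ" "y \<in> Q" for k kR kZ y h c
  proof -
    obtain R Z where y: "y = (R, Z)" by force
    have R: "R \<le> 0" using that(2) QD by (auto simp: y Dom_def)
    have "((\<lambda>h. k (R, Z + c * h)) has_real_derivative kZ (R, Z + c * h) * c) (at h within U)"
      by (rule DERIV_chain2[OF C1_Dom_Z[OF that(1) R]]) (auto intro!: derivative_eq_intros)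
    then show ?thesis by (simp add: y mult.commute)
  qed
  have D1: "((\<lambda>h. integral Q (\<lambda>y. aR y * b (y + (0, 1 * h)))) has_real_derivative integral Q (\<lambda>y. aR y * (1 * bZ (y + (0, 1 * 0))))) (at 0 within U)"
    unfolding Q_def
  proof (rule leibniz_rule_field_derivative[where U = U and f = "\<lambda>h y. aR y * b (y + (0, 1 * h))" and fx = "\<lambda>h y. aR y * (1 * bZ (y + (0, 1 * h)))"])
    show "continuous_on (U \<times> cbox (-L, -K) (0, K)) (\<lambda>(h, y). aR y * (1 * bZ (y + (0, 1 * h))))"
      using cF[OF cc(1,4), of 1] by (simp add: Q_def)
  qed (use lin[OF b, of _ 1, unfolded Q_def] cF1[OF cc(1) cb, unfolded Q_def] in
      \<open>auto intro!: DERIV_cmult integrable_continuous simp: U_def\<close>)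
  have D2: "((\<lambda>h. integral Q (\<lambda>y. bR y * a (y + (0, -1 * h)))) has_real_derivative integral Q (\<lambda>y. bR y * (-1 * aZ (y + (0, -1 * 0))))) (at 0 within U)"
    unfolding Q_def
  proof (rule leibniz_rule_field_derivative[where U = U and f = "\<lambda>h y. bR y * a (y + (0, -1 * h))" and fx = "\<lambda>h y. bR y * (-1 * aZ (y + (0, -1 * h)))"])
    show "continuous_on (U \<times> cbox (-L, -K) (0, K)) (\<lambda>(h, y). bR y * (-1 * aZ (y + (0, -1 * h))))"
      using continuous_on_minus[OF cF[OF cc(3,2), of "-1"]] by (simp add: Q_def case_prod_unfold)
    show "((\<lambda>h. bR y * a (y + (0, -1 * h))) has_real_derivative bR y * (-1 * aZ (y + (0, -1 * h)))) (at h within U)"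
      if "y \<in> cbox (-L, -K) (0, K)" for h y
      using that by (intro DERIV_cmult lin[OF a]) (simp add: Q_def)
    show "(\<lambda>y. bR y * a (y + (0, -1 * h))) integrable_on cbox (-L, -K) (0, K)" for h
      using cF1[OF cc(3) ca, of "-1 * h"] by (intro integrable_continuous) (simp add: Q_def)
  qed (auto simp: U_def)
  \<comment> \<open>The boundary term at R = 0 is the integral of
    \<open>a (0, Z) * b (0, Z + h)\<close>. Since \<open>b\<close> is constant on the boundary, it
    does not depend on \<open>h\<close>.\<close>
  define c0 where "c0 = integral {-K..K} (\<lambda>Z. a (0, Z) * b (0, 0))"
  have b0: "b (0, Z) = b (0, 0)" for Z
    using DERIV_const_ratio_const[of Z 0 "\<lambda>z. b (0, z)" 0] C1_Dom_Z[OF b, of 0] bdry by (cases "Z = 0") auto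
  have sum: "integral Q (\<lambda>y. aR y * b (y + (0, 1 * h))) + integral Q (\<lambda>y. bR y * a (y + (0, -1 * h))) = c0"
    if h: "h \<in> U" for h
  proof -
    \<comment> \<open>Translating in Z moves the shift from \<open>a\<close> to \<open>bR\<close>;
      the two integrands then combine to the R-derivative of \<open>a\<close> times the shifted
      \<open>b\<close>.\<close>
    have 1: "integral Q (\<lambda>y. bR y * a (y + (0, -1 * h))) = integral Q (\<lambda>y. a y * bR (y + (0, h)))"
    proof -
      have "integral Q (\<lambda>y. bR y * a (y + (0, - h))) = integral {-L..0} (\<lambda>R. integral {-K..K} (\<lambda>Z. bR (R, Z) * a ((R, Z) + (0, -h))))"
        unfolding Q_def using integral_integrable_2dim(1) integral_prod_continuous cF1[OF cc(3) ca, unfolded Q_def]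
        by (subst integral_prod_continuous) auto
      also have "\<dots> = integral {-L..0} (\<lambda>R. integral {-K..K} (\<lambda>Z. a (R, Z) * bR ((R, Z) + (0, h))))"
      proof (rule integral_cong)
        fix R assume R: "R \<in> {-L..0}"
        have "integral {-K..K} (\<lambda>x. a (R, x) * bR (R, x + h)) = integral {-K..K} (\<lambda>x. a (R, x - h) * bR (R, x))"
        proof (rule integral_shift_compact_support)
          show "a (R, x) = 0" if "L \<le> \<bar>x\<bar>" for x
            using supp[of "(R, x)"] R that norm_snd_le[of x R] by (auto simp: Dom_def)
          show "continuous_on UNIV (\<lambda>x. a (R, x))" "continuous_on UNIV (\<lambda>x. bR (R, x))"
            by (rule continuous_on_compose2[OF ca] continuous_on_compose2[OF cc(3)]; use R in \<open>force intro!: continuous_intros simp: Dom_def\<close>)+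
        qed (use h L in \<open>auto simp: U_def K_def\<close>)
        then show "integral {-K..K} (\<lambda>Z. bR (R, Z) * a ((R, Z) + (0, -h))) = integral {-K..K} (\<lambda>Z. a (R, Z) * bR ((R, Z) + (0, h)))"
          by (simp add: mult.commute)
      qed
      also have "\<dots> = integral Q (\<lambda>y. a y * bR (y + (0, h)))"
        unfolding Q_def using cF1[OF ca cc(3), unfolded Q_def]
        by (subst integral_prod_continuous) auto
      finally show ?thesis by simp
    qed
    have i1: "(\<lambda>y. aR y * b (y + (0, h))) integrable_on Q" "(\<lambda>y. a y * bR (y + (0, h))) integrable_on Q"
      unfolding Q_def by (intro integrable_continuous cF1[OF cc(1) cb, unfolded Q_def] cF1[OF ca cc(3), unfolded Q_def])+
    have "integral Q (\<lambda>y. aR y * b (y + (0, 1 * h))) + integral Q (\<lambda>y. bR y * a (y + (0, -1 * h)))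
        = integral Q (\<lambda>y. aR y * b (y + (0, h)) + a y * bR (y + (0, h)))"
      unfolding 1 using integral_add[OF i1] by simp
    also have "\<dots> = integral {-K..K} (\<lambda>Z. integral {-L..0} (\<lambda>R. aR (R, Z) * b (R, Z + h) + a (R, Z) * bR (R, Z + h)))"
    proof -
      have c: "continuous_on (cbox (-L, -K) (0, K)) (\<lambda>y. aR y * b (y + (0, h)) + a y * bR (y + (0, h)))"
        by (intro continuous_on_add cF1[OF cc(1) cb, unfolded Q_def] cF1[OF ca cc(3), unfolded Q_def])
      have "continuous_on (cbox (-L, -K) (0, K)) (\<lambda>(R, Z). aR (R, Z) * b ((R, Z) + (0, h)) + a (R, Z) * bR ((R, Z) + (0, h)))"
        by (rule continuous_on_eq[OF c]) auto
      from integral_swap_continuous[OF this] integral_prod_continuous[OF c]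
      show ?thesis by (simp add: Q_def)
    qed
    also have "\<dots> = c0" unfolding c0_def
    proof (rule integral_cong)
      fix Z assume "Z \<in> {-K..K}"
      have "((\<lambda>R. aR (R, Z) * b (R, Z + h) + a (R, Z) * bR (R, Z + h)) has_integral
          (a (0, Z) * b (0, Z + h) - a (-L, Z) * b (-L, Z + h))) {-L..0}"
      proof (rule fundamental_theorem_of_calculus)
        fix R assume R: "R \<in> {-L..0}"
        have "((\<lambda>r. a (r, Z) * b (r, Z + h)) has_real_derivative (aR (R, Z) * b (R, Z + h) + bR (R, Z + h) * a (R, Z))) (at R within {..0})"
          using R by (intro DERIV_mult C1_Dom_R[OF a] C1_Dom_R[OF b]) auto
        then have "((\<lambda>r. a (r, Z) * b (r, Z + h)) has_real_derivative (aR (R, Z) * b (R, Z + h) + a (R, Z) * bR (R, Z + h))) (at R within {-L..0})"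
          by (rule DERIV_subset[THEN DERIV_cong]) auto
        then show "((\<lambda>r. a (r, Z) * b (r, Z + h)) has_vector_derivative (aR (R, Z) * b (R, Z + h) + a (R, Z) * bR (R, Z + h))) (at R within {-L..0})"
          by (simp add: has_real_derivative_iff_has_vector_derivative)
      qed (use L in auto)
      moreover have "a (-L, Z) = 0" using supp[of "(-L, Z)"] L norm_fst_le[of "-L" Z] by (auto simp: Dom_def)
      ultimately show "integral {-L..0} (\<lambda>R. aR (R, Z) * b (R, Z + h) + a (R, Z) * bR (R, Z + h)) = a (0, Z) * b (0, 0)"
        using b0[of "Z + h"] by (simp add: integral_unique)
    qed
    finally show ?thesis .
  qed
  have dc: "((\<lambda>_. c0) has_real_derivative integral Q (\<lambda>y. aR y * (1 * bZ (y + (0, 1 * 0)))) + integral Q (\<lambda>y. bR y * (-1 * aZ (y + (0, -1 * 0))))) (at 0 within U)"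
    by (rule has_field_derivative_transform_within[OF DERIV_add[OF D1 D2], of 1]) (use sum in \<open>auto simp: U_def\<close>)
  have "integral Q (\<lambda>y. aR y * (1 * bZ (y + (0, 1 * 0)))) + integral Q (\<lambda>y. bR y * (-1 * aZ (y + (0, -1 * 0)))) = 0"
  proof -
    have "at 0 within U \<noteq> bot" unfolding U_def by (simp add: at_within_Icc_at_right)
    from vector_derivative_unique_within[OF this dc[unfolded has_real_derivative_iff_has_vector_derivative]
        has_vector_derivative_const] show ?thesis .
  qed
  then have *: "integral Q (\<lambda>y. aR y * bZ y) + integral Q (\<lambda>y. - (aZ y * bR y)) = 0"
    by (simp add: mult.commute zero_prod_def[symmetric])
  have i: "(\<lambda>y. aR y * bZ y) integrable_on Q" "(\<lambda>y. - (aZ y * bR y)) integrable_on Q"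
    using cF1[OF cc(1,4), of 0] continuous_on_minus[OF cF1[OF cc(2,3), of 0]]
    by (auto simp: Q_def zero_prod_def[symmetric] intro!: integrable_continuous)
  show ?thesis using * integral_add[OF i] by (simp add: Q_def K_def)
qed


lemma attains_max_decaying:
  fixes h :: "'a::euclidean_space \<Rightarrow> real"
  assumes S: "closed S" and c: "continuous_on S h" and lim: "(h \<longlongrightarrow> 0) (inf at_infinity (principal S))"
    and y: "y \<in> S" "0 < h y"
  obtains x where "x \<in> S" "\<And>z. z \<in> S \<Longrightarrow> h z \<le> h x"
proof -
  have "\<forall>\<^sub>F z in inf at_infinity (principal S). h z < h y" by (rule order_tendstoD(2)[OF lim y(2)])
  then obtain B where B: "\<And>z. z \<in> S \<Longrightarrow> B \<le> norm z \<Longrightarrow> h z < h y"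
    unfolding eventually_inf_principal eventually_at_infinity by blast
  define C where "C = S \<inter> cball 0 (max B (norm y))"
  have "compact C" unfolding C_def using S by (simp add: closed_Int_compact)
  moreover have "y \<in> C" using y by (simp add: C_def)
  moreover have "continuous_on C h" using c by (rule continuous_on_subset) (simp add: C_def)
  ultimately obtain x where x: "x \<in> C" "\<And>z. z \<in> C \<Longrightarrow> h z \<le> h x" using continuous_attains_sup[of C h] by blast
  have mx: "h z \<le> h x" if "z \<in> S" for z
  proof (cases "z \<in> C")
    case False
    then have "B \<le> norm z" using that by (auto simp: C_def)
    then show ?thesis using B[OF that] x(2)[OF \<open>y \<in> C\<close>] by linarith
  qed (rule x(2))
  show thesis by (rule that[of x]) (use x(1) mx in \<open>auto simp: C_def\<close>)
qed

lemma directional_derivative_at_max: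
  fixes h :: "real \<times> real \<Rightarrow> real"
  assumes h: "(h has_derivative A) (at y within Dom)" and d: "0 < d"
    and V: "\<And>t. \<bar>t\<bar> < d \<Longrightarrow> y + t *\<^sub>R V \<in> Dom \<and> h (y + t *\<^sub>R V) \<le> h y"
  shows "A V = 0"
proof -
  define I where "I = {-d<..<d}"
  have "(h has_derivative A) (at (y + 0 *\<^sub>R V) within (\<lambda>t. y + t *\<^sub>R V) ` I)"
    using has_derivative_subset[OF h, of "(\<lambda>t. y + t *\<^sub>R V) ` I"] V by (force simp: I_def)
  moreover have "((\<lambda>t. y + t *\<^sub>R V) has_derivative (\<lambda>t. t *\<^sub>R V)) (at 0 within I)"
    by (auto intro!: derivative_eq_intros)
  ultimately have "((\<lambda>t. h (y + t *\<^sub>R V)) has_derivative (\<lambda>t. A (t *\<^sub>R V))) (at 0 within I)"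
    using has_derivative_in_compose[of "\<lambda>t. y + t *\<^sub>R V" "\<lambda>t. t *\<^sub>R V" 0 I h A] by blast
  moreover have "at 0 within I = at (0::real)" using d by (intro at_within_open) (auto simp: I_def)
  moreover have "A (t *\<^sub>R V) = A V * t" for t
    using linear_simps(5)[OF has_derivative_bounded_linear[OF h], of t V] by simp
  ultimately have D: "((\<lambda>t. h (y + t *\<^sub>R V)) has_real_derivative A V) (at 0)"
    by (simp add: has_field_derivative_def mult_commute_abs)
  show ?thesis by (rule DERIV_local_max[OF D d]) (use V in auto)
qed

text \<open>A maximum over the closed half plane may sit on R = 0. Directions tangential there can
  be followed both ways, so the derivative along them vanishes also at boundary maxima.\<close>

lemma Dom_feasible_direction:
  assumes "y \<in> Dom" "fst y = 0 \<Longrightarrow> fst V = 0"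
  shows "\<exists>d>0. \<forall>t. \<bar>t\<bar> < d \<longrightarrow> y + t *\<^sub>R V \<in> Dom"
proof (cases "fst y = 0")
  case True
  then show ?thesis using assms by (intro exI[of _ 1]) (auto simp: Dom_def)
next
  case False
  then have neg: "fst y < 0" using assms by (auto simp: Dom_def)
  define d where "d = - fst y / (\<bar>fst V\<bar> + 1)"
  have "0 < d" unfolding d_def using neg by (intro divide_pos_pos) auto
  moreover have "y + t *\<^sub>R V \<in> Dom" if t: "\<bar>t\<bar> < d" for t
  proof -
    have "t * fst V \<le> \<bar>t\<bar> * \<bar>fst V\<bar>" by (metis abs_ge_self abs_mult)
    also have "\<dots> \<le> d * (\<bar>fst V\<bar> + 1)" using t by (intro mult_mono) auto
    also have "\<dots> = - fst y" by (simp add: d_def add_nonneg_eq_0_iff)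
    finally show ?thesis by (simp add: Dom_def)
  qed
  ultimately show ?thesis by blast
qed

text \<open>For \<open>\<alpha> \<noteq> 0\<close> the maximum principle applies to \<open>f\<^sup>2\<close>. In the resonant case \<open>\<alpha> = 0\<close> it is applied to
  \<open>f\<^sup>2 (1 - M\<^sup>2 / \<bar>Y\<bar>\<^sup>2)\<close> far away, where the velocity points outwards, and then the equation is integrated against \<open>f\<close>.\<close>

lemma transport_profile_zero:
  fixes \<alpha> \<gamma> :: real
  assumes \<gamma>: "0 < \<gamma>" and f: "C1_Dom f fR fZ" and g: "C1_Dom g gR gZ"
    and flim: "(f \<longlongrightarrow> 0) (inf at_infinity (principal Dom))"
    and glim: "(\<lambda>Y. norm (gR Y, gZ Y)) \<in> o[inf at_infinity (principal Dom)](\<lambda>Y. norm Y)"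
    and bdry: "\<And>Z. gZ (0, Z) = 0"
    and eq: "\<And>Y. Y \<in> Dom \<Longrightarrow> \<alpha> * f Y + \<gamma> * (fst Y * fR Y + snd Y * fZ Y) - gZ Y * fR Y + gR Y * fZ Y = 0"
    and Y: "Y \<in> Dom"
  shows "f Y = 0"
proof -
  note cf = C1_Dom_continuous[OF f]
  define V where "V = (\<lambda>Y. (\<gamma> * fst Y - gZ Y, \<gamma> * snd Y + gR Y))"
  have V0: "fst (V y) = 0" if "fst y = 0" for y
    using bdry[of "snd y"] that by (cases y) (simp add: V_def)
  have Df: "(f has_derivative (\<lambda>h. fR y * fst h + fZ y * snd h)) (at y within Dom)" if "y \<in> Dom" for y
    using f that by (simp add: C1_Dom_def)
  have fV: "fR y * fst (V y) + fZ y * snd (V y) = - \<alpha> * f y" if "y \<in> Dom" for y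
    using eq[OF that] by (simp add: V_def algebra_simps)
  have fsq: "((\<lambda>y. (f y)\<^sup>2) \<longlongrightarrow> 0) (inf at_infinity (principal Dom))"
    using tendsto_power[OF flim, of 2] by simp
  show ?thesis
  proof (cases "\<alpha> = 0")
    case False
    show ?thesis
    proof (rule ccontr)
      assume "f Y \<noteq> 0"
      then have "0 < (f Y)\<^sup>2" by simp
      from attains_max_decaying[OF closed_Dom _ fsq Y this] obtain y where
        y: "y \<in> Dom" "\<And>z. z \<in> Dom \<Longrightarrow> (f z)\<^sup>2 \<le> (f y)\<^sup>2" using cf by (blast intro: continuous_intros)
      obtain d where d: "0 < d" "\<And>t. \<bar>t\<bar> < d \<Longrightarrow> y + t *\<^sub>R V y \<in> Dom"
        using Dom_feasible_direction[OF y(1) V0] by blast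
      have "((\<lambda>y. (f y)\<^sup>2) has_derivative (\<lambda>h. 2 * f y * (fR y * fst h + fZ y * snd h))) (at y within Dom)"
        using Df[OF y(1)] by (auto intro!: derivative_eq_intros)
      from directional_derivative_at_max[OF this d(1)] have "2 * f y * (fR y * fst (V y) + fZ y * snd (V y)) = 0"
        using d(2) y(2) by blast
      \<comment> \<open>The equation reads V . grad f = -\<alpha> f, so stationarity of
        \<open>f\<^sup>2\<close> along V gives \<alpha> f^2 = 0 at the maximum.\<close>
      then have "f y = 0" using fV[OF y(1)] False by simp
      then show False using y(2)[OF Y] \<open>f Y \<noteq> 0\<close> by simp
    qed
  next
    case True
    obtain M where M: "1 \<le> M" and far: "\<And>y. y \<in> Dom \<Longrightarrow> M \<le> norm y \<Longrightarrow> norm (gR y, gZ y) \<le> \<gamma> / 2 * norm y"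
    proof -
      have "\<forall>\<^sub>F y in inf at_infinity (principal Dom). norm (norm (gR y, gZ y)) \<le> \<gamma> / 2 * norm (norm y)"
        using landau_o.smallD[OF glim, of "\<gamma> / 2"] \<gamma> by simp
      then obtain B where "\<And>y. y \<in> Dom \<Longrightarrow> B \<le> norm y \<Longrightarrow> norm (gR y, gZ y) \<le> \<gamma> / 2 * norm y"
        unfolding eventually_inf_principal eventually_at_infinity by auto
      then show thesis using that[of "max 1 B"] by auto
    qed
    have outw: "0 < y \<bullet> V y" if y: "y \<in> Dom" "M \<le> norm y" for y
    proof -
      have "y \<bullet> V y = \<gamma> * (norm y)\<^sup>2 + y \<bullet> (- gZ y, gR y)"
        by (cases y) (simp add: V_def power2_norm_eq_inner algebra_simps)
      moreover have "\<bar>y \<bullet> (- gZ y, gR y)\<bar> \<le> norm y * norm (gR y, gZ y)"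
        using Cauchy_Schwarz_ineq2[of y "(- gZ y, gR y)"] by (simp add: norm_Pair add.commute)
      moreover have "norm y * norm (gR y, gZ y) \<le> norm y * (\<gamma> / 2 * norm y)"
        using far[OF y] by (intro mult_left_mono) auto
      moreover have "0 < \<gamma> / 2 * (norm y)\<^sup>2" using \<gamma> y M by (intro mult_pos_pos) auto
      ultimately show ?thesis by (simp add: power2_eq_square algebra_simps)
    qed
    have far0: "f y1 = 0" if y1: "y1 \<in> Dom" "M < norm y1" for y1
    proof (rule ccontr)
      assume nz: "f y1 \<noteq> 0"
      define S where "S = Dom \<inter> {y. M \<le> norm y}"
      \<comment> \<open>The factor vanishes on the circle of radius \<open>M\<close>, which keeps
        the maximum off it, and increases strictly outwards. With \<alpha> = 0 the derivative of
        \<open>h\<close> along V is \<open>f\<^sup>2\<close> times the derivative of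
        \<open>k\<close>, positive because V points outwards.\<close>
      define k where "k = (\<lambda>y :: real \<times> real. 1 - M\<^sup>2 / (y \<bullet> y))"
      define h where "h = (\<lambda>y. (f y)\<^sup>2 * k y)"
      have cS: "closed S" unfolding S_def by (intro closed_Int closed_Dom closed_Collect_le continuous_intros)
      have ynz: "y \<bullet> y \<noteq> 0" if "y \<in> S" for y using that M by (auto simp: S_def)
      have kb: "0 \<le> k y" "k y \<le> 1" if "y \<in> S" for y
      proof -
        have "M\<^sup>2 \<le> y \<bullet> y" using that M unfolding power2_norm_eq_inner[symmetric] by (intro power_mono) (auto simp: S_def)
        then show "0 \<le> k y" "k y \<le> 1" using ynz[OF that] by (auto simp: k_def divide_le_eq_1)
      qed
      have ch: "continuous_on S h" unfolding h_def k_def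
        using ynz by (intro continuous_intros continuous_on_subset[OF cf]) (auto simp: S_def)
      have hlim: "(h \<longlongrightarrow> 0) (inf at_infinity (principal S))"
      proof (rule tendsto_0_le[where K = 1])
        show "((\<lambda>y. (f y)\<^sup>2) \<longlongrightarrow> 0) (inf at_infinity (principal S))"
          by (rule tendsto_mono[OF inf_mono[OF order_refl] fsq]) (auto simp: S_def)
        have "\<bar>h y\<bar> \<le> (f y)\<^sup>2" if "y \<in> S" for y
          using kb[OF that] mult_left_mono[of "k y" 1 "(f y)\<^sup>2"] by (simp add: h_def abs_mult)
        then show "\<forall>\<^sub>F y in inf at_infinity (principal S). norm (h y) \<le> norm ((f y)\<^sup>2) * 1"
          unfolding eventually_inf_principal by simp
      qed
      have kpos: "0 < k y" if "M < norm y" for y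
      proof -
        have "M\<^sup>2 < y \<bullet> y" using that M unfolding power2_norm_eq_inner[symmetric] by (intro power_strict_mono) auto
        then show ?thesis using M by (simp add: k_def divide_less_eq_1)
      qed
      have "0 < h y1" using nz kpos[OF y1(2)] by (simp add: h_def)
      moreover have "y1 \<in> S" using y1 by (simp add: S_def)
      ultimately obtain y where y: "y \<in> S" "\<And>z. z \<in> S \<Longrightarrow> h z \<le> h y" and hy: "0 < h y"
        using attains_max_decaying[OF cS ch hlim] by (metis less_le_trans)
      have yM: "M < norm y"
      proof (rule ccontr)
        assume "\<not> M < norm y"
        then have "y \<bullet> y = M\<^sup>2" using y(1) by (simp add: S_def flip: power2_norm_eq_inner)
        then have "h y = 0" using M by (simp add: h_def k_def)
        then show False using hy by simp
      qed
      have yD: "y \<in> Dom" using y(1) by (simp add: S_def)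
      obtain d0 where d0: "0 < d0" "\<And>t. \<bar>t\<bar> < d0 \<Longrightarrow> y + t *\<^sub>R V y \<in> Dom"
        using Dom_feasible_direction[OF yD V0] by blast
      define d where "d = min d0 ((norm y - M) / (norm (V y) + 1))"
      have d: "0 < d" using d0 yM by (simp add: d_def add_nonneg_pos)
      have inS: "y + t *\<^sub>R V y \<in> S" if t: "\<bar>t\<bar> < d" for t
      proof -
        have "\<bar>t\<bar> * norm (V y) \<le> (norm y - M) / (norm (V y) + 1) * (norm (V y) + 1)"
          using t by (intro mult_mono) (auto simp: d_def)
        also have "\<dots> = norm y - M" by (simp add: add_nonneg_eq_0_iff)
        finally have "M \<le> norm (y + t *\<^sub>R V y)" using norm_diff_ineq[of y "t *\<^sub>R V y"] by simp
        then show ?thesis using d0(2) t by (simp add: S_def d_def)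
      qed
      have Dh: "(h has_derivative (\<lambda>v. (f y)\<^sup>2 * (2 * M\<^sup>2 * (y \<bullet> v) / (y \<bullet> y)\<^sup>2) + 2 * f y * (fR y * fst v + fZ y * snd v) * k y)) (at y within Dom)"
      proof -
        have D1: "((\<lambda>y. y \<bullet> y) has_derivative (\<lambda>v. 2 * (y \<bullet> v))) (at y within Dom)"
          by (auto intro!: derivative_eq_intros simp: inner_commute)
        have "(k has_derivative (\<lambda>v. 2 * M\<^sup>2 * (y \<bullet> v) / (y \<bullet> y)\<^sup>2)) (at y within Dom)"
          unfolding k_def
          by (rule has_derivative_eq_rhs[OF has_derivative_diff[OF has_derivative_const
              has_derivative_divide[OF has_derivative_const D1 ynz[OF y(1)]]]])
             (auto simp: fun_eq_iff power2_eq_square divide_inverse)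
        moreover have "((\<lambda>y. (f y)\<^sup>2) has_derivative (\<lambda>h. 2 * f y * (fR y * fst h + fZ y * snd h))) (at y within Dom)"
          using Df[OF yD] by (auto intro!: derivative_eq_intros)
        ultimately show ?thesis unfolding h_def
          using has_derivative_mult[of "\<lambda>y. (f y)\<^sup>2" _ y Dom k] by blast
      qed
      have "(f y)\<^sup>2 * (2 * M\<^sup>2 * (y \<bullet> V y) / (y \<bullet> y)\<^sup>2) + 2 * f y * (fR y * fst (V y) + fZ y * snd (V y)) * k y = 0"
        by (rule directional_derivative_at_max[OF Dh d]) (use inS y(2) in \<open>auto simp: S_def\<close>)
      moreover have "f y \<noteq> 0" using hy by (auto simp: h_def)
      moreover have "0 < y \<bullet> V y" using outw yD yM by auto
      ultimately show False using fV[OF yD] True M ynz[OF y(1)] by simp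
    qed
    \<comment> \<open>\<open>f\<close> now vanishes outside a disc, so \<open>f\<^sup>2\<close> has
      compact support and can be integrated by parts.\<close>
    define a aR aZ where "a = (\<lambda>y. (f y)\<^sup>2)" and "aR = (\<lambda>y. 2 * f y * fR y)" and "aZ = (\<lambda>y. 2 * f y * fZ y)"
    have a: "C1_Dom a aR aZ"
      using f cf unfolding C1_Dom_def a_def aR_def aZ_def
      by (auto intro!: continuous_intros derivative_eq_intros simp: algebra_simps)
    define L where "L = max (M + 1) (norm Y)"
    have L: "0 < L" "M < L" "norm Y \<le> L" using M by (auto simp: L_def)
    have supp: "a y = 0" if "y \<in> Dom" "L \<le> norm y" for y
      using far0[OF that(1)] that L by (simp add: a_def)
    define Q where "Q = cbox (-L, -(L + 1)) (0::real, L + 1)"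
    have QD: "Q \<subseteq> Dom" by (auto simp: Q_def Dom_def cbox_Pair_eq)
    have ca: "continuous_on Q a" "continuous_on Q aR" "continuous_on Q aZ" "continuous_on Q gR" "continuous_on Q gZ"
      using C1_Dom_continuous[OF a] a g by (auto simp: C1_Dom_def intro: continuous_on_subset[OF _ QD])
    have J: "integral Q (\<lambda>y. aR y * gZ y - aZ y * gR y) = 0"
      unfolding Q_def by (rule jacobian_integral_zero[OF a g supp L(1) bdry])
    have JR: "integral Q (\<lambda>y. fst y * aR y + a y) = 0"
    proof -
      have c: "continuous_on (cbox (-L, -(L + 1)) (0, L + 1)) (\<lambda>y. fst y * aR y + a y)"
        using ca by (auto simp: Q_def intro!: continuous_intros)
      then have c': "continuous_on (cbox (-L, -(L + 1)) (0, L + 1)) (\<lambda>(R, Z). R * aR (R, Z) + a (R, Z))"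
        by (rule continuous_on_eq) auto
      have "integral {-L..0} (\<lambda>R. R * aR (R, Z) + a (R, Z)) = 0" for Z
      proof (rule integral_unique)
        have "((\<lambda>R. R * aR (R, Z) + a (R, Z)) has_integral (0 * a (0, Z) - (-L) * a (-L, Z))) {-L..0}"
        proof (rule fundamental_theorem_of_calculus)
          fix R assume R: "R \<in> {-L..0}"
          then have "((\<lambda>r. a (r, Z)) has_real_derivative aR (R, Z)) (at R within {-L..0})"
            by (intro DERIV_subset[OF C1_Dom_R[OF a]]) auto
          then show "((\<lambda>r. r * a (r, Z)) has_vector_derivative R * aR (R, Z) + a (R, Z)) (at R within {-L..0})"
            unfolding has_real_derivative_iff_has_vector_derivative[symmetric]
            by (auto intro!: derivative_eq_intros)
        qed (use L in auto)
        moreover have "a (-L, Z) = 0" using L norm_fst_le[of "-L" Z] by (intro supp) (auto simp: Dom_def)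
        ultimately show "((\<lambda>R. R * aR (R, Z) + a (R, Z)) has_integral 0) {-L..0}" by simp
      qed
      then show ?thesis unfolding Q_def integral_prod_continuous[OF c]
        using integral_swap_continuous[OF c'] by simp
    qed
    have JZ: "integral Q (\<lambda>y. snd y * aZ y + a y) = 0"
    proof -
      have c: "continuous_on (cbox (-L, -(L + 1)) (0, L + 1)) (\<lambda>y. snd y * aZ y + a y)"
        using ca by (auto simp: Q_def intro!: continuous_intros)
      have "integral {-(L + 1)..L + 1} (\<lambda>Z. Z * aZ (R, Z) + a (R, Z)) = 0" if R: "R \<in> {-L..0}" for R
      proof (rule integral_unique)
        have "((\<lambda>Z. Z * aZ (R, Z) + a (R, Z)) has_integral ((L + 1) * a (R, L + 1) - (-(L + 1)) * a (R, -(L + 1)))) {-(L + 1)..L + 1}"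
        proof (rule fundamental_theorem_of_calculus)
          fix Z assume "Z \<in> {-(L + 1)..L + 1}"
          have "((\<lambda>z. a (R, z)) has_real_derivative aZ (R, Z)) (at Z within {-(L + 1)..L + 1})"
            using R by (intro DERIV_subset[OF C1_Dom_Z[OF a]]) auto
          then show "((\<lambda>z. z * a (R, z)) has_vector_derivative Z * aZ (R, Z) + a (R, Z)) (at Z within {-(L + 1)..L + 1})"
            unfolding has_real_derivative_iff_has_vector_derivative[symmetric]
            by (auto intro!: derivative_eq_intros)
        qed (use L in auto)
        moreover have "a (R, L + 1) = 0" "a (R, -(L + 1)) = 0"
          using L R norm_snd_le[of "L + 1" R] norm_snd_le[of "-(L + 1)" R] by (auto intro!: supp simp: Dom_def)
        ultimately show "((\<lambda>Z. Z * aZ (R, Z) + a (R, Z)) has_integral 0) {-(L + 1)..L + 1}" by simp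
      qed
      then have "integral {-L..0} (\<lambda>R. integral {-(L + 1)..L + 1} (\<lambda>Z. Z * aZ (R, Z) + a (R, Z))) = integral {-L..0} (\<lambda>_. 0)"
        by (intro integral_cong) auto
      then show ?thesis unfolding Q_def integral_prod_continuous[OF c] by simp
    qed
    have i: "(\<lambda>y. fst y * aR y + a y) integrable_on Q" "(\<lambda>y. snd y * aZ y + a y) integrable_on Q"
      "(\<lambda>y. aR y * gZ y - aZ y * gR y) integrable_on Q"
      using ca by (auto simp: Q_def intro!: integrable_continuous continuous_intros)
    \<comment> \<open>The integrand is \<gamma> div(Y a) minus a Jacobian, and both integrate to 0.
      By the transport equation it equals 2 \<gamma> a pointwise, the 2 being the divergence of Y in
      the plane.\<close>
    have "integral Q (\<lambda>y. \<gamma> * ((fst y * aR y + a y) + (snd y * aZ y + a y)) - (aR y * gZ y - aZ y * gR y)) = 0"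
    proof -
      have i4: "(\<lambda>y. \<gamma> * ((fst y * aR y + a y) + (snd y * aZ y + a y))) integrable_on Q"
        using integrable_on_cmult_left[OF integrable_add[OF i(1,2)], of \<gamma>] by simp
      have "integral Q (\<lambda>y. \<gamma> * ((fst y * aR y + a y) + (snd y * aZ y + a y))) = 0"
        using integral_add[OF i(1,2)] JR JZ by simp
      then show ?thesis using integral_diff[OF i4 i(3)] J by simp
    qed
    moreover have "\<gamma> * ((fst y * aR y + a y) + (snd y * aZ y + a y)) - (aR y * gZ y - aZ y * gR y) = 2 * \<gamma> * a y" if "y \<in> Q" for y
    proof -
      have "2 * f y * (\<gamma> * (fst y * fR y + snd y * fZ y) - gZ y * fR y + gR y * fZ y) = 0"
        using eq[of y] True QD that by auto
      then show ?thesis by (simp add: aR_def aZ_def algebra_simps)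
    qed
    ultimately have "integral Q (\<lambda>y. 2 * \<gamma> * a y) = 0" by (metis (no_types, lifting) integral_cong)
    then have "integral Q a = 0" using \<gamma> by simp
    moreover have "a integrable_on Q" using ca by (simp add: Q_def integrable_continuous)
    ultimately have "(a has_integral 0) (cbox (-L, -(L + 1)) (0, L + 1))" unfolding Q_def by (metis integrable_integral)
    moreover have "box (-L, -(L + 1)) (0::real, L + 1) \<noteq> {}" using L by (simp add: box_ne_empty Basis_prod_def ball_Un)
    moreover have "Y \<in> cbox (-L, -(L + 1)) (0, L + 1)"
      using Y L norm_fst_le[of "fst Y" "snd Y"] norm_snd_le[of "snd Y" "fst Y"] by (cases Y) (auto simp: cbox_Pair_eq Dom_def)
    ultimately have "a Y = 0" using ca(1) by (intro has_integral_0_cbox_imp_0[of "(-L, -(L + 1))" _ a]) (auto simp: Q_def a_def)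
    then show ?thesis by (simp add: a_def)
  qed
qed

text \<open>Uniform closeness \<open>\<epsilon>\<close> cannot hold a maximum away from the
  boundary, but a quadratic penalty exceeding \<open>2 * \<epsilon>\<close> there can. Its
  derivatives are explicit and small, so first- and second-order tests survive a merely uniform
  limit.\<close>

lemma penalized_interior_max:
  fixes u v :: "'a::euclidean_space \<Rightarrow> real"
  assumes \<rho>: "0 < \<rho>" and c: "continuous_on (cball y0 \<rho>) u" "continuous_on (cball y0 \<rho>) v"
    and close: "\<And>y. y \<in> cball y0 \<rho> \<Longrightarrow> \<bar>u y - v y - w y\<bar> \<le> \<epsilon>"
    and w: "\<And>y. y \<in> cball y0 \<rho> \<Longrightarrow> w y \<le> w y0" and pen: "2 * \<epsilon> < \<mu> * \<rho>\<^sup>2" and \<mu>: "0 < \<mu>"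
  obtains y where "y \<in> ball y0 \<rho>"
    "\<And>z. z \<in> cball y0 \<rho> \<Longrightarrow> u z - v z - \<mu> * (norm (z - y0))\<^sup>2 \<le> u y - v y - \<mu> * (norm (y - y0))\<^sup>2"
proof -
  define H where "H = (\<lambda>y. u y - v y - \<mu> * (norm (y - y0))\<^sup>2)"
  have "continuous_on (cball y0 \<rho>) H" unfolding H_def by (intro continuous_intros c)
  moreover have "compact (cball y0 \<rho>)" "cball y0 \<rho> \<noteq> {}" using \<rho> by auto
  ultimately obtain y where y: "y \<in> cball y0 \<rho>" "\<And>z. z \<in> cball y0 \<rho> \<Longrightarrow> H z \<le> H y"
    using continuous_attains_sup by metis
  have y0: "y0 \<in> cball y0 \<rho>" using \<rho> by simp
  have "y \<in> ball y0 \<rho>"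
  proof (rule ccontr)
    assume "y \<notin> ball y0 \<rho>"
    then have "norm (y - y0) = \<rho>" using y(1) by (simp add: dist_norm norm_minus_commute)
    then have "H y \<le> w y0 + \<epsilon> - \<mu> * \<rho>\<^sup>2" using close[OF y(1)] w[OF y(1)] by (simp add: H_def)
    moreover have "w y0 - \<epsilon> \<le> H y0" using close[OF y0] by (simp add: H_def)
    ultimately show False using y(2)[OF y0] pen by linarith
  qed
  then show thesis using that y(2) by (simp add: H_def)
qed

lemma norm_sq_line:
  fixes y y0 e :: "'a::real_inner"
  shows "(norm (y + t *\<^sub>R e - y0))\<^sup>2 = (norm (y - y0))\<^sup>2 + 2 * t * ((y - y0) \<bullet> e) + t\<^sup>2 * (e \<bullet> e)"
  unfolding power2_norm_eq_inner
  by (simp add: inner_add_left inner_add_right inner_diff_left inner_diff_right inner_commute power2_eq_square algebra_simps)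

text \<open>A viscosity argument: at an interior maximum of \<open>F n - f - \<mu> \<bar>y - y0\<bar>\<^sup>2\<close> the gradient of \<open>F n\<close> is close to that of
  \<open>f\<close>, so no convergence of the gradients is needed.\<close>

lemma transport_limit:
  fixes f fR fZ V1 V2 :: "real \<times> real \<Rightarrow> real"
  assumes \<rho>: "0 < \<rho>"
    and cf: "continuous_on (ball y0 \<rho>) f" "continuous_on (ball y0 \<rho>) fR" "continuous_on (ball y0 \<rho>) fZ"
      "continuous_on (ball y0 \<rho>) V1" "continuous_on (ball y0 \<rho>) V2"
    and df: "\<And>y. y \<in> ball y0 \<rho> \<Longrightarrow> ((\<lambda>t. f (y + t *\<^sub>R (1, 0))) has_real_derivative fR y) (at 0)"
      "\<And>y. y \<in> ball y0 \<rho> \<Longrightarrow> ((\<lambda>t. f (y + t *\<^sub>R (0, 1))) has_real_derivative fZ y) (at 0)"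
    and cF: "\<And>\<epsilon>. 0 < \<epsilon> \<Longrightarrow> \<exists>F. continuous_on (ball y0 \<rho>) F \<and> (\<forall>y\<in>ball y0 \<rho>. \<bar>F y - f y\<bar> \<le> \<epsilon> \<and>
      (\<exists>p q v w. ((\<lambda>t. F (y + t *\<^sub>R (1, 0))) has_real_derivative p) (at 0) \<and>
         ((\<lambda>t. F (y + t *\<^sub>R (0, 1))) has_real_derivative q) (at 0) \<and>
         \<bar>v - V1 y\<bar> \<le> \<epsilon> \<and> \<bar>w - V2 y\<bar> \<le> \<epsilon> \<and> \<bar>\<alpha> * F y + v * p + w * q\<bar> \<le> \<epsilon>))"
  shows "\<alpha> * f y0 + V1 y0 * fR y0 + V2 y0 * fZ y0 = 0"
proof (rule ccontr)
  define Q where "Q = (\<lambda>y. \<alpha> * f y + V1 y * fR y + V2 y * fZ y)"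
  assume "\<alpha> * f y0 + V1 y0 * fR y0 + V2 y0 * fZ y0 \<noteq> 0"
  then have Q0: "0 < \<bar>Q y0\<bar>" by (simp add: Q_def)
  define \<kappa> where "\<kappa> = \<bar>Q y0\<bar> / 4"
  have \<kappa>: "0 < \<kappa>" using Q0 by (simp add: \<kappa>_def)
  have cQ: "continuous_on (ball y0 \<rho>) Q" unfolding Q_def by (intro continuous_intros cf)
  have "isCont Q y0" using cQ \<rho> by (simp add: continuous_on_eq_continuous_at)
  then obtain d where d: "0 < d" "\<And>y. dist y y0 < d \<Longrightarrow> \<bar>Q y - Q y0\<bar> < \<kappa>"
    using \<kappa> unfolding continuous_at_eps_delta dist_real_def by metis
  define r where "r = min (min 1 (\<rho> / 2)) (d / 2)"
  have r: "0 < r" "r \<le> 1" "r < \<rho>" "r < d" using \<rho> d by (auto simp: r_def min_def)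
  have sub: "cball y0 r \<subseteq> ball y0 \<rho>" using r by auto
  have bd: "\<exists>B. \<forall>y\<in>cball y0 r. \<bar>k y\<bar> \<le> B" if "continuous_on (ball y0 \<rho>) k" for k :: "real \<times> real \<Rightarrow> real"
  proof -
    have "compact (k ` cball y0 r)" using continuous_on_subset[OF that sub] by (intro compact_continuous_image) auto
    then show ?thesis using compact_imp_bounded bounded_iff by (metis imageI real_norm_def)
  qed
  obtain B1 B2 B3 B4 where B': "\<And>y. y \<in> cball y0 r \<Longrightarrow> \<bar>fR y\<bar> \<le> B1" "\<And>y. y \<in> cball y0 r \<Longrightarrow> \<bar>fZ y\<bar> \<le> B2"
    "\<And>y. y \<in> cball y0 r \<Longrightarrow> \<bar>V1 y\<bar> \<le> B3" "\<And>y. y \<in> cball y0 r \<Longrightarrow> \<bar>V2 y\<bar> \<le> B4"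
    using bd cf by metis
  define B where "B = max 1 (max (max B1 B2) (max B3 B4))"
  have B: "1 \<le> B" "\<And>y. y \<in> cball y0 r \<Longrightarrow> \<bar>fR y\<bar> \<le> B" "\<And>y. y \<in> cball y0 r \<Longrightarrow> \<bar>fZ y\<bar> \<le> B"
    "\<And>y. y \<in> cball y0 r \<Longrightarrow> \<bar>V1 y\<bar> \<le> B" "\<And>y. y \<in> cball y0 r \<Longrightarrow> \<bar>V2 y\<bar> \<le> B"
  proof -
    have Bk: "1 \<le> B" "B1 \<le> B" "B2 \<le> B" "B3 \<le> B" "B4 \<le> B" by (auto simp: B_def)
    show "1 \<le> B" by (rule Bk(1))
    fix y assume y: "y \<in> cball y0 r"
    show "\<bar>fR y\<bar> \<le> B" "\<bar>fZ y\<bar> \<le> B" "\<bar>V1 y\<bar> \<le> B" "\<bar>V2 y\<bar> \<le> B"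
      using B'(1)[OF y] B'(2)[OF y] B'(3)[OF y] B'(4)[OF y] Bk by linarith+
  qed
  \<comment> \<open>On a ball of radius at most 1 the penalty changes each partial derivative by at
    most \<open>2 * \<mu>\<close>; multiplied by speeds bounded by \<open>B\<close> this costs
    \<open>\<kappa>\<close> in total. The terms proportional to \<open>\<epsilon>\<close> cost
    another \<open>\<kappa>\<close> and the continuity of \<open>Q\<close> a third, against the
    assumed \<open>4 * \<kappa>\<close>.\<close>
  define \<mu> where "\<mu> = \<kappa> / (4 * B)"
  have \<mu>: "0 < \<mu>" "4 * B * \<mu> = \<kappa>" using \<kappa> B by (auto simp: \<mu>_def)
  define D where "D = 1 + \<bar>\<alpha>\<bar> + 2 * (B + 2 * \<mu>)"
  have D: "0 < D" using B \<mu> by (simp add: D_def add_pos_nonneg)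
  define \<epsilon> where "\<epsilon> = min (\<kappa> / D) (\<mu> * r\<^sup>2 / 4)"
  have \<epsilon>: "0 < \<epsilon>" "\<epsilon> * D \<le> \<kappa>" "2 * \<epsilon> < \<mu> * r\<^sup>2"
  proof -
    show "0 < \<epsilon>" using \<kappa> D \<mu> r by (simp add: \<epsilon>_def)
    have "\<epsilon> * D \<le> \<kappa> / D * D" using D by (intro mult_right_mono) (auto simp: \<epsilon>_def)
    then show "\<epsilon> * D \<le> \<kappa>" using D by simp
    have "2 * \<epsilon> \<le> \<mu> * r\<^sup>2 / 2" by (simp add: \<epsilon>_def)
    moreover have "0 < \<mu> * r\<^sup>2" using \<mu> r by simp
    ultimately show "2 * \<epsilon> < \<mu> * r\<^sup>2" by linarith
  qed
  obtain F where F: "continuous_on (ball y0 \<rho>) F" "\<And>y. y \<in> ball y0 \<rho> \<Longrightarrow> \<bar>F y - f y\<bar> \<le> \<epsilon>"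
    "\<And>y. y \<in> ball y0 \<rho> \<Longrightarrow> \<exists>p q v w. ((\<lambda>t. F (y + t *\<^sub>R (1, 0))) has_real_derivative p) (at 0) \<and>
         ((\<lambda>t. F (y + t *\<^sub>R (0, 1))) has_real_derivative q) (at 0) \<and>
         \<bar>v - V1 y\<bar> \<le> \<epsilon> \<and> \<bar>w - V2 y\<bar> \<le> \<epsilon> \<and> \<bar>\<alpha> * F y + v * p + w * q\<bar> \<le> \<epsilon>"
    using cF[OF \<epsilon>(1)] by (elim exE conjE) blast
  obtain y where y: "y \<in> ball y0 r" and ymax: "\<And>z. z \<in> cball y0 r \<Longrightarrow> F z - f z - \<mu> * (norm (z - y0))\<^sup>2 \<le> F y - f y - \<mu> * (norm (y - y0))\<^sup>2"
  proof (rule penalized_interior_max[of r y0 F f "\<lambda>_. 0" \<epsilon> \<mu>])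
    show "continuous_on (cball y0 r) F" "continuous_on (cball y0 r) f"
      using continuous_on_subset[OF F(1) sub] continuous_on_subset[OF cf(1) sub] by auto
    show "\<bar>F y - f y - 0\<bar> \<le> \<epsilon>" if "y \<in> cball y0 r" for y using F(2)[OF subsetD[OF sub that]] by simp
  qed (use r \<epsilon> \<mu> in \<open>simp_all add: that\<close>)
  have yr: "y \<in> cball y0 r" using y by simp
  have y\<rho>: "y \<in> ball y0 \<rho>" using yr sub by blast
  obtain p q v w where pq: "((\<lambda>t. F (y + t *\<^sub>R (1, 0))) has_real_derivative p) (at 0)"
    "((\<lambda>t. F (y + t *\<^sub>R (0, 1))) has_real_derivative q) (at 0)"
    and vw: "\<bar>v - V1 y\<bar> \<le> \<epsilon>" "\<bar>w - V2 y\<bar> \<le> \<epsilon>" "\<bar>\<alpha> * F y + v * p + w * q\<bar> \<le> \<epsilon>"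
    using F(3)[OF y\<rho>] by blast
  define \<delta> where "\<delta> = r - dist y0 y"
  have \<delta>: "0 < \<delta>" using y by (simp add: \<delta>_def)
  have crit: "P - P' - 2 * \<mu> * ((y - y0) \<bullet> e) = 0"
    if e: "norm e = 1" and D: "((\<lambda>t. F (y + t *\<^sub>R e)) has_real_derivative P) (at 0)" "((\<lambda>t. f (y + t *\<^sub>R e)) has_real_derivative P') (at 0)"
    for e P P'
  proof (rule DERIV_local_max[OF _ \<delta>])
    show "((\<lambda>t. F (y + t *\<^sub>R e) - f (y + t *\<^sub>R e) - \<mu> * (norm (y + t *\<^sub>R e - y0))\<^sup>2) has_real_derivative (P - P' - 2 * \<mu> * ((y - y0) \<bullet> e))) (at 0)"
      unfolding norm_sq_line using D by (auto intro!: derivative_eq_intros)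
    show "\<forall>t. \<bar>0 - t\<bar> < \<delta> \<longrightarrow> F (y + t *\<^sub>R e) - f (y + t *\<^sub>R e) - \<mu> * (norm (y + t *\<^sub>R e - y0))\<^sup>2 \<le> F (y + 0 *\<^sub>R e) - f (y + 0 *\<^sub>R e) - \<mu> * (norm (y + 0 *\<^sub>R e - y0))\<^sup>2"
    proof (intro allI impI)
      fix t assume "\<bar>0 - t\<bar> < \<delta>"
      then have "y + t *\<^sub>R e \<in> cball y0 r"
        using dist_triangle[of y0 "y + t *\<^sub>R e" y] e by (simp add: \<delta>_def dist_norm)
      then show "F (y + t *\<^sub>R e) - f (y + t *\<^sub>R e) - \<mu> * (norm (y + t *\<^sub>R e - y0))\<^sup>2 \<le> F (y + 0 *\<^sub>R e) - f (y + 0 *\<^sub>R e) - \<mu> * (norm (y + 0 *\<^sub>R e - y0))\<^sup>2"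
        using ymax by simp
    qed
  qed
  have ip: "\<bar>(y - y0) \<bullet> e\<bar> \<le> 1" if "norm e = 1" for e
    using Cauchy_Schwarz_ineq2[of "y - y0" e] that yr r by (simp add: dist_norm norm_minus_commute)
  define P1 P2 where "P1 = 2 * \<mu> * ((y - y0) \<bullet> (1, 0))" and "P2 = 2 * \<mu> * ((y - y0) \<bullet> (0, 1))"
  have p: "p = fR y + P1" "q = fZ y + P2"
    using crit[OF _ pq(1) df(1)[OF y\<rho>]] crit[OF _ pq(2) df(2)[OF y\<rho>]] by (auto simp: P1_def P2_def norm_Pair)
  have P: "\<bar>P1\<bar> \<le> 2 * \<mu>" "\<bar>P2\<bar> \<le> 2 * \<mu>"
    using ip[of "(1, 0)"] ip[of "(0, 1)"] \<mu> by (auto simp: P1_def P2_def abs_mult norm_Pair)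
  have pb: "\<bar>p\<bar> \<le> B + 2 * \<mu>" "\<bar>q\<bar> \<le> B + 2 * \<mu>"
    using p P B(2,3)[OF yr] by linarith+
  have tri: "\<bar>x1 + x2 + x3 + x4 - x5 - x6\<bar> \<le> \<bar>x1\<bar> + \<bar>x2\<bar> + \<bar>x3\<bar> + \<bar>x4\<bar> + \<bar>x5\<bar> + \<bar>x6\<bar>" for x1 x2 x3 x4 x5 x6 :: real
    by (rule order.trans[OF abs_triangle_ineq4], rule add_right_mono, rule order.trans[OF abs_triangle_ineq4], rule add_right_mono,
        rule order.trans[OF abs_triangle_ineq], rule add_right_mono, rule order.trans[OF abs_triangle_ineq], rule add_right_mono,
        rule abs_triangle_ineq)
  have "Q y = (\<alpha> * F y + v * p + w * q) + \<alpha> * (f y - F y) + (V1 y - v) * p + (V2 y - w) * q - V1 y * P1 - V2 y * P2"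
    by (simp add: Q_def p algebra_simps)
  then have "\<bar>Q y\<bar> \<le> \<bar>\<alpha> * F y + v * p + w * q\<bar> + \<bar>\<alpha> * (f y - F y)\<bar> + \<bar>(V1 y - v) * p\<bar> + \<bar>(V2 y - w) * q\<bar> + \<bar>V1 y * P1\<bar> + \<bar>V2 y * P2\<bar>"
    by (simp only: tri)
  also have "\<dots> \<le> \<epsilon> + \<bar>\<alpha>\<bar> * \<epsilon> + \<epsilon> * (B + 2 * \<mu>) + \<epsilon> * (B + 2 * \<mu>) + B * (2 * \<mu>) + B * (2 * \<mu>)"
  proof (intro add_mono)
    show "\<bar>\<alpha> * (f y - F y)\<bar> \<le> \<bar>\<alpha>\<bar> * \<epsilon>" unfolding abs_mult using F(2)[OF y\<rho>] by (intro mult_left_mono) auto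
    show "\<bar>(V1 y - v) * p\<bar> \<le> \<epsilon> * (B + 2 * \<mu>)"
      unfolding abs_mult by (rule mult_mono) (use vw(1) pb \<epsilon>(1) in linarith)+
    show "\<bar>(V2 y - w) * q\<bar> \<le> \<epsilon> * (B + 2 * \<mu>)"
      unfolding abs_mult by (rule mult_mono) (use vw(2) pb \<epsilon>(1) in linarith)+
    show "\<bar>V1 y * P1\<bar> \<le> B * (2 * \<mu>)" "\<bar>V2 y * P2\<bar> \<le> B * (2 * \<mu>)"
      unfolding abs_mult by (rule mult_mono; use P B(1) B(4,5)[OF yr] in linarith)+
  qed (rule vw(3))
  also have "\<dots> = \<epsilon> * D + 4 * B * \<mu>" by (simp add: D_def algebra_simps)
  also have "\<dots> \<le> 2 * \<kappa>" unfolding \<mu>(2) using \<epsilon>(2) by simp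
  finally have "\<bar>Q y\<bar> \<le> 2 * \<kappa>" .
  moreover have "\<bar>Q y - Q y0\<bar> < \<kappa>" using d(2)[of y] yr r by (simp add: dist_commute)
  ultimately show False unfolding \<kappa>_def by linarith
qed

text \<open>Limits of solutions of the rescaled equation; they replace distributional solutions of \<open>\<Delta>v = \<kappa>\<close>.\<close>

definition ell_limit :: "(nat \<Rightarrow> real) \<Rightarrow> real \<Rightarrow> (real \<times> real \<Rightarrow> real) \<Rightarrow> bool" where
  "ell_limit s \<kappa> v \<longleftrightarrow> (\<forall>y. fst y < 0 \<longrightarrow> (\<exists>\<rho>>0. \<exists>g f. uniform_limit (ball y \<rho>) g v sequentially \<and>
     (\<forall>\<^sub>F n in sequentially. ell (s n) (ball y \<rho>) (g n) (f n)) \<and> uniform_limit (ball y \<rho>) f (\<lambda>_. \<kappa>) sequentially))"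

section \<open>Operations on limits of rescaled elliptic solutions\<close>

lemma ell_combine:
  assumes g: "ell s S g f" and h: "ell s S h f'"
  shows "ell s S (\<lambda>y. a * g y + b * h y) (\<lambda>y. a * f y + b * f' y)"
proof -
  obtain g1 g11 g2 g22 where G: "\<And>R Z. (R, Z) \<in> S \<Longrightarrow>
        ((\<lambda>x. g (x, Z)) has_real_derivative g1 (R, Z)) (at R) \<and> ((\<lambda>x. g1 (x, Z)) has_real_derivative g11 (R, Z)) (at R) \<and>
        ((\<lambda>z. g (R, z)) has_real_derivative g2 (R, Z)) (at Z) \<and> ((\<lambda>z. g2 (R, z)) has_real_derivative g22 (R, Z)) (at Z) \<and>
        g11 (R, Z) + 3 * s / (1 + s * R) * g1 (R, Z) + g22 (R, Z) = f (R, Z)"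
    and c: "continuous_on S g" and p: "open S" "\<forall>R Z. (R, Z) \<in> S \<longrightarrow> 0 < 1 + s * R"
    using g unfolding ell_def by (elim conjE exE) blast
  obtain h1 h11 h2 h22 where H: "\<And>R Z. (R, Z) \<in> S \<Longrightarrow>
        ((\<lambda>x. h (x, Z)) has_real_derivative h1 (R, Z)) (at R) \<and> ((\<lambda>x. h1 (x, Z)) has_real_derivative h11 (R, Z)) (at R) \<and>
        ((\<lambda>z. h (R, z)) has_real_derivative h2 (R, Z)) (at Z) \<and> ((\<lambda>z. h2 (R, z)) has_real_derivative h22 (R, Z)) (at Z) \<and>
        h11 (R, Z) + 3 * s / (1 + s * R) * h1 (R, Z) + h22 (R, Z) = f' (R, Z)"
    and c': "continuous_on S h"
    using h unfolding ell_def by (elim conjE exE) blast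
  define k1 k11 k2 k22 where "k1 = (\<lambda>y. a * g1 y + b * h1 y)" and "k11 = (\<lambda>y. a * g11 y + b * h11 y)"
    and "k2 = (\<lambda>y. a * g2 y + b * h2 y)" and "k22 = (\<lambda>y. a * g22 y + b * h22 y)"
  have "((\<lambda>x. a * g (x, Z) + b * h (x, Z)) has_real_derivative k1 (R, Z)) (at R) \<and> ((\<lambda>x. k1 (x, Z)) has_real_derivative k11 (R, Z)) (at R) \<and>
        ((\<lambda>z. a * g (R, z) + b * h (R, z)) has_real_derivative k2 (R, Z)) (at Z) \<and> ((\<lambda>z. k2 (R, z)) has_real_derivative k22 (R, Z)) (at Z) \<and>
        k11 (R, Z) + 3 * s / (1 + s * R) * k1 (R, Z) + k22 (R, Z) = a * f (R, Z) + b * f' (R, Z)" if "(R, Z) \<in> S" for R Z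
  proof (intro conjI)
    note G = G[OF that] and H = H[OF that]
    show "((\<lambda>x. a * g (x, Z) + b * h (x, Z)) has_real_derivative k1 (R, Z)) (at R)" "((\<lambda>x. k1 (x, Z)) has_real_derivative k11 (R, Z)) (at R)"
      "((\<lambda>z. a * g (R, z) + b * h (R, z)) has_real_derivative k2 (R, Z)) (at Z)" "((\<lambda>z. k2 (R, z)) has_real_derivative k22 (R, Z)) (at Z)"
      unfolding k1_def k2_def k11_def k22_def using G H by (auto intro!: DERIV_add DERIV_cmult)
    have "k11 (R, Z) + 3 * s / (1 + s * R) * k1 (R, Z) + k22 (R, Z)
        = a * (g11 (R, Z) + 3 * s / (1 + s * R) * g1 (R, Z) + g22 (R, Z)) + b * (h11 (R, Z) + 3 * s / (1 + s * R) * h1 (R, Z) + h22 (R, Z))"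
      unfolding k1_def k2_def k11_def k22_def by (simp add: distrib_left mult.left_commute mult.commute add_ac)
    then show "k11 (R, Z) + 3 * s / (1 + s * R) * k1 (R, Z) + k22 (R, Z) = a * f (R, Z) + b * f' (R, Z)" using G H by simp
  qed
  moreover have "continuous_on S (\<lambda>y. a * g y + b * h y)" by (intro continuous_intros c c')
  ultimately show ?thesis unfolding ell_def using p by blast
qed

lemma ell_shift:
  assumes g: "ell s S g f"
  shows "ell s ((\<lambda>y. y - (0, h)) ` S) (\<lambda>y. g (y + (0, h))) (\<lambda>y. f (y + (0, h)))"
proof -
  obtain g1 g11 g2 g22 where G: "\<And>R Z. (R, Z) \<in> S \<Longrightarrow>
        ((\<lambda>x. g (x, Z)) has_real_derivative g1 (R, Z)) (at R) \<and> ((\<lambda>x. g1 (x, Z)) has_real_derivative g11 (R, Z)) (at R) \<and>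
        ((\<lambda>z. g (R, z)) has_real_derivative g2 (R, Z)) (at Z) \<and> ((\<lambda>z. g2 (R, z)) has_real_derivative g22 (R, Z)) (at Z) \<and>
        g11 (R, Z) + 3 * s / (1 + s * R) * g1 (R, Z) + g22 (R, Z) = f (R, Z)"
    and c: "continuous_on S g" and p: "open S" "\<forall>R Z. (R, Z) \<in> S \<longrightarrow> 0 < 1 + s * R"
    using g unfolding ell_def by (elim conjE exE) blast
  define S' where "S' = (\<lambda>y. y - (0, h)) ` S"
  have S': "(R, Z) \<in> S' \<longleftrightarrow> (R, Z + h) \<in> S" for R Z
    unfolding S'_def by (force intro: image_eqI[of _ _ "(R, Z + h)"])
  have op: "open S'" unfolding S'_def using open_translation_subtract[OF p(1)] by simp
  have cS': "continuous_on S' (\<lambda>y. g (y + (0, h)))"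
    by (rule continuous_on_compose2[OF c]) (auto intro!: continuous_intros simp: S')
  have sh: "((\<lambda>z. k (R, z + h)) has_real_derivative D) (at Z)" if "((\<lambda>z. k (R, z)) has_real_derivative D) (at (Z + h))" for k R D Z
    using that DERIV_shift[of "\<lambda>z. k (R, z)" D Z h] by simp
  define k1 k11 k2 k22 where "k1 = (\<lambda>y. g1 (y + (0, h)))" and "k11 = (\<lambda>y. g11 (y + (0, h)))"
    and "k2 = (\<lambda>y. g2 (y + (0, h)))" and "k22 = (\<lambda>y. g22 (y + (0, h)))"
  have "((\<lambda>x. g ((x, Z) + (0, h))) has_real_derivative k1 (R, Z)) (at R) \<and> ((\<lambda>x. k1 (x, Z)) has_real_derivative k11 (R, Z)) (at R) \<and>
        ((\<lambda>z. g ((R, z) + (0, h))) has_real_derivative k2 (R, Z)) (at Z) \<and> ((\<lambda>z. k2 (R, z)) has_real_derivative k22 (R, Z)) (at Z) \<and>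
        k11 (R, Z) + 3 * s / (1 + s * R) * k1 (R, Z) + k22 (R, Z) = f ((R, Z) + (0, h))" if "(R, Z) \<in> S'" for R Z
  proof -
    have "(R, Z + h) \<in> S" using that S' by simp
    note G = G[OF this]
    from G have "((\<lambda>z. g (R, z + h)) has_real_derivative g2 (R, Z + h)) (at Z)" "((\<lambda>z. g2 (R, z + h)) has_real_derivative g22 (R, Z + h)) (at Z)"
      by (intro sh; blast)+
    then show ?thesis using G by (simp add: k1_def k11_def k2_def k22_def)
  qed
  moreover have "\<forall>R Z. (R, Z) \<in> S' \<longrightarrow> 0 < 1 + s * R" using p(2) S' by blast
  moreover note cS' op
  ultimately show ?thesis unfolding ell_def S'_def[symmetric] by blast
qed

lemma ell_limit_uminus:
  assumes "ell_limit s \<kappa> v" shows "ell_limit s (- \<kappa>) (\<lambda>y. - v y)"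
  unfolding ell_limit_def
proof (intro allI impI)
  fix y :: "real \<times> real" assume "fst y < 0"
  then obtain \<rho> g f where *: "0 < \<rho>" "uniform_limit (ball y \<rho>) g v sequentially"
     "\<forall>\<^sub>F n in sequentially. ell (s n) (ball y \<rho>) (g n) (f n)" "uniform_limit (ball y \<rho>) f (\<lambda>_. \<kappa>) sequentially"
    using assms unfolding ell_limit_def by blast
  have "\<forall>\<^sub>F n in sequentially. ell (s n) (ball y \<rho>) (\<lambda>y. - g n y) (\<lambda>y. - f n y)"
    using *(3)
  proof eventually_elim
    case (elim n)
    show ?case using ell_combine[OF elim elim, of "-1" 0] by simp
  qed
  then show "\<exists>\<rho>>0. \<exists>g f. uniform_limit (ball y \<rho>) g (\<lambda>y. - v y) sequentially \<and>
     (\<forall>\<^sub>F n in sequentially. ell (s n) (ball y \<rho>) (g n) (f n)) \<and> uniform_limit (ball y \<rho>) f (\<lambda>_. - \<kappa>) sequentially"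
    using *(1) uniform_limit_uminus[OF *(2)] uniform_limit_uminus[OF *(4)]
    by (intro exI[of _ \<rho>] conjI exI[of _ "\<lambda>n y. - g n y"] exI[of _ "\<lambda>n y. - f n y"]) auto
qed

text \<open>The coefficients of the rescaled operator depend on R alone, so translation in Z
  preserves the equation. Tangential differences are the useful quantity because the boundary
  condition makes them vanish on R = 0.\<close>

lemma ell_limit_shift_diff:
  assumes "ell_limit s 0 v" shows "ell_limit s 0 (\<lambda>y. v (y + (0, h)) - v y)"
  unfolding ell_limit_def
proof (intro allI impI)
  fix y :: "real \<times> real" assume y: "fst y < 0"
  then obtain \<rho> g f where 1: "0 < \<rho>" "uniform_limit (ball y \<rho>) g v sequentially"
     "\<forall>\<^sub>F n in sequentially. ell (s n) (ball y \<rho>) (g n) (f n)" "uniform_limit (ball y \<rho>) f (\<lambda>_. 0) sequentially"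
    using assms unfolding ell_limit_def by blast
  have "fst (y + (0, h)) < 0" using y by simp
  then obtain \<rho>' g' f' where 2: "0 < \<rho>'" "uniform_limit (ball (y + (0, h)) \<rho>') g' v sequentially"
     "\<forall>\<^sub>F n in sequentially. ell (s n) (ball (y + (0, h)) \<rho>') (g' n) (f' n)" "uniform_limit (ball (y + (0, h)) \<rho>') f' (\<lambda>_. 0) sequentially"
    using assms unfolding ell_limit_def by blast
  define r where "r = min \<rho> \<rho>'"
  have sub: "ball y r \<subseteq> ball y \<rho>" by (auto simp: r_def)
  have sh: "z + (0, h) \<in> ball (y + (0, h)) \<rho>'" if "z \<in> ball y r" for z using that by (simp add: r_def)
  have sub': "ball y r \<subseteq> (\<lambda>y. y - (0, h)) ` ball (y + (0, h)) \<rho>'"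
  proof
    fix z assume "z \<in> ball y r"
    then show "z \<in> (\<lambda>y. y - (0, h)) ` ball (y + (0, h)) \<rho>'" by (rule rev_image_eqI[OF sh]) simp
  qed
  have us: "uniform_limit (ball y r) (\<lambda>n z. k n (z + (0, h))) (\<lambda>z. l (z + (0, h))) sequentially"
    if "uniform_limit (ball (y + (0, h)) \<rho>') k l sequentially" for k :: "nat \<Rightarrow> real \<times> real \<Rightarrow> real" and l
    unfolding uniform_limit_iff
  proof (intro allI impI)
    fix e :: real assume "0 < e"
    from uniform_limitD[OF that this] show "\<forall>\<^sub>F n in sequentially. \<forall>z\<in>ball y r. dist (k n (z + (0, h))) (l (z + (0, h))) < e"
      by eventually_elim (use sh in blast)
  qed
  have "uniform_limit (ball y r) (\<lambda>n z. g' n (z + (0, h)) - g n z) (\<lambda>z. v (z + (0, h)) - v z) sequentially"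
    by (intro uniform_limit_minus us[OF 2(2)] uniform_limit_on_subset[OF 1(2) sub])
  moreover have "uniform_limit (ball y r) (\<lambda>n z. f' n (z + (0, h)) - f n z) (\<lambda>_. 0 - 0) sequentially"
    by (intro uniform_limit_minus us[OF 2(4)] uniform_limit_on_subset[OF 1(4) sub])
  moreover have "\<forall>\<^sub>F n in sequentially. ell (s n) (ball y r) (\<lambda>z. g' n (z + (0, h)) - g n z) (\<lambda>z. f' n (z + (0, h)) - f n z)"
    using 1(3) 2(3)
  proof eventually_elim
    case (elim n)
    show ?case
      using ell_combine[OF ell_subset[OF ell_shift[OF elim(2)] _ sub'] ell_subset[OF elim(1) _ sub], of 1 "-1"] by simp
  qed
  ultimately show "\<exists>\<rho>>0. \<exists>g f. uniform_limit (ball y \<rho>) g (\<lambda>y. v (y + (0, h)) - v y) sequentially \<and>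
     (\<forall>\<^sub>F n in sequentially. ell (s n) (ball y \<rho>) (g n) (f n)) \<and> uniform_limit (ball y \<rho>) f (\<lambda>_. 0) sequentially"
    using 1(1) 2(1) by (intro exI[of _ r] conjI exI[of _ "\<lambda>n z. g' n (z + (0, h)) - g n z"]
        exI[of _ "\<lambda>n z. f' n (z + (0, h)) - f n z"]) (simp_all add: r_def)
qed

definition quad :: "real \<Rightarrow> real \<Rightarrow> real \<Rightarrow> real \<Rightarrow> real \<times> real \<Rightarrow> real" where
  "quad A B C D y = A * (fst y)\<^sup>2 + B * (snd y)\<^sup>2 + C * fst y + D * snd y"

section \<open>Liouville theorem on the half plane\<close>

text \<open>The viscosity form of the equation with Laplacian \<kappa>: a quadratic touching
  \<open>v\<close> from above has Laplacian at least \<kappa>. The test is carried out on the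
  approximating solutions, which have second derivatives.\<close>

lemma ell_limit_test:
  assumes lim: "ell_limit s \<kappa> v" and s: "\<And>n. 0 < s n" "s \<longlonglongrightarrow> 0"
    and v: "continuous_on Dom v" and y0: "fst y0 < 0" and r: "0 < r"
    and max: "\<And>y. y \<in> ball y0 r \<Longrightarrow> v y - quad A B C D y \<le> v y0 - quad A B C D y0"
  shows "\<kappa> \<le> 2 * A + 2 * B"
proof (rule ccontr)
  assume neg: "\<not> \<kappa> \<le> 2 * A + 2 * B"
  \<comment> \<open>Of the eight parts, the Hessian of the penalty uses four, the first-order term
    one, and the error of the source one.\<close>
  define \<mu> where "\<mu> = (\<kappa> - (2 * A + 2 * B)) / 8"
  have \<mu>: "0 < \<mu>" using neg by (simp add: \<mu>_def)
  obtain \<rho> g f where \<rho>: "0 < \<rho>" and gu: "uniform_limit (ball y0 \<rho>) g v sequentially"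
     and ge: "\<forall>\<^sub>F n in sequentially. ell (s n) (ball y0 \<rho>) (g n) (f n)" and fu: "uniform_limit (ball y0 \<rho>) f (\<lambda>_. \<kappa>) sequentially"
    using lim y0 unfolding ell_limit_def by blast
  define d where "d = min (min r \<rho>) (- fst y0) / 2"
  have d: "0 < d" "d < r" "d < \<rho>" "d < - fst y0" using r \<rho> y0 by (auto simp: d_def min_def)
  have cbd: "cball y0 d \<subseteq> ball y0 \<rho>" "cball y0 d \<subseteq> ball y0 r" using d by auto
  have R_bound: "\<bar>fst y - fst y0\<bar> \<le> d" if "y \<in> cball y0 d" for y
    using that dist_fst_le[of y0 y] by (simp add: dist_real_def abs_minus_commute)
  have cD: "cball y0 d \<subseteq> Dom" using R_bound d by (force simp: Dom_def)
  \<comment> \<open>At the contact point the R-derivative of \<open>g n\<close> equals that of the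
    quadratic plus the penalty, hence is at most \<open>L\<close>. This makes the first-order term,
    which carries a factor \<open>s n\<close>, negligible without a gradient bound for
    \<open>g n\<close>.\<close>
  define L where "L = 2 * \<bar>A\<bar> * (\<bar>fst y0\<bar> + d) + \<bar>C\<bar> + 2 * \<mu> * d"
  have L: "0 \<le> L" using d \<mu> by (simp add: L_def)
  define \<epsilon> where "\<epsilon> = \<mu> * d\<^sup>2 / 4"
  have \<epsilon>: "0 < \<epsilon>" "2 * \<epsilon> < \<mu> * d\<^sup>2" using \<mu> d by (auto simp: \<epsilon>_def)
  have slim: "\<forall>\<^sub>F n in sequentially. s n < min (1 / (2 * (\<bar>fst y0\<bar> + d))) (\<mu> / (6 * (L + 1)))"
    by (rule order_tendstoD(2)[OF s(2)]) (use d \<mu> L in auto)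
  have "\<forall>\<^sub>F n in sequentially. ell (s n) (ball y0 \<rho>) (g n) (f n) \<and> s n < min (1 / (2 * (\<bar>fst y0\<bar> + d))) (\<mu> / (6 * (L + 1)))
      \<and> (\<forall>y\<in>ball y0 \<rho>. dist (g n y) (v y) < \<epsilon>) \<and> (\<forall>y\<in>ball y0 \<rho>. dist (f n y) \<kappa> < \<mu>)"
    using ge slim uniform_limitD[OF gu \<epsilon>(1)] uniform_limitD[OF fu \<mu>] by eventually_elim auto
  then obtain n where n: "ell (s n) (ball y0 \<rho>) (g n) (f n) \<and> s n < min (1 / (2 * (\<bar>fst y0\<bar> + d))) (\<mu> / (6 * (L + 1)))
      \<and> (\<forall>y\<in>ball y0 \<rho>. dist (g n y) (v y) < \<epsilon>) \<and> (\<forall>y\<in>ball y0 \<rho>. dist (f n y) \<kappa> < \<mu>)"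
    unfolding eventually_sequentially by blast
  have en: "ell (s n) (ball y0 \<rho>) (g n) (f n)" and sn: "s n < 1 / (2 * (\<bar>fst y0\<bar> + d))" "s n < \<mu> / (6 * (L + 1))"
    and gv: "\<And>y. y \<in> ball y0 \<rho> \<Longrightarrow> \<bar>g n y - v y\<bar> < \<epsilon>" and fv: "\<And>y. y \<in> ball y0 \<rho> \<Longrightarrow> \<bar>f n y - \<kappa>\<bar> < \<mu>"
    using n unfolding dist_real_def by simp_all
  define q where "q = quad A B C D"
  have cq: "continuous_on S q" for S unfolding q_def quad_def by (intro continuous_intros)
  have cg: "continuous_on (ball y0 \<rho>) (g n)" using en by (simp add: ell_def)
  obtain y where y: "y \<in> ball y0 d" and ymax: "\<And>z. z \<in> cball y0 d \<Longrightarrow> g n z - q z - \<mu> * (norm (z - y0))\<^sup>2 \<le> g n y - q y - \<mu> * (norm (y - y0))\<^sup>2"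
  proof (rule penalized_interior_max[of d y0 "g n" q "\<lambda>y. v y - q y" \<epsilon> \<mu>])
    show "continuous_on (cball y0 d) (g n)" using continuous_on_subset[OF cg cbd(1)] .
    show "\<bar>g n y - q y - (v y - q y)\<bar> \<le> \<epsilon>" if "y \<in> cball y0 d" for y using gv[OF subsetD[OF cbd(1) that]] by simp
    show "v y - q y \<le> v y0 - q y0" if "y \<in> cball y0 d" for y using max[OF subsetD[OF cbd(2) that]] by (simp add: q_def)
  qed (use d \<epsilon> \<mu> cq in \<open>simp_all add: that\<close>)
  obtain R Z where RZ: "y = (R, Z)" by force
  obtain R0 Z0 where RZ0: "y0 = (R0, Z0)" by force
  have yc: "y \<in> cball y0 d" using y by simp
  have y\<rho>: "y \<in> ball y0 \<rho>" using yc cbd by blast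
  obtain g1 g11 g2 g22 where G: "\<And>R Z. (R, Z) \<in> ball y0 \<rho> \<Longrightarrow> ((\<lambda>x. g n (x, Z)) has_real_derivative g1 (R, Z)) (at R)"
        "\<And>R Z. (R, Z) \<in> ball y0 \<rho> \<Longrightarrow> ((\<lambda>x. g1 (x, Z)) has_real_derivative g11 (R, Z)) (at R)"
        "\<And>R Z. (R, Z) \<in> ball y0 \<rho> \<Longrightarrow> ((\<lambda>z. g n (R, z)) has_real_derivative g2 (R, Z)) (at Z)"
        "\<And>R Z. (R, Z) \<in> ball y0 \<rho> \<Longrightarrow> ((\<lambda>z. g2 (R, z)) has_real_derivative g22 (R, Z)) (at Z)"
        "\<And>R Z. (R, Z) \<in> ball y0 \<rho> \<Longrightarrow> g11 (R, Z) + 3 * s n / (1 + s n * R) * g1 (R, Z) + g22 (R, Z) = f n (R, Z)"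
    using en unfolding ell_def by (elim conjE exE) blast
  define \<delta> where "\<delta> = d - dist y0 y"
  have \<delta>: "0 < \<delta>" using y by (simp add: \<delta>_def)
  have inR: "(R + t, Z) \<in> cball y0 d" and inZ: "(R, Z + t) \<in> cball y0 d" if "\<bar>t\<bar> < \<delta>" for t
  proof -
    have "dist (R, Z) (R + t, Z) = \<bar>t\<bar>" "dist (R, Z) (R, Z + t) = \<bar>t\<bar>" by (simp_all add: dist_prod_def dist_real_def)
    then show "(R + t, Z) \<in> cball y0 d" "(R, Z + t) \<in> cball y0 d"
      using that dist_triangle[of y0 "(R + t, Z)" y] dist_triangle[of y0 "(R, Z + t)" y] by (auto simp: \<delta>_def RZ)
  qed
  have nsq: "(norm ((a, b) - y0))\<^sup>2 = (a - R0)\<^sup>2 + (b - Z0)\<^sup>2" for a b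
    by (simp add: RZ0 norm_Pair)
  define h where "h = (\<lambda>t. g n (R + t, Z) - q (R + t, Z) - \<mu> * ((R + t - R0)\<^sup>2 + (Z - Z0)\<^sup>2))"
  define h' where "h' = (\<lambda>t. g1 (R + t, Z) - (2 * A * (R + t) + C) - 2 * \<mu> * (R + t - R0))"
  have dh: "(h has_real_derivative h' t) (at t)" if "\<bar>t\<bar> < \<delta>" for t
  proof -
    have "((\<lambda>t. g n (R + t, Z)) has_real_derivative g1 (R + t, Z)) (at t)"
      using G(1)[of "R + t" Z] subsetD[OF cbd(1) inR[OF that]] DERIV_shift[of "\<lambda>x. g n (x, Z)" _ t R] by (simp add: add.commute)
    then show ?thesis unfolding h_def h'_def q_def quad_def
      by (auto intro!: derivative_eq_intros simp: algebra_simps)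
  qed
  have dh': "(h' has_real_derivative (g11 (R, Z) - 2 * A - 2 * \<mu>)) (at 0)"
  proof -
    have "((\<lambda>t. g1 (R + t, Z)) has_real_derivative g11 (R, Z)) (at 0)"
      using G(2)[of R Z] y\<rho> DERIV_shift[of "\<lambda>x. g1 (x, Z)" _ 0 R] by (simp add: add.commute RZ)
    then show ?thesis unfolding h'_def by (auto intro!: derivative_eq_intros simp: algebra_simps)
  qed
  have hmax: "h t \<le> h 0" if "\<bar>t\<bar> < \<delta>" for t
    using ymax[OF inR[OF that]] unfolding RZ nsq by (simp add: h_def)
  note H = second_deriv_local_max[OF \<delta> dh dh' hmax]
  define k where "k = (\<lambda>t. g n (R, Z + t) - q (R, Z + t) - \<mu> * ((R - R0)\<^sup>2 + (Z + t - Z0)\<^sup>2))"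
  define k' where "k' = (\<lambda>t. g2 (R, Z + t) - (2 * B * (Z + t) + D) - 2 * \<mu> * (Z + t - Z0))"
  have dk: "(k has_real_derivative k' t) (at t)" if "\<bar>t\<bar> < \<delta>" for t
  proof -
    have "((\<lambda>t. g n (R, Z + t)) has_real_derivative g2 (R, Z + t)) (at t)"
      using G(3)[of R "Z + t"] subsetD[OF cbd(1) inZ[OF that]] DERIV_shift[of "\<lambda>x. g n (R, x)" _ t Z] by (simp add: add.commute)
    then show ?thesis unfolding k_def k'_def q_def quad_def
      by (auto intro!: derivative_eq_intros simp: algebra_simps)
  qed
  have dk': "(k' has_real_derivative (g22 (R, Z) - 2 * B - 2 * \<mu>)) (at 0)"
  proof -
    have "((\<lambda>t. g2 (R, Z + t)) has_real_derivative g22 (R, Z)) (at 0)"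
      using G(4)[of R Z] y\<rho> DERIV_shift[of "\<lambda>x. g2 (R, x)" _ 0 Z] by (simp add: add.commute RZ)
    then show ?thesis unfolding k'_def by (auto intro!: derivative_eq_intros simp: algebra_simps)
  qed
  have kmax: "k t \<le> k 0" if "\<bar>t\<bar> < \<delta>" for t
    using ymax[OF inZ[OF that]] unfolding RZ nsq by (simp add: k_def)
  note K = second_deriv_local_max(2)[OF \<delta> dk dk' kmax]
  have Rd: "\<bar>R - R0\<bar> \<le> d" using R_bound[OF yc] by (simp add: RZ RZ0)
  have "\<bar>g1 (R, Z)\<bar> \<le> L"
  proof -
    have "g1 (R, Z) = 2 * A * R + C + 2 * \<mu> * (R - R0)" using H(1) by (simp add: h'_def)
    also have "\<bar>\<dots>\<bar> \<le> \<bar>2 * A * R\<bar> + \<bar>C\<bar> + \<bar>2 * \<mu> * (R - R0)\<bar>"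
      by (rule order.trans[OF abs_triangle_ineq], rule add_right_mono, rule abs_triangle_ineq)
    also have "\<dots> \<le> L"
      unfolding L_def
    proof (intro add_mono order_refl)
      show "\<bar>2 * A * R\<bar> \<le> 2 * \<bar>A\<bar> * (\<bar>fst y0\<bar> + d)"
        unfolding abs_mult using Rd by (intro mult_mono) (auto simp: RZ0)
      show "\<bar>2 * \<mu> * (R - R0)\<bar> \<le> 2 * \<mu> * d"
        unfolding abs_mult using Rd \<mu> by (intro mult_mono) auto
    qed
    finally show ?thesis .
  qed
  moreover have "\<bar>3 * s n / (1 + s n * R)\<bar> \<le> 6 * s n"
  proof -
    have "s n * \<bar>R\<bar> \<le> s n * (\<bar>fst y0\<bar> + d)" using Rd s(1)[of n] by (intro mult_left_mono) (auto simp: RZ0)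
    also have "\<dots> \<le> 1 / 2" using sn(1) d by (simp add: field_simps)
    finally have "1 / 2 \<le> 1 + s n * R" using s(1)[of n] abs_ge_minus_self[of "s n * R"] by (simp add: abs_mult)
    then have "3 * s n / (1 + s n * R) \<le> 3 * s n / (1 / 2)" using s(1)[of n] by (intro divide_left_mono) auto
    then show ?thesis using s(1)[of n] \<open>1 / 2 \<le> 1 + s n * R\<close> by simp
  qed
  ultimately have "\<bar>3 * s n / (1 + s n * R) * g1 (R, Z)\<bar> \<le> 6 * s n * L"
    unfolding abs_mult[of _ "g1 (R, Z)"] using s(1)[of n] by (intro mult_mono) auto
  also have "\<dots> \<le> 6 * s n * (L + 1)" using s(1)[of n] by (intro mult_left_mono) auto
  also have "\<dots> \<le> \<mu>"
  proof -
    have "0 < 6 * (L + 1)" using L by simp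
    then have "s n * (6 * (L + 1)) < \<mu>" using sn(2) by (simp only: pos_less_divide_eq)
    then show ?thesis by (simp add: algebra_simps)
  qed
  finally have "f n y \<le> 2 * A + 2 * B + 5 * \<mu>"
    using G(5)[of R Z] y\<rho> H(2) K unfolding RZ by linarith
  moreover have "\<kappa> - \<mu> < f n y" using fv[OF y\<rho>] by linarith
  moreover have "\<kappa> = 2 * A + 2 * B + 8 * \<mu>" by (simp add: \<mu>_def field_simps)
  ultimately show False using \<mu> by linarith
qed

lemma ell_limit_max_principle:
  assumes lim: "ell_limit s \<kappa> v" and s: "\<And>n. 0 < s n" "s \<longlonglongrightarrow> 0" and v: "continuous_on Dom v"
    and AB: "2 * A + 2 * B < \<kappa>" and \<rho>: "0 < \<rho>"
    and bd: "\<And>R Z. -\<rho> \<le> R \<Longrightarrow> R \<le> 0 \<Longrightarrow> \<bar>Z\<bar> \<le> \<rho> \<Longrightarrow> R = 0 \<or> R = -\<rho> \<or> \<bar>Z\<bar> = \<rho> \<Longrightarrow> v (R, Z) - quad A B C D (R, Z) \<le> m"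
    and RZ: "-\<rho> \<le> R" "R \<le> 0" "\<bar>Z\<bar> \<le> \<rho>"
  shows "v (R, Z) - quad A B C D (R, Z) \<le> m"
proof -
  define Q where "Q = cbox (-\<rho>, -\<rho>) (0::real, \<rho>)"
  have Q: "y \<in> Q \<longleftrightarrow> -\<rho> \<le> fst y \<and> fst y \<le> 0 \<and> \<bar>snd y\<bar> \<le> \<rho>" for y
    by (cases y) (auto simp: Q_def cbox_Pair_eq abs_le_iff)
  have "continuous_on Q (\<lambda>y. v y - quad A B C D y)"
    unfolding quad_def by (intro continuous_intros continuous_on_subset[OF v] subsetI) (simp add: Q Dom_def)
  moreover have "compact Q" by (simp add: Q_def)
  moreover have "(R, Z) \<in> Q" using RZ by (simp add: Q)
  then have "Q \<noteq> {}" by blast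
  ultimately obtain y where y: "y \<in> Q" "\<And>z. z \<in> Q \<Longrightarrow> v z - quad A B C D z \<le> v y - quad A B C D y"
    using continuous_attains_sup[of Q "\<lambda>y. v y - quad A B C D y"] by blast
  have "fst y = 0 \<or> fst y = -\<rho> \<or> \<bar>snd y\<bar> = \<rho>"
  proof (rule ccontr)
    assume "\<not> ?thesis"
    then have int: "-\<rho> < fst y" "fst y < 0" "\<bar>snd y\<bar> < \<rho>" using y(1) by (auto simp: Q)
    define r where "r = min (min (fst y + \<rho>) (- fst y)) (\<rho> - \<bar>snd y\<bar>)"
    have r: "0 < r" using int by (simp add: r_def)
    have "z \<in> Q" if "z \<in> ball y r" for z
    proof -
      have "\<bar>fst z - fst y\<bar> < r" "\<bar>snd z - snd y\<bar> < r"
        using that dist_fst_le[of y z] dist_snd_le[of y z] by (auto simp: dist_real_def abs_minus_commute)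
      then show ?thesis unfolding Q r_def by linarith
    qed
    from ell_limit_test[OF lim s v int(2) r y(2)[OF this]] AB show False by simp
  qed
  then have "v y - quad A B C D y \<le> m" using bd[of "fst y" "snd y"] y(1) by (simp add: Q)
  then show ?thesis using y(2)[of "(R, Z)"] RZ by (simp add: Q)
qed

text \<open>A Phragmen-Lindelof argument: on a box of size \<open>\<rho>\<close> the function is at
  most \<open>3 * \<epsilon> * \<rho>\<close>, and a superharmonic quadratic of that height on the
  far sides is only of order \<open>\<epsilon>\<close> at a fixed point, however large
  \<open>\<rho>\<close> is.\<close>

lemma sublinear_zero_boundary:
  assumes lim: "ell_limit s 0 w" and s: "\<And>n. 0 < s n" "s \<longlonglongrightarrow> 0" and w: "continuous_on Dom w"
    and w0: "\<And>Z. w (0, Z) = 0" and sub: "\<And>\<epsilon>. 0 < \<epsilon> \<Longrightarrow> \<exists>C. \<forall>y\<in>Dom. \<bar>w y\<bar> \<le> \<epsilon> * norm y + C"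
    and y: "y \<in> Dom"
  shows "w y \<le> 0"
proof (rule field_le_epsilon)
  fix e :: real assume e: "0 < e"
  obtain R Z where yRZ: "y = (R, Z)" by force
  have R: "R \<le> 0" using y by (simp add: yRZ Dom_def)
  define \<epsilon> where "\<epsilon> = e / (3 * (\<bar>Z\<bar> + 3 * \<bar>R\<bar> + 1))"
  have \<epsilon>: "0 < \<epsilon>" unfolding \<epsilon>_def using e by (intro divide_pos_pos) auto
  obtain C where C: "\<And>y. y \<in> Dom \<Longrightarrow> \<bar>w y\<bar> \<le> \<epsilon> * norm y + C" using sub[OF \<epsilon>] by blast
  \<comment> \<open>\<open>\<rho>\<close> contains the given point and exceeds
    \<open>C / \<epsilon>\<close>, so that the constant is absorbed into the linear growth.\<close>
  define \<rho> where "\<rho> = max (max (\<bar>Z\<bar>) (\<bar>R\<bar>)) (max 1 (C / \<epsilon>))"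
  have \<rho>: "0 < \<rho>" "\<bar>Z\<bar> \<le> \<rho>" "\<bar>R\<bar> \<le> \<rho>" "C \<le> \<epsilon> * \<rho>"
  proof -
    show "C \<le> \<epsilon> * \<rho>" using \<epsilon> by (simp add: \<rho>_def pos_divide_le_eq[symmetric] mult.commute[of \<epsilon>])
    have "1 \<le> \<rho>" unfolding \<rho>_def by linarith
    then show "0 < \<rho>" by simp
    show "\<bar>Z\<bar> \<le> \<rho>" "\<bar>R\<bar> \<le> \<rho>" unfolding \<rho>_def by linarith+
  qed
  have bound: "w (R, Z) \<le> 3 * \<epsilon> * \<rho>" if "-\<rho> \<le> R" "R \<le> 0" "\<bar>Z\<bar> \<le> \<rho>" for R Z
  proof -
    have "norm (R, Z) \<le> 2 * \<rho>" using norm_Pair_le[of R Z] that by simp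
    then have "\<epsilon> * norm (R, Z) \<le> \<epsilon> * (2 * \<rho>)" using \<epsilon> by (intro mult_left_mono) auto
    then show ?thesis using C[of "(R, Z)"] that \<rho>(4) by (simp add: Dom_def)
  qed
  \<comment> \<open>With t = -R / \<rho> and z = Z / \<rho> the barrier is 3 \<epsilon> \<rho> (z^2
    + 3 t - 2 t^2): negative Laplacian, nonnegative at t = 0, and at least 3 \<epsilon> \<rho> at t
    = 1 and at |z| = 1.\<close>
  have "w (R, Z) - quad (- (6 * \<epsilon>) / \<rho>) (3 * \<epsilon> / \<rho>) (- 9 * \<epsilon>) 0 (R, Z) \<le> 0"
  proof (rule ell_limit_max_principle[OF lim s w _ \<rho>(1)])
    show "2 * (- (6 * \<epsilon>) / \<rho>) + 2 * (3 * \<epsilon> / \<rho>) < 0" using \<epsilon> \<rho> by (simp add: field_simps)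
    fix R Z assume b: "-\<rho> \<le> R" "R \<le> 0" "\<bar>Z\<bar> \<le> \<rho>" "R = 0 \<or> R = -\<rho> \<or> \<bar>Z\<bar> = \<rho>"
    define t where "t = - R / \<rho>"
    have t: "0 \<le> t" "t \<le> 1" "R = - t * \<rho>" using b \<rho> by (auto simp: t_def field_simps)
    define z where "z = Z / \<rho>"
    have z: "Z = z * \<rho>" using \<rho> by (simp add: z_def)
    have q: "quad (- (6 * \<epsilon>) / \<rho>) (3 * \<epsilon> / \<rho>) (- 9 * \<epsilon>) 0 (R, Z) = 3 * \<epsilon> * \<rho> * (z\<^sup>2 + 3 * t - 2 * t\<^sup>2)"
      using \<rho>(1) by (simp add: quad_def t z field_simps power2_eq_square)
    have tt: "0 \<le> 3 * t - 2 * t\<^sup>2" using t mult_left_mono[of t 1 t] by (simp add: power2_eq_square)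
    have pos: "0 \<le> 3 * \<epsilon> * \<rho>" using \<epsilon> \<rho> by simp
    show "w (R, Z) - quad (- (6 * \<epsilon>) / \<rho>) (3 * \<epsilon> / \<rho>) (- 9 * \<epsilon>) 0 (R, Z) \<le> 0"
      using b(4)
    proof (elim disjE)
      assume "R = 0"
      then have "w (R, Z) = 0" using w0 by simp
      moreover have "0 \<le> 3 * \<epsilon> * \<rho> * (z\<^sup>2 + 3 * t - 2 * t\<^sup>2)" 
        using tt zero_le_power2[of z] by (intro mult_nonneg_nonneg[OF pos]) linarith
      ultimately show ?thesis unfolding q by simp
    next
      assume "R = -\<rho>"
      then have "t = 1" using \<rho> by (simp add: t_def)
      then have "3 * \<epsilon> * \<rho> * 1 \<le> 3 * \<epsilon> * \<rho> * (z\<^sup>2 + 3 * t - 2 * t\<^sup>2)" using pos by (intro mult_left_mono) auto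
      then show ?thesis unfolding q using bound[OF b(1-3)] by simp
    next
      assume "\<bar>Z\<bar> = \<rho>"
      then have "\<bar>z\<bar> = 1" using \<rho> by (simp add: z_def)
      then have "z\<^sup>2 = 1" by (metis power2_abs power_one)
      then have "3 * \<epsilon> * \<rho> * 1 \<le> 3 * \<epsilon> * \<rho> * (z\<^sup>2 + 3 * t - 2 * t\<^sup>2)" using pos tt by (intro mult_left_mono) auto
      then show ?thesis unfolding q using bound[OF b(1-3)] by simp
    qed
  qed (use \<rho> R in auto)
  then have "w (R, Z) \<le> quad (- (6 * \<epsilon>) / \<rho>) (3 * \<epsilon> / \<rho>) (- 9 * \<epsilon>) 0 (R, Z)" by simp
  also have "\<dots> \<le> 3 * \<epsilon> * \<bar>Z\<bar> + 9 * \<epsilon> * \<bar>R\<bar>"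
  proof -
    have "3 * \<epsilon> / \<rho> * Z\<^sup>2 = 3 * \<epsilon> * (\<bar>Z\<bar> / \<rho> * \<bar>Z\<bar>)" by (simp add: power2_eq_square flip: power2_abs)
    also have "\<dots> \<le> 3 * \<epsilon> * (1 * \<bar>Z\<bar>)" using \<rho> \<epsilon> by (intro mult_left_mono mult_right_mono) auto
    finally have "3 * \<epsilon> / \<rho> * Z\<^sup>2 \<le> 3 * \<epsilon> * \<bar>Z\<bar>" by simp
    moreover have "- (6 * \<epsilon>) / \<rho> * R\<^sup>2 \<le> 0" using \<epsilon> \<rho> by (intro mult_nonpos_nonneg) auto
    moreover have "- 9 * \<epsilon> * R = 9 * \<epsilon> * \<bar>R\<bar>" using R by simp
    ultimately show ?thesis unfolding quad_def fst_conv snd_conv by linarith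
  qed
  also have "\<dots> \<le> \<epsilon> * (3 * (\<bar>Z\<bar> + 3 * \<bar>R\<bar> + 1))" using \<epsilon> by (simp add: algebra_simps)
  also have "\<dots> = e" by (simp add: \<epsilon>_def add_nonneg_eq_0_iff)
  finally show "w y \<le> 0 + e" by (simp add: yRZ)
qed


lemma C1_Dom_uminus:
  assumes "C1_Dom v vR vZ" shows "C1_Dom (\<lambda>y. - v y) (\<lambda>y. - vR y) (\<lambda>y. - vZ y)"
  unfolding C1_Dom_def
proof (intro conjI ballI)
  fix y assume "y \<in> Dom"
  then have "(v has_derivative (\<lambda>h. vR y * fst h + vZ y * snd h)) (at y within Dom)" using assms by (simp add: C1_Dom_def)
  from has_derivative_minus[OF this]
  show "((\<lambda>y. - v y) has_derivative (\<lambda>h. - vR y * fst h + - vZ y * snd h)) (at y within Dom)" by simp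
qed (use assms in \<open>simp_all add: C1_Dom_def continuous_on_minus\<close>)

lemma sublinear_gradient_bound:
  assumes v: "C1_Dom v vR vZ"
    and sub: "(\<lambda>Y. norm (vR Y, vZ Y)) \<in> o[inf at_infinity (principal Dom)](\<lambda>Y. norm Y)" and \<epsilon>: "0 < \<epsilon>"
  shows "\<exists>C\<ge>0. \<forall>y\<in>Dom. \<bar>vR y\<bar> \<le> \<epsilon> * norm y + C \<and> \<bar>vZ y\<bar> \<le> \<epsilon> * norm y + C"
proof -
  have "\<forall>\<^sub>F y in inf at_infinity (principal Dom). norm (norm (vR y, vZ y)) \<le> \<epsilon> * norm (norm y)"
    using landau_o.smallD[OF sub \<epsilon>] .
  then obtain B where B: "\<And>y. y \<in> Dom \<Longrightarrow> B \<le> norm y \<Longrightarrow> norm (vR y, vZ y) \<le> \<epsilon> * norm y"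
    unfolding eventually_inf_principal eventually_at_infinity by auto
  define K where "K = Dom \<inter> cball 0 B"
  have "compact K" unfolding K_def using closed_Dom by (simp add: closed_Int_compact)
  moreover have "continuous_on K (\<lambda>y. norm (vR y, vZ y))"
    using v unfolding C1_Dom_def K_def by (auto intro!: continuous_intros intro: continuous_on_subset)
  ultimately have "bounded ((\<lambda>y. norm (vR y, vZ y)) ` K)" by (intro compact_imp_bounded compact_continuous_image)
  then obtain C where C: "\<And>y. y \<in> K \<Longrightarrow> norm (vR y, vZ y) \<le> C" unfolding bounded_iff by force
  have main: "norm (vR y, vZ y) \<le> \<epsilon> * norm y + \<bar>C\<bar>" if y: "y \<in> Dom" for y
  proof (cases "B \<le> norm y")
    case True
    then show ?thesis using B[OF y] by linarith
  next
    case False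
    then have "norm (vR y, vZ y) \<le> C" using y by (intro C) (simp add: K_def)
    moreover have "0 \<le> \<epsilon> * norm y" using \<epsilon> by simp
    ultimately show ?thesis by linarith
  qed
  have "\<bar>vR y\<bar> \<le> \<epsilon> * norm y + \<bar>C\<bar> \<and> \<bar>vZ y\<bar> \<le> \<epsilon> * norm y + \<bar>C\<bar>" if y: "y \<in> Dom" for y
    using main[OF y] norm_fst_le[of "vR y" "vZ y"] norm_snd_le[of "vZ y" "vR y"] by simp
  then show ?thesis by (intro exI[of _ "\<bar>C\<bar>"]) simp
qed

lemma const_on_boundary:
  assumes v: "C1_Dom v vR vZ" and bdry: "\<And>Z. vZ (0, Z) = 0"
  shows "v (0, Z) = v (0, 0)"
proof (rule DERIV_isconst_all[of "\<lambda>z. v (0, z)" Z 0], intro allI)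
  show "((\<lambda>z. v (0, z)) has_real_derivative 0) (at z)" for z
    using C1_Dom_Z[OF v order_refl, of z] bdry by simp
qed

text \<open>A sublinear gradient makes differences in Z grow sublinearly; they vanish on the
  boundary, hence are nonpositive for shifts of either sign, and \<open>v\<close> depends on R
  alone. What remains is a one-dimensional solution of v'' = 0 in the viscosity sense.\<close>

lemma liouville_half_plane:
  assumes v: "C1_Dom v vR vZ" and bdry: "\<And>Z. vZ (0, Z) = 0"
    and sub: "(\<lambda>Y. norm (vR Y, vZ Y)) \<in> o[inf at_infinity (principal Dom)](\<lambda>Y. norm Y)"
    and lim: "ell_limit s 0 v" and s: "\<And>n. 0 < s n" "s \<longlonglongrightarrow> 0"
  shows "\<exists>a. \<forall>R\<le>0. \<forall>Z. v (R, Z) = v (0, 0) + a * R"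
proof -
  note cv = C1_Dom_continuous[OF v]
  have indep: "v (R, Z + h) - v (R, Z) \<le> 0" if "R \<le> 0" for R Z h
  proof -
    define w where "w = (\<lambda>y. v (y + (0, h)) - v y)"
    have "w (R, Z) \<le> 0"
    proof (rule sublinear_zero_boundary[OF _ s])
      show "ell_limit s 0 w" unfolding w_def by (rule ell_limit_shift_diff[OF lim])
      show "continuous_on Dom w" unfolding w_def
        by (intro continuous_intros cv continuous_on_compose2[OF cv]) (auto simp: Dom_def)
      show "w (0, Z) = 0" for Z
        using const_on_boundary[OF v bdry, of "Z + h"] const_on_boundary[OF v bdry, of Z] by (simp add: w_def)
      show "(R, Z) \<in> Dom" using that by (simp add: Dom_def)
      fix \<epsilon> :: real assume \<epsilon>: "0 < \<epsilon>"
      define \<epsilon>' where "\<epsilon>' = \<epsilon> / (\<bar>h\<bar> + 1)"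
      have \<epsilon>': "0 < \<epsilon>'" using \<epsilon> by (simp add: \<epsilon>'_def)
      from sublinear_gradient_bound[OF v sub \<epsilon>'] obtain C
        where C': "\<forall>y\<in>Dom. \<bar>vR y\<bar> \<le> \<epsilon>' * norm y + C \<and> \<bar>vZ y\<bar> \<le> \<epsilon>' * norm y + C" by (elim exE conjE)
      have C: "\<bar>vZ y\<bar> \<le> \<epsilon>' * norm y + C" if "y \<in> Dom" for y using bspec[OF C' that] ..
      have "\<bar>w y\<bar> \<le> \<epsilon> * norm y + \<bar>h\<bar> * (\<epsilon>' * \<bar>h\<bar> + C)" if y: "y \<in> Dom" for y
      proof -
        obtain R Z where yRZ: "y = (R, Z)" by force
        have R: "R \<le> 0" using y by (simp add: yRZ Dom_def)
        define S where "S = {z. \<bar>z - Z\<bar> \<le> \<bar>h\<bar>}"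
        have cS: "convex S"
        proof -
          have "S = {Z - \<bar>h\<bar>..Z + \<bar>h\<bar>}" by (auto simp: S_def)
          then show ?thesis by simp
        qed
        have "norm (v (R, Z + h) - v (R, Z)) \<le> (\<epsilon>' * (norm y + \<bar>h\<bar>) + C) * norm (Z + h - Z)"
        proof (rule field_differentiable_bound[OF cS, where f = "\<lambda>z. v (R, z)" and f' = "\<lambda>z. vZ (R, z)"])
          fix z assume z: "z \<in> S"
          show "((\<lambda>z. v (R, z)) has_field_derivative vZ (R, z)) (at z within S)"
            using C1_Dom_Z[OF v R] by (rule has_field_derivative_at_within)
          have "norm (R, z) \<le> norm y + \<bar>h\<bar>"
          proof -
            have "norm (R, z) \<le> norm (R, Z) + norm (0 :: real, z - Z)"
              using norm_triangle_ineq[of "(R, Z)" "(0, z - Z)"] by simp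
            then show ?thesis using z by (simp add: yRZ S_def)
          qed
          then have "\<epsilon>' * norm (R, z) \<le> \<epsilon>' * (norm y + \<bar>h\<bar>)" using \<epsilon>' by (intro mult_left_mono) auto
          then show "norm (vZ (R, z)) \<le> \<epsilon>' * (norm y + \<bar>h\<bar>) + C"
            using C[of "(R, z)"] R by (simp add: Dom_def)
        qed (auto simp: S_def)
        then have "\<bar>w y\<bar> \<le> (\<epsilon>' * (norm y + \<bar>h\<bar>) + C) * \<bar>h\<bar>" by (simp add: w_def yRZ)
        also have "\<dots> = \<epsilon>' * \<bar>h\<bar> * norm y + \<bar>h\<bar> * (\<epsilon>' * \<bar>h\<bar> + C)" by (simp add: algebra_simps)
        also have "\<epsilon>' * \<bar>h\<bar> * norm y \<le> \<epsilon> * norm y"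
          using \<epsilon> by (intro mult_right_mono) (auto simp: \<epsilon>'_def field_simps)
        finally show ?thesis by simp
      qed
      then show "\<exists>C. \<forall>y\<in>Dom. \<bar>w y\<bar> \<le> \<epsilon> * norm y + C" by blast
    qed
    then show ?thesis by (simp add: w_def)
  qed
  define V where "V = (\<lambda>R. v (R, 0))"
  have vV: "v (R, Z) = V R" if "R \<le> 0" for R Z
    using indep[OF that, of 0 Z] indep[OF that, of Z "- Z"] by (simp add: V_def)
  \<comment> \<open>Comparison with the chord over \<open>{-L..0}\<close>, from above for \<sigma> =
    1 and from below for \<sigma> = -1. If the graph crossed the chord, adding a small
    \<open>\<mu> * r\<^sup>2\<close> would leave an interior maximum, which the test excludes with
    the quadratic \<open>- \<mu>\<close>.\<close>
  have conv: "\<sigma> * V R \<le> \<sigma> * V 0 + \<sigma> * ((V 0 - V (-L)) / L) * R"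
    if L: "0 < L" and R: "-L \<le> R" "R \<le> 0" and \<sigma>: "\<sigma> = 1 \<or> \<sigma> = -1" for L R \<sigma>
  proof (rule ccontr)
    define sl where "sl = \<sigma> * ((V 0 - V (-L)) / L)"
    define D where "D = (\<lambda>R. \<sigma> * V R - \<sigma> * V 0 - sl * R)"
    assume "\<not> ?thesis"
    then have DR: "0 < D R" by (simp add: D_def sl_def)
    have D0: "D 0 = 0" "D (-L) = 0" using L by (simp_all add: D_def sl_def field_simps)
    define \<mu> where "\<mu> = D R / (2 * L\<^sup>2)"
    have \<mu>: "0 < \<mu>" "\<mu> * L\<^sup>2 < D R" using DR L by (auto simp: \<mu>_def)
    have cV: "continuous_on {-L..0} (\<lambda>r. D r + \<mu> * r\<^sup>2)"
      unfolding D_def V_def by (intro continuous_intros continuous_on_compose2[OF cv]) (auto simp: Dom_def)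
    then obtain r where r: "r \<in> {-L..0}" "\<And>t. t \<in> {-L..0} \<Longrightarrow> D t + \<mu> * t\<^sup>2 \<le> D r + \<mu> * r\<^sup>2"
      using continuous_attains_sup[of "{-L..0}" "\<lambda>r. D r + \<mu> * r\<^sup>2"] L by force
    have "0 \<le> \<mu> * R\<^sup>2" using \<mu> by simp
    then have big: "\<mu> * L\<^sup>2 < D r + \<mu> * r\<^sup>2" using r(2)[of R] R \<mu>(2) by simp
    have "0 \<le> \<mu> * L\<^sup>2" using \<mu>(1) by simp
    then have rn: "r \<noteq> 0" "r \<noteq> -L" using big D0 by auto
    then have r0: "-L < r" "r < 0" using r(1) by auto
    have lim': "ell_limit s 0 (\<lambda>y. \<sigma> * v y)" using \<sigma> lim ell_limit_uminus[OF lim] by auto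
    have "0 \<le> 2 * (- \<mu>) + 2 * 0"
    proof (rule ell_limit_test[OF lim' s, of "(r, 0)" "min (r + L) (- r)" _ _ sl 0])
      show "continuous_on Dom (\<lambda>y. \<sigma> * v y)" by (intro continuous_intros cv)
      fix y assume "y \<in> ball (r, 0::real) (min (r + L) (- r))"
      then have "\<bar>fst y - r\<bar> < min (r + L) (- r)" using dist_fst_le[of "(r, 0)" y] by (simp add: dist_real_def abs_minus_commute)
      then have in_I: "fst y \<in> {-L..0}" by auto
      have "v y = V (fst y)" using vV[of "fst y" "snd y"] in_I by simp
      then show "\<sigma> * v y - quad (- \<mu>) 0 sl 0 y \<le> \<sigma> * v (r, 0) - quad (- \<mu>) 0 sl 0 (r, 0)"
        using r(2)[OF in_I] vV[of r 0] r0 by (simp add: D_def quad_def)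
    qed (use r0 in auto)
    then show False using \<mu> by simp
  qed
  have lin: "V R = V 0 + ((V 0 - V (-L)) / L) * R" if "0 < L" "-L \<le> R" "R \<le> 0" for L R
  proof (rule antisym)
    show "V R \<le> V 0 + ((V 0 - V (-L)) / L) * R" using conv[OF that, of 1] by simp
    have "-1 * V R \<le> -1 * V 0 + -1 * ((V 0 - V (-L)) / L) * R" using conv[OF that, of "-1"] by simp
    then show "V 0 + ((V 0 - V (-L)) / L) * R \<le> V R" by linarith
  qed
  have "V R = V 0 + (V 0 - V (-1)) * R" if "R \<le> 0" for R
  proof -
    define L where "L = max 1 (- R)"
    have L: "0 < L" "-L \<le> R" "- L \<le> -1" by (auto simp: L_def)
    have "(V 0 - V (-L)) / L = V 0 - V (-1)" using lin[OF L(1), of "-1"] L by simp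
    then show ?thesis using lin[OF L(1,2) that] by simp
  qed
  note VR = this
  show ?thesis
  proof (intro exI allI impI)
    fix R Z :: real assume R: "R \<le> 0"
    show "v (R, Z) = v (0, 0) + (V 0 - V (-1)) * R"
      unfolding vV[OF R, of Z] vV[OF order_refl, of 0] by (rule VR[OF R])
  qed
qed

text \<open>A function with Laplacian \<kappa> > 0 oscillates at least quadratically in the size of
  a box, while a sublinear gradient bounds the oscillation by a small multiple of the square. The
  comparison function is the paraboloid \<kappa> / 8 |Y - center|^2 centered at (-\<rho>, 0), of
  Laplacian \<kappa> / 2.\<close>

lemma constant_laplacian_nonpos:
  assumes v: "C1_Dom v vR vZ" and bdry: "\<And>Z. vZ (0, Z) = 0"
    and sub: "(\<lambda>Y. norm (vR Y, vZ Y)) \<in> o[inf at_infinity (principal Dom)](\<lambda>Y. norm Y)"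
    and lim: "ell_limit s \<kappa> v" and s: "\<And>n. 0 < s n" "s \<longlonglongrightarrow> 0"
  shows "\<kappa> \<le> 0"
proof (rule ccontr)
  assume "\<not> \<kappa> \<le> 0"
  then have \<kappa>: "0 < \<kappa>" by simp
  note cv = C1_Dom_continuous[OF v]
  \<comment> \<open>The comparison gives \<kappa> \<rho>^2 / 8 \<le> 2 m. This
    \<open>\<epsilon>\<close> makes the quadratic part of 2 m equal to half of the left side, and
    the choice of \<open>\<rho>\<close> keeps the linear part strictly below the other half.\<close>
  define \<epsilon> where "\<epsilon> = \<kappa> / 256"
  have \<epsilon>: "0 < \<epsilon>" using \<kappa> by (simp add: \<epsilon>_def)
  from sublinear_gradient_bound[OF v sub \<epsilon>] obtain C
    where C0: "0 \<le> C" and C': "\<forall>y\<in>Dom. \<bar>vR y\<bar> \<le> \<epsilon> * norm y + C \<and> \<bar>vZ y\<bar> \<le> \<epsilon> * norm y + C" by (elim exE conjE)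
  have C: "0 \<le> C" "\<And>y. y \<in> Dom \<Longrightarrow> \<bar>vR y\<bar> \<le> \<epsilon> * norm y + C" using C0 bspec[OF C'] by auto
  define \<rho> where "\<rho> = 1 + 64 * C / \<kappa>"
  have \<rho>: "0 < \<rho>" "64 * C < \<kappa> * \<rho>" using C \<kappa> by (auto simp: \<rho>_def field_simps add_pos_nonneg)
  define m where "m = 2 * \<rho> * (4 * \<epsilon> * \<rho> + C)"
  have vb: "\<bar>v (R, Z) - v (0, 0)\<bar> \<le> m" if RZ: "- (2 * \<rho>) \<le> R" "R \<le> 0" "\<bar>Z\<bar> \<le> 2 * \<rho>" for R Z
  proof -
    have "norm (v (R, Z) - v (0, Z)) \<le> (4 * \<epsilon> * \<rho> + C) * norm (R - 0)"
    proof (rule field_differentiable_bound[of "{R..0}" "\<lambda>r. v (r, Z)" "\<lambda>r. vR (r, Z)"])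
      fix r assume r: "r \<in> {R..0}"
      then show "((\<lambda>r. v (r, Z)) has_field_derivative vR (r, Z)) (at r within {R..0})"
        by (intro DERIV_subset[OF C1_Dom_R[OF v]]) auto
      have "norm (r, Z) \<le> 4 * \<rho>" using norm_Pair_le[of r Z] r RZ by simp
      then have "\<epsilon> * norm (r, Z) \<le> \<epsilon> * (4 * \<rho>)" using \<epsilon> by (intro mult_left_mono) auto
      then show "norm (vR (r, Z)) \<le> 4 * \<epsilon> * \<rho> + C" using C(2)[of "(r, Z)"] r by (simp add: Dom_def)
    qed (use RZ in auto)
    also have "\<dots> \<le> (4 * \<epsilon> * \<rho> + C) * (2 * \<rho>)" using RZ \<epsilon> \<rho> C by (intro mult_left_mono) auto
    finally show ?thesis using const_on_boundary[OF v bdry, of Z] by (simp add: m_def mult_ac)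
  qed
  define w where "w = (\<lambda>y. v y - v (0, 0))"
  have q: "quad (\<kappa> / 8) (\<kappa> / 8) (\<kappa> / 4 * \<rho>) 0 (R, Z) = \<kappa> / 8 * ((R + \<rho>)\<^sup>2 + Z\<^sup>2) - \<kappa> / 8 * \<rho>\<^sup>2" for R Z
    by (simp add: quad_def power2_eq_square algebra_simps)
  have "v (-\<rho>, 0) - quad (\<kappa> / 8) (\<kappa> / 8) (\<kappa> / 4 * \<rho>) 0 (-\<rho>, 0) \<le> v (0, 0) + m"
  proof (rule ell_limit_max_principle[OF lim s cv, where \<rho> = "2 * \<rho>"])
    fix R Z assume RZ: "- (2 * \<rho>) \<le> R" "R \<le> 0" "\<bar>Z\<bar> \<le> 2 * \<rho>" "R = 0 \<or> R = - (2 * \<rho>) \<or> \<bar>Z\<bar> = 2 * \<rho>"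
    have "\<rho>\<^sup>2 \<le> (R + \<rho>)\<^sup>2 + Z\<^sup>2"
      using RZ(4)
    proof (elim disjE)
      assume "\<bar>Z\<bar> = 2 * \<rho>"
      then have "Z\<^sup>2 = (2 * \<rho>)\<^sup>2" by (metis power2_abs)
      then show ?thesis using zero_le_power2[of "R + \<rho>"] zero_le_power2[of \<rho>] by (simp add: power_mult_distrib)
    qed auto
    then have "\<kappa> / 8 * \<rho>\<^sup>2 \<le> \<kappa> / 8 * ((R + \<rho>)\<^sup>2 + Z\<^sup>2)" using \<kappa> by (intro mult_left_mono) auto
    then show "v (R, Z) - quad (\<kappa> / 8) (\<kappa> / 8) (\<kappa> / 4 * \<rho>) 0 (R, Z) \<le> v (0, 0) + m"
      using vb[OF RZ(1-3)] unfolding q by linarith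
  qed (use \<kappa> \<rho> in auto)
  then have "\<kappa> / 8 * \<rho>\<^sup>2 \<le> 2 * m" using vb[of "-\<rho>" 0] \<rho> unfolding q by simp
  moreover have "2 * m = 16 * \<epsilon> * \<rho>\<^sup>2 + 4 * C * \<rho>" by (simp add: m_def power2_eq_square algebra_simps)
  moreover have "4 * C * \<rho> < \<kappa> / 16 * \<rho>\<^sup>2" using \<rho> by (simp add: power2_eq_square)
  moreover have "16 * \<epsilon> * \<rho>\<^sup>2 = \<kappa> / 16 * \<rho>\<^sup>2" by (simp add: \<epsilon>_def)
  ultimately show False by linarith
qed

lemma constant_laplacian_zero:
  assumes v: "C1_Dom v vR vZ" and bdry: "\<And>Z. vZ (0, Z) = 0"
    and sub: "(\<lambda>Y. norm (vR Y, vZ Y)) \<in> o[inf at_infinity (principal Dom)](\<lambda>Y. norm Y)"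
    and lim: "ell_limit s \<kappa> v" and s: "\<And>n. 0 < s n" "s \<longlonglongrightarrow> 0"
  shows "\<kappa> = 0"
proof -
  have "(\<lambda>Y. norm (- vR Y, - vZ Y)) \<in> o[inf at_infinity (principal Dom)](\<lambda>Y. norm Y)"
    using sub by (simp add: norm_Pair)
  then have "- \<kappa> \<le> 0"
    using constant_laplacian_nonpos[OF C1_Dom_uminus[OF v] _ _ ell_limit_uminus[OF lim] s] bdry by simp
  then show ?thesis using constant_laplacian_nonpos[OF v bdry sub lim s] by simp
qed

section \<open>Self-similar solutions\<close>

lemma series_first_term:
  fixes c :: "nat \<Rightarrow> real"
  assumes c: "\<And>j. \<bar>c j\<bar> \<le> N * x ^ j" and x: "0 \<le> x" "x \<le> 1 / 2"
  shows "\<bar>(\<Sum>j. c j) - c 0\<bar> \<le> 2 * N * x"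
proof -
  have N: "0 \<le> N" using c[of 0] by simp
  have sx: "summable (\<lambda>j. N * x ^ j)" using x by (intro summable_mult summable_geometric) auto
  have sc: "summable c" using c by (intro summable_comparison_test'[OF sx]) auto
  have sc': "summable (\<lambda>j. \<bar>c (Suc j)\<bar>)"
    by (rule summable_comparison_test'[OF sx[THEN summable_Suc_iff[THEN iffD2]], of 0])
      (simp only: real_norm_def abs_abs c)
  have "\<bar>\<Sum>j. c (Suc j)\<bar> \<le> (\<Sum>j. \<bar>c (Suc j)\<bar>)" by (rule summable_rabs[OF sc'])
  also have "\<dots> \<le> (\<Sum>j. N * x * x ^ j)"
  proof (rule suminf_le[OF _ sc'])
    show "summable (\<lambda>j. N * x * x ^ j)" using x by (intro summable_mult summable_geometric) auto
    show "\<bar>c (Suc j)\<bar> \<le> N * x * x ^ j" for j using c[of "Suc j"] by (simp add: mult.assoc)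
  qed
  also have "\<dots> = N * x * (1 / (1 - x))" using x by (subst suminf_mult) (auto simp: suminf_geometric summable_geometric)
  also have "\<dots> \<le> N * x * 2" using x N by (intro mult_left_mono) (auto simp: field_simps)
  finally show ?thesis using suminf_split_head[OF sc] by (simp add: mult.commute mult.left_commute)
qed

text \<open>Category is enough here since the location and size of the smaller ball are irrelevant:
  it serves only to reach a dense set.\<close>

lemma baire_coefficient_bound:
  fixes a :: "nat \<Rightarrow> 'a::euclidean_space \<Rightarrow> real"
  assumes \<rho>: "0 < \<rho>" and cont: "\<And>k. continuous_on (cball y0 \<rho>) (a k)"
    and fin: "\<And>y. y \<in> cball y0 \<rho> \<Longrightarrow> \<exists>m. \<forall>k. \<bar>a k y\<bar> * b ^ k \<le> m"
  shows "\<exists>y1 \<rho>1 N. 0 < \<rho>1 \<and> ball y1 \<rho>1 \<subseteq> cball y0 \<rho> \<and> (\<forall>y\<in>ball y1 \<rho>1. \<forall>k. \<bar>a k y\<bar> * b ^ k \<le> N)"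
proof (rule ccontr)
  assume no: "\<not> ?thesis"
  define F where "F = (\<lambda>N::nat. {x \<in> cball y0 \<rho>. \<forall>k. \<bar>a k x\<bar> * b ^ k \<le> real N})"
  have cl: "closed (F N)" for N
  proof -
    have "F N = (\<Inter>k. {x \<in> cball y0 \<rho>. \<bar>a k x\<bar> * b ^ k \<le> real N})"
      unfolding F_def by auto
    moreover have "closed {x \<in> cball y0 \<rho>. \<bar>a k x\<bar> * b ^ k \<le> real N}" for k
      using cont by (intro continuous_on_closed_Collect_le continuous_intros) auto
    ultimately show ?thesis by (auto intro!: closed_INT)
  qed
  have "cball y0 \<rho> \<subseteq> closure (\<Inter>(range (\<lambda>N. cball y0 \<rho> - F N)))"
  proof (rule Baire)
    fix T assume "T \<in> range (\<lambda>N. cball y0 \<rho> - F N)"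
    then obtain N where T: "T = cball y0 \<rho> - F N" by auto
    have "openin (top_of_set (cball y0 \<rho>)) T"
      unfolding T by (intro openin_diff openin_subtopology_self closed_subset cl) (auto simp: F_def)
    moreover have "cball y0 \<rho> \<subseteq> closure T"
    proof
      fix y assume y: "y \<in> cball y0 \<rho>"
      show "y \<in> closure T" unfolding closure_approachable
      proof (intro allI impI)
        fix e :: real assume e: "0 < e"
        have "y \<in> closure (ball y0 \<rho>)" using y \<rho> by simp
        then obtain y' where y': "y' \<in> ball y0 \<rho>" "dist y' y < e" using e unfolding closure_approachable by blast
        have "open (ball y0 \<rho> \<inter> ball y e)" by auto
        moreover have "y' \<in> ball y0 \<rho> \<inter> ball y e" using y' by (simp add: dist_commute)
        ultimately obtain r where r: "0 < r" "ball y' r \<subseteq> ball y0 \<rho> \<inter> ball y e"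
          unfolding open_contains_ball by blast
        have "\<not> ball y' r \<subseteq> F N"
        proof
          assume "ball y' r \<subseteq> F N"
          then have "\<forall>y\<in>ball y' r. \<forall>k. \<bar>a k y\<bar> * b ^ k \<le> real N" by (auto simp: F_def)
          moreover have "ball y' r \<subseteq> cball y0 \<rho>" using r(2) ball_subset_cball by blast
          ultimately show False using no r(1) by blast
        qed
        then obtain z where z: "z \<in> ball y' r" "z \<notin> F N" by blast
        then have "z \<in> ball y0 \<rho>" "z \<in> ball y e" using r(2) by auto
        then show "\<exists>z\<in>T. dist z y < e" using z(2) unfolding T by (intro bexI[of _ z]) (auto simp: dist_commute)
      qed
    qed
    ultimately show "openin (top_of_set (cball y0 \<rho>)) T \<and> cball y0 \<rho> \<subseteq> closure T" by blast
  qed auto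
  moreover have "(\<Inter>(range (\<lambda>N. cball y0 \<rho> - F N))) = {}"
  proof (rule equals0I)
    fix y assume y: "y \<in> (\<Inter>(range (\<lambda>N. cball y0 \<rho> - F N)))"
    then have y1: "y \<in> cball y0 \<rho>" "\<And>N. y \<notin> F N" by auto
    obtain m where m: "\<forall>k. \<bar>a k y\<bar> * b ^ k \<le> m" using fin[OF y1(1)] ..
    obtain N :: nat where "m \<le> real N" using real_arch_simple by blast
    then have "y \<in> F N" using m y1(1) unfolding F_def by (auto intro: order_trans[OF m[rule_format]])
    then show False using y1(2) by blast
  qed
  ultimately have "cball y0 \<rho> = {}" by (simp only: closure_empty) blast
  then show False using \<rho> by simp
qed

text \<open>A self-similar path moves all three arguments at once, whereas the solution class speaks
  of partial derivatives. Joint differentiability is assembled in two steps, first in (t, z) and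
  then in r, from continuity of the z- and r-partials.\<close>

lemma C1_spacetime_chain:
  assumes W: "\<And>r' z' t'. \<bar>r' - r\<bar> < e \<Longrightarrow> \<bar>z' - z\<bar> < e \<Longrightarrow> \<bar>t' - t\<bar> < e \<Longrightarrow> (r', z', t') \<in> W" and e: "0 < e"
    and w: "C1_spacetime W w"
    and a: "(a has_real_derivative a') (at x)" "a x = r" and b: "(b has_real_derivative b') (at x)" "b x = z"
    and c: "(c has_real_derivative c') (at x)" "c x = t"
  shows "((\<lambda>x. w (a x) (b x) (c x)) has_real_derivative pr w r z t * a' + pz w r z t * b' + pt w r z t * c') (at x)"
proof -
  define I where "I = (\<lambda>x::real. {x - e<..<x + e})"
  have IW: "(r', z', t') \<in> W" if "r' \<in> I r" "z' \<in> I z" "t' \<in> I t" for r' z' t'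
    by (rule W) (use that in \<open>auto simp: I_def abs_less_iff\<close>)
  have I0: "x \<in> I x" "convex (I x)" "open (I x)" for x using e by (auto simp: I_def)
  have cr: "continuous_on W (\<lambda>(r,z,t). pr w r z t)" and cz: "continuous_on W (\<lambda>(r,z,t). pz w r z t)"
    and dr: "\<And>r z t. (r, z, t) \<in> W \<Longrightarrow> (\<lambda>s. w s z t) differentiable (at r)"
    and dz: "\<And>r z t. (r, z, t) \<in> W \<Longrightarrow> (\<lambda>s. w r s t) differentiable (at z)"
    and dt: "\<And>r z t. (r, z, t) \<in> W \<Longrightarrow> (\<lambda>s. w r z s) differentiable (at t)"
    using w unfolding C1_spacetime_def C1_space_def cont3_def by auto
  have hd: "(f has_derivative (\<lambda>h. deriv f x * h)) (at x within S)" if "f differentiable (at x)" for f :: "real \<Rightarrow> real" and x S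
  proof -
    have "(f has_field_derivative deriv f x) (at x)" using that unfolding DERIV_deriv_iff_real_differentiable .
    then show ?thesis unfolding has_field_derivative_def by (rule has_derivative_at_withinI)
  qed
  have tz: "((\<lambda>(t', z'). w r z' t') has_derivative (\<lambda>(ht, hz). pt w r z t * ht + (pz w r z t *\<^sub>R id_blinfun) hz)) (at (t, z) within I t \<times> I z)"
  proof (rule has_derivative_partialsI)
    show "((\<lambda>x. w r z x) has_derivative (\<lambda>ht. pt w r z t * ht)) (at t within I t)"
      unfolding pt_def by (rule hd[OF dt[OF IW]]) (auto simp: I0)
    show "((\<lambda>y. w r y x) has_derivative blinfun_apply (pz w r y x *\<^sub>R id_blinfun)) (at y within I z)" if "x \<in> I t" "y \<in> I z" for x y
      using hd[OF dz[OF IW[OF I0(1) that(2,1)]], of "I z"] by (simp add: pz_def scaleR_blinfun.rep_eq)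
    have "continuous_on (I t \<times> I z) (\<lambda>p. pz w r (snd p) (fst p))"
      by (rule continuous_on_compose2[OF cz, of _ "\<lambda>p. (r, snd p, fst p)", simplified case_prod_conv])
        (auto intro!: continuous_intros IW I0)
    then have "continuous_on (I t \<times> I z) (\<lambda>(x, y). pz w r y x *\<^sub>R (id_blinfun :: real \<Rightarrow>\<^sub>L real))"
      unfolding case_prod_beta by (intro continuous_intros)
    then show "continuous (at (t, z) within I t \<times> I z) (\<lambda>(x, y). pz w r y x *\<^sub>R (id_blinfun :: real \<Rightarrow>\<^sub>L real))"
      using I0(1) by (auto simp: continuous_on_eq_continuous_within)
  qed (auto simp: I0)
  have "((\<lambda>(q, r'). w r' (snd q) (fst q)) has_derivative (\<lambda>(hq, hr). (case hq of (ht, hz) \<Rightarrow> pt w r z t * ht + (pz w r z t *\<^sub>R id_blinfun) hz) + (pr w r z t *\<^sub>R id_blinfun) hr))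
      (at ((t, z), r) within (I t \<times> I z) \<times> I r)"
  proof (rule has_derivative_partialsI[where f="\<lambda>q r'. w r' (snd q) (fst q)" and x="(t, z)" and y=r
      and fy="\<lambda>q y. pr w y (snd q) (fst q) *\<^sub>R id_blinfun", unfolded fst_conv snd_conv])
    show "((\<lambda>q. w r (snd q) (fst q)) has_derivative (\<lambda>hq. case hq of (ht, hz) \<Rightarrow> pt w r z t * ht + (pz w r z t *\<^sub>R id_blinfun) hz)) (at (t, z) within I t \<times> I z)"
      using tz by (simp only: case_prod_beta')
    show "((\<lambda>y. w y (snd q) (fst q)) has_derivative blinfun_apply (pr w y (snd q) (fst q) *\<^sub>R id_blinfun)) (at y within I r)"
      if "q \<in> I t \<times> I z" "y \<in> I r" for q y
    proof -
      have "(y, snd q, fst q) \<in> W" by (rule IW) (use that in auto)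
      from hd[OF dr[OF this], of "I r"] show ?thesis by (simp add: pr_def scaleR_blinfun.rep_eq)
    qed
    have "continuous_on ((I t \<times> I z) \<times> I r) (\<lambda>p. pr w (snd p) (snd (fst p)) (fst (fst p)))"
      by (rule continuous_on_compose2[OF cr, of _ "\<lambda>p. (snd p, snd (fst p), fst (fst p))", simplified case_prod_conv])
        (auto intro!: continuous_intros IW)
    then have "continuous_on ((I t \<times> I z) \<times> I r) (\<lambda>(q, y). pr w y (snd q) (fst q) *\<^sub>R (id_blinfun :: real \<Rightarrow>\<^sub>L real))"
      unfolding case_prod_beta by (intro continuous_intros)
    then show "continuous (at ((t, z), r) within (I t \<times> I z) \<times> I r) (\<lambda>(q, y). pr w y (snd q) (fst q) *\<^sub>R (id_blinfun :: real \<Rightarrow>\<^sub>L real))"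
      using I0(1) by (auto simp: continuous_on_eq_continuous_within)
  qed (auto simp: I0)
  moreover have "at ((t, z), r) within (I t \<times> I z) \<times> I r = at ((t, z), r)"
    by (rule at_within_open) (auto simp: I0 open_Times)
  ultimately have D: "((\<lambda>(q, r'). w r' (snd q) (fst q)) has_derivative (\<lambda>(hq, hr). pt w r z t * fst hq + pz w r z t * snd hq + pr w r z t * hr)) (at ((c x, b x), a x))"
    by (simp add: case_prod_beta scaleR_blinfun.rep_eq a b c)
  have "((\<lambda>x. ((c x, b x), a x)) has_derivative (\<lambda>h. ((c' * h, b' * h), a' * h))) (at x)"
    using a(1) b(1) c(1) unfolding has_field_derivative_def by (intro has_derivative_Pair)
  from has_derivative_compose[OF this D]
  have "((\<lambda>x. w (a x) (b x) (c x)) has_derivative (\<lambda>h. pt w r z t * (c' * h) + pz w r z t * (b' * h) + pr w r z t * (a' * h))) (at x)"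
    by simp
  then show ?thesis unfolding has_field_derivative_def by (rule has_derivative_eq_rhs) (auto simp: fun_eq_iff algebra_simps)
qed

section \<open>Self-similar form and the rescaled equations\<close>

definition series_form :: "(real \<times> real \<times> real) set \<Rightarrow> real \<Rightarrow> real \<Rightarrow> real \<Rightarrow> (nat \<Rightarrow> real \<times> real \<Rightarrow> real) \<Rightarrow> (real \<Rightarrow> real \<Rightarrow> real \<Rightarrow> real) \<Rightarrow> bool" where
  "series_form W T \<gamma> \<beta> A w \<longleftrightarrow> (\<forall>r z t. (r, z, t) \<in> W \<longrightarrow>
     (\<lambda>k. A k ((r - 1) * (T - t) powr (-\<gamma>), z * (T - t) powr (-\<gamma>)) * ((T - t) powr \<gamma>) ^ k) sums (w r z t * (T - t) powr (-\<beta>)))"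

definition half_box :: "real \<Rightarrow> (real \<times> real) set" where
  "half_box M = {y. - M < fst y \<and> fst y < 0 \<and> \<bar>snd y\<bar> < M}"

text \<open>Both shapes of the region enter only through \<open>good_interval\<close>: arbitrarily
  close to T there are whole time intervals on which a profile box of any prescribed size lies in
  the region. Single times would not do, since time derivatives and intervals of s are needed; a
  full left neighbourhood of T is not provided by a limsup condition.\<close>

locale self_similar_flow =
  fixes \<gamma> T :: real and W :: "(real \<times> real \<times> real) set" and psi om :: "real \<Rightarrow> real \<Rightarrow> real \<Rightarrow> real"
    and Psi PsiR PsiZ Om :: "nat \<Rightarrow> real \<times> real \<Rightarrow> real"
  assumes \<gamma>: "0 < \<gamma>"
    and W_bounds: "\<And>r z t. (r, z, t) \<in> W \<Longrightarrow> 0 < r \<and> r < 1 \<and> t < T"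
    and good_interval: "\<And>M \<epsilon>. 0 < M \<Longrightarrow> 0 < \<epsilon> \<Longrightarrow> \<exists>t0 t1. T - \<epsilon> < t0 \<and> t0 < t1 \<and> t1 < T \<and>
      (\<forall>t\<in>{t0..t1}. \<forall>y\<in>half_box M. (1 + (T - t) powr \<gamma> * fst y, (T - t) powr \<gamma> * snd y, t) \<in> W)"
    and psi_C1: "C1_space W psi" "C1_space W (pr psi)" "C1_space W (pz psi)"
    and poisson: "\<And>r z t. (r, z, t) \<in> W \<Longrightarrow> pr (pr psi) r z t + 3 / r * pr psi r z t + pz (pz psi) r z t = - om r z t"
    and psi_form: "series_form W T \<gamma> (-1 + 2 * \<gamma>) Psi psi"
    and om_form: "series_form W T \<gamma> (-1) Om om"
    and Om_cont: "\<And>k. continuous_on Dom (Om k)"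
    and Psi_C1: "\<And>k. C1_Dom (Psi k) (PsiR k) (PsiZ k)"
    and Psi_sublinear: "\<And>k. (\<lambda>Y. norm (PsiR k Y, PsiZ k Y)) \<in> o[inf at_infinity (principal Dom)](\<lambda>Y. norm Y)"
    and Psi_bdry: "\<And>k Z. PsiZ k (0, Z) = 0"
begin

definition sc :: "real \<Rightarrow> real" where "sc t = (T - t) powr \<gamma>"

definition good :: "real \<Rightarrow> real \<Rightarrow> bool" where
  "good t M \<longleftrightarrow> t < T \<and> (\<forall>y\<in>half_box M. (1 + sc t * fst y, sc t * snd y, t) \<in> W)"

definition prof :: "real \<Rightarrow> (real \<Rightarrow> real \<Rightarrow> real \<Rightarrow> real) \<Rightarrow> real \<Rightarrow> real \<times> real \<Rightarrow> real" where
  "prof \<beta> w t y = w (1 + sc t * fst y) (sc t * snd y) t * (T - t) powr (-\<beta>)"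

lemma open_half_box: "open (half_box M)"
  unfolding half_box_def by (intro open_Collect_conj open_Collect_less continuous_intros)

lemma sc_pos: "t < T \<Longrightarrow> 0 < sc t"
  by (simp add: sc_def)

lemma good_in_W: "good t M \<Longrightarrow> (R, Z) \<in> half_box M \<Longrightarrow> (1 + sc t * R, sc t * Z, t) \<in> W"
  by (auto simp: good_def)

lemma prof_sums:
  assumes "series_form W T \<gamma> \<beta> A w" "good t M" "y \<in> half_box M"
  shows "(\<lambda>k. A k y * sc t ^ k) sums prof \<beta> w t y"
proof -
  have t: "t < T" and W: "(1 + sc t * fst y, sc t * snd y, t) \<in> W" using assms by (auto simp: good_def)
  have "sc t * (T - t) powr (-\<gamma>) = 1" using t by (simp add: sc_def powr_minus)
  then have i: "sc t * x * (T - t) powr (-\<gamma>) = x" for x by (simp add: mult.assoc mult.left_commute)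
  have "(\<lambda>k. A k ((1 + sc t * fst y - 1) * (T - t) powr (-\<gamma>), sc t * snd y * (T - t) powr (-\<gamma>)) * ((T - t) powr \<gamma>) ^ k) sums prof \<beta> w t y"
    unfolding prof_def using assms(1) W unfolding series_form_def by blast
  then show ?thesis by (simp only: add_diff_cancel_left' i prod.collapse flip: sc_def)
qed

lemma
  assumes w: "C1_space W w" and g: "good t M" "(R, Z) \<in> half_box M"
  shows prof_deriv_R: "((\<lambda>x. prof \<beta> w t (x, Z)) has_real_derivative pr w (1 + sc t * R) (sc t * Z) t * sc t * (T - t) powr (-\<beta>)) (at R)"
    and prof_deriv_Z: "((\<lambda>z. prof \<beta> w t (R, z)) has_real_derivative pz w (1 + sc t * R) (sc t * Z) t * sc t * (T - t) powr (-\<beta>)) (at Z)"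
proof -
  have W: "(1 + sc t * R, sc t * Z, t) \<in> W" by (rule good_in_W[OF g])
  have "(\<lambda>s. w s (sc t * Z) t) differentiable (at (1 + sc t * R))" "(\<lambda>s. w (1 + sc t * R) s t) differentiable (at (sc t * Z))"
    using w W unfolding C1_space_def by auto
  then have D: "((\<lambda>s. w s (sc t * Z) t) has_real_derivative pr w (1 + sc t * R) (sc t * Z) t) (at (1 + sc t * R))"
     "((\<lambda>s. w (1 + sc t * R) s t) has_real_derivative pz w (1 + sc t * R) (sc t * Z) t) (at (sc t * Z))"
    unfolding pr_def pz_def DERIV_deriv_iff_real_differentiable[symmetric] .
  show "((\<lambda>x. prof \<beta> w t (x, Z)) has_real_derivative pr w (1 + sc t * R) (sc t * Z) t * sc t * (T - t) powr (-\<beta>)) (at R)"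
    unfolding prof_def fst_conv snd_conv
    by (rule DERIV_cmult_right, rule DERIV_chain2[where f="\<lambda>s. w s (sc t * Z) t" and g="\<lambda>x. 1 + sc t * x" and x=R, OF D(1)]) (auto intro!: derivative_eq_intros)
  show "((\<lambda>z. prof \<beta> w t (R, z)) has_real_derivative pz w (1 + sc t * R) (sc t * Z) t * sc t * (T - t) powr (-\<beta>)) (at Z)"
    unfolding prof_def fst_conv snd_conv
    by (rule DERIV_cmult_right, rule DERIV_chain2[where f="\<lambda>s. w (1 + sc t * R) s t" and g="\<lambda>x. sc t * x" and x=Z, OF D(2)]) (auto intro!: derivative_eq_intros)
qed

lemma prof_cont:
  assumes "cont3 W w" "good t M"
  shows "continuous_on (half_box M) (prof \<beta> w t)"
proof -
  have "continuous_on (half_box M) (\<lambda>y. w (1 + sc t * fst y) (sc t * snd y) t)"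
    by (rule continuous_on_compose2[OF assms(1)[unfolded cont3_def], of _ "\<lambda>y. (1 + sc t * fst y, sc t * snd y, t)", simplified case_prod_conv])
      (use assms(2) in \<open>auto intro!: continuous_intros simp: good_def\<close>)
  then show ?thesis unfolding prof_def by (intro continuous_intros)
qed

lemma ell_prof:
  assumes g: "good t M"
  shows "ell (sc t) (half_box M) (prof (-1 + 2 * \<gamma>) psi t) (\<lambda>y. - prof (-1) om t y)"
  unfolding ell_def
proof (intro conjI)
  have t: "t < T" using g by (simp add: good_def)
  define s where "s = sc t"
  define Q where "Q = (T - t) powr (1 - 2 * \<gamma>)"
  \<comment> \<open>Two spatial derivatives of the scaling of \<open>psi\<close> produce exactly the
    scaling of \<open>om\<close>, so no power of T - t is left in the profile equation.\<close>
  have sQ: "s * s * Q = T - t" using t by (simp add: s_def Q_def sc_def flip: powr_add)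
  note dR = prof_deriv_R[OF psi_C1(1) g, of _ _ "-1 + 2 * \<gamma>"] prof_deriv_R[OF psi_C1(2) g, of _ _ 0]
  note dZ = prof_deriv_Z[OF psi_C1(1) g, of _ _ "-1 + 2 * \<gamma>"] prof_deriv_Z[OF psi_C1(3) g, of _ _ 0]
  show "open (half_box M)" by (rule open_half_box)
  show "continuous_on (half_box M) (prof (-1 + 2 * \<gamma>) psi t)"
    using psi_C1(1) g by (intro prof_cont[OF _ g]) (simp add: C1_space_def)
  have pos: "0 < 1 + sc t * R" if "(R, Z) \<in> half_box M" for R Z using W_bounds[OF good_in_W[OF g that]] by simp
  then show "\<forall>R Z. (R, Z) \<in> half_box M \<longrightarrow> 0 < 1 + sc t * R" by blast
  let ?r = "\<lambda>y. 1 + s * fst y" and ?z = "\<lambda>y. s * snd y"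
  show "\<exists>g1 g11 g2 g22. \<forall>R Z. (R, Z) \<in> half_box M \<longrightarrow>
        ((\<lambda>x. prof (-1 + 2 * \<gamma>) psi t (x, Z)) has_real_derivative g1 (R, Z)) (at R) \<and> ((\<lambda>x. g1 (x, Z)) has_real_derivative g11 (R, Z)) (at R) \<and>
        ((\<lambda>z. prof (-1 + 2 * \<gamma>) psi t (R, z)) has_real_derivative g2 (R, Z)) (at Z) \<and> ((\<lambda>z. g2 (R, z)) has_real_derivative g22 (R, Z)) (at Z) \<and>
        g11 (R, Z) + 3 * sc t / (1 + sc t * R) * g1 (R, Z) + g22 (R, Z) = - prof (-1) om t (R, Z)"
  proof (rule exI[of _ "\<lambda>y. pr psi (?r y) (?z y) t * s * Q"], rule exI[of _ "\<lambda>y. pr (pr psi) (?r y) (?z y) t * s * s * Q"],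
      rule exI[of _ "\<lambda>y. pz psi (?r y) (?z y) t * s * Q"], rule exI[of _ "\<lambda>y. pz (pz psi) (?r y) (?z y) t * s * s * Q"],
      intro allI impI conjI)
    fix R Z assume b: "(R, Z) \<in> half_box M"
    show "((\<lambda>x. prof (-1 + 2 * \<gamma>) psi t (x, Z)) has_real_derivative pr psi (?r (R, Z)) (?z (R, Z)) t * s * Q) (at R)"
      using dR(1)[OF b] by (simp add: Q_def s_def)
    show "((\<lambda>z. prof (-1 + 2 * \<gamma>) psi t (R, z)) has_real_derivative pz psi (?r (R, Z)) (?z (R, Z)) t * s * Q) (at Z)"
      using dZ(1)[OF b] by (simp add: Q_def s_def)
    have "((\<lambda>x. prof 0 (pr psi) t (x, Z) * (s * Q)) has_real_derivative pr (pr psi) (?r (R, Z)) (?z (R, Z)) t * s * (s * Q)) (at R)"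
      using DERIV_cmult_right[OF dR(2)[OF b], of "s * Q"] t by (simp add: s_def)
    then show "((\<lambda>x. pr psi (?r (x, Z)) (?z (x, Z)) t * s * Q) has_real_derivative pr (pr psi) (?r (R, Z)) (?z (R, Z)) t * s * s * Q) (at R)"
      using t by (simp add: prof_def s_def mult.assoc)
    have "((\<lambda>z. prof 0 (pz psi) t (R, z) * (s * Q)) has_real_derivative pz (pz psi) (?r (R, Z)) (?z (R, Z)) t * s * (s * Q)) (at Z)"
      using DERIV_cmult_right[OF dZ(2)[OF b], of "s * Q"] t by (simp add: s_def)
    then show "((\<lambda>z. pz psi (?r (R, z)) (?z (R, z)) t * s * Q) has_real_derivative pz (pz psi) (?r (R, Z)) (?z (R, Z)) t * s * s * Q) (at Z)"
      using t by (simp add: prof_def s_def mult.assoc)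
    define p pp qq where "p = pr psi (1 + s * R) (s * Z) t" and "pp = pr (pr psi) (1 + s * R) (s * Z) t" and "qq = pz (pz psi) (1 + s * R) (s * Z) t"
    have "pp + 3 / (1 + s * R) * p + qq = - om (1 + s * R) (s * Z) t"
      using poisson[OF good_in_W[OF g b]] by (simp add: p_def pp_def qq_def s_def)
    then have "(s * s * Q) * (pp + 3 / (1 + s * R) * p + qq) = (T - t) * - om (1 + s * R) (s * Z) t" by (simp only: sQ)
    moreover have "pp * s * s * Q + 3 * s / (1 + s * R) * (p * s * Q) + qq * s * s * Q = (s * s * Q) * (pp + 3 / (1 + s * R) * p + qq)"
      by (simp add: algebra_simps)
    moreover have "(T - t) powr 1 = T - t" using t by simp
    ultimately show "pr (pr psi) (?r (R, Z)) (?z (R, Z)) t * s * s * Q + 3 * sc t / (1 + sc t * R) * (pr psi (?r (R, Z)) (?z (R, Z)) t * s * Q)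
        + pz (pz psi) (?r (R, Z)) (?z (R, Z)) t * s * s * Q = - prof (-1) om t (R, Z)"
      unfolding prof_def p_def pp_def qq_def s_def by (simp add: mult.commute)
  qed
qed

lemma sc_deriv: "t < T \<Longrightarrow> (sc has_real_derivative - \<gamma> * sc t / (T - t)) (at t)"
proof -
  assume t: "t < T"
  have "((\<lambda>t. T - t) has_real_derivative -1) (at t)" by (auto intro!: derivative_eq_intros)
  from DERIV_chain2[OF has_real_derivative_powr this, of \<gamma>] t show ?thesis
    unfolding sc_def by (simp add: powr_diff)
qed

text \<open>The time derivative along a curve of fixed (R, Z) is computed twice, by the chain rule
  and by termwise differentiation of the power series in s. Everything that disappears in the limit,
  namely stretching, \<open>diffs\<close> and the corrections to the velocity, shows an explicit
  factor \<open>sc t\<close>.\<close>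

lemma transport_scaled:
  assumes w: "C1_spacetime W w" and A: "series_form W T \<gamma> \<beta> A w"
    and e: "0 < e" and g: "\<And>t'. \<bar>t' - t\<bar> < e \<Longrightarrow> good t' M" and b: "(R, Z) \<in> half_box M"
    and pde: "\<And>r z t. (r, z, t) \<in> W \<Longrightarrow> pt w r z t + (- r * pz psi r z t) * pr w r z t
       + (2 * psi r z t + r * pr psi r z t) * pz w r z t = \<kappa> * w r z t * pz psi r z t"
    and p: "((\<lambda>x. prof \<beta> w t (x, Z)) has_real_derivative p) (at R)"
    and q: "((\<lambda>z. prof \<beta> w t (R, z)) has_real_derivative q) (at Z)"
    and vr: "((\<lambda>x. prof (-1 + 2 * \<gamma>) psi t (x, Z)) has_real_derivative vr) (at R)"
    and vz: "((\<lambda>z. prof (-1 + 2 * \<gamma>) psi t (R, z)) has_real_derivative vz) (at Z)"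
  shows "- \<beta> * prof \<beta> w t (R, Z) + (\<gamma> * R - (1 + sc t * R) * vz) * p
    + (\<gamma> * Z + (1 + sc t * R) * vr + 2 * sc t * prof (-1 + 2 * \<gamma>) psi t (R, Z)) * q
    = sc t * (\<kappa> * prof \<beta> w t (R, Z) * vz + \<gamma> * (\<Sum>n. diffs (\<lambda>k. A k (R, Z)) n * sc t ^ n))"
proof -
  define s \<tau> P Q r z D where "s = sc t" and "\<tau> = T - t" and "P = (T - t) powr (-\<beta>)" and "Q = (T - t) powr (1 - 2 * \<gamma>)"
    and "r = 1 + s * R" and "z = s * Z" and "D = (\<Sum>n. diffs (\<lambda>k. A k (R, Z)) n * s ^ n)"
  have gt: "good t M" using g[of t] e by simp
  then have t: "0 < \<tau>" "t < T" by (auto simp: good_def \<tau>_def)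
  have w1: "C1_space W w" using w by (simp add: C1_spacetime_def)
  have rW: "(r, z, t) \<in> W" unfolding r_def z_def s_def by (rule good_in_W[OF gt b])
  have sQ: "s * s * Q = \<tau>" using t by (simp add: s_def Q_def sc_def \<tau>_def flip: powr_add)
  have pe: "p = pr w r z t * s * P" unfolding r_def z_def s_def P_def by (rule DERIV_unique[OF p prof_deriv_R[OF w1 gt b]])
  have qe: "q = pz w r z t * s * P" unfolding r_def z_def s_def P_def by (rule DERIV_unique[OF q prof_deriv_Z[OF w1 gt b]])
  have vre: "vr = pr psi r z t * s * Q" using DERIV_unique[OF vr prof_deriv_R[OF psi_C1(1) gt b]]
    by (simp add: r_def z_def s_def Q_def)
  have vze: "vz = pz psi r z t * s * Q" using DERIV_unique[OF vz prof_deriv_Z[OF psi_C1(1) gt b]]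
    by (simp add: r_def z_def s_def Q_def)
  define F G where "F = prof \<beta> w t (R, Z)" and "G = prof (-1 + 2 * \<gamma>) psi t (R, Z)"
  have Fe: "F = w r z t * P" and Ge: "G = psi r z t * Q" by (simp_all add: F_def G_def prof_def r_def z_def s_def P_def Q_def)
  have scd: "(sc has_real_derivative - \<gamma> * s / \<tau>) (at t)" unfolding s_def \<tau>_def by (rule sc_deriv[OF t(2)])
  \<comment> \<open>Convergence at a slightly earlier time means convergence at a larger s, so the
    current s lies strictly inside the disc of convergence.\<close>
  have Dder: "((\<lambda>x. \<Sum>k. A k (R, Z) * x ^ k) has_real_derivative D) (at s)"
    unfolding D_def
  proof (rule termdiffs_strong)
    have "good (t - e / 2) M" using e by (intro g) simp
    then show "summable (\<lambda>k. A k (R, Z) * sc (t - e / 2) ^ k)" using prof_sums[OF A _ b] by (blast dest: sums_summable)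
    show "norm s < norm (sc (t - e / 2))" using t e \<gamma> by (simp add: s_def sc_def powr_less_mono2)
  qed
  \<comment> \<open>The region is not assumed open; the neighbourhood comes from all nearby times
    being good, as the preimage of the open box under the scaling map.\<close>
  have open_nbhd: "\<exists>e'>0. \<forall>r' z' t'. \<bar>r' - r\<bar> < e' \<longrightarrow> \<bar>z' - z\<bar> < e' \<longrightarrow> \<bar>t' - t\<bar> < e' \<longrightarrow> (r', z', t') \<in> W"
  proof -
    define h where "h = (\<lambda>p::real \<times> real \<times> real. ((fst p - 1) * (T - snd (snd p)) powr (-\<gamma>), fst (snd p) * (T - snd (snd p)) powr (-\<gamma>)))"
    define V where "V = {p::real \<times> real \<times> real. \<bar>snd (snd p) - t\<bar> < e \<and> snd (snd p) < T}"
    have "continuous_on V h" unfolding h_def V_def by (intro continuous_intros) auto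
    moreover have "open V" unfolding V_def by (intro open_Collect_conj open_Collect_less continuous_intros)
    ultimately have op: "open (V \<inter> h -` half_box M)" by (intro continuous_open_preimage open_half_box)
    have "(T - t) powr (-\<gamma>) * s = 1" using t by (simp add: s_def sc_def powr_minus)
    then have hrz: "h (r, z, t) = (R, Z)" by (simp add: h_def r_def z_def mult.commute mult.left_commute)
    then have "(r, z, t) \<in> V \<inter> h -` half_box M" using b e t by (simp add: V_def)
    then obtain d where d: "0 < d" "ball (r, z, t) d \<subseteq> V \<inter> h -` half_box M" using op unfolding open_contains_ball by blast
    show ?thesis
    proof (intro exI[of _ "d / 3"] conjI allI impI)
      fix r' z' t' assume a: "\<bar>r' - r\<bar> < d / 3" "\<bar>z' - z\<bar> < d / 3" "\<bar>t' - t\<bar> < d / 3"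
      have "dist (r, z, t) (r', z', t') \<le> \<bar>r' - r\<bar> + (\<bar>z' - z\<bar> + \<bar>t' - t\<bar>)"
        using norm_Pair_le[of "r - r'" "(z - z', t - t')"] norm_Pair_le[of "z - z'" "t - t'"] by (simp add: dist_norm)
      then have m: "(r', z', t') \<in> ball (r, z, t) d" using a by simp
      then have m': "(r', z', t') \<in> V" "h (r', z', t') \<in> half_box M" using d(2) by auto
      then have g': "good t' M" and t': "t' < T" by (auto intro: g simp: V_def)
      have "sc t' * (T - t') powr (-\<gamma>) = 1" using t' by (simp add: sc_def powr_minus)
      then have i: "sc t' * (x * (T - t') powr (-\<gamma>)) = x" for x by (simp add: mult.left_commute)
      from good_in_W[OF g' m'(2)[unfolded h_def]] show "(r', z', t') \<in> W" by (simp only: fst_conv snd_conv i) simp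
    qed (use d in auto)
  qed
  then obtain e' where e': "0 < e'" "\<And>r' z' t'. \<bar>r' - r\<bar> < e' \<Longrightarrow> \<bar>z' - z\<bar> < e' \<Longrightarrow> \<bar>t' - t\<bar> < e' \<Longrightarrow> (r', z', t') \<in> W" by blast
  have "((\<lambda>x. w (1 + sc x * R) (sc x * Z) x) has_real_derivative
      pr w r z t * (- \<gamma> * s / \<tau> * R) + pz w r z t * (- \<gamma> * s / \<tau> * Z) + pt w r z t * 1) (at t)"
    by (rule C1_spacetime_chain[OF e'(2,1) w]) (auto intro!: derivative_eq_intros scd simp: r_def z_def s_def)
  moreover have "((\<lambda>x. w (1 + sc x * R) (sc x * Z) x) has_real_derivative
      - \<beta> * \<tau> powr (\<beta> - 1) * F + \<tau> powr \<beta> * (D * (- \<gamma> * s / \<tau>))) (at t)"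
  proof (rule has_field_derivative_transform_within_open[where S="{t - e<..<t + e}"])
    have Ds: "((\<lambda>x. \<Sum>k. A k (R, Z) * sc x ^ k) has_real_derivative D * (- \<gamma> * s / \<tau>)) (at t)"
      by (rule DERIV_chain2[where f="\<lambda>x. \<Sum>k. A k (R, Z) * x ^ k" and g=sc and x=t, OF _ scd]) (use Dder in \<open>simp add: s_def\<close>)
    have Fs: "F = (\<Sum>k. A k (R, Z) * sc t ^ k)" unfolding F_def by (rule sums_unique[OF prof_sums[OF A gt b]])
    have "((\<lambda>x. (T - x) powr \<beta>) has_real_derivative - \<beta> * \<tau> powr (\<beta> - 1)) (at t)"
      using t by (auto intro!: derivative_eq_intros simp: \<tau>_def)
    from DERIV_mult[OF this Ds]
    show "((\<lambda>x. (T - x) powr \<beta> * (\<Sum>k. A k (R, Z) * sc x ^ k)) has_real_derivative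
      - \<beta> * \<tau> powr (\<beta> - 1) * F + \<tau> powr \<beta> * (D * (- \<gamma> * s / \<tau>))) (at t)"
      by (simp add: Fs \<tau>_def mult.commute)
    fix x assume "x \<in> {t - e<..<t + e}"
    then have gx: "good x M" by (intro g) auto
    have x: "x < T" using gx by (simp add: good_def)
    show "(T - x) powr \<beta> * (\<Sum>k. A k (R, Z) * sc x ^ k) = w (1 + sc x * R) (sc x * Z) x"
      unfolding sums_unique[OF prof_sums[OF A gx b], symmetric] using x by (simp add: prof_def powr_minus)
  qed (use e in auto)
  ultimately have ch: "pr w r z t * (- \<gamma> * s / \<tau> * R) + pz w r z t * (- \<gamma> * s / \<tau> * Z) + pt w r z t
     = - \<beta> * \<tau> powr (\<beta> - 1) * F + \<tau> powr \<beta> * (D * (- \<gamma> * s / \<tau>))" using DERIV_unique by fastforce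
  have P1: "\<tau> powr \<beta> * P = 1" "\<tau> * (\<tau> powr (\<beta> - 1) * P) = 1" using t by (simp_all add: P_def \<tau>_def powr_minus powr_diff)
  \<comment> \<open>Multiplication by \<open>\<tau> * P\<close> turns the partial derivatives of
    \<open>w\<close> into those of its profile, since s * s * Q = \<tau>.\<close>
  have "\<tau> * P * (pr w r z t * (- \<gamma> * s / \<tau> * R) + pz w r z t * (- \<gamma> * s / \<tau> * Z) + pt w r z t)
     = - \<gamma> * (R * p + Z * q) + \<tau> * P * pt w r z t"
    using t by (simp add: pe qe field_simps)
  moreover have "\<tau> * P * (- \<beta> * \<tau> powr (\<beta> - 1) * F + \<tau> powr \<beta> * (D * (- \<gamma> * s / \<tau>)))
     = - \<beta> * (\<tau> * (\<tau> powr (\<beta> - 1) * P)) * F - (\<tau> powr \<beta> * P) * (D * \<gamma> * s)"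
    using t by (simp add: algebra_simps)
  ultimately have c1: "- \<gamma> * (R * p + Z * q) + \<tau> * P * pt w r z t = - \<beta> * F - D * \<gamma> * s"
    using ch P1 by simp
  have h: "\<tau> * pz psi r z t = s * vz" "\<tau> * pr psi r z t = s * vr" "\<tau> * psi r z t = s * (s * G)"
    by (simp_all add: vze vre Ge flip: sQ)
  have "\<tau> * P * pt w r z t = \<kappa> * (w r z t * P) * (\<tau> * pz psi r z t) + r * (\<tau> * pz psi r z t) * (pr w r z t * P)
     - (2 * (\<tau> * psi r z t) + r * (\<tau> * pr psi r z t)) * (pz w r z t * P)"
  proof -
    have "pt w r z t = \<kappa> * w r z t * pz psi r z t + r * pz psi r z t * pr w r z t - (2 * psi r z t + r * pr psi r z t) * pz w r z t"
      using pde[OF rW] by simp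
    then show ?thesis by (simp only:) (simp add: algebra_simps)
  qed
  also have "\<dots> = \<kappa> * F * (s * vz) + r * vz * p - (2 * s * G + r * vr) * q"
    unfolding h Fe pe qe by (simp add: algebra_simps)
  finally show ?thesis using c1 unfolding F_def[symmetric] G_def[symmetric] s_def[symmetric] D_def[symmetric] r_def[symmetric]
    by (simp add: algebra_simps)
qed

end

lemma uniform_limit_series:
  fixes A :: "nat \<Rightarrow> 'a \<Rightarrow> real"
  assumes A: "\<And>y k. y \<in> S \<Longrightarrow> \<bar>A k y\<bar> * b ^ k \<le> N" and b: "0 < b" and s: "\<And>n. 0 < s n" "s \<longlonglongrightarrow> 0"
    and F: "\<forall>\<^sub>F n in sequentially. \<forall>y\<in>S. (\<lambda>k. A k y * s n ^ k) sums F n y"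
  shows "uniform_limit S F (A 0) sequentially"
proof (rule uniform_limitI)
  fix \<epsilon> :: real assume \<epsilon>: "0 < \<epsilon>"
  have "(\<lambda>n. 2 * N * (s n / b)) \<longlonglongrightarrow> 2 * N * (0 / b)" using b s by (intro tendsto_intros) auto
  then have 1: "\<forall>\<^sub>F n in sequentially. 2 * N * (s n / b) < \<epsilon>" using \<epsilon> by (intro order_tendstoD(2)) auto
  have 2: "\<forall>\<^sub>F n in sequentially. s n < b / 2" using b s by (intro order_tendstoD(2)) auto
  show "\<forall>\<^sub>F n in sequentially. \<forall>y\<in>S. dist (F n y) (A 0 y) < \<epsilon>"
    using 1 2 F
  proof eventually_elim
    case (elim n)
    show ?case
    proof
      fix y assume y: "y \<in> S"
      have "\<bar>A j y * s n ^ j\<bar> \<le> N * (s n / b) ^ j" for j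
      proof -
        have "\<bar>A j y * s n ^ j\<bar> = \<bar>A j y\<bar> * b ^ j * (s n / b) ^ j" using b s(1)[of n] by (simp add: abs_mult power_divide)
        also have "\<dots> \<le> N * (s n / b) ^ j" using b s(1)[of n] A[OF y, of j] by (intro mult_right_mono) auto
        finally show ?thesis .
      qed
      from series_first_term[OF this] have "\<bar>(\<Sum>k. A k y * s n ^ k) - A 0 y\<bar> \<le> 2 * N * (s n / b)"
        using b s(1)[of n] elim(2) by (simp add: field_simps)
      then show "dist (F n y) (A 0 y) < \<epsilon>"
        using elim(1) sums_unique[OF elim(3)[rule_format, OF y]] by (simp add: dist_real_def)
    qed
  qed
qed

lemma diffs_series_bound:
  fixes c :: "nat \<Rightarrow> real"
  assumes c: "\<And>k. \<bar>c k\<bar> * b ^ k \<le> N" and s: "0 < s" "s \<le> b / 4"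
  shows "\<bar>\<Sum>n. diffs c n * s ^ n\<bar> \<le> 2 * N / b"
proof -
  have b: "0 < b" using s by simp
  have N: "0 \<le> N" using c[of 0] by simp
  have t: "\<bar>diffs c n * s ^ n\<bar> \<le> N / b * (2 * s / b) ^ n" for n
  proof -
    have "\<bar>diffs c n * s ^ n\<bar> = (real (Suc n) / 2 ^ n) * (\<bar>c (Suc n)\<bar> * b ^ Suc n) / b * (2 * s / b) ^ n"
      using b s by (simp add: diffs_def abs_mult power_divide power_mult_distrib)
    also have "\<dots> \<le> 1 * N / b * (2 * s / b) ^ n"
    proof (intro mult_right_mono divide_right_mono mult_mono c)
      \<comment> \<open>The factor n + 1 from differentiation is traded for doubling the ratio,
        which \<open>s \<le> b / 4\<close> can afford.\<close>
      have "Suc n \<le> 2 ^ n" by (induction n) auto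
      then have "real (Suc n) \<le> 2 ^ n" by (metis of_nat_le_iff of_nat_numeral of_nat_power)
      then show "real (Suc n) / 2 ^ n \<le> 1" by (simp add: field_simps)
    qed (use b s in auto)
    finally show ?thesis by simp
  qed
  have "\<bar>(\<Sum>n. diffs c n * s ^ n) - diffs c 0 * s ^ 0\<bar> \<le> 2 * (N / b) * (2 * s / b)"
    by (rule series_first_term[OF t]) (use b s in \<open>auto simp: field_simps\<close>)
  also have "\<dots> \<le> 2 * (N / b) * (1 / 2)" using b s N by (intro mult_left_mono) (auto simp: field_simps)
  finally have 1: "\<bar>(\<Sum>n. diffs c n * s ^ n) - diffs c 0 * s ^ 0\<bar> \<le> N / b" by simp
  have 2: "\<bar>diffs c 0 * s ^ 0\<bar> \<le> N / b" using t[of 0] by simp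
  have "2 * N / b = N / b + N / b" by simp
  then show ?thesis using 1 2 by linarith
qed

lemma has_derivative_along_axes:
  shows "((\<lambda>x. g (x, Z)) has_real_derivative D) (at R) \<Longrightarrow> ((\<lambda>t. g ((R, Z) + t *\<^sub>R (1, 0))) has_real_derivative D) (at 0)"
    and "((\<lambda>z. g (R, z)) has_real_derivative D) (at Z) \<Longrightarrow> ((\<lambda>t. g ((R, Z) + t *\<^sub>R (0, 1))) has_real_derivative D) (at 0)"
  using DERIV_shift[of "\<lambda>x. g (x, Z)" D 0 R] DERIV_shift[of "\<lambda>z. g (R, z)" D 0 Z] by (simp_all add: add.commute)

lemma C1_Dom_R_interior:
  assumes "C1_Dom a aR aZ" "R < 0"
  shows "((\<lambda>r. a (r, Z)) has_real_derivative aR (R, Z)) (at R)"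
proof -
  have "at R within {..0} = at R" by (rule at_within_open_subset[of _ "{..<0}"]) (use assms(2) in auto)
  then show ?thesis using C1_Dom_R[OF assms(1), of R Z] assms(2) by simp
qed

context self_similar_flow begin

lemma half_box_mono: "M \<le> M' \<Longrightarrow> half_box M \<subseteq> half_box M'"
  by (auto simp: half_box_def)

lemma good_mono: "good t M' \<Longrightarrow> M \<le> M' \<Longrightarrow> good t M"
  using half_box_mono by (fastforce simp: good_def)

lemma cball_in_half_box:
  assumes "\<rho> < - fst y0" shows "cball y0 \<rho> \<subseteq> half_box (norm y0 + \<rho> + 1)"
proof
  fix y assume "y \<in> cball y0 \<rho>"
  then have d: "dist y0 y \<le> \<rho>" by simp
  have 1: "\<bar>fst y0 - fst y\<bar> \<le> \<rho>" "\<bar>snd y0 - snd y\<bar> \<le> \<rho>"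
    using d dist_fst_le[of y0 y] dist_snd_le[of y0 y] by (simp_all add: dist_real_def)
  have 2: "\<bar>fst y0\<bar> \<le> norm y0" "\<bar>snd y0\<bar> \<le> norm y0" using norm_fst_le[of "fst y0" "snd y0"] norm_snd_le[of "snd y0" "fst y0"] by simp_all
  show "y \<in> half_box (norm y0 + \<rho> + 1)" using 1 2 assms by (simp add: half_box_def abs_le_iff abs_less_iff)
qed

text \<open>A sequence of times whose good boxes exhaust the half plane while s tends to 0. Each
  time comes with an open interval of good times around it, for the time derivative.\<close>

lemma good_times:
  obtains t e where "\<And>n. 0 < e n" "\<And>n t'. \<bar>t' - t n\<bar> < e n \<Longrightarrow> good t' (real n + 1)" "\<And>n. 0 < sc (t n)" "(\<lambda>n. sc (t n)) \<longlonglongrightarrow> 0"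
proof -
  have "\<exists>p. T - 1 / (real n + 1) < fst p \<and> fst p < T \<and> 0 < snd p \<and> (\<forall>t'. \<bar>t' - fst p\<bar> < snd p \<longrightarrow> good t' (real n + 1))" for n
  proof -
    obtain t0 t1 where t: "T - 1 / (real n + 1) < t0" "t0 < t1" "t1 < T"
      and g: "\<forall>t\<in>{t0..t1}. \<forall>y\<in>half_box (real n + 1). (1 + (T - t) powr \<gamma> * fst y, (T - t) powr \<gamma> * snd y, t) \<in> W"
      using good_interval[of "real n + 1" "1 / (real n + 1)"] by auto
    have "good t' (real n + 1)" if "t0 < t'" "t' < t1" for t'
      unfolding good_def sc_def using that g t by auto
    moreover have "T - 1 / (real n + 1) < (t0 + t1) / 2" "(t0 + t1) / 2 < T" "0 < (t1 - t0) / 2"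
      using less_trans[OF t(1), of "(t0 + t1) / 2"] t(2,3) by auto
    moreover have "t0 < t' \<and> t' < t1" if "\<bar>t' - (t0 + t1) / 2\<bar> < (t1 - t0) / 2" for t'
      using that by (auto simp: abs_real_def field_simps split: if_splits)
    ultimately show ?thesis by (intro exI[of _ "((t0 + t1) / 2, (t1 - t0) / 2)"]) (simp only: fst_conv snd_conv, blast)
  qed
  then obtain p where p: "\<And>n. T - 1 / (real n + 1) < fst (p n) \<and> fst (p n) < T \<and> 0 < snd (p n) \<and>
      (\<forall>t'. \<bar>t' - fst (p n)\<bar> < snd (p n) \<longrightarrow> good t' (real n + 1))" by metis
  have lim: "(\<lambda>n. T - fst (p n)) \<longlonglongrightarrow> 0"
  proof (rule real_tendsto_sandwich[OF _ _ tendsto_const LIMSEQ_inverse_real_of_nat])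
    show "\<forall>\<^sub>F n in sequentially. 0 \<le> T - fst (p n)" using p by (auto intro!: always_eventually less_imp_le)
    have "T - fst (p n) \<le> inverse (real (Suc n))" for n using p[of n] by (simp add: inverse_eq_divide add.commute)
    then show "\<forall>\<^sub>F n in sequentially. T - fst (p n) \<le> inverse (real (Suc n))" by (intro always_eventually allI)
  qed
  have "(\<lambda>n. sc (fst (p n))) \<longlonglongrightarrow> 0"
    unfolding sc_def by (rule tendsto_zero_powrI[OF lim tendsto_const]) (use p \<gamma> in \<open>auto intro!: always_eventually less_imp_le\<close>)
  then show thesis using p by (intro that[of "snd \<circ> p" "fst \<circ> p"]) (auto intro: sc_pos)
qed

text \<open>Convergence of the series only bounds the coefficients pointwise; Baire makes the bound uniform on a smaller ball, which
  suffices since the profile equations extend by continuity from a dense set.\<close>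

lemma bounded_on_subball:
  assumes A: "series_form W T \<gamma> \<beta> A w" and Ac: "\<And>k. continuous_on Dom (A k)"
    and \<rho>: "0 < \<rho>" "\<rho> < - fst y0"
  obtains y1 \<rho>1 b N where "0 < \<rho>1" "ball y1 \<rho>1 \<subseteq> cball y0 \<rho>" "0 < b"
    "\<And>y k. y \<in> ball y1 \<rho>1 \<Longrightarrow> \<bar>A k y\<bar> * b ^ k \<le> N" "\<And>y k. y \<in> ball y1 \<rho>1 \<Longrightarrow> \<bar>Om k y\<bar> * b ^ k \<le> N"
    "\<And>y k. y \<in> ball y1 \<rho>1 \<Longrightarrow> \<bar>Psi k y\<bar> * b ^ k \<le> N"
proof -
  obtain t e where te: "\<And>n. 0 < e n" "\<And>n t'. \<bar>t' - t n\<bar> < e n \<Longrightarrow> good t' (real n + 1)" "\<And>n. 0 < sc (t n)"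
    using good_times by metis
  obtain n :: nat where n: "norm y0 + \<rho> < real n" using reals_Archimedean2 by blast
  define b where "b = sc (t n)"
  have b: "0 < b" using te by (simp add: b_def)
  have g: "good (t n) (real n + 1)" by (rule te(2)) (simp add: te(1))
  have cb: "cball y0 \<rho> \<subseteq> half_box (real n + 1)" using cball_in_half_box[OF \<rho>(2)] half_box_mono[of "norm y0 + \<rho> + 1" "real n + 1"] n by auto
  have sub: "cball y0 \<rho> \<subseteq> Dom" using cb by (auto simp: half_box_def Dom_def)
  have bound: "\<exists>m. \<forall>k. \<bar>B k y\<bar> * b ^ k \<le> m" if "series_form W T \<gamma> \<beta>' B v" "y \<in> cball y0 \<rho>" for \<beta>' B v y
    using prof_sums[OF that(1) g, of y] that(2) cb b by (intro powser_term_bound) (auto simp: b_def simp del: mem_cball dest!: subsetD[of _ _ y] sums_summable)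
  define a where "a = (\<lambda>k y. \<bar>A k y\<bar> + \<bar>Om k y\<bar> + \<bar>Psi k y\<bar>)"
  have "\<exists>y1 \<rho>1 N. 0 < \<rho>1 \<and> ball y1 \<rho>1 \<subseteq> cball y0 \<rho> \<and> (\<forall>y\<in>ball y1 \<rho>1. \<forall>k. \<bar>a k y\<bar> * b ^ k \<le> N)"
  proof (rule baire_coefficient_bound[OF \<rho>(1)])
    show "continuous_on (cball y0 \<rho>) (a k)" for k
      unfolding a_def using Ac Om_cont C1_Dom_continuous[OF Psi_C1]
      by (intro continuous_intros; blast intro: continuous_on_subset[OF _ sub])
    fix y assume y: "y \<in> cball y0 \<rho>"
    obtain m1 where m1: "\<forall>k. \<bar>A k y\<bar> * b ^ k \<le> m1" using bound[OF A y] ..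
    obtain m2 where m2: "\<forall>k. \<bar>Om k y\<bar> * b ^ k \<le> m2" using bound[OF om_form y] ..
    obtain m3 where m3: "\<forall>k. \<bar>Psi k y\<bar> * b ^ k \<le> m3" using bound[OF psi_form y] ..
    have "\<bar>a k y\<bar> * b ^ k \<le> m1 + m2 + m3" for k
      using m1[rule_format, of k] m2[rule_format, of k] m3[rule_format, of k] by (simp add: a_def distrib_right)
    then show "\<exists>m. \<forall>k. \<bar>a k y\<bar> * b ^ k \<le> m" by blast
  qed
  then obtain y1 \<rho>1 N where r: "0 < \<rho>1" "ball y1 \<rho>1 \<subseteq> cball y0 \<rho>" and N: "\<forall>y\<in>ball y1 \<rho>1. \<forall>k. \<bar>a k y\<bar> * b ^ k \<le> N"
    by (elim exE conjE)
  have le: "x * b ^ k \<le> N" if "y \<in> ball y1 \<rho>1" "x \<le> a k y" for x k y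
  proof -
    have "x * b ^ k \<le> \<bar>a k y\<bar> * b ^ k" using that(2) b by (intro mult_right_mono) auto
    also have "\<dots> \<le> N" using N that(1) by blast
    finally show ?thesis .
  qed
  show thesis by (rule that[OF r b]) (auto intro!: le simp: a_def)
qed

text \<open>Gradients of the potential converge by the elliptic estimate and those of
  \<open>w\<close> are handled by the maximum test, both on the small balls where the coefficients
  are bounded. Such balls occur inside every ball, so the continuous expression \<open>E\<close>
  cannot be nonzero anywhere.\<close>

lemma leading_profile_eq:
  assumes w: "C1_spacetime W w" and A: "series_form W T \<gamma> \<beta> A w" and Ac: "\<And>k. continuous_on Dom (A k)"
    and A0: "C1_Dom (A 0) aR aZ"
    and pde: "\<And>r z t. (r, z, t) \<in> W \<Longrightarrow> pt w r z t + (- r * pz psi r z t) * pr w r z t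
       + (2 * psi r z t + r * pr psi r z t) * pz w r z t = \<kappa> * w r z t * pz psi r z t"
    and Y: "Y \<in> Dom"
  shows "- \<beta> * A 0 Y + (\<gamma> * fst Y - PsiZ 0 Y) * aR Y + (\<gamma> * snd Y + PsiR 0 Y) * aZ Y = 0"
proof -
  define V1 V2 E where "V1 = (\<lambda>y. \<gamma> * fst y - PsiZ 0 y)" and "V2 = (\<lambda>y. \<gamma> * snd y + PsiR 0 y)"
    and "E = (\<lambda>y. - \<beta> * A 0 y + V1 y * aR y + V2 y * aZ y)"
  have ca: "continuous_on Dom aR" "continuous_on Dom aZ" using A0 by (auto simp: C1_Dom_def)
  have cP: "continuous_on Dom (PsiR 0)" "continuous_on Dom (PsiZ 0)" using Psi_C1[of 0] by (auto simp: C1_Dom_def)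
  have cV: "continuous_on Dom V1" "continuous_on Dom V2" unfolding V1_def V2_def by (intro continuous_intros cP)+
  have cE: "continuous_on Dom E" unfolding E_def by (intro continuous_intros ca cV Ac)
  obtain t e where te: "\<And>n. 0 < e n" "\<And>n t'. \<bar>t' - t n\<bar> < e n \<Longrightarrow> good t' (real n + 1)"
    and s: "\<And>n. 0 < sc (t n)" "(\<lambda>n. sc (t n)) \<longlonglongrightarrow> 0" using good_times by metis
  have gt: "good (t n) (real n + 1)" for n by (rule te(2)) (simp add: te(1))
  have w1: "C1_space W w" using w by (simp add: C1_spacetime_def)
  let ?F = "\<lambda>n. prof \<beta> w (t n)" and ?G = "\<lambda>n. prof (-1 + 2 * \<gamma>) psi (t n)" and ?s = "\<lambda>n. sc (t n)"
  have interior: "E y0 = 0" if y0: "fst y0 < 0" for y0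
  proof (rule ccontr)
    \<comment> \<open>By continuity \<open>E\<close> is nonzero on a whole ball, which contains a
      ball with uniform coefficient bounds; the equation is derived at the center of the
      latter.\<close>
    assume ne: "E y0 \<noteq> 0"
    have "open {y::real \<times> real. fst y < 0}" by (intro open_Collect_less continuous_intros)
    moreover have "continuous_on {y. fst y < 0} E" by (rule continuous_on_subset[OF cE]) (auto simp: Dom_def)
    ultimately have "open ({y. fst y < 0} \<inter> E -` (- {0}))" by (intro continuous_open_preimage) auto
    moreover have "y0 \<in> {y. fst y < 0} \<inter> E -` (- {0})" using y0 ne by simp
    ultimately obtain \<rho>0 where \<rho>0: "0 < \<rho>0" "cball y0 \<rho>0 \<subseteq> {y. fst y < 0} \<inter> E -` (- {0})"
      unfolding open_contains_cball by blast
    define \<rho> where "\<rho> = min \<rho>0 (- fst y0 / 2)"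
    have \<rho>: "0 < \<rho>" "\<rho> < - fst y0" "\<rho> \<le> \<rho>0" using \<rho>0 y0 by (auto simp: \<rho>_def)
    obtain y1 \<rho>1 b N where r1: "0 < \<rho>1" "ball y1 \<rho>1 \<subseteq> cball y0 \<rho>" and b: "0 < b"
      and N: "\<And>y k. y \<in> ball y1 \<rho>1 \<Longrightarrow> \<bar>A k y\<bar> * b ^ k \<le> N" "\<And>y k. y \<in> ball y1 \<rho>1 \<Longrightarrow> \<bar>Om k y\<bar> * b ^ k \<le> N"
        "\<And>y k. y \<in> ball y1 \<rho>1 \<Longrightarrow> \<bar>Psi k y\<bar> * b ^ k \<le> N"
      using bounded_on_subball[OF A Ac \<rho>(1,2)] by metis
    define M where "M = norm y0 + \<rho> + 1"
    have inM: "ball y1 \<rho>1 \<subseteq> half_box M" using r1(2) cball_in_half_box[OF \<rho>(2)] by (auto simp: M_def)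
    have inD: "ball y1 \<rho>1 \<subseteq> Dom" using inM by (auto simp: half_box_def Dom_def)
    have evM: "\<forall>\<^sub>F n in sequentially. M \<le> real n + 1"
      using eventually_ge_at_top[of "nat \<lceil>M\<rceil>"] by eventually_elim linarith
    have sums: "\<forall>\<^sub>F n in sequentially. \<forall>y\<in>ball y1 \<rho>1. (\<lambda>k. B k y * ?s n ^ k) sums prof \<beta>' v (t n) y"
      if "series_form W T \<gamma> \<beta>' B v" for \<beta>' B v
      using evM
    proof eventually_elim
      case (elim n)
      show ?case using prof_sums[OF that good_mono[OF gt elim]] inM by blast
    qed
    have uF: "uniform_limit (ball y1 \<rho>1) ?F (A 0) sequentially" by (rule uniform_limit_series[OF N(1) b s sums[OF A]])
    have uG: "uniform_limit (ball y1 \<rho>1) ?G (Psi 0) sequentially" by (rule uniform_limit_series[OF N(3) b s sums[OF psi_form]])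
    have "uniform_limit (ball y1 \<rho>1) (\<lambda>n. prof (-1) om (t n)) (Om 0) sequentially" by (rule uniform_limit_series[OF N(2) b s sums[OF om_form]])
    then have uO: "uniform_limit (ball y1 \<rho>1) (\<lambda>n y. - prof (-1) om (t n) y) (\<lambda>y. - Om 0 y) sequentially" by (intro uniform_limit_intros)
    have evE: "\<forall>\<^sub>F n in sequentially. ell (?s n) (ball y1 \<rho>1) (?G n) (\<lambda>y. - prof (-1) om (t n) y)"
      using evM by eventually_elim (rule ell_subset[OF ell_prof[OF good_mono[OF gt]]], use inM in auto)
    have cont: "continuous_on (ball y1 \<rho>1) (Psi 0)" "continuous_on (ball y1 \<rho>1) (\<lambda>y. - Om 0 y)"
      by (intro continuous_intros continuous_on_subset[OF C1_Dom_continuous[OF Psi_C1] inD] continuous_on_subset[OF Om_cont inD])+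
    define r where "r = \<rho>1 / 4"
    have r: "0 < r" "ball y1 r \<subseteq> ball y1 \<rho>1" "cball y1 r \<subseteq> ball y1 \<rho>1" using r1(1) by (auto simp: r_def)
    have rD: "ball y1 r \<subseteq> Dom" "cball y1 r \<subseteq> Dom" using r inD by auto
    have neg: "fst y < 0" if "y \<in> ball y1 r" for y using that r(2) inM by (auto simp: half_box_def)
    obtain B where B: "0 < B" "\<And>y. y \<in> ball y1 r \<Longrightarrow> \<bar>PsiR 0 y\<bar> \<le> B" "\<And>y. y \<in> ball y1 r \<Longrightarrow> \<bar>PsiZ 0 y\<bar> \<le> B"
    proof -
      have "compact ((\<lambda>y. (PsiR 0 y, PsiZ 0 y)) ` cball y1 r)"
        by (intro compact_continuous_image continuous_intros continuous_on_subset[OF cP(1) rD(2)] continuous_on_subset[OF cP(2) rD(2)]) auto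
      then obtain B where B: "0 < B" "\<forall>x\<in>(\<lambda>y. (PsiR 0 y, PsiZ 0 y)) ` cball y1 r. norm x \<le> B"
        using bounded_pos compact_imp_bounded by blast
      have "\<bar>PsiR 0 y\<bar> \<le> B \<and> \<bar>PsiZ 0 y\<bar> \<le> B" if "y \<in> ball y1 r" for y
      proof -
        have "y \<in> cball y1 r" using that by simp
        then have "norm (PsiR 0 y, PsiZ 0 y) \<le> B" using B(2) by blast
        then show ?thesis using norm_fst_le[of "PsiR 0 y" "PsiZ 0 y"] norm_snd_le[of "PsiZ 0 y" "PsiR 0 y"]
          unfolding real_norm_def by linarith
      qed
      then show thesis using that B(1) by blast
    qed
    have "- \<beta> * A 0 y1 + V1 y1 * aR y1 + V2 y1 * aZ y1 = 0"
    proof (rule transport_limit[OF r(1)])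
      show "continuous_on (ball y1 r) (A 0)" "continuous_on (ball y1 r) aR" "continuous_on (ball y1 r) aZ"
        "continuous_on (ball y1 r) V1" "continuous_on (ball y1 r) V2"
        using Ac[of 0] ca cV rD(1) by (blast intro: continuous_on_subset)+
      fix y assume y: "y \<in> ball y1 r"
      obtain R Z where yRZ: "y = (R, Z)" by force
      show "((\<lambda>t. A 0 (y + t *\<^sub>R (1, 0))) has_real_derivative aR y) (at 0)"
        unfolding yRZ by (intro has_derivative_along_axes C1_Dom_R_interior[OF A0]) (use neg[OF y] yRZ in simp)
      show "((\<lambda>t. A 0 (y + t *\<^sub>R (0, 1))) has_real_derivative aZ y) (at 0)"
        unfolding yRZ by (intro has_derivative_along_axes C1_Dom_Z[OF A0]) (use neg[OF y] yRZ in simp)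
    next
      fix \<epsilon> :: real assume \<epsilon>: "0 < \<epsilon>"
      define d where "d = min (\<epsilon> / 2) 1"
      have d: "0 < d" "d \<le> \<epsilon> / 2" "d \<le> 1" using \<epsilon> by (auto simp: d_def)
      \<comment> \<open>\<open>K\<close> collects every term that is multiplied by s: the correction
        1 + sR of the velocity, the contribution of the potential itself, and the right side of the
        scaled equation.\<close>
      define K where "K = M * (B + 1) + 2 * (N + 1) + \<bar>\<kappa>\<bar> * (N + 1) * (B + 1) + \<gamma> * (2 * N / b)"
      have "(\<lambda>n. ?s n * K) \<longlonglongrightarrow> 0 * K" by (intro tendsto_intros s)
      then have evK: "\<forall>\<^sub>F n in sequentially. ?s n * K < \<epsilon> / 2" using \<epsilon> by (intro order_tendstoD(2)) auto
      have evb: "\<forall>\<^sub>F n in sequentially. ?s n < b / 4" using b s by (intro order_tendstoD(2)) auto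
      have evR: "\<forall>\<^sub>F n in sequentially. \<forall>y\<in>ball y1 (\<rho>1 / 4). \<forall>D D'. ((\<lambda>x. ?G n (y + x *\<^sub>R (1, 0))) has_real_derivative D) (at 0) \<longrightarrow>
         ((\<lambda>x. Psi 0 (y + x *\<^sub>R (1, 0))) has_real_derivative D') (at 0) \<longrightarrow> \<bar>D - D'\<bar> \<le> d"
        by (rule C1_convergence[OF evE s r1(1) uG uO cont _ d(1)]) simp
      have evZ: "\<forall>\<^sub>F n in sequentially. \<forall>y\<in>ball y1 (\<rho>1 / 4). \<forall>D D'. ((\<lambda>x. ?G n (y + x *\<^sub>R (0, 1))) has_real_derivative D) (at 0) \<longrightarrow>
         ((\<lambda>x. Psi 0 (y + x *\<^sub>R (0, 1))) has_real_derivative D') (at 0) \<longrightarrow> \<bar>D - D'\<bar> \<le> d"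
        by (rule C1_convergence[OF evE s r1(1) uG uO cont _ d(1)]) simp
      have "\<forall>\<^sub>F n in sequentially. M \<le> real n + 1 \<and> ?s n * K < \<epsilon> / 2 \<and> ?s n < b / 4 \<and>
         (\<forall>y\<in>ball y1 \<rho>1. dist (?F n y) (A 0 y) < d) \<and> (\<forall>y\<in>ball y1 \<rho>1. dist (?G n y) (Psi 0 y) < d) \<and>
         (\<forall>y\<in>ball y1 (\<rho>1 / 4). \<forall>D D'. ((\<lambda>x. ?G n (y + x *\<^sub>R (1, 0))) has_real_derivative D) (at 0) \<longrightarrow>
         ((\<lambda>x. Psi 0 (y + x *\<^sub>R (1, 0))) has_real_derivative D') (at 0) \<longrightarrow> \<bar>D - D'\<bar> \<le> d) \<and>
         (\<forall>y\<in>ball y1 (\<rho>1 / 4). \<forall>D D'. ((\<lambda>x. ?G n (y + x *\<^sub>R (0, 1))) has_real_derivative D) (at 0) \<longrightarrow>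
         ((\<lambda>x. Psi 0 (y + x *\<^sub>R (0, 1))) has_real_derivative D') (at 0) \<longrightarrow> \<bar>D - D'\<bar> \<le> d)"
        by (intro eventually_conj evM evK evb evR evZ uniform_limitD[OF uF d(1)] uniform_limitD[OF uG d(1)])
      then obtain n where n: "M \<le> real n + 1" "?s n * K < \<epsilon> / 2" "?s n < b / 4"
         and nF: "\<forall>y\<in>ball y1 \<rho>1. dist (?F n y) (A 0 y) < d" and nG: "\<forall>y\<in>ball y1 \<rho>1. dist (?G n y) (Psi 0 y) < d"
         and nR: "\<forall>y\<in>ball y1 (\<rho>1 / 4). \<forall>D D'. ((\<lambda>x. ?G n (y + x *\<^sub>R (1, 0))) has_real_derivative D) (at 0) \<longrightarrow>
         ((\<lambda>x. Psi 0 (y + x *\<^sub>R (1, 0))) has_real_derivative D') (at 0) \<longrightarrow> \<bar>D - D'\<bar> \<le> d"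
         and nZ: "\<forall>y\<in>ball y1 (\<rho>1 / 4). \<forall>D D'. ((\<lambda>x. ?G n (y + x *\<^sub>R (0, 1))) has_real_derivative D) (at 0) \<longrightarrow>
         ((\<lambda>x. Psi 0 (y + x *\<^sub>R (0, 1))) has_real_derivative D') (at 0) \<longrightarrow> \<bar>D - D'\<bar> \<le> d"
        unfolding eventually_sequentially by (elim exE) (drule spec, drule mp, rule order_refl, elim conjE, rule that)
      show "\<exists>F. continuous_on (ball y1 r) F \<and> (\<forall>y\<in>ball y1 r. \<bar>F y - A 0 y\<bar> \<le> \<epsilon> \<and>
         (\<exists>p q v w. ((\<lambda>t. F (y + t *\<^sub>R (1, 0))) has_real_derivative p) (at 0) \<and>
         ((\<lambda>t. F (y + t *\<^sub>R (0, 1))) has_real_derivative q) (at 0) \<and>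
         \<bar>v - V1 y\<bar> \<le> \<epsilon> \<and> \<bar>w - V2 y\<bar> \<le> \<epsilon> \<and> \<bar>- \<beta> * F y + v * p + w * q\<bar> \<le> \<epsilon>))"
      proof (rule exI[of _ "?F n"], intro conjI ballI)
        have gM: "\<bar>t' - t n\<bar> < e n \<Longrightarrow> good t' M" for t' by (rule good_mono[OF te(2) n(1)])
        have gM0: "good (t n) M" by (rule gM) (simp add: te(1))
        show "continuous_on (ball y1 r) (?F n)"
          by (rule continuous_on_subset[OF prof_cont[OF _ gM0]]) (use w1 r(2) inM in \<open>auto simp: C1_space_def\<close>)
        fix y assume y: "y \<in> ball y1 r"
        then have y': "y \<in> ball y1 \<rho>1" using r(2) by blast
        obtain R Z where yRZ: "y = (R, Z)" by force
        have bM: "(R, Z) \<in> half_box M" using y' inM yRZ by blast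
        show "\<bar>?F n y - A 0 y\<bar> \<le> \<epsilon>" using nF[rule_format, OF y'] d \<epsilon> by (simp add: dist_real_def)
        define \<sigma> F G where "\<sigma> = ?s n" and "F = ?F n y" and "G = ?G n y"
        define p where "p = pr w (1 + sc (t n) * R) (sc (t n) * Z) (t n) * sc (t n) * (T - t n) powr (-\<beta>)"
        define q where "q = pz w (1 + sc (t n) * R) (sc (t n) * Z) (t n) * sc (t n) * (T - t n) powr (-\<beta>)"
        define vr where "vr = pr psi (1 + sc (t n) * R) (sc (t n) * Z) (t n) * sc (t n) * (T - t n) powr (-(-1 + 2 * \<gamma>))"
        define vz where "vz = pz psi (1 + sc (t n) * R) (sc (t n) * Z) (t n) * sc (t n) * (T - t n) powr (-(-1 + 2 * \<gamma>))"
        have p: "((\<lambda>x. ?F n (x, Z)) has_real_derivative p) (at R)" unfolding p_def by (rule prof_deriv_R[OF w1 gM0 bM])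
        have q: "((\<lambda>z. ?F n (R, z)) has_real_derivative q) (at Z)" unfolding q_def by (rule prof_deriv_Z[OF w1 gM0 bM])
        have vr: "((\<lambda>x. ?G n (x, Z)) has_real_derivative vr) (at R)" unfolding vr_def by (rule prof_deriv_R[OF psi_C1(1) gM0 bM])
        have vz: "((\<lambda>z. ?G n (R, z)) has_real_derivative vz) (at Z)" unfolding vz_def by (rule prof_deriv_Z[OF psi_C1(1) gM0 bM])
        define D where "D = (\<Sum>m. diffs (\<lambda>k. A k (R, Z)) m * \<sigma> ^ m)"
        have eq: "- \<beta> * F + (\<gamma> * R - (1 + \<sigma> * R) * vz) * p + (\<gamma> * Z + (1 + \<sigma> * R) * vr + 2 * \<sigma> * G) * q
            = \<sigma> * (\<kappa> * F * vz + \<gamma> * D)"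
          unfolding F_def G_def \<sigma>_def D_def yRZ by (rule transport_scaled[OF w A te(1) gM bM pde p q vr vz])
        have R0: "R < 0" "R \<le> 0" using neg[OF y] yRZ by auto
        have dR: "\<bar>vr - PsiR 0 y\<bar> \<le> d"
          by (rule nR[rule_format, of y]) (use y in \<open>simp add: r_def\<close>,
            simp only: yRZ, rule has_derivative_along_axes(1)[OF vr], simp only: yRZ, rule has_derivative_along_axes(1)[OF C1_Dom_R_interior[OF Psi_C1 R0(1)]])
        have dZ: "\<bar>vz - PsiZ 0 y\<bar> \<le> d"
          by (rule nZ[rule_format, of y]) (use y in \<open>simp add: r_def\<close>,
            simp only: yRZ, rule has_derivative_along_axes(2)[OF vz], simp only: yRZ, rule has_derivative_along_axes(2)[OF C1_Dom_Z[OF Psi_C1 R0(2)]])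
        have vb: "\<bar>vr\<bar> \<le> B + 1" "\<bar>vz\<bar> \<le> B + 1" using dR dZ B(2,3)[OF y] d(3) by linarith+
        have Fb: "\<bar>F\<bar> \<le> N + 1" "\<bar>G\<bar> \<le> N + 1"
          using nF[rule_format, OF y'] nG[rule_format, OF y'] N(1)[OF y', of 0] N(3)[OF y', of 0] d(3)
          by (auto simp: F_def G_def dist_real_def)
        have Db: "\<bar>D\<bar> \<le> 2 * N / b" unfolding D_def
          by (rule diffs_series_bound) (use N(1)[OF y'] s n(3) in \<open>auto simp: \<sigma>_def yRZ\<close>)
        have Rb: "\<bar>R\<bar> \<le> M" using bM by (simp add: half_box_def)
        have N0: "0 \<le> N" using N(1)[OF y', of 0] by simp
        have M0: "0 \<le> M" using Rb by simp
        have \<sigma>0: "0 < \<sigma>" using s by (simp add: \<sigma>_def)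
        define K1 K2 K3 where "K1 = M * (B + 1)" and "K2 = 2 * (N + 1)" and "K3 = \<bar>\<kappa>\<bar> * (N + 1) * (B + 1) + \<gamma> * (2 * N / b)"
        have K: "0 \<le> K1" "0 \<le> K2" "0 \<le> K3" "K = K1 + K2 + K3"
          using M0 B(1) N0 \<gamma> b by (auto simp: K1_def K2_def K3_def K_def)
        have le: "\<sigma> * x \<le> \<epsilon> / 2" if "x \<le> K" for x
        proof -
          have "\<sigma> * x \<le> \<sigma> * K" using that \<sigma>0 by (intro mult_left_mono) auto
          then show ?thesis using n(2) by (simp add: \<sigma>_def)
        qed
        have Rv: "\<bar>R * vz\<bar> \<le> K1" "\<bar>R * vr\<bar> \<le> K1"
          unfolding abs_mult K1_def using Rb vb M0 by (auto intro!: mult_mono)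
        have e1: "\<bar>\<sigma> * (R * vz)\<bar> \<le> \<epsilon> / 2"
          using le[of "\<bar>R * vz\<bar>"] Rv(1) K \<sigma>0 by (simp add: abs_mult)
        have "\<bar>R * vr + 2 * G\<bar> \<le> K1 + K2" using Rv(2) Fb(2) by (simp add: K2_def)
        then have e2: "\<bar>\<sigma> * (R * vr + 2 * G)\<bar> \<le> \<epsilon> / 2"
          using le[of "\<bar>R * vr + 2 * G\<bar>"] K \<sigma>0 by (simp add: abs_mult)
        have "\<bar>\<kappa> * F * vz\<bar> \<le> \<bar>\<kappa>\<bar> * (N + 1) * (B + 1)"
          unfolding abs_mult using Fb vb N0 by (auto intro!: mult_mono)
        moreover have "\<bar>\<gamma> * D\<bar> \<le> \<gamma> * (2 * N / b)" unfolding abs_mult using \<gamma> Db by (intro mult_mono) auto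
        ultimately have "\<bar>\<kappa> * F * vz + \<gamma> * D\<bar> \<le> K3" unfolding K3_def by linarith
        then have e3: "\<bar>\<sigma> * (\<kappa> * F * vz + \<gamma> * D)\<bar> \<le> \<epsilon> / 2"
          using le[of "\<bar>\<kappa> * F * vz + \<gamma> * D\<bar>"] K \<sigma>0 by (simp add: abs_mult)
        show "\<exists>p q v w. ((\<lambda>t. ?F n (y + t *\<^sub>R (1, 0))) has_real_derivative p) (at 0) \<and>
         ((\<lambda>t. ?F n (y + t *\<^sub>R (0, 1))) has_real_derivative q) (at 0) \<and>
         \<bar>v - V1 y\<bar> \<le> \<epsilon> \<and> \<bar>w - V2 y\<bar> \<le> \<epsilon> \<and> \<bar>- \<beta> * ?F n y + v * p + w * q\<bar> \<le> \<epsilon>"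
        proof (rule exI[of _ p], rule exI[of _ q], rule exI[of _ "\<gamma> * R - (1 + \<sigma> * R) * vz"],
            rule exI[of _ "\<gamma> * Z + (1 + \<sigma> * R) * vr + 2 * \<sigma> * G"], intro conjI)
          show "((\<lambda>t. ?F n (y + t *\<^sub>R (1, 0))) has_real_derivative p) (at 0)" unfolding yRZ by (rule has_derivative_along_axes(1)[OF p])
          show "((\<lambda>t. ?F n (y + t *\<^sub>R (0, 1))) has_real_derivative q) (at 0)" unfolding yRZ by (rule has_derivative_along_axes(2)[OF q])
          have "\<gamma> * R - (1 + \<sigma> * R) * vz - V1 y = - (vz - PsiZ 0 y) - \<sigma> * (R * vz)"
            by (simp add: V1_def yRZ algebra_simps)
          then show "\<bar>\<gamma> * R - (1 + \<sigma> * R) * vz - V1 y\<bar> \<le> \<epsilon>" using dZ e1 d(2) by linarith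
          have "\<gamma> * Z + (1 + \<sigma> * R) * vr + 2 * \<sigma> * G - V2 y = (vr - PsiR 0 y) + \<sigma> * (R * vr + 2 * G)"
            by (simp add: V2_def yRZ algebra_simps)
          then show "\<bar>\<gamma> * Z + (1 + \<sigma> * R) * vr + 2 * \<sigma> * G - V2 y\<bar> \<le> \<epsilon>" using dR e2 d(2) by linarith
          show "\<bar>- \<beta> * ?F n y + (\<gamma> * R - (1 + \<sigma> * R) * vz) * p + (\<gamma> * Z + (1 + \<sigma> * R) * vr + 2 * \<sigma> * G) * q\<bar> \<le> \<epsilon>"
            unfolding F_def[symmetric] eq using e3 \<epsilon> by linarith
        qed
      qed
    qed
    moreover have "y1 \<in> cball y0 \<rho>0" using subsetD[OF r1(2), of y1] r1(1) \<rho>(3) by simp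
    then have "E y1 \<noteq> 0" using \<rho>0(2) by blast
    ultimately show False by (simp add: E_def)
  qed
  \<comment> \<open>Boundary points are reached from the interior along R, since the scaled solution
    lives only at R < 0.\<close>
  have "E Y = 0"
  proof (rule LIMSEQ_unique)
    have seq: "(\<lambda>n. Y + (- inverse (real (Suc n)), 0)) \<longlonglongrightarrow> Y + (- 0, 0)"
      by (intro tendsto_intros LIMSEQ_inverse_real_of_nat)
    have fstneg: "fst (Y + (- inverse (real (Suc n)), 0)) < 0" for n
      using Y by (simp add: Dom_def) (smt (verit) inverse_positive_iff_positive of_nat_0_le_iff)
    show "(\<lambda>n. E (Y + (- inverse (real (Suc n)), 0))) \<longlonglongrightarrow> E Y"
      by (rule continuous_on_tendsto_compose[OF cE]) (use seq Y fstneg in \<open>auto simp: Dom_def less_imp_le zero_prod_def[symmetric] intro!: always_eventually\<close>)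
    show "(\<lambda>n. E (Y + (- inverse (real (Suc n)), 0))) \<longlonglongrightarrow> 0"
      using interior[OF fstneg] by simp
  qed
  then show ?thesis by (simp add: E_def V1_def V2_def)
qed

end

section \<open>Vanishing of the coefficients order by order\<close>

lemma ell_cong:
  assumes g: "ell s S g f" and eq: "\<And>y. y \<in> S \<Longrightarrow> g' y = g y" "\<And>y. y \<in> S \<Longrightarrow> f' y = f y"
  shows "ell s S g' f'"
proof -
  obtain g1 g11 g2 g22 where G: "\<And>R Z. (R, Z) \<in> S \<Longrightarrow>
        ((\<lambda>x. g (x, Z)) has_real_derivative g1 (R, Z)) (at R) \<and> ((\<lambda>x. g1 (x, Z)) has_real_derivative g11 (R, Z)) (at R) \<and>
        ((\<lambda>z. g (R, z)) has_real_derivative g2 (R, Z)) (at Z) \<and> ((\<lambda>z. g2 (R, z)) has_real_derivative g22 (R, Z)) (at Z) \<and>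
        g11 (R, Z) + 3 * s / (1 + s * R) * g1 (R, Z) + g22 (R, Z) = f (R, Z)"
    and c: "continuous_on S g" and p: "open S" "\<forall>R Z. (R, Z) \<in> S \<longrightarrow> 0 < 1 + s * R"
    using g unfolding ell_def by (elim conjE exE) blast
  have dR: "((\<lambda>x. g' (x, Z)) has_real_derivative g1 (R, Z)) (at R)" if "(R, Z) \<in> S" for R Z
  proof (rule has_field_derivative_transform_within_open[OF G[OF that, THEN conjunct1]])
    show "open ((\<lambda>x. (x, Z)) -` S)" by (intro open_vimage p continuous_intros)
  qed (use that eq in auto)
  have dZ: "((\<lambda>z. g' (R, z)) has_real_derivative g2 (R, Z)) (at Z)" if "(R, Z) \<in> S" for R Z
  proof (rule has_field_derivative_transform_within_open[OF G[OF that, THEN conjunct2, THEN conjunct2, THEN conjunct1]])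
    show "open ((\<lambda>z. (R, z)) -` S)" by (intro open_vimage p continuous_intros)
  qed (use that eq in auto)
  have c': "continuous_on S g'" using c eq by (simp cong: continuous_on_cong)
  show ?thesis unfolding ell_def
    by (rule conjI[OF p(1)], rule conjI[OF c'], rule conjI[OF p(2)],
        rule exI[of _ g1], rule exI[of _ g11], rule exI[of _ g2], rule exI[of _ g22],
        intro allI impI, frule G, elim conjE, intro conjI, erule dR, assumption, erule dZ, assumption, simp only: eq)
qed

lemma ell_affine:
  assumes "open S" "\<And>y. y \<in> S \<Longrightarrow> 0 < 1 + s * fst y"
  shows "ell s S (\<lambda>y. c + a * fst y) (\<lambda>y. 3 * s / (1 + s * fst y) * a)"
  unfolding ell_def
proof (intro conjI)
  show "\<exists>g1 g11 g2 g22. \<forall>R Z. (R, Z) \<in> S \<longrightarrow>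
      ((\<lambda>x. c + a * fst (x, Z)) has_real_derivative g1 (R, Z)) (at R) \<and> ((\<lambda>x. g1 (x, Z)) has_real_derivative g11 (R, Z)) (at R) \<and>
      ((\<lambda>z. c + a * fst (R, z)) has_real_derivative g2 (R, Z)) (at Z) \<and> ((\<lambda>z. g2 (R, z)) has_real_derivative g22 (R, Z)) (at Z) \<and>
      g11 (R, Z) + 3 * s / (1 + s * R) * g1 (R, Z) + g22 (R, Z) = 3 * s / (1 + s * fst (R, Z)) * a"
    by (rule exI[of _ "\<lambda>_. a"], rule exI[of _ "\<lambda>_. 0"], rule exI[of _ "\<lambda>_. 0"], rule exI[of _ "\<lambda>_. 0"])
      (auto intro!: derivative_eq_intros)
qed (use assms in \<open>force intro!: continuous_intros\<close>)+

context self_similar_flow begin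

lemma W_scaled:
  assumes "(r, z, t) \<in> W"
  shows "((r - 1) * (T - t) powr (-\<gamma>), z * (T - t) powr (-\<gamma>)) \<in> Dom"
  using W_bounds[OF assms] by (simp add: Dom_def mult_nonpos_nonneg)

text \<open>Once the first k coefficients vanish, the series has the same form with the exponent
  raised by k \<gamma>. Every coefficient thus becomes a leading one in turn.\<close>

lemma series_form_shift:
  assumes A: "series_form W T \<gamma> \<beta> A w" and zero: "\<And>j y. j < k \<Longrightarrow> y \<in> Dom \<Longrightarrow> A j y = 0"
  shows "series_form W T \<gamma> (\<beta> + real k * \<gamma>) (\<lambda>j. A (k + j)) w"
  unfolding series_form_def
proof (intro allI impI)
  fix r z t assume W: "(r, z, t) \<in> W"
  define y s where "y = ((r - 1) * (T - t) powr (-\<gamma>), z * (T - t) powr (-\<gamma>))" and "s = (T - t) powr \<gamma>"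
  have t: "t < T" using W_bounds[OF W] by simp
  have s: "0 < s" using t by (simp add: s_def)
  have y: "y \<in> Dom" using W_scaled[OF W] by (simp add: y_def)
  have "(\<lambda>j. A j y * s ^ j) sums (w r z t * (T - t) powr (-\<beta>))" using A W unfolding series_form_def y_def s_def by blast
  then have "(\<lambda>j. A (j + k) y * s ^ (j + k)) sums (w r z t * (T - t) powr (-\<beta>) - (\<Sum>j<k. A j y * s ^ j))"
    by (subst sums_iff_shift) simp
  then have "(\<lambda>j. A (k + j) y * s ^ (k + j)) sums (w r z t * (T - t) powr (-\<beta>))"
    using zero y by (simp add: add.commute)
  from sums_mult[OF this, of "1 / s ^ k"]
  have "(\<lambda>j. A (k + j) y * s ^ j) sums (w r z t * ((T - t) powr (-\<beta>) / s ^ k))" using s by (simp add: power_add)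
  moreover have "(T - t) powr (-\<beta>) / s ^ k = (T - t) powr (-(\<beta> + real k * \<gamma>))"
    using t by (simp add: s_def powr_powr powr_diff powr_minus divide_simps mult.commute flip: powr_realpow powr_add)
  ultimately have "(\<lambda>j. A (k + j) y * s ^ j) sums (w r z t * (T - t) powr (-(\<beta> + real k * \<gamma>)))" by (simp only:)
  then show "(\<lambda>j. A (k + j) ((r - 1) * (T - t) powr - \<gamma>, z * (T - t) powr - \<gamma>) * ((T - t) powr \<gamma>) ^ j)
      sums (w r z t * (T - t) powr - (\<beta> + real k * \<gamma>))" unfolding y_def s_def .
qed

text \<open>Order k satisfies the transport equation with \<alpha> = -(\<beta> + k \<gamma>). This
  may be 0 for one k, for instance when k \<gamma> = 1 with \<beta> = -1, which is why the resonant
  case had to be included.\<close>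

lemma profiles_zero:
  assumes w: "C1_spacetime W w" and A: "series_form W T \<gamma> \<beta> A w" and A1: "\<And>k. \<exists>aR aZ. C1_Dom (A k) aR aZ"
    and lim: "\<And>k. (A k \<longlongrightarrow> 0) (inf at_infinity (principal Dom))"
    and pde: "\<And>r z t. (r, z, t) \<in> W \<Longrightarrow> pt w r z t + (- r * pz psi r z t) * pr w r z t
       + (2 * psi r z t + r * pr psi r z t) * pz w r z t = \<kappa> * w r z t * pz psi r z t"
    and rzt: "(r, z, t) \<in> W"
  shows "w r z t = 0"
proof -
  have zero: "\<forall>y\<in>Dom. A k y = 0" for k
  proof (induction k rule: less_induct)
    case (less k)
    have Ak: "series_form W T \<gamma> (\<beta> + real k * \<gamma>) (\<lambda>j. A (k + j)) w" by (rule series_form_shift[OF A]) (use less in auto)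
    obtain aR aZ where a: "C1_Dom (A k) aR aZ" using A1 by blast
    have c: "continuous_on Dom (A (k + j))" for j using A1[of "k + j"] C1_Dom_continuous by blast
    have e: "- (\<beta> + real k * \<gamma>) * A k Y + (\<gamma> * fst Y - PsiZ 0 Y) * aR Y + (\<gamma> * snd Y + PsiR 0 Y) * aZ Y = 0" if "Y \<in> Dom" for Y
      using leading_profile_eq[OF w Ak c _ pde that, of aR aZ] a by simp
    show ?case
    proof
      fix Y assume Y: "Y \<in> Dom"
      show "A k Y = 0"
        by (rule transport_profile_zero[OF \<gamma> a Psi_C1 lim Psi_sublinear Psi_bdry _ Y, where \<alpha>="- (\<beta> + real k * \<gamma>)"])
          (drule e, simp add: algebra_simps)
    qed
  qed
  have "(\<lambda>k. A k ((r - 1) * (T - t) powr (-\<gamma>), z * (T - t) powr (-\<gamma>)) * ((T - t) powr \<gamma>) ^ k) sums (w r z t * (T - t) powr (-\<beta>))"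
    using A rzt unfolding series_form_def by blast
  then have "(\<lambda>k. 0) sums (w r z t * (T - t) powr (-\<beta>))" using zero W_scaled[OF rzt] by simp
  then have "w r z t * (T - t) powr (-\<beta>) = 0" using sums_unique2 sums_zero by blast
  then show ?thesis using W_bounds[OF rzt] by simp
qed

text \<open>Without vorticity the potential solves a homogeneous equation at all s of an interval
  arbitrarily close to 0, which is the hypothesis of the separate analyticity argument. The bound
  holds near every interior point, as the definition of \<open>ell_limit\<close> requires.\<close>

lemma psi_coefficient_bound:
  assumes om0: "\<And>r z t. (r, z, t) \<in> W \<Longrightarrow> om r z t = 0" and y0: "fst y0 < 0"
  shows "\<exists>\<eta> b C. 0 < \<eta> \<and> 0 < b \<and> (\<forall>y\<in>ball y0 \<eta>. \<forall>k. \<bar>Psi k y\<bar> * b ^ k \<le> C)"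
proof (rule coeff_uniform_bound)
  define \<rho> M where "\<rho> = - fst y0 / 2" and "M = norm y0 + \<rho> + 1"
  show \<rho>: "0 < - fst y0 / 2" using y0 by simp
  have \<rho>': "0 < \<rho>" "\<rho> < - fst y0" using y0 by (auto simp: \<rho>_def)
  have cM: "cball y0 \<rho> \<subseteq> half_box M" unfolding M_def by (rule cball_in_half_box[OF \<rho>'(2)])
  then have bM: "ball y0 \<rho> \<subseteq> half_box M" using ball_subset_cball by blast
  have M: "0 < M" using \<rho>' by (simp add: M_def add_nonneg_pos)
  show "continuous_on (ball y0 (- fst y0 / 2)) (Psi k)" for k
    by (rule continuous_on_subset[OF C1_Dom_continuous[OF Psi_C1]]) (use bM in \<open>auto simp: \<rho>_def half_box_def Dom_def\<close>)
  fix \<epsilon> :: real assume \<epsilon>: "0 < \<epsilon>"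
  \<comment> \<open>Times within \<open>\<epsilon> powr (1 / \<gamma>)\<close> of T correspond to s
    below \<open>\<epsilon>\<close>.\<close>
  obtain t0 t1 where t: "T - \<epsilon> powr (1 / \<gamma>) < t0" "t0 < t1" "t1 < T"
    and g: "\<forall>t\<in>{t0..t1}. \<forall>y\<in>half_box M. (1 + (T - t) powr \<gamma> * fst y, (T - t) powr \<gamma> * snd y, t) \<in> W"
    using good_interval[OF M, of "\<epsilon> powr (1 / \<gamma>)"] \<epsilon> by auto
  have gW: "(1 + (T - t) powr \<gamma> * fst y, (T - t) powr \<gamma> * snd y, t) \<in> W" if "y \<in> cball y0 \<rho>" "t \<in> {t0..t1}" for y t
    using g cM that by blast
  have good: "good t M" if "t \<in> {t0..t1}" for t unfolding good_def sc_def using g that t by auto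
  have "compact (cball y0 \<rho> \<times> {t0..t1})" by (intro compact_Times compact_cball compact_Icc)
  moreover have "continuous_on (cball y0 \<rho> \<times> {t0..t1}) (\<lambda>x. prof (-1 + 2 * \<gamma>) psi (snd x) (fst x))"
  proof -
    have cpsi: "continuous_on W (\<lambda>(r,z,t). psi r z t)" using psi_C1(1) by (simp add: C1_space_def cont3_def)
    have csc: "continuous_on (cball y0 \<rho> \<times> {t0..t1}) (\<lambda>x. (T - snd x) powr c)" for c
      by (intro continuous_intros) (use t in auto)
    have "continuous_on (cball y0 \<rho> \<times> {t0..t1}) (\<lambda>x. psi (1 + sc (snd x) * fst (fst x)) (sc (snd x) * snd (fst x)) (snd x))"
      by (rule continuous_on_compose2[OF cpsi, of _ "\<lambda>x. (1 + sc (snd x) * fst (fst x), sc (snd x) * snd (fst x), snd x)", simplified case_prod_conv])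
        (unfold sc_def, intro continuous_intros csc, use gW in \<open>auto simp del: mem_cball atLeastAtMost_iff\<close>)
    then show ?thesis unfolding prof_def by (intro continuous_intros csc)
  qed
  ultimately have "compact ((\<lambda>x. prof (-1 + 2 * \<gamma>) psi (snd x) (fst x)) ` (cball y0 \<rho> \<times> {t0..t1}))"
    using compact_continuous_image by blast
  then obtain K where K: "\<forall>x\<in>(\<lambda>x. prof (-1 + 2 * \<gamma>) psi (snd x) (fst x)) ` (cball y0 \<rho> \<times> {t0..t1}). norm x \<le> K"
    using compact_imp_bounded bounded_iff by blast
  have main: "ell s (ball y0 (- fst y0 / 2)) (\<lambda>y. \<Sum>k. Psi k y * s ^ k) (\<lambda>_. 0) \<and>
        (\<forall>y\<in>ball y0 (- fst y0 / 2). summable (\<lambda>k. Psi k y * s ^ k) \<and> \<bar>\<Sum>k. Psi k y * s ^ k\<bar> \<le> K)" if s: "s \<in> {sc t1..sc t0}" for s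
  proof -
    \<comment> \<open>The time at which the scale equals s.\<close>
    define t where "t = T - s powr (1 / \<gamma>)"
    have s0: "0 < s" using s sc_pos[OF t(3)] by auto
    have st: "sc t = s" using s0 \<gamma> by (simp add: sc_def t_def powr_powr)
    have "sc t1 powr (1 / \<gamma>) \<le> s powr (1 / \<gamma>)" "s powr (1 / \<gamma>) \<le> sc t0 powr (1 / \<gamma>)"
      using s s0 sc_pos[OF t(3)] \<gamma> by (auto intro!: powr_mono2)
    then have tt: "t \<in> {t0..t1}" using t(2,3) \<gamma> by (simp add: t_def sc_def powr_powr)
    have gt: "good t M" by (rule good[OF tt])
    have sums: "(\<lambda>k. Psi k y * s ^ k) sums prof (-1 + 2 * \<gamma>) psi t y" if "y \<in> ball y0 \<rho>" for y
      using prof_sums[OF psi_form gt, of y] bM that st by auto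
    have sums_eq: "(\<Sum>k. Psi k y * s ^ k) = prof (-1 + 2 * \<gamma>) psi t y" if "y \<in> ball y0 \<rho>" for y
      by (rule sums_unique[OF sums[OF that], symmetric])
    have om: "prof (-1) om t y = 0" if "y \<in> ball y0 \<rho>" for y
    proof -
      have "(1 + sc t * fst y, sc t * snd y, t) \<in> W" by (rule good_in_W[OF gt]) (use that bM in auto)
      from om0[OF this] show ?thesis by (simp add: prof_def)
    qed
    have "ell s (ball y0 \<rho>) (prof (-1 + 2 * \<gamma>) psi t) (\<lambda>y. - prof (-1) om t y)"
      using ell_subset[OF ell_prof[OF gt] _ bM] st by simp
    then have "ell s (ball y0 \<rho>) (\<lambda>y. \<Sum>k. Psi k y * s ^ k) (\<lambda>_. 0)"
      by (rule ell_cong) (simp_all only: sums_eq om minus_zero)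
    moreover have "\<bar>prof (-1 + 2 * \<gamma>) psi t y\<bar> \<le> K" if y: "y \<in> ball y0 \<rho>" for y
    proof -
      have "(y, t) \<in> cball y0 \<rho> \<times> {t0..t1}" using y tt by simp
      from bspec[OF K imageI[OF this]] show ?thesis by simp
    qed
    ultimately show ?thesis unfolding \<rho>_def[symmetric]
      by (intro conjI ballI) (simp_all only: sums_eq sums_summable[OF sums])
  qed
  show "\<exists>s1 s2 K. 0 < s1 \<and> s1 < s2 \<and> s2 < \<epsilon> \<and> (\<forall>s\<in>{s1..s2}.
        ell s (ball y0 (- fst y0 / 2)) (\<lambda>y. \<Sum>k. Psi k y * s ^ k) (\<lambda>_. 0) \<and>
        (\<forall>y\<in>ball y0 (- fst y0 / 2). summable (\<lambda>k. Psi k y * s ^ k) \<and> \<bar>\<Sum>k. Psi k y * s ^ k\<bar> \<le> K))"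
  proof (rule exI[of _ "sc t1"], rule exI[of _ "sc t0"], rule exI[of _ K], intro conjI)
    show "0 < sc t1" by (rule sc_pos[OF t(3)])
    show "sc t1 < sc t0" unfolding sc_def using t \<gamma> by (intro powr_less_mono2) auto
    have "sc t0 < (\<epsilon> powr (1 / \<gamma>)) powr \<gamma>" unfolding sc_def using t \<gamma> by (intro powr_less_mono2) auto
    then show "sc t0 < \<epsilon>" using \<epsilon> \<gamma> by (simp add: powr_powr)
  qed (use main in blast)
qed

text \<open>The known terms of order below m are subtracted and the remainder is divided by s^m.
  Constants solve the equation, and an affine coefficient of order m - 1 fails to do so by 3 s a /
  (1 + s R) times s^(m - 1), which is exactly of order s^m and survives as a source.\<close>

lemma ell_limit_coefficient:
  assumes om0: "\<And>r z t. (r, z, t) \<in> W \<Longrightarrow> om r z t = 0"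
    and g: "\<And>n. good (t n) (real n + 1)" and s: "\<And>n. 0 < sc (t n)" "(\<lambda>n. sc (t n)) \<longlonglongrightarrow> 0"
    and low: "\<And>j y. j < m \<Longrightarrow> y \<in> Dom \<Longrightarrow> Psi j y = c j + (if Suc j = m then a else 0) * fst y" and a0: "m = 0 \<Longrightarrow> a = 0"
  shows "ell_limit (\<lambda>n. sc (t n)) (- 3 * a) (Psi m)"
  unfolding ell_limit_def
proof (intro allI impI)
  fix y0 :: "real \<times> real" assume y0: "fst y0 < 0"
  let ?s = "\<lambda>n. sc (t n)"
  obtain \<eta> b C where \<eta>: "0 < \<eta>" and b: "0 < b" and C: "\<forall>y\<in>ball y0 \<eta>. \<forall>k. \<bar>Psi k y\<bar> * b ^ k \<le> C"
    using psi_coefficient_bound[OF _ y0] om0 by (metis (no_types, lifting))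
  define \<rho> where "\<rho> = min \<eta> (- fst y0 / 2)"
  define M where "M = norm y0 + \<rho> + 1"
  have \<rho>: "0 < \<rho>" "\<rho> < - fst y0" "\<rho> \<le> \<eta>" using \<eta> y0 by (auto simp: \<rho>_def)
  have bM: "ball y0 \<rho> \<subseteq> half_box M" using cball_in_half_box[OF \<rho>(2)] ball_subset_cball unfolding M_def by blast
  have inD: "y \<in> Dom" if "y \<in> ball y0 \<rho>" for y using that bM by (auto simp: half_box_def Dom_def)
  define G where "G = (\<lambda>n y. \<Sum>j. Psi (m + j) y * ?s n ^ j)"
  define f where "f = (\<lambda>n (y::real \<times> real). - 3 * a / (1 + ?s n * fst y))"
  have evM: "\<forall>\<^sub>F n in sequentially. M \<le> real n + 1"
    using eventually_ge_at_top[of "nat \<lceil>M\<rceil>"] by eventually_elim linarith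
  have sums: "(\<lambda>j. Psi (m + j) y * ?s n ^ j) sums ((prof (-1 + 2 * \<gamma>) psi (t n) y - (\<Sum>j<m. Psi j y * ?s n ^ j)) / ?s n ^ m)"
    if "M \<le> real n + 1" "y \<in> ball y0 \<rho>" for n y
  proof -
    have "(\<lambda>j. Psi j y * ?s n ^ j) sums prof (-1 + 2 * \<gamma>) psi (t n) y"
      using prof_sums[OF psi_form good_mono[OF g that(1)], of y] bM that(2) by auto
    then have "(\<lambda>j. Psi (j + m) y * ?s n ^ (j + m)) sums (prof (-1 + 2 * \<gamma>) psi (t n) y - (\<Sum>j<m. Psi j y * ?s n ^ j))"
      by (subst sums_iff_shift) simp
    from sums_divide[OF this, of "?s n ^ m"] show ?thesis using s(1)[of n] by (simp add: power_add add.commute)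
  qed
  have "uniform_limit (ball y0 \<rho>) G (Psi (m + 0)) sequentially"
  proof (rule uniform_limit_series[where A="\<lambda>j. Psi (m + j)", OF _ b s])
    show "\<forall>\<^sub>F n in sequentially. \<forall>y\<in>ball y0 \<rho>. (\<lambda>j. Psi (m + j) y * ?s n ^ j) sums G n y"
      using evM by eventually_elim (unfold G_def, blast intro: summable_sums sums_summable[OF sums])
    fix y k assume y: "y \<in> ball y0 \<rho>"
    have "\<bar>Psi (m + k) y\<bar> * b ^ k = (\<bar>Psi (m + k) y\<bar> * b ^ (m + k)) / b ^ m" using b by (simp add: power_add)
    also have "\<dots> \<le> C / b ^ m" using C y \<rho>(3) b by (intro divide_right_mono) auto
    finally show "\<bar>Psi (m + k) y\<bar> * b ^ k \<le> C / b ^ m" .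
  qed
  then have lim: "uniform_limit (ball y0 \<rho>) G (Psi m) sequentially" by simp
  have ell: "\<forall>\<^sub>F n in sequentially. ell (?s n) (ball y0 \<rho>) (G n) (f n)"
    using evM
  proof eventually_elim
    case (elim n)
    define \<sigma> where "\<sigma> = ?s n"
    have \<sigma>: "0 < \<sigma>" using s by (simp add: \<sigma>_def)
    have gM: "good (t n) M" by (rule good_mono[OF g elim])
    have W: "(1 + \<sigma> * fst y, \<sigma> * snd y, t n) \<in> W" if "y \<in> ball y0 \<rho>" for y
      unfolding \<sigma>_def by (rule good_in_W[OF gM]) (use that bM in auto)
    have e1: "ell \<sigma> (ball y0 \<rho>) (prof (-1 + 2 * \<gamma>) psi (t n)) (\<lambda>y. - prof (-1) om (t n) y)"
      unfolding \<sigma>_def by (rule ell_subset[OF ell_prof[OF gM] _ bM]) simp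
    define c0 where "c0 = (\<Sum>j<m. c j * \<sigma> ^ j)"
    \<comment> \<open>\<open>a * \<sigma> ^ m / \<sigma>\<close> stands for a times the power m - 1;
      for m = 0 it vanishes through \<open>a0\<close>, so truncated subtraction is avoided.\<close>
    have e2: "ell \<sigma> (ball y0 \<rho>) (\<lambda>y. c0 + a * \<sigma> ^ m / \<sigma> * fst y) (\<lambda>y. 3 * \<sigma> / (1 + \<sigma> * fst y) * (a * \<sigma> ^ m / \<sigma>))"
      by (rule ell_affine[OF open_ball]) (use W_bounds[OF W] in blast)
    have "ell \<sigma> (ball y0 \<rho>) (G n) (f n)"
    proof (rule ell_cong[OF ell_combine[OF e1 e2, of "1 / \<sigma> ^ m" "- 1 / \<sigma> ^ m"]])
      fix y assume y: "y \<in> ball y0 \<rho>"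
      have "(\<Sum>j<m. Psi j y * \<sigma> ^ j) = (\<Sum>j<m. c j * \<sigma> ^ j + (if Suc j = m then a else 0) * fst y * \<sigma> ^ j)"
        by (rule sum.cong) (use low inD[OF y] in \<open>auto simp: distrib_right\<close>)
      also have "\<dots> = c0 + (\<Sum>j<m. (if Suc j = m then a else 0) * fst y * \<sigma> ^ j)" by (simp add: sum.distrib c0_def)
      also have "(\<Sum>j<m. (if Suc j = m then a else 0) * fst y * \<sigma> ^ j) = a * \<sigma> ^ m / \<sigma> * fst y"
        using a0 \<sigma> by (cases m) (auto intro!: sum.neutral)
      finally show "G n y = 1 / \<sigma> ^ m * prof (-1 + 2 * \<gamma>) psi (t n) y + - 1 / \<sigma> ^ m * (c0 + a * \<sigma> ^ m / \<sigma> * fst y)"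
        using sums_unique[OF sums[OF elim y]] by (simp add: G_def diff_divide_distrib flip: \<sigma>_def)
      have "prof (-1) om (t n) y = 0" using om0[OF W[OF y]] by (simp add: prof_def \<sigma>_def)
      then show "f n y = 1 / \<sigma> ^ m * - prof (-1) om (t n) y + - 1 / \<sigma> ^ m * (3 * \<sigma> / (1 + \<sigma> * fst y) * (a * \<sigma> ^ m / \<sigma>))"
        using \<sigma> by (simp add: f_def \<sigma>_def[symmetric])
    qed
    then show ?case by (simp add: \<sigma>_def)
  qed
  have flim: "uniform_limit (ball y0 \<rho>) f (\<lambda>_. - 3 * a) sequentially"
  proof (rule uniform_limitI)
    fix \<epsilon> :: real assume \<epsilon>: "0 < \<epsilon>"
    have M: "0 < M" using \<rho>(1) by (simp add: M_def add_nonneg_pos)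
    have "(\<lambda>n. 6 * \<bar>a\<bar> * M * ?s n) \<longlonglongrightarrow> 6 * \<bar>a\<bar> * M * 0" by (intro tendsto_intros s)
    then have 1: "\<forall>\<^sub>F n in sequentially. 6 * \<bar>a\<bar> * M * ?s n < \<epsilon>" using \<epsilon> by (intro order_tendstoD(2)) auto
    have "(\<lambda>n. ?s n * M) \<longlonglongrightarrow> 0 * M" by (intro tendsto_intros s)
    then have 2: "\<forall>\<^sub>F n in sequentially. ?s n * M < 1 / 2" by (intro order_tendstoD(2)) auto
    show "\<forall>\<^sub>F n in sequentially. \<forall>y\<in>ball y0 \<rho>. dist (f n y) (- 3 * a) < \<epsilon>"
      using 1 2
    proof eventually_elim
      case (elim n)
      show ?case
      proof
        fix y assume "y \<in> ball y0 \<rho>"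
        then have "y \<in> half_box M" using bM by blast
        then have R: "\<bar>fst y\<bar> \<le> M" by (simp add: half_box_def)
        define x where "x = ?s n * fst y"
        have xM: "\<bar>x\<bar> \<le> ?s n * M" unfolding x_def abs_mult using R s(1)[of n] by (simp add: mult_left_mono)
        then have x: "1 / 2 \<le> 1 + x" using elim(2) by linarith
        have "f n y = - 3 * a / (1 + x)" by (simp add: f_def x_def)
        moreover have "- 3 * a / (1 + x) - (- 3 * a) = 3 * a * x / (1 + x)" using x by (simp add: field_simps)
        ultimately have "f n y - (- 3 * a) = 3 * a * x / (1 + x)" by simp
        then have "dist (f n y) (- 3 * a) = 3 * \<bar>a\<bar> * \<bar>x\<bar> / (1 + x)" using x by (simp add: dist_real_def abs_mult)
        also have "\<dots> \<le> 3 * \<bar>a\<bar> * \<bar>x\<bar> / (1 / 2)" using x by (intro divide_left_mono) auto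
        also have "\<dots> \<le> 6 * \<bar>a\<bar> * (?s n * M)" using mult_left_mono[OF xM, of "6 * \<bar>a\<bar>"] by simp
        finally show "dist (f n y) (- 3 * a) < \<epsilon>" using elim(1) by (simp add: mult.commute mult.left_commute)
      qed
    qed
  qed
  show "\<exists>\<rho>>0. \<exists>g f. uniform_limit (ball y0 \<rho>) g (Psi m) sequentially \<and>
     (\<forall>\<^sub>F n in sequentially. ell (?s n) (ball y0 \<rho>) (g n) (f n)) \<and> uniform_limit (ball y0 \<rho>) f (\<lambda>_. - 3 * a) sequentially"
    using \<rho>(1) lim ell flim by blast
qed

lemma psi_profiles_constant:
  assumes om0: "\<And>r z t. (r, z, t) \<in> W \<Longrightarrow> om r z t = 0"
  shows "\<forall>y\<in>Dom. Psi m y = Psi m (0, 0)"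
proof -
  obtain t e where te: "\<And>n. 0 < e n" "\<And>n t'. \<bar>t' - t n\<bar> < e n \<Longrightarrow> good t' (real n + 1)"
    and s: "\<And>n. 0 < sc (t n)" "(\<lambda>n. sc (t n)) \<longlonglongrightarrow> 0" using good_times by metis
  have gt: "good (t n) (real n + 1)" for n by (rule te(2)) (simp add: te(1))
  note lim = ell_limit_coefficient[OF om0 gt s, where c="\<lambda>j. Psi j (0, 0)"]
  show ?thesis
  proof (induction m rule: less_induct)
    case (less m)
    have "ell_limit (\<lambda>n. sc (t n)) (- 3 * 0) (Psi m)" by (rule lim) (use less in auto)
    then have "ell_limit (\<lambda>n. sc (t n)) 0 (Psi m)" by simp
    from liouville_half_plane[OF Psi_C1 Psi_bdry Psi_sublinear this s]
    obtain a where a: "\<forall>R\<le>0. \<forall>Z. Psi m (R, Z) = Psi m (0, 0) + a * R" by blast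
    \<comment> \<open>A constant slope is itself sublinear growth of the gradient, so order m alone
      cannot exclude it; the contradiction has to come from the next coefficient.\<close>
    have "ell_limit (\<lambda>n. sc (t n)) (- 3 * a) (Psi (Suc m))"
    proof (rule lim)
      fix j and y :: "real \<times> real" assume j: "j < Suc m" and y: "y \<in> Dom"
      show "Psi j y = Psi j (0, 0) + (if Suc j = Suc m then a else 0) * fst y"
      proof (cases "j = m")
        case True
        have "Psi m (fst y, snd y) = Psi m (0, 0) + a * fst y" using a y unfolding Dom_def by blast
        then show ?thesis using True by simp
      next
        case False
        then have "Psi j y = Psi j (0, 0)" using bspec[OF less[of j] y] j by simp
        then show ?thesis using False by simp
      qed
    qed auto
    from constant_laplacian_zero[OF Psi_C1 Psi_bdry Psi_sublinear this s] have "a = 0" by simp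
    then have "Psi m (R, Z) = Psi m (0, 0)" if "R \<le> 0" for R Z using a[rule_format, OF that] by simp
    then show ?case unfolding Dom_def by (metis mem_Collect_eq prod.collapse)
  qed
qed

lemma psi_gradient_zero:
  assumes om0: "\<And>r z t. (r, z, t) \<in> W \<Longrightarrow> om r z t = 0" and W: "(r, z, t) \<in> W"
    and e: "0 < e" "\<And>r' z'. \<bar>r' - r\<bar> < e \<Longrightarrow> \<bar>z' - z\<bar> < e \<Longrightarrow> (r', z', t) \<in> W"
  shows "pr psi r z t = 0" "pz psi r z t = 0"
proof -
  define c where "c = (\<Sum>k. Psi k (0, 0) * ((T - t) powr \<gamma>) ^ k) * (T - t) powr (-1 + 2 * \<gamma>)"
  have t: "t < T" using W_bounds[OF W] by simp
  have const: "psi r' z' t = c" if "\<bar>r' - r\<bar> < e" "\<bar>z' - z\<bar> < e" for r' z'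
  proof -
    have W': "(r', z', t) \<in> W" by (rule e(2)[OF that])
    have "(\<lambda>k. Psi k ((r' - 1) * (T - t) powr (-\<gamma>), z' * (T - t) powr (-\<gamma>)) * ((T - t) powr \<gamma>) ^ k) sums (psi r' z' t * (T - t) powr (-(-1 + 2 * \<gamma>)))"
      using psi_form W' unfolding series_form_def by blast
    then have "(\<lambda>k. Psi k (0, 0) * ((T - t) powr \<gamma>) ^ k) sums (psi r' z' t * (T - t) powr (-(-1 + 2 * \<gamma>)))"
      by (simp only: bspec[OF psi_profiles_constant[OF om0] W_scaled[OF W']])
    from sums_unique[OF this, symmetric] have "c = psi r' z' t * (T - t) powr (-(-1 + 2 * \<gamma>)) * (T - t) powr (-1 + 2 * \<gamma>)"
      by (simp only: c_def)
    then have "c = psi r' z' t * ((T - t) powr (-(-1 + 2 * \<gamma>)) * (T - t) powr (-1 + 2 * \<gamma>))" by (simp only: mult.assoc)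
    then show ?thesis using t by (simp flip: powr_add)
  qed
  have "((\<lambda>x. psi x z t) has_real_derivative 0) (at r)"
    by (rule has_field_derivative_transform_within_open[of "\<lambda>_. c" _ _ "ball r e"])
      (use e const in \<open>auto simp: dist_real_def abs_minus_commute[of r]\<close>)
  then show "pr psi r z t = 0" unfolding pr_def by (rule DERIV_imp_deriv)
  have "((\<lambda>x. psi r x t) has_real_derivative 0) (at z)"
    by (rule has_field_derivative_transform_within_open[of "\<lambda>_. c" _ _ "ball z e"])
      (use e const in \<open>auto simp: dist_real_def abs_minus_commute[of z]\<close>)
  then show "pz psi r z t = 0" unfolding pz_def by (rule DERIV_imp_deriv)
qed

end

lemma region_good_interval:
  fixes \<gamma> T :: real
  assumes \<gamma>: "0 < \<gamma>"
    and region: "(\<exists>\<delta>. 0 < \<delta> \<and> \<delta> < 1 \<and> W = region_C \<delta> T) \<or>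
       (\<exists>T0 \<delta>. T0 < T \<and> (\<forall>t. T0 < t \<and> t < T \<longrightarrow> 0 < \<delta> t) \<and>
          (\<forall>s t. T0 < s \<and> s \<le> t \<and> t < T \<longrightarrow> \<delta> t \<le> \<delta> s) \<and>
          (\<delta> \<longlongrightarrow> 0) (at_left T) \<and>
          Limsup (at_left T) (\<lambda>t. ereal ((T - t) powr (- \<gamma>) * \<delta> t)) = \<infinity> \<and>
          W = region_W \<delta> T0 T)"
    and M: "0 < M" and \<epsilon>: "0 < \<epsilon>"
  shows "\<exists>t0 t1. T - \<epsilon> < t0 \<and> t0 < t1 \<and> t1 < T \<and>
      (\<forall>t\<in>{t0..t1}. \<forall>y\<in>half_box M. (1 + (T - t) powr \<gamma> * fst y, (T - t) powr \<gamma> * snd y, t) \<in> W)"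
proof -
  have small: "(T - t) powr \<gamma> * M < d" if "T - (d / M) powr (1 / \<gamma>) < t" "t < T" "0 < d" for t d
  proof -
    have "(T - t) powr \<gamma> < ((d / M) powr (1 / \<gamma>)) powr \<gamma>" using that \<gamma> by (intro powr_less_mono2) auto
    then show ?thesis using M \<gamma> that(3) by (simp add: powr_powr field_simps)
  qed
  have scaled: "- d < (T - t) powr \<gamma> * fst y \<and> (T - t) powr \<gamma> * fst y < 0 \<and> - d < (T - t) powr \<gamma> * snd y \<and> (T - t) powr \<gamma> * snd y < d"
    if "(T - t) powr \<gamma> * M < d" "y \<in> half_box M" "t < T" for t d y
  proof -
    define s where "s = (T - t) powr \<gamma>"
    have s: "0 < s" using that(3) by (simp add: s_def)
    have y: "- M < fst y" "fst y < 0" "- M < snd y" "snd y < M" using that(2) by (auto simp: half_box_def abs_less_iff)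
    have "s * - M < s * fst y" "s * - M < s * snd y" "s * snd y < s * M"
      by (rule mult_strict_left_mono[OF _ s], rule y)+
    moreover have "s * fst y < 0" using s y by (simp add: mult_pos_neg)
    moreover have "s * - M = - (s * M)" by simp
    ultimately show ?thesis using that(1) unfolding s_def[symmetric] by (intro conjI; linarith)
  qed
  from region show ?thesis
  proof (elim disjE exE conjE)
    fix \<delta> assume \<delta>: "0 < \<delta>" "\<delta> < 1" and W: "W = region_C \<delta> T"
    define h where "h = min (min \<epsilon> \<delta>) ((\<delta> / M) powr (1 / \<gamma>))"
    have h: "0 < h" "h \<le> \<epsilon>" "h \<le> \<delta>" "h \<le> (\<delta> / M) powr (1 / \<gamma>)" using \<epsilon> \<delta> M by (auto simp: h_def)
    have "(1 + (T - t) powr \<gamma> * fst y, (T - t) powr \<gamma> * snd y, t) \<in> W" if "t \<in> {T - h / 2..T - h / 3}" "y \<in> half_box M" for t y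
    proof -
      have t: "T - h < t" "t < T" using that(1) h(1) by auto
      have "(T - t) powr \<gamma> * M < \<delta>" by (rule small) (use t h \<delta> in auto)
      from scaled[OF this that(2) t(2)] show ?thesis using t h unfolding W region_C_def by auto
    qed
    then show ?thesis using h by (intro exI[of _ "T - h / 2"] exI[of _ "T - h / 3"]) auto
  next
    fix T0 \<delta> assume T0: "T0 < T" and pos: "\<forall>t. T0 < t \<and> t < T \<longrightarrow> 0 < \<delta> t"
      and mono: "\<forall>s t. T0 < s \<and> s \<le> t \<and> t < T \<longrightarrow> \<delta> t \<le> \<delta> s"
      and ls: "Limsup (at_left T) (\<lambda>t. ereal ((T - t) powr (- \<gamma>) * \<delta> t)) = \<infinity>" and W: "W = region_W \<delta> T0 T"
    \<comment> \<open>The last entry keeps \<open>(T - t) powr \<gamma> * M\<close> below 1, hence r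
      positive, since \<open>\<delta>\<close> may exceed 1.\<close>
    define h where "h = min (min \<epsilon> (T - T0)) ((1 / M) powr (1 / \<gamma>))"
    have h: "0 < h" "h \<le> \<epsilon>" "h \<le> T - T0" "h \<le> (1 / M) powr (1 / \<gamma>)" using \<epsilon> T0 M by (auto simp: h_def)
    have "\<exists>t. T - h < t \<and> t < T \<and> M < (T - t) powr (- \<gamma>) * \<delta> t"
    proof (rule ccontr)
      assume no: "\<not> ?thesis"
      have "\<forall>\<^sub>F t in at_left T. ereal ((T - t) powr (- \<gamma>) * \<delta> t) \<le> ereal M"
        unfolding eventually_at_left_field
      proof (intro exI[of _ "T - h"] conjI allI impI)
        show "ereal ((T - t) powr (- \<gamma>) * \<delta> t) \<le> ereal M" if "T - h < t" "t < T" for t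
          using no that not_less unfolding ereal_less_eq by blast
      qed (use h(1) in simp)
      from Limsup_bounded[OF this] show False unfolding ls by simp
    qed
    then obtain t1 where t1: "T - h < t1" "t1 < T" "M < (T - t1) powr (- \<gamma>) * \<delta> t1" by blast
    have d1: "0 < \<delta> t1" using pos t1 h by auto
    have "(T - t1) powr \<gamma> * M < \<delta> t1" using t1 by (simp add: powr_minus field_simps)
    then have "(T - t1) powr \<gamma> < \<delta> t1 / M" using M by (simp add: field_simps)
    then have "((T - t1) powr \<gamma>) powr (1 / \<gamma>) < (\<delta> t1 / M) powr (1 / \<gamma>)" using \<gamma> by (intro powr_less_mono2) auto
    then have q: "T - t1 < (\<delta> t1 / M) powr (1 / \<gamma>)" using \<gamma> t1 by (simp add: powr_powr)
    \<comment> \<open>The limsup yields a single time \<open>t1\<close> with room to spare. As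
      \<open>\<delta>\<close> decreases, \<open>\<delta> t1\<close> bounds its earlier values from
      below, so the inequality spreads to an interval on the left of \<open>t1\<close>.\<close>
    define a where "a = max (T - h) (T - (\<delta> t1 / M) powr (1 / \<gamma>))"
    have a: "a < t1" "T - h \<le> a" "T - (\<delta> t1 / M) powr (1 / \<gamma>) \<le> a" using q t1(1) by (auto simp: a_def)
    have "(1 + (T - t) powr \<gamma> * fst y, (T - t) powr \<gamma> * snd y, t) \<in> W" if "t \<in> {(a + t1) / 2..t1}" "y \<in> half_box M" for t y
    proof -
      have t: "a < t" "t \<le> t1" "t < T" "T0 < t" using that(1) a h(3) t1(2) by auto
      have "(T - t) powr \<gamma> * M < \<delta> t1" by (rule small) (use t a d1 in auto)
      moreover have "\<delta> t1 \<le> \<delta> t" using mono t t1 by blast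
      ultimately have 1: "(T - t) powr \<gamma> * M < \<delta> t" by linarith
      have 2: "(T - t) powr \<gamma> * M < 1" by (rule small) (use t a h(4) in auto)
      from scaled[OF 1 that(2) t(3)] scaled[OF 2 that(2) t(3)] show ?thesis
        unfolding W region_W_def using t by auto
    qed
    then show ?thesis using a h t1 by (intro exI[of _ "(a + t1) / 2"] exI[of _ t1]) auto
  qed
qed

text \<open>Openness is claimed in (r, z) only: \<open>\<delta>\<close> is merely monotone in the
  second kind of region and may jump, so the region need not be open in time.\<close>

lemma region_slice_open:
  assumes region: "(\<exists>\<delta>. 0 < \<delta> \<and> \<delta> < 1 \<and> W = region_C \<delta> T) \<or> (\<exists>T0 \<delta>. W = region_W \<delta> T0 T)"
    and W: "(r, z, t) \<in> W"
  shows "0 < r" "r < 1" "t < T"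
    and "\<exists>e>0. \<forall>r' z'. \<bar>r' - r\<bar> < e \<longrightarrow> \<bar>z' - z\<bar> < e \<longrightarrow> (r', z', t) \<in> W"
proof -
  show "0 < r" "r < 1" "t < T" using region W by (auto simp: region_C_def region_W_def)
  obtain d where d: "0 < r" "1 - d < r" "r < 1" "- d < z" "z < d"
    and sub: "\<And>r' z'. 0 < r' \<Longrightarrow> 1 - d < r' \<Longrightarrow> r' < 1 \<Longrightarrow> - d < z' \<Longrightarrow> z' < d \<Longrightarrow> (r', z', t) \<in> W"
    using region W by (force simp: region_C_def region_W_def)
  define e where "e = Min {r, r - (1 - d), 1 - r, z + d, d - z}"
  have e: "0 < e" "e \<le> r" "e \<le> r - (1 - d)" "e \<le> 1 - r" "e \<le> z + d" "e \<le> d - z" using d by (auto simp: e_def)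
  show "\<exists>e>0. \<forall>r' z'. \<bar>r' - r\<bar> < e \<longrightarrow> \<bar>z' - z\<bar> < e \<longrightarrow> (r', z', t) \<in> W"
  proof (intro exI[of _ e] conjI allI impI)
    fix r' z' assume "\<bar>r' - r\<bar> < e" "\<bar>z' - z\<bar> < e"
    then show "(r', z', t) \<in> W" using e by (intro sub) (auto simp: abs_less_iff)
  qed (rule e)
qed

theorem theorem2:
  fixes \<gamma> T :: real
    and u1 om1 psi1 :: "real \<Rightarrow> real \<Rightarrow> real \<Rightarrow> real"
    and W :: "(real \<times> real \<times> real) set"
    and U Om Psi PsiR PsiZ :: "nat \<Rightarrow> real \<times> real \<Rightarrow> real"
    and p :: nat
  assumes gamma: "0 < \<gamma>" and Tpos: "0 < T"
    and region: "(\<exists>\<delta>. 0 < \<delta> \<and> \<delta> < 1 \<and> W = region_C \<delta> T) \<or>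
       (\<exists>T0 \<delta>. T0 < T \<and> (\<forall>t. T0 < t \<and> t < T \<longrightarrow> 0 < \<delta> t) \<and>
          (\<forall>s t. T0 < s \<and> s \<le> t \<and> t < T \<longrightarrow> \<delta> t \<le> \<delta> s) \<and>
          (\<delta> \<longlongrightarrow> 0) (at_left T) \<and>
          Limsup (at_left T) (\<lambda>t. ereal ((T - t) powr (- \<gamma>) * \<delta> t)) = \<infinity> \<and>
          W = region_W \<delta> T0 T)"
    and sol: "classical_solution W u1 om1 psi1"
    and form: "\<forall>(r,z,t)\<in>W.
        (let R = (r - 1) * (T - t) powr (- \<gamma>); Z = z * (T - t) powr (- \<gamma>) in
          summable (\<lambda>k. (T - t) powr (real k * \<gamma>) * U k (R, Z)) \<and>
          summable (\<lambda>k. (T - t) powr (real k * \<gamma>) * Om k (R, Z)) \<and>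
          summable (\<lambda>k. (T - t) powr (real k * \<gamma>) * Psi k (R, Z)) \<and>
          u1 r z t = (T - t) powr (-1 + \<gamma> / 2) * (\<Sum>k. (T - t) powr (real k * \<gamma>) * U k (R, Z)) \<and>
          om1 r z t = (T - t) powr (-1) * (\<Sum>k. (T - t) powr (real k * \<gamma>) * Om k (R, Z)) \<and>
          psi1 r z t = (T - t) powr (-1 + 2 * \<gamma>) * (\<Sum>k. (T - t) powr (real k * \<gamma>) * Psi k (R, Z)))"
    and a_U: "\<forall>k. \<exists>fR fZ. C1_Dom (U k) fR fZ"
    and a_Om: "\<forall>k. \<exists>fR fZ. C1_Dom (Om k) fR fZ"
    and a_Psi: "\<forall>k. C1_Dom (Psi k) (PsiR k) (PsiZ k)"
    and b_UOm: "\<forall>k. ((\<lambda>Y. \<bar>U k Y\<bar> + \<bar>Om k Y\<bar>) \<longlongrightarrow> 0) (inf at_infinity (principal Dom))"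
    and b_Psi: "\<forall>k. (\<lambda>Y. norm (PsiR k Y, PsiZ k Y)) \<in> o[inf at_infinity (principal Dom)](\<lambda>Y. norm Y)"
    and c: "\<forall>k Z. PsiZ k (0, Z) = 0"
    and p_even: "even p"
    and d: "\<forall>k. real k \<le> 1 / \<gamma> \<longrightarrow>
       ((\<lambda>\<rho>. integral {Y \<in> Dom. \<rho> < norm Y \<and> norm Y < 2 * \<rho>} (\<lambda>Y. U k Y ^ p + Om k Y ^ p))
          \<longlongrightarrow> 0) at_top"
  shows "\<forall>(r,z,t)\<in>W. u1 r z t = 0 \<and> om1 r z t = 0 \<and> pr psi1 r z t = 0 \<and> pz psi1 r z t = 0"
proof -
  note slice = region_slice_open[where W=W and T=T]
  have region': "(\<exists>\<delta>. 0 < \<delta> \<and> \<delta> < 1 \<and> W = region_C \<delta> T) \<or> (\<exists>T0 \<delta>. W = region_W \<delta> T0 T)" using region by blast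
  note W_bounds = slice(1-3)[OF region'] and W_open = slice(4)[OF region']
  have sol_psi: "C1_spacetime W u1" "C1_spacetime W om1" "C1_space W psi1" "C1_space W (pr psi1)" "C1_space W (pz psi1)"
    using sol unfolding classical_solution_def by blast+
  have eqs: "pt u1 r z t + (- r * pz psi1 r z t) * pr u1 r z t + (2 * psi1 r z t + r * pr psi1 r z t) * pz u1 r z t = 2 * u1 r z t * pz psi1 r z t"
    "pt om1 r z t + (- r * pz psi1 r z t) * pr om1 r z t + (2 * psi1 r z t + r * pr psi1 r z t) * pz om1 r z t = pz (\<lambda>r z t. (u1 r z t)\<^sup>2) r z t"
    "- (pr (pr psi1) r z t + 3 / r * pr psi1 r z t + pz (pz psi1) r z t) = om1 r z t" if "(r, z, t) \<in> W" for r z t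
    using sol that unfolding classical_solution_def Let_def by auto
  have pw: "(T - t) powr (real k * \<gamma>) = ((T - t) powr \<gamma>) ^ k" if "t < T" for t k
    using that by (simp add: powr_powr mult.commute flip: powr_realpow)
  have sf: "(\<lambda>k. A k y * ((T - t) powr \<gamma>) ^ k) sums (v * (T - t) powr (-\<beta>))"
    if "t < T" "summable (\<lambda>k. (T - t) powr (real k * \<gamma>) * A k y)" "v = (T - t) powr \<beta> * (\<Sum>k. (T - t) powr (real k * \<gamma>) * A k y)"
    for A :: "nat \<Rightarrow> real \<times> real \<Rightarrow> real" and y t v \<beta>
  proof -
    have "v * (T - t) powr (-\<beta>) = (\<Sum>k. (T - t) powr (real k * \<gamma>) * A k y)" using that(1,3) by (simp add: powr_minus)
    then show ?thesis using summable_sums[OF that(2)] pw[OF that(1)] by (simp add: mult.commute)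
  qed
  have forms: "series_form W T \<gamma> (-1 + \<gamma> / 2) U u1" "series_form W T \<gamma> (-1) Om om1" "series_form W T \<gamma> (-1 + 2 * \<gamma>) Psi psi1"
    unfolding series_form_def
    by ((intro allI impI, rule sf, erule W_bounds(3)); (drule bspec[OF form], simp only: case_prod_conv Let_def))+
  have lim: "(U k \<longlongrightarrow> 0) (inf at_infinity (principal Dom))" "(Om k \<longlongrightarrow> 0) (inf at_infinity (principal Dom))" for k
    by (rule Lim_null_comparison[OF _ b_UOm[rule_format, of k]], simp)+
  interpret self_similar_flow \<gamma> T W psi1 om1 Psi PsiR PsiZ Om
  proof
    show "0 < r \<and> r < 1 \<and> t < T" if "(r, z, t) \<in> W" for r z t using W_bounds[OF that] by blast
    show "\<exists>t0 t1. T - \<epsilon> < t0 \<and> t0 < t1 \<and> t1 < T \<and>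
      (\<forall>t\<in>{t0..t1}. \<forall>y\<in>half_box M. (1 + (T - t) powr \<gamma> * fst y, (T - t) powr \<gamma> * snd y, t) \<in> W)"
      if "0 < M" "0 < \<epsilon>" for M \<epsilon> by (rule region_good_interval[OF gamma region that])
    show "pr (pr psi1) r z t + 3 / r * pr psi1 r z t + pz (pz psi1) r z t = - om1 r z t" if "(r, z, t) \<in> W" for r z t
      using eqs(3)[OF that] by linarith
    show "continuous_on Dom (Om k)" for k using a_Om C1_Dom_continuous by blast
  qed (use gamma sol_psi forms a_Psi b_Psi c in auto)
  have u0: "u1 r z t = 0" if "(r, z, t) \<in> W" for r z t
    by (rule profiles_zero[OF sol_psi(1) forms(1) _ lim(1) eqs(1) that]) (use a_U in blast)+
  \<comment> \<open>Since \<open>u1\<close> vanishes on a neighbourhood within the time slice, the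
    source of the vorticity equation is 0; that equation then has the form treated above with
    \<kappa> = 0.\<close>
  have "pz (\<lambda>r z t. (u1 r z t)\<^sup>2) r z t = 0" if W: "(r, z, t) \<in> W" for r z t
  proof -
    obtain e where e: "0 < e" "\<forall>r' z'. \<bar>r' - r\<bar> < e \<longrightarrow> \<bar>z' - z\<bar> < e \<longrightarrow> (r', z', t) \<in> W" using W_open[OF W] by blast
    have "((\<lambda>x. (u1 r x t)\<^sup>2) has_real_derivative 0) (at z)"
      by (rule has_field_derivative_transform_within_open[of "\<lambda>_. 0" _ _ "ball z e"])
        (use e u0 in \<open>auto simp: dist_real_def abs_minus_commute[of z]\<close>)
    then show ?thesis unfolding pz_def by (rule DERIV_imp_deriv)
  qed
  then have pde: "pt om1 r z t + (- r * pz psi1 r z t) * pr om1 r z t + (2 * psi1 r z t + r * pr psi1 r z t) * pz om1 r z t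
      = 0 * om1 r z t * pz psi1 r z t" if "(r, z, t) \<in> W" for r z t
    using eqs(2)[OF that] that by simp
  have om0: "om1 r z t = 0" if "(r, z, t) \<in> W" for r z t
    by (rule profiles_zero[OF sol_psi(2) forms(2) _ lim(2) pde that]) (use a_Om in blast)+
  have "u1 r z t = 0 \<and> om1 r z t = 0 \<and> pr psi1 r z t = 0 \<and> pz psi1 r z t = 0" if W: "(r, z, t) \<in> W" for r z t
  proof -
    obtain e where e: "0 < e" "\<forall>r' z'. \<bar>r' - r\<bar> < e \<longrightarrow> \<bar>z' - z\<bar> < e \<longrightarrow> (r', z', t) \<in> W" using W_open[OF W] by blast
    have "pr psi1 r z t = 0" "pz psi1 r z t = 0"
      by (rule psi_gradient_zero[OF om0 W e(1)], assumption, use e(2) in blast)+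
    then show ?thesis using u0[OF W] om0[OF W] by blast
  qed
  then show ?thesis by auto
qed

end
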